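(* Let $u$ be the solution of the convection-diffusion problem with large shift \[-\varepsilon u''(x)-b(x)u'(x)+c(x)u(x)+d(x)u(x-1)=f(x),\ x\in\Omega=(0,2),\qquad u(2)=0,\qquad u(x)=\Phi(x),\ x\in(-1,0],\] and let $u_N\in\mathcal U_N$ be the finite element solution, i.e. $B(u_N,v)=F(v)$ for all $v\in\mathcal U_N$, on the coarser Durán mesh with parameter $H\in(0,1)$ (problem data, mesh, $\mathcal U_N$, $B$ and $F$ as specified in the context). Then \[\left(\varepsilon\|(u-u_N)'\|_{L^2(\Omega)}^2+\gamma\|u-u_N\|_{L^2(\Omega)}^2\right)^{1/2}\le C\,H^k ,\] where $C>0$ is a constant independent of $\varepsilon$ and of the mesh (i.e. of $H$).
   Context: Problem: $\Omega=(0,2)$, and $0<\varepsilon\ll1$ is a small perturbation parameter, $\varepsilon\in(0,1)$. The data $b,c,d$ and $f$ on $[0,2]$ and $\Phi$ on $[-1,0]$ are independent of $\varepsilon$ and smooth enough (i.e. of class $C^m$ for some sufficiently large $m$ depending only on $k$), with $b\ge\beta>0$ and $d\ge0$ for a constant $\beta$, $c+\frac{b'}{2}-\frac{\|d\|_{L^\infty(1,2)}}{2}\ge\gamma>0$ for a constant $\gamma$, and $\Phi(0)=0$. Thus $u\in H_0^1(\Omega)$, where for $x\in(0,1)$ the term $u(x-1)$ means $\Phi(x-1)$. Weak form: with $\langle\cdot,\cdot\rangle_D$ the $L^2(D)$ scalar product, for $u,v\in H_0^1(\Omega)$, \[B(u,v)=\varepsilon\langle u',v'\rangle_\Omega+\langle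 cu-bu',v\rangle_\Omega+\langle d\,u(\cdot-1),v\rangle_{(1,2)},\qquad F(v)=\langle f,v\rangle_\Omega-\langle d\,\Phi(\cdot-1),v\rangle_{(0,1)};\] the solution $u$ satisfies $B(u,v)=F(v)$ for all $v\in H_0^1(\Omega)$. Coarser Durán mesh: let $k\ge1$ be the fixed integer polynomial degree. For $H\in(0,1)$ put \[M=\left\lceil\left\lceil\tfrac1H\right\rceil-\frac{\ln\left(H\varepsilon\lceil 1/H\rceil\right)}{\ln(1+H)}\right\rceil,\qquad M_2=\left\lceil\left\lceil\tfrac1H\right\rceil-\frac{\ln\left(H\varepsilon^{\frac{k-1}{k}}\lceil 1/H\rceil\right)}{\ln(1+H)}\right\rceil\] and $x_0=0$; $x_i=iH\varepsilon$ for $1\le i\le\lceil1/H\rceil$; $x_i=(1+H)x_{i-1}$ for $\lceil1/H\rceil<i\le M-1$; $x_M=1$; $x_i=1+(i-M)H\varepsilon^{\frac{k-1}{k}}$ for $M+1\le i\le M+\lceil1/H\rceil$; $x_i=1+(1+H)(x_{i-1}-1)$ for $M+\lceil1/H\rceil<i\le M+M_2-1$; $x_{M+M_2}=2$. The values $x_M=1$ and $x_{M+M_2}=2$ take precedence (e.g. for $k=1$ one has $M_2=\lceil1/H\rceil$). The mesh cells are $(x_{i-1},x_i)$, $1\le i\le M+M_2$. Discrete space: $\mathcal U_N=\{v\in H_0^1(\Omega): v|_\tau\in\mathcal P_k(\tau)\text{ for every mesh cell }\tau\}$, where $\mathcal P_k(\tau)$ is the space of polynomials of degree at most $k$ on $\tau$.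 *)

theory Defs
  imports
    "HOL-Analysis.Analysis"
    "HOL-Probability.Essential_Supremum"
    "HOL-Computational_Algebra.Polynomial"
begin

section \<open>Function spaces\<close>

(* On a closed interval the derivatives at the end points are one-sided. *)
definition C_k_on :: "nat \<Rightarrow> real set \<Rightarrow> (real \<Rightarrow> real) \<Rightarrow> bool" where
  "C_k_on m S f \<longleftrightarrow>
     (\<exists>D :: nat \<Rightarrow> real \<Rightarrow> real.
        (\<forall>x\<in>S. D 0 x = f x) \<and>
        (\<forall>j<m. \<forall>x\<in>S. (D j has_real_derivative D (Suc j) x) (at x within S)) \<and>
        continuous_on S (D m))"

(* Elements of the spaces below are representatives: they are only relevant up to null sets, and
   their values outside the domain do not matter. *)
definition L2 :: "real set \<Rightarrow> (real \<Rightarrow> real) set" where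
  "L2 D = {f \<in> borel_measurable (lebesgue_on D). integrable (lebesgue_on D) (\<lambda>x. (f x)\<^sup>2)}"

definition L2_inner :: "real set \<Rightarrow> (real \<Rightarrow> real) \<Rightarrow> (real \<Rightarrow> real) \<Rightarrow> real" where
  "L2_inner D f g = (\<integral>x. f x * g x \<partial>(lebesgue_on D))"

definition L2_norm :: "real set \<Rightarrow> (real \<Rightarrow> real) \<Rightarrow> real" where
  "L2_norm D f = sqrt (L2_inner D f f)"

definition Linf_norm :: "real set \<Rightarrow> (real \<Rightarrow> real) \<Rightarrow> real" where
  "Linf_norm D f = real_of_ereal (esssup (lebesgue_on D) (\<lambda>x. ereal \<bar>f x\<bar>))"

definition test_functions :: "real set \<Rightarrow> (real \<Rightarrow> real) set" where
  "test_functions D =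
     {\<phi>. (\<forall>m. C_k_on m UNIV \<phi>) \<and> (\<exists>K. compact K \<and> K \<subseteq> D \<and> (\<forall>x. x \<notin> K \<longrightarrow> \<phi> x = 0))}"

definition has_L2_weak_deriv :: "real set \<Rightarrow> (real \<Rightarrow> real) \<Rightarrow> (real \<Rightarrow> real) \<Rightarrow> bool" where
  "has_L2_weak_deriv D v g \<longleftrightarrow>
     g \<in> L2 D \<and> (\<forall>\<phi>\<in>test_functions D. L2_inner D v (deriv \<phi>) = - L2_inner D g \<phi>)"

definition H1 :: "real set \<Rightarrow> (real \<Rightarrow> real) set" where
  "H1 D = {v \<in> L2 D. \<exists>g. has_L2_weak_deriv D v g}"

(* For open D the weak derivative is unique up to a null set, so the choice is immaterial. *)
definition weak_deriv :: "real set \<Rightarrow> (real \<Rightarrow> real) \<Rightarrow> real \<Rightarrow> real" where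
  "weak_deriv D v = (SOME g. has_L2_weak_deriv D v g)"

definition H1_norm :: "real set \<Rightarrow> (real \<Rightarrow> real) \<Rightarrow> real" where
  "H1_norm D v = sqrt ((L2_norm D v)\<^sup>2 + (L2_norm D (weak_deriv D v))\<^sup>2)"

definition H10 :: "real set \<Rightarrow> (real \<Rightarrow> real) set" where
  "H10 D = {v \<in> H1 D. \<forall>e>0. \<exists>\<phi>\<in>test_functions D. H1_norm D (\<lambda>x. v x - \<phi> x) < e}"

section \<open>The convection-diffusion problem with large shift\<close>

abbreviation Omega :: "real set" where
  "Omega \<equiv> {0<..<2}"

(* Classical solution. As u 0 = \<Phi> 0 = 0 and u is continuous on [0,2], the shifted function
   x \<mapsto> u (x - 1) is continuous at 1, so u'' exists on all of Omega. *)
definition solves_shift_problem ::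
  "real \<Rightarrow> (real \<Rightarrow> real) \<Rightarrow> (real \<Rightarrow> real) \<Rightarrow> (real \<Rightarrow> real) \<Rightarrow> (real \<Rightarrow> real) \<Rightarrow> (real \<Rightarrow> real)
     \<Rightarrow> (real \<Rightarrow> real) \<Rightarrow> bool" where
  "solves_shift_problem \<epsilon> b c d f \<Phi> u \<longleftrightarrow>
     continuous_on {0..2} u \<and>
     (\<exists>u' u''. \<forall>x\<in>Omega.
        (u has_real_derivative u' x) (at x) \<and>
        (u' has_real_derivative u'' x) (at x) \<and>
        - \<epsilon> * u'' x - b x * u' x + c x * u x + d x * u (x - 1) = f x) \<and>
     u 2 = 0 \<and>
     (\<forall>x\<in>{-1<..0}. u x = \<Phi> x)"

definition bilin ::
  "real \<Rightarrow> (real \<Rightarrow> real) \<Rightarrow> (real \<Rightarrow> real) \<Rightarrow> (real \<Rightarrow> real) \<Rightarrow> (real \<Rightarrow> real) \<Rightarrow> (real \<Rightarrow> real) \<Rightarrow> real"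
  where
  "bilin \<epsilon> b c d u v =
     \<epsilon> * L2_inner Omega (weak_deriv Omega u) (weak_deriv Omega v)
     + L2_inner Omega (\<lambda>x. c x * u x - b x * weak_deriv Omega u x) v
     + L2_inner {1<..<2} (\<lambda>x. d x * u (x - 1)) v"

definition linform ::
  "(real \<Rightarrow> real) \<Rightarrow> (real \<Rightarrow> real) \<Rightarrow> (real \<Rightarrow> real) \<Rightarrow> (real \<Rightarrow> real) \<Rightarrow> real" where
  "linform d f \<Phi> v =
     L2_inner Omega f v - L2_inner {0<..<1} (\<lambda>x. d x * \<Phi> (x - 1)) v"

section \<open>Coarser Duran mesh\<close>

(* For 0 < H, \<epsilon> < 1 one has 1 \<le> H * \<lceil>1/H\<rceil> < 1 + H, hence both rounded values below are at
   least \<lceil>1/H\<rceil> and the conversions to nat do not truncate. *)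
definition mesh_M1 :: "real \<Rightarrow> real \<Rightarrow> nat" where
  "mesh_M1 \<epsilon> H =
     nat \<lceil>of_int \<lceil>1 / H\<rceil> - ln (H * \<epsilon> * of_int \<lceil>1 / H\<rceil>) / ln (1 + H)\<rceil>"

definition mesh_M2 :: "nat \<Rightarrow> real \<Rightarrow> real \<Rightarrow> nat" where
  "mesh_M2 k \<epsilon> H =
     nat \<lceil>of_int \<lceil>1 / H\<rceil>
           - ln (H * \<epsilon> powr ((real k - 1) / real k) * of_int \<lceil>1 / H\<rceil>) / ln (1 + H)\<rceil>"

(* The values at the indices M and M + M2 take precedence over the other cases; indices beyond
   M + M2 are not part of the mesh. *)
fun mesh_node :: "nat \<Rightarrow> real \<Rightarrow> real \<Rightarrow> nat \<Rightarrow> real" where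
  "mesh_node k \<epsilon> H 0 = 0"
| "mesh_node k \<epsilon> H (Suc n) =
     (let i = Suc n; L = nat \<lceil>1 / H\<rceil>; M = mesh_M1 \<epsilon> H; M2 = mesh_M2 k \<epsilon> H in
      if i = M then 1
      else if i = M + M2 then 2
      else if i < M then
        (if i \<le> L then real i * H * \<epsilon> else (1 + H) * mesh_node k \<epsilon> H n)
      else
        (if i \<le> M + L then 1 + real (i - M) * H * \<epsilon> powr ((real k - 1) / real k)
         else 1 + (1 + H) * (mesh_node k \<epsilon> H n - 1)))"

definition mesh_cells :: "nat \<Rightarrow> real \<Rightarrow> real \<Rightarrow> real set set" where
  "mesh_cells k \<epsilon> H =
     {{mesh_node k \<epsilon> H (i - 1)<..<mesh_node k \<epsilon> H i} | i. i \<in> {1..mesh_M1 \<epsilon> H + mesh_M2 k \<epsilon> H}}"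

definition FE_space :: "nat \<Rightarrow> real \<Rightarrow> real \<Rightarrow> (real \<Rightarrow> real) set" where
  "FE_space k \<epsilon> H =
     {v \<in> H10 Omega. \<forall>\<tau>\<in>mesh_cells k \<epsilon> H.
        \<exists>p :: real poly. degree p \<le> k \<and> (AE x in lebesgue_on \<tau>. v x = poly p x)}"

definition FE_solution ::
  "nat \<Rightarrow> real \<Rightarrow> real \<Rightarrow> (real \<Rightarrow> real) \<Rightarrow> (real \<Rightarrow> real) \<Rightarrow> (real \<Rightarrow> real) \<Rightarrow> (real \<Rightarrow> real)
     \<Rightarrow> (real \<Rightarrow> real) \<Rightarrow> (real \<Rightarrow> real) \<Rightarrow> bool" where
  "FE_solution k \<epsilon> H b c d f \<Phi> uN \<longleftrightarrow>
     uN \<in> FE_space k \<epsilon> H \<and>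
     (\<forall>v\<in>FE_space k \<epsilon> H. bilin \<epsilon> b c d uN v = linform d f \<Phi> v)"

end

theory Submission
  imports Defs
begin

text \<open>
The error is estimated against a function \<open>u\<^sub>I\<close> of the discrete space, with \<open>v = u\<^sub>I - u\<^sub>N\<close>.
The form \<open>B\<close> is coercive in the energy norm: the convection term contributes \<open>b' / 2\<close>, and the
shifted term pairs the values of \<open>v\<close> on \<open>(1, 2)\<close> with those on \<open>(0, 1)\<close>, so that it costs at most
half of the maximum of \<open>d\<close> on either interval (\<open>form_coercive\<close>). By Galerkin orthogonality
\<open>B(v, v) = - B(u - u\<^sub>I, v)\<close>, and the whole question is how to bound the right-hand side by \<open>H^k\<close> times
the energy norm of \<open>v\<close>, uniformly in \<open>\<epsilon>\<close>.

The solution has a layer \<open>exp (- b x / \<epsilon>)\<close> at \<open>x = 0\<close>. The shifted term transports it to \<open>x = 1\<close>, where it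
acts as a right-hand side and produces a layer that is weaker by one power of \<open>\<epsilon>\<close>. Barrier functions
make this precise: the equation is a first order equation \<open>\<epsilon> z' + b z = F\<close> for
\<open>z = u'\<close>, in which \<open>F\<close> contains \<open>u\<close> and the shifted function but not \<open>u'\<close>.
Comparison and repeated differentiation give \<open>\<bar>u^(j)\<bar> \<le> C (1 + \<epsilon>^(- j) exp (- \<kappa> x / \<epsilon>))\<close> on \<open>(0, 1)\<close> and
\<open>\<bar>u^(j)\<bar> \<le> C (1 + \<epsilon>^(1 - j) exp (- \<kappa> (x - 1) / \<epsilon>))\<close> on \<open>(1, 2)\<close> (\<open>solution_layer_bounds\<close>). The
starting point is a bound of \<open>u\<close> in \<open>L\<^sup>2\<close> by testing with \<open>u\<close>, together with an integrated form of the equation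
(\<open>solution_stability\<close>).

On a mesh cell, the derivative of order \<open>k + 1\<close> is cut into a bounded part and a part of layer type.
Integrating both from the right end of the cell writes \<open>u\<close> as a polynomial of degree \<open>k\<close> plus a smooth
remainder \<open>S\<close> plus a layer remainder \<open>W\<close>; a linear correction makes \<open>S\<close> and \<open>W\<close> vanish at the nodes
(\<open>cell_approximation\<close>). The right end is chosen because the layer is smallest there, which
keeps \<open>W\<close> of the size of the layer even on cells that are long compared with \<open>\<epsilon>\<close>. The polynomials form
\<open>u\<^sub>I\<close>, and \<open>u - u\<^sub>I = S + W\<close>. As no cell is longer than \<open>H\<close>, \<open>S, S' = O(H^k)\<close>, and the grading
of the mesh ensures that \<open>W\<close> has \<open>L\<^sup>2\<close> norm \<open>O(\<epsilon>^(1/2) H^k)\<close> and \<open>W'\<close> has \<open>L\<^sup>2\<close> norm \<open>O(\<epsilon>^(-1/2) H^k)\<close> (\<open>mesh_cell_split\<close>). Near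
\<open>x = 1\<close> the first steps \<open>\<mu> = H \<epsilon>^((k - 1) / k)\<close> may exceed \<open>\<epsilon>\<close>; but \<open>\<mu>^k = H^k \<epsilon>^(k - 1)\<close>, so this only happens
when \<open>\<epsilon> \<le> H^k\<close>, and then the weak layer is itself below the required accuracy.

These norms fit the form: in the convection term the part with \<open>S'\<close> is estimated directly, whereas the
part with \<open>W'\<close> is integrated by parts, so that \<open>W\<close> meets \<open>\<epsilon>^(1/2) v'\<close> (\<open>form_upper\<close>). Young's inequality
then absorbs half of the energy norm of \<open>v\<close>.

The spaces are handled through piecewise continuously differentiable functions: a smooth
cut-off shows that weak derivatives are unique up to null sets, that such functions with zero boundary
values and piecewise polynomial form belong to \<open>H10\<close>, and that integration by parts extends to \<open>H10\<close> by
density.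
\<close>

section \<open>Comparison for first order equations\<close>

lemma mvt_within_interval:
  fixes f f' :: "real \<Rightarrow> real"
  assumes "\<And>x. x \<in> {s..e} \<Longrightarrow> (f has_real_derivative f' x) (at x within {s..e})"
    and "s \<le> a" "a < b" "b \<le> e"
  shows "\<exists>\<xi>\<in>{a<..<b}. f b - f a = f' \<xi> * (b - a)"
proof -
  have "\<exists>\<xi>\<in>{a<..<b}. f b - f a = (*) (f' \<xi>) (b - a)"
  proof (rule mvt_simple[OF \<open>a < b\<close>])
    fix x assume "a \<le> x" "x \<le> b"
    with assms have "(f has_real_derivative f' x) (at x within {a..b})"
      by (intro DERIV_subset[OF assms(1)]) auto
    then show "(f has_derivative (*) (f' x)) (at x within {a..b})"
      by (simp add: has_field_derivative_def)
  qed
  then show ?thesis by simp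
qed

lemma integrating_factor:
  fixes y y' b :: "real \<Rightarrow> real"
  assumes "\<epsilon> > 0" and b: "continuous_on {s..e} b"
    and y: "\<And>x. x \<in> {s..e} \<Longrightarrow> (y has_real_derivative y' x) (at x within {s..e})"
  obtains E where "\<And>x. E x > 0"
    and "\<And>x. x \<in> {s..e} \<Longrightarrow>
          ((\<lambda>x. E x * y x) has_real_derivative E x / \<epsilon> * (\<epsilon> * y' x + b x * y x)) (at x within {s..e})"
proof
  let ?B = "\<lambda>x. integral {s..x} b"
  show "exp (?B x / \<epsilon>) > 0" for x by simp
  fix x assume x: "x \<in> {s..e}"
  have "(?B has_real_derivative b x) (at x within {s..e})"
    by (rule integral_has_real_derivative[OF b x])
  then show "((\<lambda>x. exp (?B x / \<epsilon>) * y x) has_real_derivative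
       exp (?B x / \<epsilon>) / \<epsilon> * (\<epsilon> * y' x + b x * y x)) (at x within {s..e})"
    using \<open>\<epsilon> > 0\<close> by (auto intro!: derivative_eq_intros y x simp: field_simps)
qed

text \<open>
Multiplying by the integrating factor \<open>exp (B / \<epsilon>)\<close>, \<open>B' = b\<close>, turns the differential inequality into
monotonicity. Comparison for this initial value problem takes the place of a maximum principle for the
second order equation, which may fail since \<open>c\<close> can be negative.
\<close>

lemma comparison_nonneg:
  fixes y y' b :: "real \<Rightarrow> real"
  assumes "\<epsilon> > 0" and b: "continuous_on {s..e} b"
    and y: "\<And>x. x \<in> {s..e} \<Longrightarrow> (y has_real_derivative y' x) (at x within {s..e})"
    and L: "\<And>x. x \<in> {s..e} \<Longrightarrow> \<epsilon> * y' x + b x * y x \<ge> 0"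
    and "y s \<ge> 0" and x: "x \<in> {s..e}"
  shows "y x \<ge> 0"
proof (cases "x = s")
  case False
  obtain E where E: "\<And>x. E x > 0" and dE: "\<And>x. x \<in> {s..e} \<Longrightarrow>
      ((\<lambda>x. E x * y x) has_real_derivative E x / \<epsilon> * (\<epsilon> * y' x + b x * y x)) (at x within {s..e})"
    using integrating_factor[of \<epsilon> s e b y y', OF assms(1) b y] by blast
  obtain \<xi> where "\<xi> \<in> {s<..<x}"
    and "E x * y x - E s * y s = E \<xi> / \<epsilon> * (\<epsilon> * y' \<xi> + b \<xi> * y \<xi>) * (x - s)"
    using mvt_within_interval[OF dE, of s x] x False by auto
  moreover have "E \<xi> / \<epsilon> * (\<epsilon> * y' \<xi> + b \<xi> * y \<xi>) * (x - s) \<ge> 0" 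
    using E[of \<xi>] L[of \<xi>] x \<open>\<epsilon> > 0\<close> \<open>\<xi> \<in> {s<..<x}\<close> by (intro mult_nonneg_nonneg) auto
  ultimately have "E x * y x \<ge> 0" using E[of s] \<open>y s \<ge> 0\<close> 
    by (smt (verit) mult_nonneg_nonneg)
  then show ?thesis using E[of x] by (simp add: zero_le_mult_iff)
qed (use assms in simp)

lemma comparison_pos:
  fixes y y' b :: "real \<Rightarrow> real"
  assumes "\<epsilon> > 0" "s < e" and b: "continuous_on {s..e} b"
    and y: "\<And>x. x \<in> {s..e} \<Longrightarrow> (y has_real_derivative y' x) (at x within {s..e})"
    and L: "\<And>x. x \<in> {s..e} \<Longrightarrow> \<epsilon> * y' x + b x * y x > 0"
    and "y s \<ge> 0"
  shows "y e > 0"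
proof -
  obtain E where E: "\<And>x. E x > 0" and dE: "\<And>x. x \<in> {s..e} \<Longrightarrow>
      ((\<lambda>x. E x * y x) has_real_derivative E x / \<epsilon> * (\<epsilon> * y' x + b x * y x)) (at x within {s..e})"
    using integrating_factor[of \<epsilon> s e b y y', OF assms(1) b y] by blast
  obtain \<xi> where \<xi>: "\<xi> \<in> {s<..<e}"
    and eq: "E e * y e - E s * y s = E \<xi> / \<epsilon> * (\<epsilon> * y' \<xi> + b \<xi> * y \<xi>) * (e - s)"
    using mvt_within_interval[OF dE, of s e] \<open>s < e\<close> by auto
  have "E \<xi> / \<epsilon> * (\<epsilon> * y' \<xi> + b \<xi> * y \<xi>) * (e - s) > 0" 
    using E[of \<xi>] L[of \<xi>] \<xi> \<open>\<epsilon> > 0\<close> \<open>s < e\<close> by (intro mult_pos_pos divide_pos_pos) auto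
  then have "E e * y e > 0" using E[of s] \<open>y s \<ge> 0\<close> eq
    by (smt (verit) mult_nonneg_nonneg)
  then show ?thesis using E[of e] by (simp add: zero_less_mult_iff)
qed

lemma comparison_abs:
  fixes y y' \<psi> \<psi>' b :: "real \<Rightarrow> real"
  assumes "\<epsilon> > 0" and b: "continuous_on {s..e} b"
    and y: "\<And>x. x \<in> {s..e} \<Longrightarrow> (y has_real_derivative y' x) (at x within {s..e})"
    and \<psi>: "\<And>x. x \<in> {s..e} \<Longrightarrow> (\<psi> has_real_derivative \<psi>' x) (at x within {s..e})"
    and L: "\<And>x. x \<in> {s..e} \<Longrightarrow> \<bar>\<epsilon> * y' x + b x * y x\<bar> \<le> \<epsilon> * \<psi>' x + b x * \<psi> x"
    and "\<bar>y s\<bar> \<le> \<psi> s" and x: "x \<in> {s..e}"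
  shows "\<bar>y x\<bar> \<le> \<psi> x"
proof -
  have "\<psi> x - y x \<ge> 0"
  proof (rule comparison_nonneg[OF assms(1) b _ _ _ x, of _ "\<lambda>x. \<psi>' x - y' x"])
    fix x assume "x \<in> {s..e}"
    then show "((\<lambda>x. \<psi> x - y x) has_real_derivative \<psi>' x - y' x) (at x within {s..e})"
      by (intro derivative_intros y \<psi>)
    show "0 \<le> \<epsilon> * (\<psi>' x - y' x) + b x * (\<psi> x - y x)"
      using L[OF \<open>x \<in> {s..e}\<close>] by (simp add: algebra_simps abs_le_iff)
  qed (use assms in auto)
  moreover have "\<psi> x + y x \<ge> 0"
  proof (rule comparison_nonneg[OF assms(1) b _ _ _ x, of _ "\<lambda>x. \<psi>' x + y' x"])
    fix x assume "x \<in> {s..e}"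
    then show "((\<lambda>x. \<psi> x + y x) has_real_derivative \<psi>' x + y' x) (at x within {s..e})"
      by (intro derivative_intros y \<psi>)
    show "0 \<le> \<epsilon> * (\<psi>' x + y' x) + b x * (\<psi> x + y x)"
      using L[OF \<open>x \<in> {s..e}\<close>] by (simp add: algebra_simps abs_le_iff)
  qed (use assms in auto)
  ultimately show ?thesis by auto
qed

lemma deriv_imp_continuous_on:
  fixes f f' :: "real \<Rightarrow> real"
  shows "\<forall>x\<in>S. (f has_real_derivative f' x) (at x within S) \<Longrightarrow> continuous_on S f"
  by (blast intro: DERIV_continuous_on)

section \<open>Derivative bounds with an exponential layer\<close>

text \<open>
Bounds for \<open>w\<close> and its first \<open>n\<close> derivatives on \<open>[s, s + 1]\<close> with a layer at \<open>s\<close>; every derivative loses one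
power of \<open>\<epsilon>\<close>. The exponent \<open>p\<close> is the strength of the layer: \<open>0\<close> for the layer at the outflow
boundary and \<open>1\<close> for the weak layer at \<open>x = 1\<close>. The recursion matches the differentiation of an equation.
\<close>

primrec layer_bounded :: "real \<Rightarrow> real \<Rightarrow> real \<Rightarrow> real \<Rightarrow> nat \<Rightarrow> real \<Rightarrow> (real \<Rightarrow> real) \<Rightarrow> bool" where
  "layer_bounded \<epsilon> \<kappa> s C 0 p w \<longleftrightarrow> continuous_on {s..s+1} w \<and>
     (\<forall>x\<in>{s..s+1}. \<bar>w x\<bar> \<le> C * (1 + \<epsilon> powr p * exp (- \<kappa> * (x - s) / \<epsilon>)))"
| "layer_bounded \<epsilon> \<kappa> s C (Suc n) p w \<longleftrightarrow>
     (\<forall>x\<in>{s..s+1}. \<bar>w x\<bar> \<le> C * (1 + \<epsilon> powr p * exp (- \<kappa> * (x - s) / \<epsilon>))) \<and>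
     (\<exists>w'. (\<forall>x\<in>{s..s+1}. (w has_real_derivative w' x) (at x within {s..s+1})) \<and>
           layer_bounded \<epsilon> \<kappa> s C n (p - 1) w')"

primrec deriv_bounded :: "real \<Rightarrow> real \<Rightarrow> nat \<Rightarrow> (real \<Rightarrow> real) \<Rightarrow> bool" where
  "deriv_bounded s A 0 a \<longleftrightarrow> continuous_on {s..s+1} a \<and> (\<forall>x\<in>{s..s+1}. \<bar>a x\<bar> \<le> A)"
| "deriv_bounded s A (Suc n) a \<longleftrightarrow> (\<forall>x\<in>{s..s+1}. \<bar>a x\<bar> \<le> A) \<and>
     (\<exists>a'. (\<forall>x\<in>{s..s+1}. (a has_real_derivative a' x) (at x within {s..s+1})) \<and>
           deriv_bounded s A n a')"

lemma layer_bounded_bound: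
  "layer_bounded \<epsilon> \<kappa> s C n p w \<Longrightarrow> x \<in> {s..s+1} \<Longrightarrow>
     \<bar>w x\<bar> \<le> C * (1 + \<epsilon> powr p * exp (- \<kappa> * (x - s) / \<epsilon>))"
  by (cases n) auto

lemma deriv_bounded_bound: "deriv_bounded s A n a \<Longrightarrow> x \<in> {s..s+1} \<Longrightarrow> \<bar>a x\<bar> \<le> A"
  by (cases n) auto

lemma layer_weight_pos: "0 < 1 + \<epsilon> powr p * exp (t::real)"
  by (smt (verit) exp_gt_zero mult_nonneg_nonneg powr_ge_zero)

lemma layer_bounded_nonneg:
  assumes "layer_bounded \<epsilon> \<kappa> s C n p w" shows "C \<ge> 0"
proof -
  have "0 \<le> C * (1 + \<epsilon> powr p * exp (- \<kappa> * (s - s) / \<epsilon>))"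
    using layer_bounded_bound[OF assms, of s] by simp
  then show ?thesis using layer_weight_pos[of \<epsilon> p 0] by (simp add: zero_le_mult_iff)
qed

lemma deriv_bounded_nonneg: "deriv_bounded s A n a \<Longrightarrow> A \<ge> 0"
  using deriv_bounded_bound[of s A n a s] by simp

lemma layer_bounded_mono:
  assumes "0 < \<epsilon>" "\<epsilon> < 1" "C \<le> C'" "q \<le> p" "layer_bounded \<epsilon> \<kappa> s C n p w"
  shows "layer_bounded \<epsilon> \<kappa> s C' n q w"
  using assms(4,5)
proof (induction n arbitrary: p q w)
  have *: "C * (1 + \<epsilon> powr p * exp t) \<le> C' * (1 + \<epsilon> powr q * exp t)" if "q \<le> p" "C \<ge> 0" for p q t
  proof -
    have "\<epsilon> powr p \<le> \<epsilon> powr q" using that assms(1,2) by (intro powr_mono') auto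
    then show ?thesis using that assms(3) by (intro mult_mono add_mono mult_right_mono) auto
  qed
  {
    case 0
    then show ?case using *[OF 0(1) layer_bounded_nonneg[OF 0(2)]] by (auto intro: order.trans)
  next
    case (Suc n)
    from Suc.prems(2) obtain w' where w': "\<forall>x\<in>{s..s+1}. (w has_real_derivative w' x) (at x within {s..s+1})"
      "layer_bounded \<epsilon> \<kappa> s C n (p - 1) w'" by auto
    have "layer_bounded \<epsilon> \<kappa> s C' n (q - 1) w'"
      using Suc.IH[OF _ w'(2), of "q - 1"] Suc.prems by simp
    then show ?case using w' *[OF Suc.prems(1) layer_bounded_nonneg[OF Suc.prems(2)]] Suc.prems(2) by (force intro: order.trans)
  }
qed

lemma layer_bounded_Suc: 
  assumes "layer_bounded \<epsilon> \<kappa> s C (Suc n) p w" shows "layer_bounded \<epsilon> \<kappa> s C n p w"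
  using assms
proof (induction n arbitrary: p w)
  case 0 then show ?case by (auto intro: deriv_imp_continuous_on)
next
  case (Suc n)
  then obtain w' where "\<forall>x\<in>{s..s+1}. (w has_real_derivative w' x) (at x within {s..s+1})"
      "layer_bounded \<epsilon> \<kappa> s C (Suc n) (p - 1) w'" by auto
  with Suc.IH[of "p - 1" w'] Suc.prems show ?case by auto
qed

lemma deriv_bounded_Suc: "deriv_bounded s A (Suc n) a \<Longrightarrow> deriv_bounded s A n a"
proof (induction n arbitrary: a)
  case 0 then show ?case by (auto intro: deriv_imp_continuous_on)
next
  case (Suc n)
  then obtain a' where "\<forall>x\<in>{s..s+1}. (a has_real_derivative a' x) (at x within {s..s+1})"
      "deriv_bounded s A (Suc n) a'" by auto
  with Suc.IH[of a'] Suc.prems show ?case by auto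
qed

lemma deriv_bounded_mono: "deriv_bounded s A n a \<Longrightarrow> A \<le> A' \<Longrightarrow> deriv_bounded s A' n a"
proof (induction n arbitrary: a)
  case (Suc n)
  then obtain a' where "\<forall>x\<in>{s..s+1}. (a has_real_derivative a' x) (at x within {s..s+1})"
      "deriv_bounded s A n a'" by auto
  with Suc.IH[of a'] Suc.prems show ?case by (auto intro: order.trans)
qed (auto intro: order.trans)

lemma layer_bounded_add:
  "layer_bounded \<epsilon> \<kappa> s C1 n p w1 \<Longrightarrow> layer_bounded \<epsilon> \<kappa> s C2 n p w2 \<Longrightarrow>
     layer_bounded \<epsilon> \<kappa> s (C1 + C2) n p (\<lambda>x. w1 x + w2 x)"
proof (induction n arbitrary: p w1 w2)
  have *: "\<bar>a + b\<bar> \<le> (C1 + C2) * E" if "\<bar>a\<bar> \<le> C1 * E" "\<bar>b\<bar> \<le> C2 * E" for a b E :: real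
    using that by (simp add: algebra_simps)
  {
    case 0 then show ?case by (auto intro!: continuous_intros *)
  next
    case (Suc n)
    then obtain w1' w2' where w: "\<forall>x\<in>{s..s+1}. (w1 has_real_derivative w1' x) (at x within {s..s+1})"
       "layer_bounded \<epsilon> \<kappa> s C1 n (p - 1) w1'"
       "\<forall>x\<in>{s..s+1}. (w2 has_real_derivative w2' x) (at x within {s..s+1})"
       "layer_bounded \<epsilon> \<kappa> s C2 n (p - 1) w2'" by auto
    have "\<forall>x\<in>{s..s+1}. ((\<lambda>x. w1 x + w2 x) has_real_derivative w1' x + w2' x) (at x within {s..s+1})"
      using w by (auto intro!: derivative_intros)
    with Suc.IH[OF w(2,4)] Suc.prems show ?case by (auto intro!: *)
  }
qed

text \<open>
Leibniz rule. The term \<open>a' w\<close> has one power of \<open>\<epsilon>\<close> to spare, so it obeys the weaker weight of \<open>w'\<close> as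
\<open>\<epsilon> < 1\<close>.
\<close>

lemma layer_bounded_mult:
  assumes "0 < \<epsilon>" "\<epsilon> < 1"
  shows "deriv_bounded s A n a \<Longrightarrow> layer_bounded \<epsilon> \<kappa> s C n p w \<Longrightarrow>
     layer_bounded \<epsilon> \<kappa> s (2 ^ n * A * C) n p (\<lambda>x. a x * w x)"
proof (induction n arbitrary: p w a)
  case 0
  have "\<bar>a x * w x\<bar> \<le> A * C * (1 + \<epsilon> powr p * exp (- \<kappa> * (x - s) / \<epsilon>))" if "x \<in> {s..s+1}" for x
    using mult_mono[OF deriv_bounded_bound[OF 0(1) that] layer_bounded_bound[OF 0(2) that]]
      deriv_bounded_nonneg[OF 0(1)] by (simp add: abs_mult mult.assoc)
  with 0 show ?case by (auto intro!: continuous_intros)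
next
  case (Suc n)
  from Suc.prems obtain a' w' where
    a': "\<forall>x\<in>{s..s+1}. (a has_real_derivative a' x) (at x within {s..s+1})" "deriv_bounded s A n a'" and
    w': "\<forall>x\<in>{s..s+1}. (w has_real_derivative w' x) (at x within {s..s+1})" "layer_bounded \<epsilon> \<kappa> s C n (p - 1) w'"
    by auto
  have nn: "A \<ge> 0" "C \<ge> 0" using Suc.prems by (auto dest: deriv_bounded_nonneg layer_bounded_nonneg)
  have 1: "layer_bounded \<epsilon> \<kappa> s (2 ^ n * A * C) n (p - 1) (\<lambda>x. a' x * w x)"
    by (rule layer_bounded_mono[OF assms order.refl _ Suc.IH[OF a'(2) layer_bounded_Suc[OF Suc.prems(2)]]]) simp
  have 2: "layer_bounded \<epsilon> \<kappa> s (2 ^ n * A * C) n (p - 1) (\<lambda>x. a x * w' x)"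
    by (rule Suc.IH[OF deriv_bounded_Suc[OF Suc.prems(1)] w'(2)])
  have 3: "layer_bounded \<epsilon> \<kappa> s (2 ^ Suc n * A * C) n (p - 1) (\<lambda>x. a' x * w x + a x * w' x)"
    using layer_bounded_add[OF 1 2] by (simp add: algebra_simps)
  have "\<bar>a x * w x\<bar> \<le> 2 ^ Suc n * A * C * (1 + \<epsilon> powr p * exp (- \<kappa> * (x - s) / \<epsilon>))" if "x \<in> {s..s+1}" for x
  proof -
    have "\<bar>a x * w x\<bar> \<le> 1 * (A * C * (1 + \<epsilon> powr p * exp (- \<kappa> * (x - s) / \<epsilon>)))"
    using mult_mono[OF deriv_bounded_bound[OF Suc(2) that] layer_bounded_bound[OF Suc(3) that]]
      nn by (simp add: abs_mult mult.assoc)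
    also have "\<dots> \<le> 2 ^ Suc n * (A * C * (1 + \<epsilon> powr p * exp (- \<kappa> * (x - s) / \<epsilon>)))"
      using nn layer_weight_pos[of \<epsilon> p] by (intro mult_right_mono mult_nonneg_nonneg) (auto simp: less_imp_le simp del: power_Suc)
    finally show ?thesis by (simp add: mult.assoc)
  qed
  moreover have "\<forall>x\<in>{s..s+1}. ((\<lambda>x. a x * w x) has_real_derivative a' x * w x + a x * w' x) (at x within {s..s+1})"
    using a'(1) w'(1) by (auto intro!: derivative_eq_intros simp: algebra_simps)
  ultimately show ?case using 3 by (auto simp del: power_Suc)
qed

lemma deriv_bounded_layer_bounded:
  "deriv_bounded s A n a \<Longrightarrow> layer_bounded \<epsilon> \<kappa> s A n p a"
proof (induction n arbitrary: a p)
  have *: "\<bar>y\<bar> \<le> A * (1 + \<epsilon> powr q * exp t)" if "\<bar>y\<bar> \<le> A" for y q t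
  proof -
    have "A * 1 \<le> A * (1 + \<epsilon> powr q * exp t)" using that by (intro mult_left_mono) auto
    with that show ?thesis by simp
  qed
  {
    case 0 then show ?case by (auto intro!: *)
  next
    case (Suc n) then show ?case by (auto intro!: *)
  }
qed

lemma layer_bounded_uminus:
  "layer_bounded \<epsilon> \<kappa> s C n p w \<Longrightarrow> layer_bounded \<epsilon> \<kappa> s C n p (\<lambda>x. - w x)"
proof (induction n arbitrary: p w)
  case (Suc n)
  then obtain w' where w: "\<forall>x\<in>{s..s+1}. (w has_real_derivative w' x) (at x within {s..s+1})"
       "layer_bounded \<epsilon> \<kappa> s C n (p - 1) w'" by auto
  have "\<forall>x\<in>{s..s+1}. ((\<lambda>x. - w x) has_real_derivative - w' x) (at x within {s..s+1})"
    using w by (auto intro!: derivative_intros)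
  with Suc.IH[OF w(2)] Suc.prems show ?case by auto
qed (auto intro!: continuous_intros)

lemma layer_bounded_shift:
  "layer_bounded \<epsilon> \<kappa> s C n p w \<Longrightarrow> layer_bounded \<epsilon> \<kappa> (s + t) C n p (\<lambda>x. w (x - t))"
proof (induction n arbitrary: p w)
  case 0
  have *: "continuous_on {s+t..s+t+1} (\<lambda>x. w (x - t))"
    by (rule continuous_on_compose2[of "{s..s+1}" w]) (use 0 in \<open>auto intro!: continuous_intros\<close>)
  have "\<bar>w (x - t)\<bar> \<le> C * (1 + \<epsilon> powr p * exp (- \<kappa> * (x - (s + t)) / \<epsilon>))" if "x \<in> {s+t..s+t+1}" for x
    using layer_bounded_bound[OF 0, of "x - t"] that by (simp add: algebra_simps)
  with * show ?case by simp
next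
  case (Suc n)
  then obtain w' where w0: "\<forall>x\<in>{s..s+1}. (w has_real_derivative w' x) (at x within {s..s+1})" and
       w: "layer_bounded \<epsilon> \<kappa> s C n (p - 1) w'" by auto
  have "((\<lambda>x. w (x - t)) has_real_derivative w' (x - t)) (at x within {s+t..s+t+1})" if "x\<in>{s+t..s+t+1}" for x
  proof -
    have "(w \<circ> (\<lambda>x. x - t) has_real_derivative w' (x - t) * 1) (at x within {s+t..s+t+1})"
      by (rule DERIV_image_chain) (use that in \<open>auto intro!: derivative_eq_intros DERIV_subset[OF bspec[OF w0]]\<close>)
    then show ?thesis by (simp add: o_def)
  qed
  moreover have "\<bar>w (x - t)\<bar> \<le> C * (1 + \<epsilon> powr p * exp (- \<kappa> * (x - (s + t)) / \<epsilon>))" if "x \<in> {s+t..s+t+1}" for x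
    using layer_bounded_bound[OF Suc.prems, of "x - t"] that by (simp add: algebra_simps)
  ultimately show ?case using Suc.IH[OF w] by (auto intro!: exI[of _ "\<lambda>x. w' (x - t)"])
qed

lemma C_k_on_deriv_bounded:
  assumes "C_k_on m {l..r} f" "n \<le> m" "l \<le> s" "s + 1 \<le> r"
  shows "\<exists>A. deriv_bounded s A n f"
proof -
  from assms(1) obtain D where D0: "\<forall>x\<in>{l..r}. D 0 x = f x"
    and D: "\<And>j x. j < m \<Longrightarrow> x \<in> {l..r} \<Longrightarrow> (D j has_real_derivative D (Suc j) x) (at x within {l..r})"
    and Dm: "continuous_on {l..r} (D m)" unfolding C_k_on_def by blast
  have cont: "continuous_on {l..r} (D j)" if "j \<le> m" for j
    using that Dm by (cases "j = m") (auto intro!: deriv_imp_continuous_on[of _ _ "D (Suc j)"] D)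
  have "\<exists>K. \<forall>x\<in>{l..r}. \<bar>D j x\<bar> \<le> K" if "j \<le> m" for j
    using compact_imp_bounded[OF compact_continuous_image[OF cont[OF that]]] by (auto simp: bounded_iff)
  then obtain K where K: "\<And>j x. j \<le> m \<Longrightarrow> x \<in> {l..r} \<Longrightarrow> \<bar>D j x\<bar> \<le> K j" by metis
  define A where "A = Max (K ` {..m})"
  have A: "\<bar>D j x\<bar> \<le> A" if "j \<le> m" "x \<in> {l..r}" for j x
    using order.trans[OF K[OF that] Max_ge[of "K ` {..m}" "K j"]] that by (auto simp: A_def)
  have sub: "{s..s+1} \<subseteq> {l..r}" using assms by auto
  have *: "deriv_bounded s A i (D j)" if "i + j \<le> m" for i j
    using that
  proof (induction i arbitrary: j)
    case 0
    then show ?case using A[of j] continuous_on_subset[OF cont sub] sub by auto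
  next
    case (Suc i)
    have "(D j has_real_derivative D (Suc j) x) (at x within {s..s+1})" if "x \<in> {s..s+1}" for x
      using D[of j x] Suc.prems that sub by (intro DERIV_subset[OF D sub]) auto
    with Suc.IH[of "Suc j"] Suc.prems A[of j] sub show ?case by (auto intro!: exI[of _ "D (Suc j)"])
  qed
  have "layer_bounded 1 0 s A n 0 (D 0)" using *[of n 0] assms by (intro deriv_bounded_layer_bounded) auto
  have "deriv_bounded s A n f"
  proof (cases n)
    case 0
    then show ?thesis using *[of 0 0] D0 sub continuous_on_cong[of "{s..s+1}" "{s..s+1}" f "D 0"] by auto
  next
    case (Suc i)
    have "(f has_real_derivative D 1 x) (at x within {s..s+1})" if "x \<in> {s..s+1}" for x
      by (rule has_field_derivative_transform_within[of "D 0" _ _ _ 1])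
         (use D[of 0 x] that sub Suc assms(2) D0 in \<open>auto intro!: DERIV_subset[OF D sub]\<close>)
    with *[of i 1] Suc assms(2) A[of 0] D0 sub show ?thesis by (auto intro!: exI[of _ "D 1"])
  qed
  then show ?thesis ..
qed

text \<open>
On the exponential part of the barrier the operator \<open>\<epsilon> d/dx + b\<close> acts as multiplication by
\<open>b - \<beta>/2 \<ge> \<beta>/2\<close>, so the barrier absorbs a right-hand side with the same exponential. With the decay rate
\<open>\<beta>\<close> instead of \<open>\<beta>/2\<close> a factor \<open>(x - s) / \<epsilon>\<close> would appear.
\<close>

lemma layer_ode_base:
  assumes b: "continuous_on {s..s+1} b" "\<forall>x\<in>{s..s+1}. b x \<ge> \<beta>" "\<beta> > 0"
    and eps: "0 < \<epsilon>" "\<epsilon> < 1"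
    and q: "q' \<le> q" and "0 \<le> C"
    and F: "\<And>x. x \<in> {s..s+1} \<Longrightarrow> \<bar>F x\<bar> \<le> C * (1 + \<epsilon> powr q * exp (- (\<beta>/2) * (x - s) / \<epsilon>))"
    and z: "\<And>x. x \<in> {s..s+1} \<Longrightarrow> (z has_real_derivative z' x) (at x within {s..s+1})"
    and ode: "\<And>x. x \<in> {s..s+1} \<Longrightarrow> \<epsilon> * z' x + b x * z x = F x"
    and zs: "\<bar>z s\<bar> \<le> C * \<epsilon> powr q'" and x: "x \<in> {s..s+1}"
  shows "\<bar>z x\<bar> \<le> (C + 2 * C / \<beta>) * (1 + \<epsilon> powr q' * exp (- (\<beta>/2) * (x - s) / \<epsilon>))"
proof -
  define K where "K = C + 2 * C / \<beta>"
  have K: "K \<ge> C" "K * (\<beta> / 2) \<ge> C" "K \<ge> 0" using assms by (auto simp: K_def field_simps)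
  define \<psi> where "\<psi> = (\<lambda>x. K * (1 + \<epsilon> powr q' * exp (- (\<beta>/2) * (x - s) / \<epsilon>)))"
  define \<psi>' where "\<psi>' = (\<lambda>x. K * (\<epsilon> powr q' * (exp (- (\<beta>/2) * (x - s) / \<epsilon>) * (- (\<beta>/2) / \<epsilon>))))"
  have "\<bar>z x\<bar> \<le> \<psi> x"
  proof (rule comparison_abs[OF eps(1) b(1) z _ _ _ x])
    fix x assume x: "x \<in> {s..s+1}"
    show "(\<psi> has_real_derivative \<psi>' x) (at x within {s..s + 1})"
      unfolding \<psi>_def \<psi>'_def using eps by (auto intro!: derivative_eq_intros)
    define E where "E = \<epsilon> powr q' * exp (- (\<beta>/2) * (x - s) / \<epsilon>)"
    have E: "E \<ge> 0" by (simp add: E_def)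
    have "\<epsilon> powr q \<le> \<epsilon> powr q'" using q eps by (intro powr_mono') auto
    then have "\<bar>F x\<bar> \<le> C * (1 + E)"
      using F[OF x] \<open>0 \<le> C\<close> unfolding E_def
      by (elim order.trans) (auto intro!: mult_left_mono mult_right_mono)
    also have "\<dots> \<le> K * (\<beta>/2) + K * (\<beta>/2) * E" using K(2) E mult_right_mono[OF K(2) E] by (simp add: algebra_simps)
    also have "\<dots> \<le> K * b x * 1 + K * (b x - \<beta>/2) * E"
    proof -
      have "\<beta> \<le> b x" using b(2) x by blast
      then have "K * (\<beta>/2) \<le> K * b x" "K * (\<beta>/2) \<le> K * (b x - \<beta>/2)"
        using K(3) b(3) by (auto intro!: mult_left_mono simp del: times_divide_eq_right)
      then show ?thesis using mult_right_mono[of "K * (\<beta>/2)" "K * (b x - \<beta>/2)" E] E by simp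
    qed
    also have "\<dots> = \<epsilon> * \<psi>' x + b x * \<psi> x" using eps by (simp add: \<psi>_def \<psi>'_def E_def field_simps)
    finally show "\<bar>\<epsilon> * z' x + b x * z x\<bar> \<le> \<epsilon> * \<psi>' x + b x * \<psi> x" using ode[OF x] by simp
  next
    have "C * \<epsilon> powr q' \<le> K * \<epsilon> powr q'" using K by (intro mult_right_mono) auto
    also have "\<dots> \<le> \<psi> s" using K by (simp add: \<psi>_def algebra_simps)
    finally show "\<bar>z s\<bar> \<le> \<psi> s" using zs by simp
  qed simp_all
  then show ?thesis by (simp add: \<psi>_def K_def)
qed

text \<open>
Differentiating \<open>\<epsilon> z' + b z = F\<close> gives the same equation for \<open>w = z'\<close> with right-hand side \<open>F' - b' z\<close> and
initial value \<open>(F - b z) / \<epsilon>\<close>: all weights lose one power of \<open>\<epsilon>\<close>. The conditions on \<open>q\<close> and \<open>q'\<close> are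
those that survive lowering both by one; \<open>q - 1 \<le> q'\<close> lets \<open>b' z\<close> be a part of the new right-hand side, and
\<open>q' \<le> min q 0\<close> makes the initial value dominate.
\<close>

lemma layer_ode:
  assumes "\<forall>x\<in>{s..s+1}. b x \<ge> \<beta>" "\<beta> > 0" "deriv_bounded s A n b"
    and "0 \<le> C" "q - 1 \<le> q'" "q' \<le> q" "q' \<le> 0"
  shows "\<exists>C'\<ge>0. \<forall>\<epsilon> F z z'. 0 < \<epsilon> \<longrightarrow> \<epsilon> < 1 \<longrightarrow> layer_bounded \<epsilon> (\<beta>/2) s C n q F \<longrightarrow>
     (\<forall>x\<in>{s..s+1}. (z has_real_derivative z' x) (at x within {s..s+1})) \<longrightarrow>
     (\<forall>x\<in>{s..s+1}. \<epsilon> * z' x + b x * z x = F x) \<longrightarrow> \<bar>z s\<bar> \<le> C * \<epsilon> powr q' \<longrightarrow>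
     layer_bounded \<epsilon> (\<beta>/2) s C' n q' z"
  using assms(3-7)
proof (induction n arbitrary: C q q')
  case 0
  then have b: "continuous_on {s..s+1} b" by simp
  show ?case
  proof (intro exI[of _ "C + 2 * C / \<beta>"] conjI allI impI)
    fix \<epsilon> F z z'
    assume eps: "0 < \<epsilon>" "\<epsilon> < 1" and F: "layer_bounded \<epsilon> (\<beta>/2) s C 0 q F" and
     z: "\<forall>x\<in>{s..s+1}. (z has_real_derivative z' x) (at x within {s..s+1})" and
     ode: "\<forall>x\<in>{s..s+1}. \<epsilon> * z' x + b x * z x = F x" and zs: "\<bar>z s\<bar> \<le> C * \<epsilon> powr q'"
    show "layer_bounded \<epsilon> (\<beta>/2) s (C + 2 * C / \<beta>) 0 q' z"
      using layer_ode_base[OF b assms(1,2) eps 0(4,2) layer_bounded_bound[OF F] bspec[OF z] bspec[OF ode] zs]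
        deriv_imp_continuous_on[OF z] by auto
  qed (use 0 assms in auto)
next
  case (Suc n)
  obtain b' where b': "\<forall>x\<in>{s..s+1}. (b has_real_derivative b' x) (at x within {s..s+1})" "deriv_bounded s A n b'"
    using Suc.prems by auto
  have A: "A \<ge> 0" using Suc.prems deriv_bounded_nonneg by blast
  obtain C1 where C1: "C1 \<ge> 0" "\<And>\<epsilon> F z z'. 0 < \<epsilon> \<Longrightarrow> \<epsilon> < 1 \<Longrightarrow> layer_bounded \<epsilon> (\<beta>/2) s C n q F \<Longrightarrow>
     (\<forall>x\<in>{s..s+1}. (z has_real_derivative z' x) (at x within {s..s+1})) \<Longrightarrow>
     (\<forall>x\<in>{s..s+1}. \<epsilon> * z' x + b x * z x = F x) \<Longrightarrow> \<bar>z s\<bar> \<le> C * \<epsilon> powr q' \<Longrightarrow>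
     layer_bounded \<epsilon> (\<beta>/2) s C1 n q' z"
    using Suc.IH[OF deriv_bounded_Suc[OF Suc.prems(1)] Suc.prems(2-5)] by blast
  define C2 where "C2 = 2 * C + A * C + 2 ^ n * A * C1"
  have C2: "C2 \<ge> 0" using A C1 Suc.prems by (auto simp: C2_def)
  obtain C3 where C3: "C3 \<ge> 0" "\<And>\<epsilon> F z z'. 0 < \<epsilon> \<Longrightarrow> \<epsilon> < 1 \<Longrightarrow> layer_bounded \<epsilon> (\<beta>/2) s C2 n (q-1) F \<Longrightarrow>
     (\<forall>x\<in>{s..s+1}. (z has_real_derivative z' x) (at x within {s..s+1})) \<Longrightarrow>
     (\<forall>x\<in>{s..s+1}. \<epsilon> * z' x + b x * z x = F x) \<Longrightarrow> \<bar>z s\<bar> \<le> C2 * \<epsilon> powr (q'-1) \<Longrightarrow>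
     layer_bounded \<epsilon> (\<beta>/2) s C3 n (q'-1) z"
    using Suc.IH[OF deriv_bounded_Suc[OF Suc.prems(1)] C2, of "q-1" "q'-1"] Suc.prems by auto
  show ?case
  proof (intro exI[of _ "max C1 C3"] conjI allI impI)
    fix \<epsilon> F z z'
    assume eps: "0 < \<epsilon>" "\<epsilon> < 1" and F: "layer_bounded \<epsilon> (\<beta>/2) s C (Suc n) q F" and
     z: "\<forall>x\<in>{s..s+1}. (z has_real_derivative z' x) (at x within {s..s+1})" and
     ode: "\<forall>x\<in>{s..s+1}. \<epsilon> * z' x + b x * z x = F x" and zs: "\<bar>z s\<bar> \<le> C * \<epsilon> powr q'"
    obtain F' where F': "\<forall>x\<in>{s..s+1}. (F has_real_derivative F' x) (at x within {s..s+1})"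
      "layer_bounded \<epsilon> (\<beta>/2) s C n (q-1) F'" using F by auto
    have zn: "layer_bounded \<epsilon> (\<beta>/2) s C1 n q' z"
      by (rule C1(2)[OF eps layer_bounded_Suc[OF F] z ode zs])
    define w where "w = (\<lambda>x. (F x - b x * z x) / \<epsilon>)"
    define w' where "w' = (\<lambda>x. (F' x - b' x * z x - b x * w x) / \<epsilon>)"
    have zw: "z' x = w x" if "x \<in> {s..s+1}" for x using ode that eps by (auto simp: w_def field_simps)
    have dw: "\<forall>x\<in>{s..s+1}. (w has_real_derivative w' x) (at x within {s..s+1})"
      unfolding w_def w'_def using F'(1) b'(1) z zw eps
      by (auto intro!: derivative_eq_intros simp: w_def field_simps)
    have F1: "layer_bounded \<epsilon> (\<beta>/2) s C2 n (q-1) (\<lambda>x. F' x + - (b' x * z x))"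
    proof (rule layer_bounded_mono[OF eps _ order.refl layer_bounded_add[OF F'(2) layer_bounded_uminus]])
      show "layer_bounded \<epsilon> (\<beta>/2) s (2 ^ n * A * C1) n (q-1) (\<lambda>x. b' x * z x)"
        by (rule layer_bounded_mono[OF eps order.refl _ layer_bounded_mult[OF eps b'(2) zn]]) (use Suc.prems in simp)
      show "C + 2 ^ n * A * C1 \<le> C2" using Suc.prems A C1 by (simp add: C2_def)
    qed
    have "layer_bounded \<epsilon> (\<beta>/2) s C3 n (q'-1) w"
    proof (rule C3(2)[OF eps F1 dw])
      show "\<forall>x\<in>{s..s + 1}. \<epsilon> * w' x + b x * w x = F' x + - (b' x * z x)"
        using eps by (simp add: w'_def)
      have 1: "\<bar>F s\<bar> \<le> 2 * C * \<epsilon> powr q'"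
      proof -
        have "\<bar>F s\<bar> \<le> C * (1 + \<epsilon> powr q)" using layer_bounded_bound[OF F, of s] by simp
        moreover have "\<epsilon> powr q \<le> \<epsilon> powr q'" using Suc.prems eps by (intro powr_mono') auto
        moreover have "1 \<le> \<epsilon> powr q'" using powr_mono'[of q' 0 \<epsilon>] Suc.prems eps by simp
        ultimately have "\<bar>F s\<bar> \<le> C * (\<epsilon> powr q' + \<epsilon> powr q')" 
          using Suc.prems by (elim order.trans) (intro mult_left_mono add_mono; simp)
        then show ?thesis by simp
      qed
      have "\<bar>b s\<bar> \<le> A" using deriv_bounded_bound[OF Suc.prems(1), of s] by simp
      then have 2: "\<bar>b s * z s\<bar> \<le> A * (C * \<epsilon> powr q')"
        unfolding abs_mult using zs A by (intro mult_mono) auto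
      have "\<bar>w s\<bar> \<le> (2 * C * \<epsilon> powr q' + A * (C * \<epsilon> powr q')) / \<epsilon>"
        using 1 2 eps by (simp add: w_def divide_right_mono)
      also have "\<dots> = (2 * C + A * C) * \<epsilon> powr (q' - 1)"
        using eps by (simp add: powr_diff field_simps)
      also have "\<dots> \<le> C2 * \<epsilon> powr (q' - 1)" using A C1 by (intro mult_right_mono) (auto simp: C2_def)
      finally show "\<bar>w s\<bar> \<le> C2 * \<epsilon> powr (q' - 1)" .
    qed
    then have "layer_bounded \<epsilon> (\<beta>/2) s (max C1 C3) n (q'-1) w"
      by (rule layer_bounded_mono[OF eps _ order.refl, rotated]) simp
    moreover have "layer_bounded \<epsilon> (\<beta>/2) s (max C1 C3) n q' z"
      by (rule layer_bounded_mono[OF eps _ order.refl zn]) simp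
    moreover have "\<forall>x\<in>{s..s+1}. (z has_real_derivative w x) (at x within {s..s+1})"
      using z zw by simp
    ultimately show "layer_bounded \<epsilon> (\<beta>/2) s (max C1 C3) (Suc n) q' z"
      unfolding layer_bounded.simps by (intro conjI ballI exI[of _ w] layer_bounded_bound) auto
  qed (use C1 in auto)
qed

text \<open>
Bootstrapping in the order: bounds for \<open>U\<close> up to order \<open>n\<close> bound \<open>c U + G\<close>, hence \<open>z = U'\<close> by
\<open>layer_ode\<close>, hence \<open>U\<close> up to order \<open>n + 1\<close>. The layer of \<open>U\<close> enters through the initial slope only.
\<close>

lemma layer_solution:
  assumes "\<forall>x\<in>{s..s+1}. b x \<ge> \<beta>" "\<beta> > 0" "deriv_bounded s A n b" "deriv_bounded s A n c"
    and "0 \<le> C" "0 \<le> \<sigma>" "\<sigma> \<le> 1"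
  shows "\<exists>C'\<ge>0. \<forall>\<epsilon> G U z z'. 0 < \<epsilon> \<longrightarrow> \<epsilon> < 1 \<longrightarrow> layer_bounded \<epsilon> (\<beta>/2) s C n 0 G \<longrightarrow>
     (\<forall>x\<in>{s..s+1}. \<bar>U x\<bar> \<le> C) \<longrightarrow> \<bar>z s\<bar> \<le> C * \<epsilon> powr (\<sigma> - 1) \<longrightarrow>
     (\<forall>x\<in>{s..s+1}. (U has_real_derivative z x) (at x within {s..s+1})) \<longrightarrow>
     (\<forall>x\<in>{s..s+1}. (z has_real_derivative z' x) (at x within {s..s+1})) \<longrightarrow>
     (\<forall>x\<in>{s..s+1}. \<epsilon> * z' x + b x * z x = c x * U x + G x) \<longrightarrow> 
     layer_bounded \<epsilon> (\<beta>/2) s C' (Suc n) \<sigma> U"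
proof -
  have A: "A \<ge> 0" using assms deriv_bounded_nonneg by blast
  have step: "\<exists>C'\<ge>0. \<forall>\<epsilon> G U z z'. 0 < \<epsilon> \<longrightarrow> \<epsilon> < 1 \<longrightarrow> layer_bounded \<epsilon> (\<beta>/2) s C n 0 G \<longrightarrow>
     layer_bounded \<epsilon> (\<beta>/2) s C1 n 0 U \<longrightarrow> (\<forall>x\<in>{s..s+1}. \<bar>U x\<bar> \<le> C) \<longrightarrow> \<bar>z s\<bar> \<le> C * \<epsilon> powr (\<sigma> - 1) \<longrightarrow>
     (\<forall>x\<in>{s..s+1}. (U has_real_derivative z x) (at x within {s..s+1})) \<longrightarrow>
     (\<forall>x\<in>{s..s+1}. (z has_real_derivative z' x) (at x within {s..s+1})) \<longrightarrow>
     (\<forall>x\<in>{s..s+1}. \<epsilon> * z' x + b x * z x = c x * U x + G x) \<longrightarrow> 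
     layer_bounded \<epsilon> (\<beta>/2) s C' (Suc n) \<sigma> U"
    if n: "deriv_bounded s A n b" "deriv_bounded s A n c" and C1: "C1 \<ge> 0" for n C1
  proof -
    define C2 where "C2 = C + 2 ^ n * A * C1"
    have C2: "0 \<le> C2" "C \<le> C2" using A C1 assms by (auto simp: C2_def)
    obtain C3 where C3: "C3 \<ge> 0" "\<And>\<epsilon> F z z'. 0 < \<epsilon> \<Longrightarrow> \<epsilon> < 1 \<Longrightarrow> layer_bounded \<epsilon> (\<beta>/2) s C2 n 0 F \<Longrightarrow>
     (\<forall>x\<in>{s..s+1}. (z has_real_derivative z' x) (at x within {s..s+1})) \<Longrightarrow>
     (\<forall>x\<in>{s..s+1}. \<epsilon> * z' x + b x * z x = F x) \<Longrightarrow> \<bar>z s\<bar> \<le> C2 * \<epsilon> powr (\<sigma> - 1) \<Longrightarrow>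
     layer_bounded \<epsilon> (\<beta>/2) s C3 n (\<sigma> - 1) z"
      using layer_ode[OF assms(1,2) n(1) C2(1), of 0 "\<sigma> - 1"] assms by auto
    show ?thesis
    proof (intro exI[of _ "max C3 C"] conjI allI impI)
      fix \<epsilon> G U z z'
      assume eps: "0 < \<epsilon>" "\<epsilon> < 1" and G: "layer_bounded \<epsilon> (\<beta>/2) s C n 0 G" and
       U: "layer_bounded \<epsilon> (\<beta>/2) s C1 n 0 U" "\<forall>x\<in>{s..s+1}. \<bar>U x\<bar> \<le> C" and zs: "\<bar>z s\<bar> \<le> C * \<epsilon> powr (\<sigma> - 1)" and
       dU: "\<forall>x\<in>{s..s+1}. (U has_real_derivative z x) (at x within {s..s+1})" and
       dz: "\<forall>x\<in>{s..s+1}. (z has_real_derivative z' x) (at x within {s..s+1})" and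
       ode: "\<forall>x\<in>{s..s+1}. \<epsilon> * z' x + b x * z x = c x * U x + G x"
      have F: "layer_bounded \<epsilon> (\<beta>/2) s C2 n 0 (\<lambda>x. c x * U x + G x)"
        using layer_bounded_add[OF layer_bounded_mult[OF eps n(2) U(1)] G] by (simp add: C2_def add.commute)
      have "C * \<epsilon> powr (\<sigma> - 1) \<le> C2 * \<epsilon> powr (\<sigma> - 1)" by (rule mult_right_mono[OF C2(2)]) simp
      then have "layer_bounded \<epsilon> (\<beta>/2) s C3 n (\<sigma> - 1) z"
        using zs by (intro C3(2)[OF eps F dz ode]) simp
      then have z: "layer_bounded \<epsilon> (\<beta>/2) s (max C3 C) n (\<sigma> - 1) z"
        by (rule layer_bounded_mono[OF eps _ order.refl, rotated]) simp
      have "\<bar>U x\<bar> \<le> max C3 C * (1 + \<epsilon> powr \<sigma> * exp (- (\<beta>/2) * (x - s) / \<epsilon>))" if "x \<in> {s..s+1}" for x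
      proof -
        have "\<bar>U x\<bar> \<le> max C3 C * 1" using U that by (auto simp: le_max_iff_disj)
        also have "\<dots> \<le> max C3 C * (1 + \<epsilon> powr \<sigma> * exp (- (\<beta>/2) * (x - s) / \<epsilon>))"
          using C3 by (intro mult_left_mono) auto
        finally show ?thesis .
      qed
      with z dU show "layer_bounded \<epsilon> (\<beta>/2) s (max C3 C) (Suc n) \<sigma> U" by auto
    qed (use C3 in auto)
  qed
  show ?thesis using assms(3,4)
  proof (induction n)
    case 0
    have "layer_bounded \<epsilon> (\<beta>/2) s C 0 0 U" if "0 < \<epsilon>" "\<forall>x\<in>{s..s+1}. \<bar>U x\<bar> \<le> C"
      "\<forall>x\<in>{s..s+1}. (U has_real_derivative z x) (at x within {s..s+1})" for U z and \<epsilon> :: real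
    proof -
      have "C * 1 \<le> C * (1 + exp (- (\<beta>/2) * (x - s) / \<epsilon>))" for x using assms by (intro mult_left_mono) auto
      with that show ?thesis by (auto intro: deriv_imp_continuous_on order.trans)
    qed
    with step[OF 0 assms(5)] show ?case by blast
  next
    case (Suc n)
    obtain C1 where C1: "C1 \<ge> 0" "\<And>\<epsilon> G U z z'. 0 < \<epsilon> \<Longrightarrow> \<epsilon> < 1 \<Longrightarrow> layer_bounded \<epsilon> (\<beta>/2) s C n 0 G \<Longrightarrow>
     (\<forall>x\<in>{s..s+1}. \<bar>U x\<bar> \<le> C) \<Longrightarrow> \<bar>z s\<bar> \<le> C * \<epsilon> powr (\<sigma> - 1) \<Longrightarrow>
     (\<forall>x\<in>{s..s+1}. (U has_real_derivative z x) (at x within {s..s+1})) \<Longrightarrow>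
     (\<forall>x\<in>{s..s+1}. (z has_real_derivative z' x) (at x within {s..s+1})) \<Longrightarrow>
     (\<forall>x\<in>{s..s+1}. \<epsilon> * z' x + b x * z x = c x * U x + G x) \<Longrightarrow> 
     layer_bounded \<epsilon> (\<beta>/2) s C1 (Suc n) \<sigma> U"
      using Suc.IH Suc.prems deriv_bounded_Suc by blast
    obtain C2 where C2: "C2 \<ge> 0" "\<And>\<epsilon> G U z z'. 0 < \<epsilon> \<Longrightarrow> \<epsilon> < 1 \<Longrightarrow> layer_bounded \<epsilon> (\<beta>/2) s C (Suc n) 0 G \<Longrightarrow>
     layer_bounded \<epsilon> (\<beta>/2) s C1 (Suc n) 0 U \<Longrightarrow> (\<forall>x\<in>{s..s+1}. \<bar>U x\<bar> \<le> C) \<Longrightarrow> \<bar>z s\<bar> \<le> C * \<epsilon> powr (\<sigma> - 1) \<Longrightarrow>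
     (\<forall>x\<in>{s..s+1}. (U has_real_derivative z x) (at x within {s..s+1})) \<Longrightarrow>
     (\<forall>x\<in>{s..s+1}. (z has_real_derivative z' x) (at x within {s..s+1})) \<Longrightarrow>
     (\<forall>x\<in>{s..s+1}. \<epsilon> * z' x + b x * z x = c x * U x + G x) \<Longrightarrow> 
     layer_bounded \<epsilon> (\<beta>/2) s C2 (Suc (Suc n)) \<sigma> U"
      using step[OF Suc.prems C1(1)] by blast
    show ?case
    proof (intro exI[of _ C2] conjI allI impI C2(1))
      fix \<epsilon> G U z z'
      assume eps: "0 < \<epsilon>" "\<epsilon> < 1" and G: "layer_bounded \<epsilon> (\<beta>/2) s C (Suc n) 0 G" and
       U: "\<forall>x\<in>{s..s+1}. \<bar>U x\<bar> \<le> C" "\<bar>z s\<bar> \<le> C * \<epsilon> powr (\<sigma> - 1)"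
       "\<forall>x\<in>{s..s+1}. (U has_real_derivative z x) (at x within {s..s+1})"
       "\<forall>x\<in>{s..s+1}. (z has_real_derivative z' x) (at x within {s..s+1})"
       "\<forall>x\<in>{s..s+1}. \<epsilon> * z' x + b x * z x = c x * U x + G x"
      have "layer_bounded \<epsilon> (\<beta>/2) s C1 (Suc n) \<sigma> U"
        by (rule C1(2)[OF eps layer_bounded_Suc[OF G] U])
      then have "layer_bounded \<epsilon> (\<beta>/2) s C1 (Suc n) 0 U"
        by (rule layer_bounded_mono[OF eps order.refl assms(6)])
      then show "layer_bounded \<epsilon> (\<beta>/2) s C2 (Suc (Suc n)) \<sigma> U"
        by (intro C2(2)[OF eps G _ U])
    qed
  qed
qed

section \<open>Regularity and stability of the classical solution\<close>

text \<open>
The values left of \<open>1\<close> are taken from the history, which is continuous up to \<open>- 1\<close>; a solution is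
prescribed on the half-open interval only.
\<close>

definition shifted :: "(real \<Rightarrow> real) \<Rightarrow> (real \<Rightarrow> real) \<Rightarrow> real \<Rightarrow> real" where
  "shifted \<Phi> u x = (if x < 1 then \<Phi> (x - 1) else u (x - 1))"

definition regular_solution ::
  "real \<Rightarrow> (real \<Rightarrow> real) \<Rightarrow> (real \<Rightarrow> real) \<Rightarrow> (real \<Rightarrow> real) \<Rightarrow> (real \<Rightarrow> real) \<Rightarrow> (real \<Rightarrow> real)
     \<Rightarrow> (real \<Rightarrow> real) \<Rightarrow> (real \<Rightarrow> real) \<Rightarrow> (real \<Rightarrow> real) \<Rightarrow> bool" where
  "regular_solution \<epsilon> b c d f \<Phi> u V V' \<longleftrightarrow>
     u 0 = 0 \<and> u 2 = 0 \<and> continuous_on {0..2} (shifted \<Phi> u) \<and>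
     (\<forall>x\<in>{0..2}. (u has_real_derivative V x) (at x within {0..2}) \<and>
        (V has_real_derivative V' x) (at x within {0..2}) \<and>
        \<epsilon> * V' x + b x * V x = c x * u x + d x * shifted \<Phi> u x - f x)"

lemma continuous_on_shifted:
  assumes "continuous_on {-1..0} \<Phi>" "continuous_on {0..2} u" "\<Phi> 0 = u 0"
  shows "continuous_on {0..2} (shifted \<Phi> u)"
proof -
  have "continuous_on ({0..1} \<union> {1..2}) (\<lambda>x. if x \<le> 1 then \<Phi> (x - 1) else u (x - 1))"
    by (intro continuous_on_If continuous_on_compose2[OF assms(1)] continuous_on_compose2[OF assms(2)]
        continuous_intros) (use assms in auto)
  moreover have "{0..1} \<union> {1..2::real} = {0..2}" by auto
  ultimately have "continuous_on {0..2} (\<lambda>x. if x \<le> 1 then \<Phi> (x - 1) else u (x - 1))" by simp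
  moreover have "(if x \<le> 1 then \<Phi> (x - 1) else u (x - 1)) = shifted \<Phi> u x" for x
    using assms(3) by (cases "x = 1") (auto simp: shifted_def)
  ultimately show ?thesis by simp
qed

text \<open>
In the interior \<open>u'\<close> is given by the variation of constants formula. That formula is continuously
differentiable up to the end points, so \<open>u\<close> has one-sided derivatives there.
\<close>

lemma solution_regular:
  assumes eps: "\<epsilon> > 0" and sol: "solves_shift_problem \<epsilon> b c d f \<Phi> u" and \<Phi>0: "\<Phi> 0 = 0"
    and cont: "continuous_on {0..2} b" "continuous_on {0..2} c" "continuous_on {0..2} d"
      "continuous_on {0..2} f" "continuous_on {-1..0} \<Phi>"
  shows "\<exists>V V'. regular_solution \<epsilon> b c d f \<Phi> u V V'"
proof -
  from sol obtain u' u'' where cu: "continuous_on {0..2} u" and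
    u: "\<And>x. x \<in> Omega \<Longrightarrow> (u has_real_derivative u' x) (at x)"
       "\<And>x. x \<in> Omega \<Longrightarrow> (u' has_real_derivative u'' x) (at x)"
       "\<And>x. x \<in> Omega \<Longrightarrow> - \<epsilon> * u'' x - b x * u' x + c x * u x + d x * u (x - 1) = f x"
    and bc: "u 2 = 0" "\<And>x. x \<in> {-1<..0} \<Longrightarrow> u x = \<Phi> x"
    unfolding solves_shift_problem_def by blast
  have u0: "u 0 = 0" using bc(2)[of 0] \<Phi>0 by simp
  have cs: "continuous_on {0..2} (shifted \<Phi> u)"
    by (rule continuous_on_shifted[OF cont(5) cu]) (simp add: \<Phi>0 u0)
  define g where "g = (\<lambda>x. c x * u x + d x * shifted \<Phi> u x - f x)"
  have cg: "continuous_on {0..2} g" unfolding g_def by (intro continuous_intros cont cu cs)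
  have shift: "shifted \<Phi> u x = u (x - 1)" if "x \<in> Omega" for x
    using that bc(2)[of "x - 1"] by (auto simp: shifted_def)
  have eq: "\<epsilon> * u'' x + b x * u' x = g x" if "x \<in> Omega" for x
    using u(3)[OF that] shift[OF that] by (simp add: g_def)
  define B where "B = (\<lambda>x. integral {0..x} b)"
  have dB: "(B has_real_derivative b x) (at x within {0..2})" if "x \<in> {0..2}" for x
    unfolding B_def by (rule integral_has_real_derivative[OF cont(1) that])
  have cB: "continuous_on {0..2} B" by (rule deriv_imp_continuous_on[OF ballI[OF dB]])
  define J where "J = (\<lambda>x. integral {0..x} (\<lambda>t. exp (B t / \<epsilon>) * g t / \<epsilon>))"
  have dJ: "(J has_real_derivative exp (B x / \<epsilon>) * g x / \<epsilon>) (at x within {0..2})" if "x \<in> {0..2}" for x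
    unfolding J_def by (rule integral_has_real_derivative[OF _ that]) (use eps in \<open>auto intro!: continuous_intros cB cg\<close>)
  have interior: "at x within {0..2} = at x" if "x \<in> Omega" for x::real
    using that by (intro at_within_interior) auto
  have "\<exists>c0. \<forall>x\<in>Omega. exp (B x / \<epsilon>) * u' x - J x = c0"
  proof (rule has_field_derivative_zero_constant)
    fix x :: real assume x: "x \<in> Omega"
    have 1: "(B has_real_derivative b x) (at x)" using dB[of x] x interior[OF x] by auto
    have 2: "(J has_real_derivative exp (B x / \<epsilon>) * g x / \<epsilon>) (at x)" using dJ[of x] x interior[OF x] by auto
    have "((\<lambda>x. exp (B x / \<epsilon>) * u' x - J x) has_real_derivative 0) (at x)"
      using eps eq[OF x, symmetric] by (auto intro!: derivative_eq_intros 1 2 u(2)[OF x] simp: field_simps)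
    then show "((\<lambda>x. exp (B x / \<epsilon>) * u' x - J x) has_real_derivative 0) (at x within Omega)"
      by (rule has_field_derivative_at_within)
  qed auto
  then obtain c0 where c0: "\<And>x. x \<in> Omega \<Longrightarrow> exp (B x / \<epsilon>) * u' x - J x = c0" by blast
  define V where "V = (\<lambda>x. exp (- B x / \<epsilon>) * (c0 + J x))"
  define V' where "V' = (\<lambda>x. (g x - b x * V x) / \<epsilon>)"
  have dV: "(V has_real_derivative V' x) (at x within {0..2})" if "x \<in> {0..2}" for x
  proof -
    have "exp (B x * 2 / \<epsilon>) = exp (B x / \<epsilon>) * exp (B x / \<epsilon>)" by (simp flip: exp_add)
    then show ?thesis
    unfolding V_def V'_def using eps 
    by (auto intro!: derivative_eq_intros dB that dJ simp: field_simps exp_minus)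
  qed
  have cV: "continuous_on {0..2} V" by (rule deriv_imp_continuous_on[OF ballI[OF dV]])
  have uV: "u' x = V x" if "x \<in> Omega" for x
    using c0[OF that] by (auto simp: V_def exp_minus field_simps)
  define I where "I = (\<lambda>x. integral {0..x} V)"
  have dI: "(I has_real_derivative V x) (at x within {0..2})" if "x \<in> {0..2}" for x
    unfolding I_def by (rule integral_has_real_derivative[OF cV that])
  have cI: "continuous_on {0..2} I" by (rule deriv_imp_continuous_on[OF ballI[OF dI]])
  have uI: "u x = I x" if "x \<in> {0..2}" for x
  proof -
    have "(\<lambda>x. u x - I x) x = (\<lambda>x. u x - I x) 0"
    proof (rule DERIV_isconst2[of 0 2 "\<lambda>x. u x - I x"])
      fix y :: real assume y: "0 < y" "y < 2"
      then show "DERIV (\<lambda>x. u x - I x) y :> 0"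
        using dI[of y] interior[of y] u(1)[of y] uV[of y] by (auto intro!: derivative_eq_intros)
    qed (use that in \<open>auto intro!: continuous_intros cu cI\<close>)
    then show ?thesis by (simp add: u0 I_def)
  qed
  have dU: "(u has_real_derivative V x) (at x within {0..2})" if "x \<in> {0..2}" for x
    by (rule has_field_derivative_transform_within[OF dI[OF that], of 1]) (use that uI in auto)
  have "regular_solution \<epsilon> b c d f \<Phi> u V V'"
    unfolding regular_solution_def using u0 bc cs dU dV eps by (auto simp: V'_def g_def)
  then show ?thesis by blast
qed

text \<open>
A point where \<open>\<bar>d\<bar>\<close> exceeds the essential supremum has an open neighbourhood of such points, and this is not a
null set. The end points follow by continuity.
\<close>

lemma Linf_norm_bound:
  assumes "continuous_on {1..2} d" and x: "x \<in> {1..2}"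
  shows "\<bar>d x\<bar> \<le> Linf_norm {1<..<2} d"
proof -
  let ?M = "lebesgue_on {1<..<2::real}"
  define e where "e = esssup ?M (\<lambda>x. ereal \<bar>d x\<bar>)"
  obtain K where K: "\<And>x. x \<in> {1..2} \<Longrightarrow> \<bar>d x\<bar> \<le> K"
    using compact_imp_bounded[OF compact_continuous_image[OF assms(1)]] by (force simp: bounded_iff)
  have meas: "(\<lambda>x. ereal \<bar>d x\<bar>) \<in> borel_measurable ?M"
    by (intro borel_measurable_ereal borel_measurable_abs continuous_imp_measurable_on_sets_lebesgue
        continuous_on_subset[OF assms(1)]) auto
  have le: "e \<le> ereal K" unfolding e_def
    by (rule esssup_I[OF meas]) (use K in \<open>auto intro!: AE_I2\<close>)
  have AE: "AE x in ?M. ereal \<bar>d x\<bar> \<le> e" unfolding e_def by (rule esssup_AE)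
  have "emeasure ?M (space ?M) = 1" by (simp add: emeasure_restrict_space)
  then have nb: "ae_filter ?M \<noteq> bot" by (simp add: ae_filter_eq_bot_iff)
  obtain x0 where "ereal \<bar>d x0\<bar> \<le> e" using eventually_happens'[OF nb AE] by blast
  then have "0 \<le> e" by (meson abs_ge_zero ereal_less_eq(5) order.trans)
  then obtain r where r: "e = ereal r" using le by (cases e) auto
  have Lr: "Linf_norm {1<..<2} d = r" by (simp add: Linf_norm_def e_def[symmetric] r)
  have pt: "\<bar>d y\<bar> \<le> r" if y: "y \<in> {1<..<2}" for y
  proof (rule ccontr)
    assume "\<not> \<bar>d y\<bar> \<le> r"
    have "continuous_on {1<..<2} (\<lambda>x. \<bar>d x\<bar>)" by (intro continuous_intros continuous_on_subset[OF assms(1)]) auto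
    then have op: "open ((\<lambda>x. \<bar>d x\<bar>) -` {r<..} \<inter> {1<..<2})"
      by (intro continuous_on_open_vimage[THEN iffD1, rule_format]) auto
    define S where "S = (\<lambda>x. \<bar>d x\<bar>) -` {r<..} \<inter> {1<..<2}"
    have "y \<in> S" using y \<open>\<not> \<bar>d y\<bar> \<le> r\<close> by (auto simp: S_def)
    have "AE x in lebesgue. x \<in> {1<..<2} \<longrightarrow> \<bar>d x\<bar> \<le> r"
      using AE by (subst (asm) AE_restrict_space_iff) (auto simp: r)
    then have "AE x in lebesgue. x \<notin> S" by (auto simp: S_def)
    then have "S \<in> null_sets lebesgue" using op by (intro AE_iff_null_sets[THEN iffD2]) (auto simp: S_def)
    then have "negligible S" by (simp add: negligible_iff_null_sets)
    then show False using open_not_negligible[of S] op \<open>y \<in> S\<close> unfolding S_def by blast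
  qed
  have "closure {1<..<2} = {1..2::real}" by simp
  moreover have "\<bar>d x\<bar> \<le> r"
    by (rule continuous_le_on_closure[of "{1<..<2}" "\<lambda>x. \<bar>d x\<bar>"])
       (use assms x pt in \<open>auto intro!: continuous_intros\<close>)
  ultimately show ?thesis using Lr by simp
qed

text \<open>
Testing with \<open>u\<close> bounds \<open>u\<close> in \<open>L\<^sup>2\<close>; the shifted term on \<open>(1, 2)\<close> takes \<open>\<delta>/2\<close> from the coercivity on \<open>(1, 2)\<close> and
\<open>\<delta>/2\<close> from that on \<open>(0, 1)\<close>. Integrating the equation once gives \<open>\<epsilon> u' + b u = k + G\<close>, where \<open>G\<close> is bounded by an
\<open>L\<^sup>1\<close> norm. The constant \<open>k = \<epsilon> u'(0)\<close> cannot exceed the maximum of \<open>\<bar>G\<bar>\<close>, since otherwise \<open>u\<close>, starting from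
\<open>u(0) = 0\<close>, could not return to \<open>u(2) = 0\<close>. With \<open>k\<close> bounded, comparison with a constant bounds \<open>u\<close>.
\<close>

lemma solution_stability:
  assumes eps: "0 < \<epsilon>" "\<epsilon> < 1" and reg: "regular_solution \<epsilon> b c d f \<Phi> u V V'"
    and \<beta>: "\<beta> > 0" and \<gamma>: "\<gamma> > 0" and b\<beta>: "\<And>x. x \<in> {0..2} \<Longrightarrow> b x \<ge> \<beta>"
    and db: "\<And>x. x \<in> {0..2} \<Longrightarrow> (b has_real_derivative b' x) (at x within {0..2})"
    and cont: "continuous_on {0..2} b'" "continuous_on {0..2} c" "continuous_on {0..2} d" "continuous_on {0..2} f"
    and coer: "\<And>x. x \<in> {0..2} \<Longrightarrow> c x + b' x / 2 - \<delta> / 2 \<ge> \<gamma>"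
    and d\<delta>: "\<And>x. x \<in> {1..2} \<Longrightarrow> \<bar>d x\<bar> \<le> \<delta>"
    and K: "\<And>x. x \<in> {0..2} \<Longrightarrow> \<bar>b' x\<bar> \<le> K" "\<And>x. x \<in> {0..2} \<Longrightarrow> \<bar>c x\<bar> \<le> K"
      "\<And>x. x \<in> {0..2} \<Longrightarrow> \<bar>d x\<bar> \<le> K" "\<And>x. x \<in> {0..2} \<Longrightarrow> \<bar>f x\<bar> \<le> K"
      "\<And>x. x \<in> {-1..0} \<Longrightarrow> \<bar>\<Phi> x\<bar> \<le> K"
  defines "P \<equiv> K\<^sup>2 + K"
  defines "I \<equiv> 2 * P\<^sup>2 / \<gamma>\<^sup>2"
  defines "Q \<equiv> (2 * K + K) * (2 + I) + 2 * P"
  shows "\<And>x. x \<in> {0..2} \<Longrightarrow> \<bar>u x\<bar> \<le> 2 * Q / \<beta>" and "\<bar>V 0\<bar> \<le> Q / \<epsilon>"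
proof -
  have K0: "K \<ge> 0" using K(1)[of 0] by simp
  then have P0: "P \<ge> 0" "P \<ge> K" by (auto simp: P_def)
  have \<delta>0: "\<delta> \<ge> 0" using d\<delta>[of 1] by simp
  from reg have u0: "u 0 = 0" and u2: "u 2 = 0" and cs: "continuous_on {0..2} (shifted \<Phi> u)"
    and du: "\<And>x. x \<in> {0..2} \<Longrightarrow> (u has_real_derivative V x) (at x within {0..2})"
    and dV: "\<And>x. x \<in> {0..2} \<Longrightarrow> (V has_real_derivative V' x) (at x within {0..2})"
    and ode: "\<And>x. x \<in> {0..2} \<Longrightarrow> \<epsilon> * V' x + b x * V x = c x * u x + d x * shifted \<Phi> u x - f x"
    unfolding regular_solution_def by auto
  have cu: "continuous_on {0..2} u" by (rule deriv_imp_continuous_on[OF ballI[OF du]])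
  have cV: "continuous_on {0..2} V" by (rule deriv_imp_continuous_on[OF ballI[OF dV]])
  have cb: "continuous_on {0..2} b" by (rule deriv_imp_continuous_on[OF ballI[OF db]])
  \<comment> \<open>\<open>\<integral> W = 0\<close> is the equation tested with \<open>u\<close>.\<close>
  define W where "W = (\<lambda>x. \<epsilon> * (V x)\<^sup>2 + (c x + b' x / 2) * (u x)\<^sup>2 + d x * shifted \<Phi> u x * u x - f x * u x)"
  have cW: "continuous_on {0..2} W" unfolding W_def
    by (auto intro!: continuous_intros cont cu cV cs)
  have "(W has_integral ((\<lambda>x. \<epsilon> * (V x * u x) + b x * (u x)\<^sup>2 / 2) 2 - (\<lambda>x. \<epsilon> * (V x * u x) + b x * (u x)\<^sup>2 / 2) 0)) {0..2}"
  proof (rule fundamental_theorem_of_calculus)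
    fix x :: real assume x: "x \<in> {0..2}"
    have "u x * (\<epsilon> * V' x + b x * V x) = u x * (c x * u x + d x * shifted \<Phi> u x - f x)" using ode[OF x] by simp
    then have "\<epsilon> * (V' x * u x + V x * V x) + (b' x * (u x)\<^sup>2 + b x * (2 * u x * V x)) / 2 = W x"
      by (simp add: W_def power2_eq_square algebra_simps add_divide_distrib)
    then show "((\<lambda>x. \<epsilon> * (V x * u x) + b x * (u x)\<^sup>2 / 2) has_vector_derivative W x) (at x within {0..2})"
      unfolding has_real_derivative_iff_has_vector_derivative[symmetric]
      by (auto intro!: derivative_eq_intros du[OF x] dV[OF x] db[OF x] simp: field_simps)
  qed simp
  then have W0: "(W has_integral 0) {0..2}" using u0 u2 by simp
  have cu2: "continuous_on {0..2} (\<lambda>x. (u x)\<^sup>2)" by (intro continuous_intros cu)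
  have sub: "{0..1} \<subseteq> {0..2::real}" "{1..2} \<subseteq> {0..2::real}" by auto
  define I1 where "I1 = integral {0..1} (\<lambda>x. (u x)\<^sup>2)"
  define I2 where "I2 = integral {1..2} (\<lambda>x. (u x)\<^sup>2)"
  have i1: "((\<lambda>x. (u x)\<^sup>2) has_integral I1) {0..1}" unfolding I1_def
    by (intro integrable_integral integrable_continuous_real continuous_on_subset[OF cu2 sub(1)])
  have i2: "((\<lambda>x. (u x)\<^sup>2) has_integral I2) {1..2}" unfolding I2_def
    by (intro integrable_integral integrable_continuous_real continuous_on_subset[OF cu2 sub(2)])
  have ish: "((\<lambda>x. (u (x - 1))\<^sup>2) has_integral I1) {1..2}"
  proof -
    have "((\<lambda>x. (u (x + (-1)))\<^sup>2) has_integral I1) {0 - (-1)..1 - (-1)}"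
      using has_integral_shift_real_ivl[OF i1, of "-1"] by simp
    then show ?thesis by simp
  qed
  have I0: "I1 \<ge> 0" "I2 \<ge> 0" using has_integral_nonneg[OF i1] has_integral_nonneg[OF i2] by auto
  have iW1: "(W has_integral integral {0..1} W) {0..1}"
    by (intro integrable_integral integrable_continuous_real continuous_on_subset[OF cW sub(1)])
  have iW2: "(W has_integral integral {1..2} W) {1..2}"
    by (intro integrable_integral integrable_continuous_real continuous_on_subset[OF cW sub(2)])
  have young: "P * \<bar>t\<bar> \<le> \<gamma> / 2 * t\<^sup>2 + P\<^sup>2 / (2 * \<gamma>)" for t
  proof -
    have "0 \<le> (\<gamma> * \<bar>t\<bar> - P)\<^sup>2 / (2 * \<gamma>)" using \<gamma> by simp
    also have "\<dots> = \<gamma> / 2 * t\<^sup>2 + P\<^sup>2 / (2 * \<gamma>) - P * \<bar>t\<bar>"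
      using \<gamma> by (simp add: field_simps power2_eq_square)
    finally show ?thesis by simp
  qed
  \<comment> \<open>The part \<open>\<delta>/2\<close> gained on \<open>[0, 1]\<close> pays for the shifted values in the estimate on \<open>[1, 2]\<close>.\<close>
  have W1: "W x \<ge> (\<gamma> / 2 + \<delta> / 2) * (u x)\<^sup>2 - P\<^sup>2 / (2 * \<gamma>)" if x: "x \<in> {0..1}" for x
  proof -
    have "\<bar>shifted \<Phi> u x\<bar> \<le> K" using x K(5)[of "x - 1"] u0 K0 by (auto simp: shifted_def)
    then have "\<bar>d x * shifted \<Phi> u x\<bar> \<le> K * K" unfolding abs_mult using x K(3)[of x] by (intro mult_mono) auto
    then have "\<bar>d x * shifted \<Phi> u x - f x\<bar> \<le> P" using K(4)[of x] x by (auto simp: P_def power2_eq_square)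
    then have "\<bar>(d x * shifted \<Phi> u x - f x) * u x\<bar> \<le> P * \<bar>u x\<bar>" unfolding abs_mult by (intro mult_right_mono) auto
    moreover have "(\<gamma> + \<delta> / 2) * (u x)\<^sup>2 \<le> (c x + b' x / 2) * (u x)\<^sup>2"
      using coer[of x] x by (intro mult_right_mono) auto
    moreover have "\<epsilon> * (V x)\<^sup>2 \<ge> 0" using eps by simp
    ultimately show ?thesis using young[of "u x"] by (simp add: W_def algebra_simps abs_le_iff)
  qed
  have W2: "W x \<ge> \<gamma> / 2 * (u x)\<^sup>2 - \<delta> / 2 * (u (x - 1))\<^sup>2 - P\<^sup>2 / (2 * \<gamma>)" if x: "x \<in> {1..2}" for x
  proof -
    have "\<bar>f x * u x\<bar> \<le> P * \<bar>u x\<bar>" unfolding abs_mult using K(4)[of x] x P0 by (intro mult_right_mono) auto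
    moreover have "(\<gamma> + \<delta> / 2) * (u x)\<^sup>2 \<le> (c x + b' x / 2) * (u x)\<^sup>2"
      using coer[of x] x by (intro mult_right_mono) auto
    moreover have "\<epsilon> * (V x)\<^sup>2 \<ge> 0" using eps by simp
    moreover have "- (d x * (u (x - 1) * u x)) \<le> \<delta> * (((u (x - 1))\<^sup>2 + (u x)\<^sup>2) / 2)" 
    proof (rule abs_le_D2, unfold abs_mult[of "d x"], intro mult_mono d\<delta> x)
      show "\<bar>u (x - 1) * u x\<bar> \<le> ((u (x - 1))\<^sup>2 + (u x)\<^sup>2) / 2"
        using sum_squares_ge_zero[of "u (x-1) - u x" 0] sum_squares_ge_zero[of "u (x-1) + u x" 0]
        by (simp add: power2_eq_square algebra_simps abs_le_iff)
    qed (use \<delta>0 in auto)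
    ultimately show ?thesis using young[of "u x"] x by (simp add: W_def algebra_simps abs_le_iff shifted_def)
  qed
  have L1: "((\<lambda>x. (\<gamma> / 2 + \<delta> / 2) * (u x)\<^sup>2 - P\<^sup>2 / (2 * \<gamma>)) has_integral
        (\<gamma> / 2 + \<delta> / 2) * I1 - P\<^sup>2 / (2 * \<gamma>)) {0..1}"
    using has_integral_diff[OF has_integral_mult_right[OF i1, of "\<gamma> / 2 + \<delta> / 2"] has_integral_const_real[of "P\<^sup>2 / (2 * \<gamma>)" 0 1]] by simp
  have L2: "((\<lambda>x. \<gamma> / 2 * (u x)\<^sup>2 - \<delta> / 2 * (u (x - 1))\<^sup>2 - P\<^sup>2 / (2 * \<gamma>)) has_integral
        \<gamma> / 2 * I2 - \<delta> / 2 * I1 - P\<^sup>2 / (2 * \<gamma>)) {1..2}"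
    using has_integral_diff[OF has_integral_diff[OF has_integral_mult_right[OF i2, of "\<gamma> / 2"]
       has_integral_mult_right[OF ish, of "\<delta> / 2"]] has_integral_const_real[of "P\<^sup>2 / (2 * \<gamma>)" 1 2]] by simp
  have "integral {0..1} W + integral {1..2} W = 0"
    using has_integral_combine[OF _ _ iW1 iW2] has_integral_unique[OF W0] by simp
  moreover have "(\<gamma> / 2 + \<delta> / 2) * I1 - P\<^sup>2 / (2 * \<gamma>) \<le> integral {0..1} W"
    by (rule has_integral_le[OF L1 iW1 W1])
  moreover have "\<gamma> / 2 * I2 - \<delta> / 2 * I1 - P\<^sup>2 / (2 * \<gamma>) \<le> integral {1..2} W"
    by (rule has_integral_le[OF L2 iW2 W2])
  ultimately have "\<gamma> / 2 * (I1 + I2) \<le> P\<^sup>2 / \<gamma>" by (simp add: field_simps)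
  then have II: "I1 + I2 \<le> I" using \<gamma> by (simp add: I_def field_simps power2_eq_square)
  \<comment> \<open>The convection term is written as \<open>(b u)' - b' u\<close>, so that one integration leaves \<open>\<epsilon> u' + b u\<close> and
    integrals of terms of order zero.\<close>
  define g where "g = (\<lambda>x. b' x * u x + c x * u x + d x * shifted \<Phi> u x - f x)"
  have cg: "continuous_on {0..2} g" unfolding g_def by (intro continuous_intros cont cu cs)
  define G where "G = (\<lambda>x. integral {0..x} g)"
  have dG: "(G has_real_derivative g x) (at x within {0..2})" if "x \<in> {0..2}" for x
    unfolding G_def by (rule integral_has_real_derivative[OF cg that])
  have sq: "\<bar>t\<bar> \<le> 1 + t\<^sup>2" for t :: real
    using sum_squares_ge_zero[of "\<bar>t\<bar> - 1" 0] by (simp add: power2_eq_square algebra_simps)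
  have gb1: "\<bar>g x\<bar> \<le> 2 * K * (1 + (u x)\<^sup>2) + P" if x: "x \<in> {0..1}" for x
  proof -
    have "\<bar>shifted \<Phi> u x\<bar> \<le> K" using x K(5)[of "x - 1"] u0 K0 by (auto simp: shifted_def)
    then have "\<bar>d x * shifted \<Phi> u x\<bar> \<le> K * K" unfolding abs_mult using x K(3)[of x] by (intro mult_mono) auto
    moreover have "\<bar>b' x * u x\<bar> \<le> K * (1 + (u x)\<^sup>2)" unfolding abs_mult using x K(1)[of x] K0 sq by (intro mult_mono) auto
    moreover have "\<bar>c x * u x\<bar> \<le> K * (1 + (u x)\<^sup>2)" unfolding abs_mult using x K(2)[of x] K0 sq by (intro mult_mono) auto
    ultimately show ?thesis using K(4)[of x] x unfolding g_def by (auto simp: P_def power2_eq_square algebra_simps)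
  qed
  have gb2: "\<bar>g x\<bar> \<le> 2 * K * (1 + (u x)\<^sup>2) + K * (1 + (u (x - 1))\<^sup>2) + P" if x: "x \<in> {1..2}" for x
  proof -
    have "\<bar>d x * shifted \<Phi> u x\<bar> \<le> K * (1 + (u (x - 1))\<^sup>2)"
      unfolding abs_mult using x K(3)[of x] sq K0 by (intro mult_mono) (auto simp: shifted_def)
    moreover have "\<bar>b' x * u x\<bar> \<le> K * (1 + (u x)\<^sup>2)" unfolding abs_mult using x K(1)[of x] K0 sq by (intro mult_mono) auto
    moreover have "\<bar>c x * u x\<bar> \<le> K * (1 + (u x)\<^sup>2)" unfolding abs_mult using x K(2)[of x] K0 sq by (intro mult_mono) auto
    ultimately show ?thesis using K(4)[of x] x P0 unfolding g_def by (auto simp: algebra_simps)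
  qed
  have GQ: "\<bar>G x\<bar> \<le> Q" if x: "x \<in> {0..2}" for x
  proof -
    have ca: "continuous_on {0..2} (\<lambda>t. \<bar>g t\<bar>)" by (intro continuous_intros cg)
    have ig: "(\<lambda>t. \<bar>g t\<bar>) integrable_on {0..2}" by (intro integrable_continuous_real ca)
    have sx: "{0..x} \<subseteq> {0..2}" using x by auto
    have "\<bar>G x\<bar> \<le> integral {0..x} (\<lambda>t. \<bar>g t\<bar>)" unfolding G_def
      using integral_norm_bound_integral[of g "{0..x}" "\<lambda>t. \<bar>g t\<bar>"]
      by (auto intro!: integrable_continuous_real continuous_on_subset[OF cg sx] continuous_on_subset[OF ca sx])
    also have "\<dots> \<le> integral {0..2} (\<lambda>t. \<bar>g t\<bar>)"
      by (rule integral_subset_le[OF sx]) (auto intro!: integrable_continuous_real continuous_on_subset[OF ca sx] ig)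
    also have "\<dots> = integral {0..1} (\<lambda>t. \<bar>g t\<bar>) + integral {1..2} (\<lambda>t. \<bar>g t\<bar>)"
      using Henstock_Kurzweil_Integration.integral_combine[of 0 1 2, OF _ _ ig] by simp
    also have "\<dots> \<le> (2 * K * (1 + I1) + P) + (2 * K * (1 + I2) + K * (1 + I1) + P)"
    proof (rule add_mono)
      have "((\<lambda>x. 2 * K * (1 + (u x)\<^sup>2) + P) has_integral 2 * K * (1 + I1) + P) {0..1}"
        using has_integral_add[OF has_integral_mult_right[OF has_integral_add[OF has_integral_const_real[of 1 0 1] i1], of "2 * K"]
           has_integral_const_real[of P 0 1]] by simp
      then show "integral {0..1} (\<lambda>t. \<bar>g t\<bar>) \<le> 2 * K * (1 + I1) + P"
        by (rule has_integral_le[rotated, OF _ gb1]) 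
           (auto intro!: integrable_integral integrable_continuous_real continuous_on_subset[OF ca sub(1)])
      have "((\<lambda>x. 2 * K * (1 + (u x)\<^sup>2) + K * (1 + (u (x - 1))\<^sup>2) + P) has_integral 2 * K * (1 + I2) + K * (1 + I1) + P) {1..2}"
        using has_integral_add[OF has_integral_add[OF has_integral_mult_right[OF has_integral_add[OF has_integral_const_real[of 1 1 2] i2], of "2 * K"]
            has_integral_mult_right[OF has_integral_add[OF has_integral_const_real[of 1 1 2] ish], of K]]
           has_integral_const_real[of P 1 2]] by simp
      then show "integral {1..2} (\<lambda>t. \<bar>g t\<bar>) \<le> 2 * K * (1 + I2) + K * (1 + I1) + P"
        by (rule has_integral_le[rotated, OF _ gb2]) 
           (auto intro!: integrable_integral integrable_continuous_real continuous_on_subset[OF ca sub(2)])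
    qed
    also have "\<dots> = 2 * K * (2 + (I1 + I2)) + K * (1 + I1) + 2 * P" by (simp add: algebra_simps)
    also have "\<dots> \<le> 2 * K * (2 + I) + K * (2 + I) + 2 * P"
      using II I0 K0 by (intro add_mono mult_left_mono) auto
    finally show ?thesis by (simp add: Q_def algebra_simps)
  qed
  define k where "k = \<epsilon> * V 0"
  have first: "\<epsilon> * V x + b x * u x = k + G x" if x: "x \<in> {0..2}" for x
  proof -
    have "\<exists>c. \<forall>y\<in>{0..2}. \<epsilon> * V y + b y * u y - G y = c"
    proof (rule has_field_derivative_zero_constant)
      fix y assume y: "y \<in> {0..2::real}"
      have "\<epsilon> * V' y + (b' y * u y + b y * V y) - g y = 0" using ode[OF y] by (simp add: g_def)
      then show "((\<lambda>x. \<epsilon> * V x + b x * u x - G x) has_real_derivative 0) (at y within {0..2})"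
        by (auto intro!: derivative_eq_intros dV y db du dG simp: algebra_simps)
    qed auto
    then obtain a where "\<And>y. y \<in> {0..2} \<Longrightarrow> \<epsilon> * V y + b y * u y - G y = a" by blast
    from this[OF x] this[of 0] show ?thesis by (simp add: k_def u0 G_def)
  qed
  have kQ: "\<bar>k\<bar> \<le> Q"
  proof (rule ccontr)
    assume "\<not> \<bar>k\<bar> \<le> Q"
    then consider "k > Q" | "k < - Q" by linarith
    then show False
    proof cases
      case 1
      have "u 2 > 0"
      proof (rule comparison_pos[OF eps(1) _ cb du])
        fix x :: real assume x: "x \<in> {0..2}"
        show "0 < \<epsilon> * V x + b x * u x" using first[OF x] GQ[OF x] 1 by simp
      qed (use u0 in auto)
      then show False using u2 by simp
    next
      case 2
      have "- u 2 > 0"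
      proof (rule comparison_pos[OF eps(1) _ cb, of _ "\<lambda>x. - V x"])
        fix x :: real assume x: "x \<in> {0..2}"
        show "((\<lambda>x. - u x) has_real_derivative - V x) (at x within {0..2})"
          using du[OF x] by (auto intro!: derivative_intros)
        show "0 < \<epsilon> * - V x + b x * - u x" using first[OF x] GQ[OF x] 2 by simp
      qed (use u0 in auto)
      then show False using u2 by simp
    qed
  qed
  show "\<bar>V 0\<bar> \<le> Q / \<epsilon>" using kQ eps by (simp add: k_def abs_mult field_simps)
  fix x assume x: "x \<in> {0..2::real}"
  have Q0: "Q \<ge> 0" using kQ by simp
  show "\<bar>u x\<bar> \<le> 2 * Q / \<beta>"
  proof (rule comparison_abs[OF eps(1) cb du _ _ _ x, of "\<lambda>_. 2 * Q / \<beta>" "\<lambda>_. 0"])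
    fix x assume x: "x \<in> {0..2::real}"
    have "\<bar>\<epsilon> * V x + b x * u x\<bar> \<le> 2 * Q" using first[OF x] kQ GQ[OF x] by simp
    also have "\<dots> = \<beta> * (2 * Q / \<beta>)" using \<beta> by simp
    also have "\<dots> \<le> b x * (2 * Q / \<beta>)" using b\<beta>[OF x] Q0 \<beta> by (intro mult_right_mono) auto
    finally show "\<bar>\<epsilon> * V x + b x * u x\<bar> \<le> \<epsilon> * 0 + b x * (2 * Q / \<beta>)" by simp
  qed (use Q0 \<beta> u0 in \<open>auto intro!: derivative_eq_intros\<close>)
qed

lemma C_k_on_continuous: "C_k_on m S f \<Longrightarrow> continuous_on S f"
proof -
  assume "C_k_on m S f"
  then obtain D where D0: "\<forall>x\<in>S. D 0 x = f x"
    and D: "\<forall>j<m. \<forall>x\<in>S. (D j has_real_derivative D (Suc j) x) (at x within S)"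
    and Dm: "continuous_on S (D m)" unfolding C_k_on_def by blast
  have "continuous_on S (D 0)" 
  proof (cases "m = 0")
    case False
    then have "\<forall>x\<in>S. (D 0 has_real_derivative D (Suc 0) x) (at x within S)" using D by blast
    then show ?thesis by (rule deriv_imp_continuous_on)
  qed (use Dm in simp)
  then show "continuous_on S f" by (rule continuous_on_eq) (use D0 in blast)
qed

lemma C_k_on_derivative:
  assumes "C_k_on m {l..r} b" "1 \<le> m" "l < r"
  shows "\<And>x. x \<in> {l..r} \<Longrightarrow> (b has_real_derivative vector_derivative b (at x within {l..r})) (at x within {l..r})"
    and "continuous_on {l..r} (\<lambda>x. vector_derivative b (at x within {l..r}))"
proof -
  from assms obtain D where D0: "\<forall>x\<in>{l..r}. D 0 x = b x"
    and D: "\<forall>j<m. \<forall>x\<in>{l..r}. (D j has_real_derivative D (Suc j) x) (at x within {l..r})"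
    and Dm: "continuous_on {l..r} (D m)" unfolding C_k_on_def by blast
  have d: "(b has_real_derivative D 1 x) (at x within {l..r})" if "x \<in> {l..r}" for x
    by (rule has_field_derivative_transform_within[of "D 0" _ _ _ 1]) (use D D0 that assms in auto)
  then have vd: "vector_derivative b (at x within {l..r}) = D 1 x" if "x \<in> {l..r}" for x
    using vector_derivative_within_cbox[of l r x b "D 1 x"] assms that
    by (auto simp: has_real_derivative_iff_has_vector_derivative)
  show "\<And>x. x \<in> {l..r} \<Longrightarrow> (b has_real_derivative vector_derivative b (at x within {l..r})) (at x within {l..r})"
    using d vd by simp
  have "continuous_on {l..r} (D 1)" 
  proof (cases "m = 1")
    case False
    then have "\<forall>x\<in>{l..r}. (D 1 has_real_derivative D (Suc 1) x) (at x within {l..r})" using D assms by auto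
    then show ?thesis by (rule deriv_imp_continuous_on)
  qed (use Dm in simp)
  then show "continuous_on {l..r} (\<lambda>x. vector_derivative b (at x within {l..r}))"
    by (rule continuous_on_eq) (use vd in simp)
qed

lemma continuous_bounded_interval:
  fixes f :: "real \<Rightarrow> real"
  assumes "continuous_on {l..r} f" shows "\<exists>K. \<forall>x\<in>{l..r}. \<bar>f x\<bar> \<le> K"
  using compact_imp_bounded[OF compact_continuous_image[OF assms]] by (force simp: bounded_iff)

lemma exp_div_bound:
  assumes "t > 0" "\<epsilon> > 0" shows "exp (- t / \<epsilon>) / \<epsilon> \<le> 1 / (t::real)"
proof -
  have "t / \<epsilon> \<le> exp (t / \<epsilon>)" using exp_ge_add_one_self[of "t / \<epsilon>"] by linarith
  then show ?thesis using assms by (simp add: exp_minus field_simps)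
qed

text \<open>
On \<open>[0, 1]\<close> the initial slope is \<open>O(1 / \<epsilon>)\<close>. At \<open>x = 1\<close> the layer of \<open>u'\<close> has decayed to \<open>O(1)\<close>, so on
\<open>[1, 2]\<close> the initial slope is bounded and the layer, driven by that of the shifted function, is weaker by
one power of \<open>\<epsilon>\<close>.
\<close>

lemma solution_layer_bounds:
  assumes C: "C_k_on (Suc n) {0..2} b" "C_k_on (Suc n) {0..2} c" "C_k_on (Suc n) {0..2} d" "C_k_on (Suc n) {0..2} f"
      "C_k_on (Suc n) {-1..0} \<Phi>"
    and \<beta>: "\<beta> > 0" and \<gamma>: "\<gamma> > 0" and b\<beta>: "\<forall>x\<in>{0..2}. b x \<ge> \<beta>"
    and coer: "\<forall>x\<in>{0..2}. c x + vector_derivative b (at x within {0..2}) / 2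
                         - Linf_norm {1<..<2} d / 2 \<ge> \<gamma>" and \<Phi>0: "\<Phi> 0 = 0"
  shows "\<exists>C\<ge>0. \<forall>\<epsilon>\<in>{0<..<1}. \<forall>u. solves_shift_problem \<epsilon> b c d f \<Phi> u \<longrightarrow> 
     (\<exists>V V'. regular_solution \<epsilon> b c d f \<Phi> u V V') \<and>
     layer_bounded \<epsilon> (\<beta>/2) 0 C (Suc n) 0 u \<and> layer_bounded \<epsilon> (\<beta>/2) 1 C (Suc n) 1 u"
proof -
  define b' where "b' = (\<lambda>x. vector_derivative b (at x within {0..2}))"
  define \<delta> where "\<delta> = Linf_norm {1<..<2} d"
  have db: "\<And>x. x \<in> {0..2} \<Longrightarrow> (b has_real_derivative b' x) (at x within {0..2})" and cb': "continuous_on {0..2} b'"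
    unfolding b'_def using C_k_on_derivative[OF C(1)] by auto
  note cont = C_k_on_continuous[OF C(1)] C_k_on_continuous[OF C(2)] C_k_on_continuous[OF C(3)] 
    C_k_on_continuous[OF C(4)] C_k_on_continuous[OF C(5)]
  obtain K1 K2 K3 K4 K5 where K': "\<forall>x\<in>{0..2}. \<bar>b' x\<bar> \<le> K1" "\<forall>x\<in>{0..2}. \<bar>c x\<bar> \<le> K2" "\<forall>x\<in>{0..2}. \<bar>d x\<bar> \<le> K3"
    "\<forall>x\<in>{0..2}. \<bar>f x\<bar> \<le> K4" "\<forall>x\<in>{-1..0}. \<bar>\<Phi> x\<bar> \<le> K5"
    using continuous_bounded_interval[OF cb'] continuous_bounded_interval[OF cont(2)] continuous_bounded_interval[OF cont(3)] 
      continuous_bounded_interval[OF cont(4)] continuous_bounded_interval[OF cont(5)] by blast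
  define K where "K = Max {K1,K2,K3,K4,K5}"
  have Kge: "K1 \<le> K" "K2 \<le> K" "K3 \<le> K" "K4 \<le> K" "K5 \<le> K" by (auto simp: K_def)
  have K: "\<And>x. x \<in> {0..2} \<Longrightarrow> \<bar>b' x\<bar> \<le> K" "\<And>x. x \<in> {0..2} \<Longrightarrow> \<bar>c x\<bar> \<le> K"
      "\<And>x. x \<in> {0..2} \<Longrightarrow> \<bar>d x\<bar> \<le> K" "\<And>x. x \<in> {0..2} \<Longrightarrow> \<bar>f x\<bar> \<le> K"
      "\<And>x. x \<in> {-1..0} \<Longrightarrow> \<bar>\<Phi> x\<bar> \<le> K"
    using K' Kge by (meson order.trans)+
  have K0: "K \<ge> 0" using K(1)[of 0] by simp
  have d\<delta>: "\<bar>d x\<bar> \<le> \<delta>" if "x \<in> {1..2}" for x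
    unfolding \<delta>_def by (rule Linf_norm_bound[OF continuous_on_subset[OF cont(3)] that]) auto
  obtain Ab0 where Ab0: "deriv_bounded 0 Ab0 n b" using C_k_on_deriv_bounded[OF C(1), of n "0"] by auto
  obtain Ac0 where Ac0: "deriv_bounded 0 Ac0 n c" using C_k_on_deriv_bounded[OF C(2), of n "0"] by auto
  obtain Ad0 where Ad0: "deriv_bounded 0 Ad0 n d" using C_k_on_deriv_bounded[OF C(3), of n "0"] by auto
  obtain Af0 where Af0: "deriv_bounded 0 Af0 n f" using C_k_on_deriv_bounded[OF C(4), of n "0"] by auto
  obtain Ab1 where Ab1: "deriv_bounded 1 Ab1 n b" using C_k_on_deriv_bounded[OF C(1), of n "1"] by auto
  obtain Ac1 where Ac1: "deriv_bounded 1 Ac1 n c" using C_k_on_deriv_bounded[OF C(2), of n "1"] by auto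
  obtain Ad1 where Ad1: "deriv_bounded 1 Ad1 n d" using C_k_on_deriv_bounded[OF C(3), of n "1"] by auto
  obtain Af1 where Af1: "deriv_bounded 1 Af1 n f" using C_k_on_deriv_bounded[OF C(4), of n "1"] by auto
  obtain Ap where Ap: "deriv_bounded (-1) Ap n \<Phi>" using C_k_on_deriv_bounded[OF C(5), of n "(-1)"] by auto
  define A where "A = Max {Ab0,Ac0,Ad0,Af0,Ab1,Ac1,Ad1,Af1,Ap}"
  have Age: "Ab0 \<le> A" "Ac0 \<le> A" "Ad0 \<le> A" "Af0 \<le> A" "Ab1 \<le> A" "Ac1 \<le> A" "Ad1 \<le> A" "Af1 \<le> A" "Ap \<le> A"
    unfolding A_def by (rule Max_ge; simp)+
  have A: "deriv_bounded 0 A n b" "deriv_bounded 0 A n c" "deriv_bounded 0 A n d" "deriv_bounded 0 A n f"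
    "deriv_bounded 1 A n b" "deriv_bounded 1 A n c" "deriv_bounded 1 A n d" "deriv_bounded 1 A n f"
    "deriv_bounded (-1) A n \<Phi>"
    using deriv_bounded_mono[OF Ab0 Age(1)] deriv_bounded_mono[OF Ac0 Age(2)] deriv_bounded_mono[OF Ad0 Age(3)]
      deriv_bounded_mono[OF Af0 Age(4)] deriv_bounded_mono[OF Ab1 Age(5)] deriv_bounded_mono[OF Ac1 Age(6)]
      deriv_bounded_mono[OF Ad1 Age(7)] deriv_bounded_mono[OF Af1 Age(8)] deriv_bounded_mono[OF Ap Age(9)] by simp_all
  have A0: "A \<ge> 0" using deriv_bounded_nonneg[OF A(1)] .
  define P where "P = K\<^sup>2 + K"
  define I where "I = 2 * P\<^sup>2 / \<gamma>\<^sup>2"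
  define Q where "Q = (2 * K + K) * (2 + I) + 2 * P"
  have Q0: "Q \<ge> 0" using K0 by (simp add: Q_def I_def P_def)
  have coer': "\<gamma> \<le> c x + b' x / 2 - \<delta> / 2" if "x \<in> {0..2}" for x
    using coer that by (auto simp: b'_def \<delta>_def)
  have stab: "\<forall>x\<in>{0..2}. \<bar>u x\<bar> \<le> 2 * Q / \<beta>" "\<bar>V 0\<bar> \<le> Q / \<epsilon>" 
    if "0 < \<epsilon>" "\<epsilon> < 1" "regular_solution \<epsilon> b c d f \<Phi> u V V'" for \<epsilon> u V V'
    using solution_stability[OF that \<beta> \<gamma> bspec[OF b\<beta>] db cb' cont(2-4) coer' d\<delta> K]
    unfolding Q_def I_def P_def by auto
  have b01: "\<forall>x\<in>{0..0+1}. b x \<ge> \<beta>" and b12: "\<forall>x\<in>{1..1+1}. b x \<ge> \<beta>" using b\<beta> by auto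
  \<comment> \<open>The constants are fixed before \<open>\<epsilon>\<close> and \<open>u\<close>: \<open>C0\<close> and \<open>C2\<close> bound the data of \<open>layer_solution\<close> on the two unit
    intervals, \<open>C1\<close> and \<open>C3\<close> are the resulting bounds, and \<open>D\<close> bounds the slope at \<open>1\<close>.\<close>
  define C0 where "C0 = 2 * Q / \<beta> + Q + 2 ^ n * A * A + A"
  have C0: "C0 \<ge> 0" using Q0 A0 \<beta> by (simp add: C0_def)
  obtain C1 where C1: "C1 \<ge> 0" "\<And>\<epsilon> G U z z'. 0 < \<epsilon> \<Longrightarrow> \<epsilon> < 1 \<Longrightarrow> layer_bounded \<epsilon> (\<beta>/2) 0 C0 n 0 G \<Longrightarrow>
     (\<forall>x\<in>{0..0+1}. \<bar>U x\<bar> \<le> C0) \<Longrightarrow> \<bar>z 0\<bar> \<le> C0 * \<epsilon> powr (0 - 1) \<Longrightarrow>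
     (\<forall>x\<in>{0..0+1}. (U has_real_derivative z x) (at x within {0..0+1})) \<Longrightarrow>
     (\<forall>x\<in>{0..0+1}. (z has_real_derivative z' x) (at x within {0..0+1})) \<Longrightarrow>
     (\<forall>x\<in>{0..0+1}. \<epsilon> * z' x + b x * z x = c x * U x + G x) \<Longrightarrow> 
     layer_bounded \<epsilon> (\<beta>/2) 0 C1 (Suc n) 0 U"
    using layer_solution[OF b01 \<beta> A(1,2) C0 order.refl zero_le_one] by blast
  define F where "F = (2 * K * (2 * Q / \<beta>) + K * K + K) + Q"
  have F0: "F \<ge> 0" using K0 Q0 \<beta> by (simp add: F_def)
  define D where "D = (F + 2 * F / \<beta>) * (1 + 2 / \<beta>)"
  define C2 where "C2 = 2 * Q / \<beta> + D + 2 ^ n * A * C1 + A"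
  have C2: "C2 \<ge> 0" using Q0 A0 \<beta> C1 F0 by (simp add: C2_def D_def)
  obtain C3 where C3: "C3 \<ge> 0" "\<And>\<epsilon> G U z z'. 0 < \<epsilon> \<Longrightarrow> \<epsilon> < 1 \<Longrightarrow> layer_bounded \<epsilon> (\<beta>/2) 1 C2 n 0 G \<Longrightarrow>
     (\<forall>x\<in>{1..1+1}. \<bar>U x\<bar> \<le> C2) \<Longrightarrow> \<bar>z 1\<bar> \<le> C2 * \<epsilon> powr (1 - 1) \<Longrightarrow>
     (\<forall>x\<in>{1..1+1}. (U has_real_derivative z x) (at x within {1..1+1})) \<Longrightarrow>
     (\<forall>x\<in>{1..1+1}. (z has_real_derivative z' x) (at x within {1..1+1})) \<Longrightarrow>
     (\<forall>x\<in>{1..1+1}. \<epsilon> * z' x + b x * z x = c x * U x + G x) \<Longrightarrow> 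
     layer_bounded \<epsilon> (\<beta>/2) 1 C3 (Suc n) 1 U"
    using layer_solution[OF b12 \<beta> A(5,6) C2 zero_le_one order.refl] by blast
  show ?thesis
  proof (intro exI[of _ "max C1 C3"] conjI ballI allI impI)
    show "max C1 C3 \<ge> 0" using C1 by simp
    fix \<epsilon> :: real and u assume "\<epsilon> \<in> {0<..<1}" and sol: "solves_shift_problem \<epsilon> b c d f \<Phi> u"
    then have eps: "0 < \<epsilon>" "\<epsilon> < 1" by auto
    show "\<exists>V V'. regular_solution \<epsilon> b c d f \<Phi> u V V'"
      using solution_regular[OF eps(1) sol \<Phi>0 cont(1-5)] .
    then obtain V V' where reg: "regular_solution \<epsilon> b c d f \<Phi> u V V'" by blast
    note st = stab[OF eps reg]
    from reg have u0: "u 0 = 0"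
      and du: "\<And>x. x \<in> {0..2} \<Longrightarrow> (u has_real_derivative V x) (at x within {0..2})"
      and dV: "\<And>x. x \<in> {0..2} \<Longrightarrow> (V has_real_derivative V' x) (at x within {0..2})"
      and ode: "\<And>x. x \<in> {0..2} \<Longrightarrow> \<epsilon> * V' x + b x * V x = c x * u x + d x * shifted \<Phi> u x - f x"
      unfolding regular_solution_def by auto
    have sub: "{0..0+1} \<subseteq> {0..2::real}" "{1..1+1} \<subseteq> {0..2::real}" by auto
    have inv: "\<epsilon> powr (0 - 1) = 1 / \<epsilon>" "\<epsilon> powr - 1 = 1 / \<epsilon>" using eps by (auto simp: powr_minus_divide)
    have L\<Phi>: "layer_bounded \<epsilon> (\<beta>/2) 0 A n 0 (\<lambda>x. \<Phi> (x - 1))"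
      using layer_bounded_shift[OF deriv_bounded_layer_bounded[OF A(9)], of \<epsilon> "\<beta>/2" 1 0] by simp
    have G1: "layer_bounded \<epsilon> (\<beta>/2) 0 C0 n 0 (\<lambda>x. d x * \<Phi> (x - 1) + - f x)"
      by (rule layer_bounded_mono[OF eps _ order.refl layer_bounded_add[OF layer_bounded_mult[OF eps A(3) L\<Phi>]
            layer_bounded_uminus[OF deriv_bounded_layer_bounded[OF A(4)]]]])
         (use Q0 \<beta> in \<open>simp add: C0_def\<close>)
    have "layer_bounded \<epsilon> (\<beta>/2) 0 C1 (Suc n) 0 u"
    proof (rule C1(2)[OF eps G1])
      have "2 * Q / \<beta> \<le> C0" "Q \<le> C0" using Q0 A0 \<beta> by (auto simp: C0_def)
      note le = this
      show "\<forall>x\<in>{0..0 + 1}. \<bar>u x\<bar> \<le> C0" using order.trans[OF bspec[OF st(1)] le(1)] by auto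
      have "\<bar>V 0\<bar> \<le> C0 / \<epsilon>" using order.trans[OF st(2) divide_right_mono[OF le(2), of \<epsilon>]] eps by simp
      then show "\<bar>V 0\<bar> \<le> C0 * \<epsilon> powr (0 - 1)" using eps by (simp add: inv)
      show "\<forall>x\<in>{0..0 + 1}. (u has_real_derivative V x) (at x within {0..0 + 1})"
        "\<forall>x\<in>{0..0 + 1}. (V has_real_derivative V' x) (at x within {0..0 + 1})"
        using DERIV_subset[OF du sub(1)] DERIV_subset[OF dV sub(1)] by auto
      show "\<forall>x\<in>{0..0 + 1}. \<epsilon> * V' x + b x * V x = c x * u x + (d x * \<Phi> (x - 1) + - f x)"
      proof
        fix x :: real assume x: "x \<in> {0..0+1}"
        then have "shifted \<Phi> u x = \<Phi> (x - 1)" using u0 \<Phi>0 by (cases "x = 1") (auto simp: shifted_def)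
        then show "\<epsilon> * V' x + b x * V x = c x * u x + (d x * \<Phi> (x - 1) + - f x)" using ode[of x] x by simp
      qed
    qed
    then show L1: "layer_bounded \<epsilon> (\<beta>/2) 0 (max C1 C3) (Suc n) 0 u"
      by (rule layer_bounded_mono[OF eps _ order.refl, rotated]) simp
    have Lu: "layer_bounded \<epsilon> (\<beta>/2) 1 C1 n 0 (\<lambda>x. u (x - 1))"
      using layer_bounded_shift[OF layer_bounded_Suc, of \<epsilon> "\<beta>/2" 0 C1 n 0 u 1] \<open>layer_bounded \<epsilon> (\<beta>/2) 0 C1 (Suc n) 0 u\<close> by simp
    have G2: "layer_bounded \<epsilon> (\<beta>/2) 1 C2 n 0 (\<lambda>x. d x * u (x - 1) + - f x)"
      by (rule layer_bounded_mono[OF eps _ order.refl layer_bounded_add[OF layer_bounded_mult[OF eps A(7) Lu]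
            layer_bounded_uminus[OF deriv_bounded_layer_bounded[OF A(8)]]]])
         (use Q0 \<beta> F0 in \<open>simp add: C2_def D_def\<close>)
    \<comment> \<open>At distance \<open>1\<close> from the boundary, \<open>\<epsilon>^(- 1) exp (- \<beta> / (2 \<epsilon>)) \<le> 2 / \<beta>\<close>.\<close>
    have V1: "\<bar>V 1\<bar> \<le> D"
    proof -
      have "\<bar>V 1\<bar> \<le> (F + 2 * F / \<beta>) * (1 + \<epsilon> powr - 1 * exp (- (\<beta>/2) * (1 - 0) / \<epsilon>))"
      proof (rule layer_ode_base[of 0 b \<beta> \<epsilon> "-1" 0 F "\<lambda>x. c x * u x + d x * shifted \<Phi> u x - f x" V V'])
        show "continuous_on {0..0 + 1} b" by (rule continuous_on_subset[OF cont(1) sub(1)])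
        show "(V has_real_derivative V' x) (at x within {0..0 + 1})" if "x \<in> {0..0+1}" for x
          using DERIV_subset[OF dV sub(1)] that by auto
        have "Q \<le> F" using K0 Q0 \<beta> by (simp add: F_def)
        then have "\<bar>V 0\<bar> \<le> F / \<epsilon>" using order.trans[OF st(2) divide_right_mono[of Q F \<epsilon>]] eps by simp
        then show "\<bar>V 0\<bar> \<le> F * \<epsilon> powr - 1" using eps by (simp add: inv)
        fix x :: real assume x: "x \<in> {0..0+1}"
        have "\<bar>shifted \<Phi> u x\<bar> \<le> K" using x K(5)[of "x - 1"] u0 K0 by (auto simp: shifted_def)
        then have "\<bar>d x * shifted \<Phi> u x\<bar> \<le> K * K" unfolding abs_mult using x K(3)[of x] by (intro mult_mono) auto
        moreover have "\<bar>c x * u x\<bar> \<le> K * (2 * Q / \<beta>)" unfolding abs_mult using x K(2)[of x] K0 st(1) by (intro mult_mono) auto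
        moreover have "K * (2 * Q / \<beta>) \<ge> 0" using K0 Q0 \<beta> by simp
        ultimately have "\<bar>c x * u x + d x * shifted \<Phi> u x - f x\<bar> \<le> F" using K(4)[of x] x Q0 unfolding F_def by auto
        also have "F * 1 \<le> F * (1 + \<epsilon> powr 0 * exp (- (\<beta>/2) * (x - 0) / \<epsilon>))" using F0 by (intro mult_left_mono) auto
        finally show "\<bar>c x * u x + d x * shifted \<Phi> u x - f x\<bar> \<le> F * (1 + \<epsilon> powr 0 * exp (- (\<beta>/2) * (x - 0) / \<epsilon>))" by simp
        show "\<epsilon> * V' x + b x * V x = c x * u x + d x * shifted \<Phi> u x - f x" using ode x by auto
      qed (use b\<beta> \<beta> eps F0 in auto)
      also have "\<dots> \<le> D" unfolding D_def
      proof (rule mult_left_mono)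
        show "1 + \<epsilon> powr - 1 * exp (- (\<beta>/2) * (1 - 0) / \<epsilon>) \<le> 1 + 2 / \<beta>"
          using exp_div_bound[of "\<beta>/2" \<epsilon>] \<beta> eps by (simp add: inv)
      qed (use F0 \<beta> in simp)
      finally show ?thesis .
    qed
    have "layer_bounded \<epsilon> (\<beta>/2) 1 C3 (Suc n) 1 u"
    proof (rule C3(2)[OF eps G2])
      have D0: "D \<ge> 0" using V1 by simp
      have "2 * Q / \<beta> \<le> C2" "D \<le> C2" using Q0 A0 \<beta> C1 D0 by (auto simp: C2_def)
      note le = this
      show "\<forall>x\<in>{1..1 + 1}. \<bar>u x\<bar> \<le> C2" using order.trans[OF bspec[OF st(1)] le(1)] by auto
      show "\<bar>V 1\<bar> \<le> C2 * \<epsilon> powr (1 - 1)" using order.trans[OF V1 le(2)] eps by simp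
      show "\<forall>x\<in>{1..1 + 1}. (u has_real_derivative V x) (at x within {1..1 + 1})"
        "\<forall>x\<in>{1..1 + 1}. (V has_real_derivative V' x) (at x within {1..1 + 1})"
        using DERIV_subset[OF du sub(2)] DERIV_subset[OF dV sub(2)] by auto
      show "\<forall>x\<in>{1..1 + 1}. \<epsilon> * V' x + b x * V x = c x * u x + (d x * u (x - 1) + - f x)"
      proof
        fix x :: real assume x: "x \<in> {1..1+1}"
        then have "shifted \<Phi> u x = u (x - 1)" by (simp add: shifted_def)
        then show "\<epsilon> * V' x + b x * V x = c x * u x + (d x * u (x - 1) + - f x)" using ode[of x] x by simp
      qed
    qed
    then show "layer_bounded \<epsilon> (\<beta>/2) 1 (max C1 C3) (Suc n) 1 u"
      by (rule layer_bounded_mono[OF eps _ order.refl, rotated]) simp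
  qed
qed

section \<open>Local approximation on a mesh cell\<close>

lemma antiderivative_poly:
  fixes q :: "real poly"
  shows "\<exists>p. pderiv p = q \<and> degree p \<le> Suc (degree q)"
proof -
  define p where "p = (\<Sum>i\<le>degree q. monom (coeff q i / real (Suc i)) (Suc i))"
  have "coeff p (Suc n) = coeff q n / real (Suc n)" for n
  proof -
    have "coeff p (Suc n) = (\<Sum>i\<le>degree q. if i = n then coeff q i / real (Suc i) else 0)"
      by (simp add: p_def coeff_sum)
    also have "\<dots> = coeff q n / real (Suc n)" by (auto simp: coeff_eq_0)
    finally show ?thesis .
  qed
  then have "pderiv p = q" by (intro poly_eqI) (simp add: coeff_pderiv del: of_nat_Suc)
  moreover have "degree p \<le> Suc (degree q)" unfolding p_def
    by (intro degree_sum_le) (auto intro: order.trans[OF degree_monom_le])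
  ultimately show ?thesis by blast
qed

lemma poly_of_zero_derivative:
  fixes T :: "nat \<Rightarrow> real \<Rightarrow> real"
  assumes "\<And>j x. j \<le> k \<Longrightarrow> x \<in> {a..b} \<Longrightarrow> (T j has_real_derivative T (Suc j) x) (at x within {a..b})"
    and "\<And>x. x \<in> {a..b} \<Longrightarrow> T (Suc k) x = 0"
  shows "\<exists>p. degree p \<le> k \<and> (\<forall>x\<in>{a..b}. T 0 x = poly p x)"
  using assms
proof (induction k arbitrary: T)
  case 0
  have "\<exists>c. \<forall>x\<in>{a..b}. T 0 x = c"
    by (rule has_field_derivative_zero_constant) (use 0(1)[of 0] 0(2) in \<open>auto simp: One_nat_def\<close>)
  then obtain c where "\<forall>x\<in>{a..b}. T 0 x = c" by blast
  then show ?case by (intro exI[of _ "[:c:]"]) simp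
next
  case (Suc k)
  obtain q where q: "degree q \<le> k" "\<And>x. x \<in> {a..b} \<Longrightarrow> T 1 x = poly q x"
    using Suc.IH[of "\<lambda>j. T (Suc j)"] Suc.prems by auto
  obtain P where P: "pderiv P = q" "degree P \<le> Suc (degree q)" using antiderivative_poly by blast
  have "\<exists>c. \<forall>x\<in>{a..b}. T 0 x - poly P x = c"
  proof (rule has_field_derivative_zero_constant)
    fix x assume x: "x \<in> {a..b}"
    show "((\<lambda>x. T 0 x - poly P x) has_real_derivative 0) (at x within {a..b})"
      using Suc.prems(1)[of 0 x] x q(2)[OF x] P(1)
      by (auto intro!: derivative_eq_intros poly_DERIV[THEN has_field_derivative_at_within])
  qed simp
  then obtain c where c: "\<And>x. x\<in>{a..b} \<Longrightarrow> T 0 x - poly P x = c" by blast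
  have "degree (P + [:c:]) \<le> Suc k" using P q by (intro degree_add_le) auto
  moreover have "T 0 x = poly (P + [:c:]) x" if "x \<in> {a..b}" for x using c[OF that] by simp
  ultimately show ?case by blast
qed

text \<open>
All antiderivatives vanish at the right end point, where an exponential layer is smallest.
\<close>

lemma iterated_antiderivative:
  fixes w :: "real \<Rightarrow> real"
  assumes "a \<le> b" and w: "continuous_on {a..b} w"
  shows "\<exists>R. (\<forall>j<n. \<forall>x\<in>{a..b}. (R j has_real_derivative R (Suc j) x) (at x within {a..b})) \<and>
     R n = w \<and> (\<forall>j<n. R j b = 0)"
proof (induction n)
  case 0
  show ?case by (rule exI[of _ "\<lambda>_. w"]) simp
next
  case (Suc n)
  then obtain R where R: "\<And>j x. j < n \<Longrightarrow> x \<in> {a..b} \<Longrightarrow> (R j has_real_derivative R (Suc j) x) (at x within {a..b})"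
     "R n = w" "\<And>j. j < n \<Longrightarrow> R j b = 0" by blast
  have cR: "continuous_on {a..b} (R 0)"
  proof (cases "n = 0")
    case False
    show ?thesis by (rule deriv_imp_continuous_on[OF ballI[OF R(1)]]) (use False in auto)
  qed (use w R(2) in simp)
  define R0 where "R0 = (\<lambda>x. integral {a..x} (R 0) - integral {a..b} (R 0))"
  define R' where "R' = (\<lambda>j. if j = 0 then R0 else R (j - 1))"
  have "(R0 has_real_derivative R 0 x) (at x within {a..b})" if "x \<in> {a..b}" for x
    unfolding R0_def using integral_has_real_derivative[OF cR that] by (auto intro!: derivative_eq_intros)
  then have "(R' j has_real_derivative R' (Suc j) x) (at x within {a..b})" if "j < Suc n" "x \<in> {a..b}" for j x
    using R(1)[of "j - 1" x] that by (cases j) (auto simp: R'_def)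
  moreover have "R' (Suc n) = w" using R by (simp add: R'_def)
  moreover have "R' j b = 0" if "j < Suc n" for j using R(3)[of "j - 1"] that by (cases j) (auto simp: R'_def R0_def)
  ultimately show ?case by blast
qed

lemma backward_bound:
  fixes y y' \<psi> \<psi>' :: "real \<Rightarrow> real"
  assumes y: "\<And>x. x \<in> {a..b} \<Longrightarrow> (y has_real_derivative y' x) (at x within {a..b})"
    and \<psi>: "\<And>x. x \<in> {a..b} \<Longrightarrow> (\<psi> has_real_derivative \<psi>' x) (at x within {a..b})"
    and le: "\<And>x. x \<in> {a..b} \<Longrightarrow> \<bar>y' x\<bar> \<le> - \<psi>' x"
    and yb: "y b = 0" and \<psi>b: "\<psi> b \<ge> 0" and x: "x \<in> {a..b}"
  shows "\<bar>y x\<bar> \<le> \<psi> x"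
proof (cases "x = b")
  case False
  then have xb: "a \<le> x" "x < b" using x by auto
  have "\<psi> x - y x \<ge> 0"
  proof -
    have d: "((\<lambda>x. \<psi> x - y x) has_real_derivative \<psi>' x - y' x) (at x within {a..b})" if "x \<in> {a..b}" for x
      by (intro derivative_intros y \<psi> that)
    obtain \<xi> where \<xi>: "\<xi> \<in> {x<..<b}" "(\<psi> b - y b) - (\<psi> x - y x) = (\<psi>' \<xi> - y' \<xi>) * (b - x)"
      using mvt_within_interval[of a b "\<lambda>x. \<psi> x - y x" "\<lambda>x. \<psi>' x - y' x" x b, OF d] xb by auto
    have "(\<psi>' \<xi> - y' \<xi>) * (b - x) \<le> 0" using le[of \<xi>] \<xi>(1) xb by (intro mult_nonpos_nonneg) auto
    then show ?thesis using \<xi>(2) yb \<psi>b by simp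
  qed
  moreover have "\<psi> x + y x \<ge> 0"
  proof -
    have d: "((\<lambda>x. \<psi> x + y x) has_real_derivative \<psi>' x + y' x) (at x within {a..b})" if "x \<in> {a..b}" for x
      by (intro derivative_intros y \<psi> that)
    obtain \<xi> where \<xi>: "\<xi> \<in> {x<..<b}" "(\<psi> b + y b) - (\<psi> x + y x) = (\<psi>' \<xi> + y' \<xi>) * (b - x)"
      using mvt_within_interval[of a b "\<lambda>x. \<psi> x + y x" "\<lambda>x. \<psi>' x + y' x" x b, OF d] xb by auto
    have "(\<psi>' \<xi> + y' \<xi>) * (b - x) \<le> 0" using le[of \<xi>] \<xi>(1) xb by (intro mult_nonpos_nonneg) auto
    then show ?thesis using \<xi>(2) yb \<psi>b by simp
  qed
  ultimately show ?thesis by auto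
qed (use yb \<psi>b in simp)

lemma antiderivative_bound_length:
  fixes R :: "nat \<Rightarrow> real \<Rightarrow> real"
  assumes R: "\<And>j x. j < n \<Longrightarrow> x \<in> {a..b} \<Longrightarrow> (R j has_real_derivative R (Suc j) x) (at x within {a..b})"
    and Rb: "\<And>j. j < n \<Longrightarrow> R j b = 0" and B: "\<And>x. x \<in> {a..b} \<Longrightarrow> \<bar>R n x\<bar> \<le> B"
    and x: "x \<in> {a..b}" "i \<le> n"
  shows "\<bar>R (n - i) x\<bar> \<le> B * (b - a) ^ i"
  using x
proof (induction i arbitrary: x)
  case (Suc i)
  have ab: "a \<le> b" using Suc.prems by simp
  have B0: "B \<ge> 0" using B[OF Suc.prems(1)] by simp
  define j where "j = n - Suc i"
  have j: "j < n" "Suc j = n - i" using Suc.prems by (auto simp: j_def)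
  define M where "M = B * (b - a) ^ i"
  have "\<bar>R j x\<bar> \<le> M * (b - x)"
  proof (rule backward_bound[OF R[OF j(1)] _ _ Rb[OF j(1)] _ Suc.prems(1)])
    show "\<bar>R (Suc j) y\<bar> \<le> - (- M)" if "y \<in> {a..b}" for y using Suc.IH[of y] that Suc.prems j by (simp add: M_def)
  qed (auto intro!: derivative_eq_intros)
  also have "\<dots> \<le> M * (b - a)" using Suc.prems B0 ab by (intro mult_left_mono) (auto simp: M_def)
  finally show ?case by (simp add: j_def M_def mult.assoc mult.commute mult.left_commute)
qed (use B in simp)

text \<open>
Integration from the right reproduces the exponential with the factor \<open>\<epsilon> / \<kappa>\<close>, whatever the length of the
interval. This complements \<open>antiderivative_bound_length\<close> on cells that are long compared with \<open>\<epsilon>\<close>.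
\<close>

lemma antiderivative_bound_layer:
  fixes R :: "nat \<Rightarrow> real \<Rightarrow> real"
  assumes R: "\<And>j x. j < n \<Longrightarrow> x \<in> {a..b} \<Longrightarrow> (R j has_real_derivative R (Suc j) x) (at x within {a..b})"
    and Rb: "\<And>j. j < n \<Longrightarrow> R j b = 0" 
    and B: "\<And>x. x \<in> {a..b} \<Longrightarrow> \<bar>R n x\<bar> \<le> B * exp (- \<kappa> * (x - s) / \<epsilon>)" and "B \<ge> 0" "\<kappa> > 0" "\<epsilon> > 0"
    and x: "x \<in> {a..b}" "i \<le> n"
  shows "\<bar>R (n - i) x\<bar> \<le> B * (\<epsilon> / \<kappa>) ^ i * exp (- \<kappa> * (x - s) / \<epsilon>)"
  using x
proof (induction i arbitrary: x)
  case (Suc i)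
  define j where "j = n - Suc i"
  have j: "j < n" "Suc j = n - i" using Suc.prems by (auto simp: j_def)
  define M where "M = B * (\<epsilon> / \<kappa>) ^ i"
  have M0: "M \<ge> 0" using assms by (simp add: M_def)
  have "\<bar>R j x\<bar> \<le> M * (\<epsilon> / \<kappa>) * exp (- \<kappa> * (x - s) / \<epsilon>)"
  proof (rule backward_bound[OF R[OF j(1)] _ _ Rb[OF j(1)] _ Suc.prems(1)])
    show "\<bar>R (Suc j) y\<bar> \<le> - (- M * exp (- \<kappa> * (y - s) / \<epsilon>))" if "y \<in> {a..b}" for y
      using Suc.IH[of y] that Suc.prems j by (simp add: M_def)
    show "((\<lambda>x. M * (\<epsilon> / \<kappa>) * exp (- \<kappa> * (x - s) / \<epsilon>)) has_real_derivative - M * exp (- \<kappa> * (y - s) / \<epsilon>)) (at y within {a..b})" for y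
      using assms(5,6) by (auto intro!: derivative_eq_intros)
  qed (use M0 assms(5,6) in auto)
  then show ?case by (simp add: j_def M_def mult.assoc mult.commute mult.left_commute)
qed (use B in simp)

text \<open>
The slope \<open>R a / (b - a)\<close> of the linear correction is a value of \<open>- R'\<close>, so the correction at most doubles
the bounds of \<open>R\<close> and \<open>R'\<close>.
\<close>

lemma zero_boundary_correction:
  fixes R R' :: "real \<Rightarrow> real"
  assumes ab: "a < b"
    and R: "\<forall>x\<in>{a..b}. (R has_real_derivative R' x) (at x within {a..b})" 
    and cR': "continuous_on {a..b} R'" and Rb: "R b = 0"
  defines "W \<equiv> (\<lambda>x. R x - R a / (b - a) * (b - x))" and "W' \<equiv> (\<lambda>x. R' x + R a / (b - a))"
  shows "W a = 0" "W b = 0" "\<forall>x\<in>{a..b}. (W has_real_derivative W' x) (at x within {a..b})"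
    "continuous_on {a..b} W'"
    "\<And>M x. \<forall>x\<in>{a..b}. \<bar>R x\<bar> \<le> M \<Longrightarrow> x \<in> {a..b} \<Longrightarrow> \<bar>W x\<bar> \<le> 2 * M"
    "\<And>M x. \<forall>x\<in>{a..b}. \<bar>R' x\<bar> \<le> M \<Longrightarrow> x \<in> {a..b} \<Longrightarrow> \<bar>W' x\<bar> \<le> 2 * M"
proof -
  show "W a = 0" "W b = 0" using ab Rb by (auto simp: W_def)
  show "\<forall>x\<in>{a..b}. (W has_real_derivative W' x) (at x within {a..b})" unfolding W_def W'_def
    using ab by (auto intro!: derivative_eq_intros bspec[OF R])
  show "continuous_on {a..b} W'" unfolding W'_def by (intro continuous_intros cR')
  show "\<bar>W x\<bar> \<le> 2 * M" if M: "\<forall>x\<in>{a..b}. \<bar>R x\<bar> \<le> M" and x: "x \<in> {a..b}" for M x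
  proof -
    have "\<bar>R a\<bar> * ((b - x) / (b - a)) \<le> \<bar>R a\<bar> * 1" using x ab by (intro mult_left_mono) auto
    then have "\<bar>R a / (b - a) * (b - x)\<bar> \<le> \<bar>R a\<bar>" using x ab by (simp add: abs_mult)
    then show ?thesis using M[rule_format, of x] M[rule_format, of a] x ab 
        abs_triangle_ineq4[of "R x" "R a / (b - a) * (b - x)"] unfolding W_def by auto
  qed
  show "\<bar>W' x\<bar> \<le> 2 * M" if M: "\<forall>x\<in>{a..b}. \<bar>R' x\<bar> \<le> M" and x: "x \<in> {a..b}" for M x
  proof -
    obtain \<xi> where \<xi>: "\<xi> \<in> {a<..<b}" "R b - R a = R' \<xi> * (b - a)"
      using mvt_within_interval[OF bspec[OF R], of a b] ab by auto
    then have "R a / (b - a) = - R' \<xi>" using ab Rb by (simp add: field_simps)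
    then show ?thesis using M[rule_format, of x] M[rule_format, of \<xi>] x \<xi>(1) unfolding W'_def by auto
  qed
qed

lemma layer_bounded_chain:
  "layer_bounded \<epsilon> \<kappa> s C n p w \<Longrightarrow> \<exists>D. D 0 = w \<and>
     (\<forall>j<n. \<forall>x\<in>{s..s+1}. (D j has_real_derivative D (Suc j) x) (at x within {s..s+1})) \<and>
     continuous_on {s..s+1} (D n) \<and>
     (\<forall>x\<in>{s..s+1}. \<bar>D n x\<bar> \<le> C * (1 + \<epsilon> powr (p - real n) * exp (- \<kappa> * (x - s) / \<epsilon>)))"
proof (induction n arbitrary: p w)
  case 0
  then show ?case by (intro exI[of _ "\<lambda>_. w"]) auto
next
  case (Suc n)
  obtain w' where w': "\<forall>x\<in>{s..s+1}. (w has_real_derivative w' x) (at x within {s..s+1})"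
    "layer_bounded \<epsilon> \<kappa> s C n (p - 1) w'" using Suc.prems by auto
  obtain D where D: "D 0 = w'" "\<And>j x. j<n \<Longrightarrow> x\<in>{s..s+1} \<Longrightarrow> (D j has_real_derivative D (Suc j) x) (at x within {s..s+1})"
     "continuous_on {s..s+1} (D n)"
     "\<forall>x\<in>{s..s+1}. \<bar>D n x\<bar> \<le> C * (1 + \<epsilon> powr (p - 1 - real n) * exp (- \<kappa> * (x - s) / \<epsilon>))"
    using Suc.IH[OF w'(2)] by blast
  define D' where "D' = (\<lambda>j. if j = 0 then w else D (j - 1))"
  have "(D' j has_real_derivative D' (Suc j) x) (at x within {s..s+1})" if "j < Suc n" "x \<in> {s..s+1}" for j x
    using D(1) D(2)[of "j - 1" x] w'(1) that by (cases j) (auto simp: D'_def)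
  moreover have "p - 1 - real n = p - real (Suc n)" by simp
  note D4 = D(4)[unfolded this]
  ultimately show ?case using D(3) D4 by (intro exI[of _ D']) (auto simp: D'_def simp del: of_nat_Suc)
qed

text \<open>
With \<open>E\<close> the layer weight of the top derivative \<open>D\<close>, the continuous functions \<open>D / (1 + E)\<close> and
\<open>D E / (1 + E)\<close> are its bounded part and its layer part. Integrating them \<open>k + 1\<close> times from the right leaves
a polynomial. For \<open>W\<close> both kinds of bounds are kept, by powers of the cell length for cells that resolve
the layer and by powers of \<open>\<epsilon> / \<kappa>\<close> for cells that do not.
\<close>

lemma cell_approximation:
  assumes lay: "layer_bounded \<epsilon> \<kappa> s C (Suc k) \<sigma> u" and k: "k \<ge> 1" and ab: "a < b" "{a..b} \<subseteq> {s..s+1}"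
    and pos: "\<epsilon> > 0" "\<kappa> > 0"
  defines "X \<equiv> \<epsilon> powr (\<sigma> - real (Suc k)) * exp (- \<kappa> * (a - s) / \<epsilon>)"
  shows "\<exists>p S S' W W'. degree p \<le> k \<and> (\<forall>x\<in>{a..b}. u x = poly p x + S x + W x) \<and>
     S a = 0 \<and> S b = 0 \<and> W a = 0 \<and> W b = 0 \<and>
     (\<forall>x\<in>{a..b}. (S has_real_derivative S' x) (at x within {a..b})) \<and> continuous_on {a..b} S' \<and>
     (\<forall>x\<in>{a..b}. (W has_real_derivative W' x) (at x within {a..b})) \<and> continuous_on {a..b} W' \<and>
     (\<forall>x\<in>{a..b}. \<bar>S x\<bar> \<le> 2 * C * (b - a) ^ Suc k \<and> \<bar>S' x\<bar> \<le> 2 * C * (b - a) ^ k \<and>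
        \<bar>W x\<bar> \<le> 2 * C * X * (b - a) ^ Suc k \<and> \<bar>W' x\<bar> \<le> 2 * C * X * (b - a) ^ k \<and>
        \<bar>W x\<bar> \<le> 2 * C * X * (\<epsilon> / \<kappa>) ^ Suc k \<and> \<bar>W' x\<bar> \<le> 2 * C * X * (\<epsilon> / \<kappa>) ^ k)"
proof -
  have C0: "C \<ge> 0" using layer_bounded_nonneg[OF lay] .
  obtain D where D: "D 0 = u"
     "\<forall>j<Suc k. \<forall>x\<in>{s..s+1}. (D j has_real_derivative D (Suc j) x) (at x within {s..s+1})"
     "continuous_on {s..s+1} (D (Suc k))"
     "\<forall>x\<in>{s..s+1}. \<bar>D (Suc k) x\<bar> \<le> C * (1 + \<epsilon> powr (\<sigma> - real (Suc k)) * exp (- \<kappa> * (x - s) / \<epsilon>))"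
    using layer_bounded_chain[OF lay] by blast
  have dD: "(D j has_real_derivative D (Suc j) x) (at x within {a..b})" if "j < Suc k" "x \<in> {a..b}" for j x
    by (rule DERIV_subset[OF _ ab(2)]) (use D(2) that ab in auto)
  define q where "q = \<epsilon> powr (\<sigma> - real (Suc k))"
  have q0: "q \<ge> 0" by (simp add: q_def)
  define E where "E = (\<lambda>x. q * exp (- \<kappa> * (x - s) / \<epsilon>))"
  have E0: "E x \<ge> 0" for x using q0 by (simp add: E_def)
  have E1: "1 + E x > 0" for x using E0[of x] by simp
  have cE: "continuous_on {a..b} E" unfolding E_def using pos by (intro continuous_intros) auto
  have cD: "continuous_on {a..b} (D (Suc k))" by (rule continuous_on_subset[OF D(3) ab(2)])
  define f where "f = (\<lambda>x. D (Suc k) x / (1 + E x))"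
  define g where "g = (\<lambda>x. D (Suc k) x / (1 + E x) * E x)"
  have cf: "continuous_on {a..b} f" unfolding f_def using E1 by (intro continuous_intros cD cE) (auto simp: less_imp_neq[symmetric])
  have cg: "continuous_on {a..b} g" using continuous_on_mult[OF cf cE] by (simp add: f_def g_def)
  have fC: "\<bar>f x\<bar> \<le> C" if "x \<in> {a..b}" for x
  proof -
    have "\<bar>D (Suc k) x\<bar> \<le> C * (1 + E x)" using D(4) that ab by (auto simp: E_def q_def)
    then show ?thesis using E1[of x] by (simp add: f_def field_simps abs_of_pos)
  qed
  have gC: "\<bar>g x\<bar> \<le> C * q * exp (- \<kappa> * (x - s) / \<epsilon>)" if "x \<in> {a..b}" for x
    using mult_right_mono[OF fC[OF that] E0[of x]] E0[of x] q0 by (simp add: f_def g_def abs_mult E_def mult.assoc)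
  have fg: "D (Suc k) x = f x + g x" for x
  proof -
    have "f x * (1 + E x) = D (Suc k) x" "g x = f x * E x" using E1[of x] by (auto simp: f_def g_def)
    then show ?thesis by (simp add: distrib_left)
  qed
  obtain P where P: "\<And>j x. j<Suc k \<Longrightarrow> x\<in>{a..b} \<Longrightarrow> (P j has_real_derivative P (Suc j) x) (at x within {a..b})"
     "P (Suc k) = f" "\<And>j. j<Suc k \<Longrightarrow> P j b = 0"
    using iterated_antiderivative[OF less_imp_le[OF ab(1)] cf, of "Suc k"] by blast
  obtain Q where Q: "\<And>j x. j<Suc k \<Longrightarrow> x\<in>{a..b} \<Longrightarrow> (Q j has_real_derivative Q (Suc j) x) (at x within {a..b})"
     "Q (Suc k) = g" "\<And>j. j<Suc k \<Longrightarrow> Q j b = 0"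
    using iterated_antiderivative[OF less_imp_le[OF ab(1)] cg, of "Suc k"] by blast
  obtain p0 where p0: "degree p0 \<le> k" "\<forall>x\<in>{a..b}. (\<lambda>j x. D j x - P j x - Q j x) 0 x = poly p0 x"
  proof -
    have "\<exists>p. degree p \<le> k \<and> (\<forall>x\<in>{a..b}. (\<lambda>j x. D j x - P j x - Q j x) 0 x = poly p x)"
    proof (rule poly_of_zero_derivative)
      fix j x assume "j \<le> k" "x \<in> {a..b}"
      then show "((\<lambda>x. D j x - P j x - Q j x) has_real_derivative D (Suc j) x - P (Suc j) x - Q (Suc j) x) (at x within {a..b})"
        by (intro derivative_intros dD P(1) Q(1)) auto
    next
      fix x show "D (Suc k) x - P (Suc k) x - Q (Suc k) x = 0" using P(2) Q(2) fg by simp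
    qed
    then show ?thesis using that by blast
  qed
  have cP1: "continuous_on {a..b} (P 1)" 
    by (rule deriv_imp_continuous_on[OF ballI[OF P(1)]]) (use k in auto)
  have cQ1: "continuous_on {a..b} (Q 1)" 
    by (rule deriv_imp_continuous_on[OF ballI[OF Q(1)]]) (use k in auto)
  have dP: "\<forall>x\<in>{a..b}. (P 0 has_real_derivative P 1 x) (at x within {a..b})"
    using P(1)[of 0] by simp
  have dQ: "\<forall>x\<in>{a..b}. (Q 0 has_real_derivative Q 1 x) (at x within {a..b})"
    using Q(1)[of 0] by simp
  note zP = zero_boundary_correction[of a b "P 0" "P 1", OF ab(1) dP cP1 P(3)[of 0, OF zero_less_Suc]]
  note zQ = zero_boundary_correction[of a b "Q 0" "Q 1", OF ab(1) dQ cQ1 Q(3)[of 0, OF zero_less_Suc]]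
  define S where "S = (\<lambda>x. P 0 x - P 0 a / (b - a) * (b - x))"
  define S' where "S' = (\<lambda>x. P 1 x + P 0 a / (b - a))"
  define W where "W = (\<lambda>x. Q 0 x - Q 0 a / (b - a) * (b - x))"
  define W' where "W' = (\<lambda>x. Q 1 x + Q 0 a / (b - a))"
  define \<alpha> where "\<alpha> = P 0 a / (b - a)"
  define \<delta> where "\<delta> = Q 0 a / (b - a)"
  \<comment> \<open>The linear corrections of both remainders go into the polynomial; this is possible since \<open>k \<ge> 1\<close>.\<close>
  define p where "p = p0 + smult (\<alpha> + \<delta>) [:b, -1:]"
  have "degree p \<le> k" unfolding p_def using p0(1) k
    by (intro degree_add_le) (auto intro!: order.trans[OF degree_smult_le])
  moreover have "u x = poly p x + S x + W x" if "x \<in> {a..b}" for x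
    using p0(2) that D(1) unfolding p_def S_def W_def \<alpha>_def[symmetric] \<delta>_def[symmetric] by (auto simp: algebra_simps)
  moreover
  have Pb: "\<bar>P (Suc k - i) x\<bar> \<le> C * (b - a) ^ i" if "x \<in> {a..b}" "i \<le> Suc k" for x i
    by (rule antiderivative_bound_length[where R=P and n="Suc k", OF P(1,3) _ that]) (use P(2) fC in auto)
  have exp_le: "exp (- \<kappa> * (x - s) / \<epsilon>) \<le> exp (- \<kappa> * (a - s) / \<epsilon>)" if "x \<in> {a..b}" for x
    using that pos by (auto intro!: divide_right_mono)
  have gX: "\<bar>g x\<bar> \<le> C * X" if "x \<in> {a..b}" for x
    using order.trans[OF gC[OF that] mult_left_mono[OF exp_le[OF that], of "C * q"]] C0 q0 by (simp add: X_def q_def mult.assoc)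
  have Qb: "\<bar>Q (Suc k - i) x\<bar> \<le> C * X * (b - a) ^ i" if "x \<in> {a..b}" "i \<le> Suc k" for x i
    by (rule antiderivative_bound_length[where R=Q and n="Suc k", OF Q(1,3) _ that]) (use Q(2) gX in auto)
  have Qc: "\<bar>Q (Suc k - i) x\<bar> \<le> C * X * (\<epsilon> / \<kappa>) ^ i" if x: "x \<in> {a..b}" "i \<le> Suc k" for x i
  proof -
    have "\<bar>Q (Suc k - i) x\<bar> \<le> C * q * (\<epsilon> / \<kappa>) ^ i * exp (- \<kappa> * (x - s) / \<epsilon>)"
      by (rule antiderivative_bound_layer[where R=Q and n="Suc k", OF Q(1,3) _ _ pos(2,1) x]) (use Q(2) gC C0 q0 in auto)
    also have "\<dots> \<le> C * q * (\<epsilon> / \<kappa>) ^ i * exp (- \<kappa> * (a - s) / \<epsilon>)"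
      using exp_le[OF x(1)] C0 q0 pos by (intro mult_left_mono) auto
    finally show ?thesis by (simp add: X_def q_def mult.assoc mult.commute mult.left_commute)
  qed
  have "\<bar>S x\<bar> \<le> 2 * C * (b - a) ^ Suc k \<and> \<bar>S' x\<bar> \<le> 2 * C * (b - a) ^ k \<and>
        \<bar>W x\<bar> \<le> 2 * C * X * (b - a) ^ Suc k \<and> \<bar>W' x\<bar> \<le> 2 * C * X * (b - a) ^ k \<and>
        \<bar>W x\<bar> \<le> 2 * C * X * (\<epsilon> / \<kappa>) ^ Suc k \<and> \<bar>W' x\<bar> \<le> 2 * C * X * (\<epsilon> / \<kappa>) ^ k" if x: "x \<in> {a..b}" for x
    using zP(5)[OF _ x, of "C * (b - a) ^ Suc k"] zP(6)[OF _ x, of "C * (b - a) ^ k", folded S'_def]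
      zQ(5)[OF _ x, of "C * X * (b - a) ^ Suc k", folded W_def] zQ(6)[OF _ x, of "C * X * (b - a) ^ k", folded W'_def]
      zQ(5)[OF _ x, of "C * X * (\<epsilon> / \<kappa>) ^ Suc k", folded W_def] zQ(6)[OF _ x, of "C * X * (\<epsilon> / \<kappa>) ^ k", folded W'_def]
      Pb[of _ "Suc k"] Pb[of _ k] Qb[of _ "Suc k"] Qb[of _ k] Qc[of _ "Suc k"] Qc[of _ k]
    by (simp add: mult.assoc S_def S'_def W_def W'_def del: power_Suc power_divide)
  moreover have "S a = 0" "S b = 0" "\<forall>x\<in>{a..b}. (S has_real_derivative S' x) (at x within {a..b})" "continuous_on {a..b} S'"
    using zP(1-4) by (simp_all add: S_def S'_def)
  moreover have "W a = 0" "W b = 0" "\<forall>x\<in>{a..b}. (W has_real_derivative W' x) (at x within {a..b})" "continuous_on {a..b} W'"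
    using zQ(1-4) by (simp_all add: W_def W'_def)
  ultimately show ?thesis by blast
qed

lemma poly_exp_bounded:
  assumes "c > 0" "n > 0" "\<tau> \<ge> 0"
  shows "(1 + \<tau>) ^ n * exp (- c * \<tau>) \<le> (1 + real n / c) ^ n"
proof -
  \<comment> \<open>Compare with \<open>(1 + c \<tau> / n)^n \<le> exp (c \<tau>)\<close>.\<close>
  have "1 + \<tau> \<le> (1 + real n / c) * (1 + c * \<tau> / real n)"
    using assms by (simp add: field_simps)
  then have "(1 + \<tau>) ^ n \<le> ((1 + real n / c) * (1 + c * \<tau> / real n)) ^ n"
    using assms by (intro power_mono) auto
  also have "\<dots> \<le> (1 + real n / c) ^ n * exp (c * \<tau>)"
  proof -
    have "- real n \<le> c * \<tau>" using mult_nonneg_nonneg[of c \<tau>] assms by linarith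
    then show ?thesis unfolding power_mult_distrib 
      using assms exp_ge_one_plus_x_over_n_power_n[of n "c * \<tau>"] by (intro mult_left_mono) auto
  qed
  finally show ?thesis by (simp add: exp_minus field_simps)
qed

text \<open>
The powers of \<open>\<epsilon>\<close> in the bounds of \<open>W\<close> and \<open>W'\<close> are those needed by the energy estimate. The density \<open>\<rho>\<close>
carries the dependence on \<open>x\<close>; only its integral has to be bounded uniformly.
\<close>

definition cell_split ::
  "(real \<Rightarrow> real) \<Rightarrow> nat \<Rightarrow> real \<Rightarrow> real \<Rightarrow> real \<Rightarrow> (real \<Rightarrow> real) \<Rightarrow> real \<Rightarrow> real \<Rightarrow> bool" where
  "cell_split u k \<epsilon> H K \<rho> a b \<longleftrightarrow> (\<exists>p S S' W W'. degree p \<le> k \<and> (\<forall>x\<in>{a..b}. u x = poly p x + S x + W x) \<and>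
     S a = 0 \<and> S b = 0 \<and> W a = 0 \<and> W b = 0 \<and>
     (\<forall>x\<in>{a..b}. (S has_real_derivative S' x) (at x within {a..b})) \<and> continuous_on {a..b} S' \<and>
     (\<forall>x\<in>{a..b}. (W has_real_derivative W' x) (at x within {a..b})) \<and> continuous_on {a..b} W' \<and>
     (\<forall>x\<in>{a..b}. \<bar>S x\<bar> \<le> K * H ^ k \<and> \<bar>S' x\<bar> \<le> K * H ^ k \<and>
        (W x)\<^sup>2 \<le> K * (\<epsilon> * H ^ (2 * k) * \<rho> x) \<and> \<epsilon> * (W' x)\<^sup>2 \<le> K * (H ^ (2 * k) * \<rho> x)))"

lemma cell_split_mono:
  assumes "cell_split u k \<epsilon> H K \<rho> a b" "K \<le> K'" "0 < \<epsilon>" "0 < H" "\<And>x. x \<in> {a..b} \<Longrightarrow> 0 \<le> \<rho> x"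
  shows "cell_split u k \<epsilon> H K' \<rho> a b"
proof -
  have 1: "K * H ^ k \<le> K' * H ^ k" using assms by (intro mult_right_mono) auto
  have 2: "K * (\<epsilon> * H ^ (2 * k) * \<rho> x) \<le> K' * (\<epsilon> * H ^ (2 * k) * \<rho> x)" 
    "K * (H ^ (2 * k) * \<rho> x) \<le> K' * (H ^ (2 * k) * \<rho> x)" if "x \<in> {a..b}" for x
    using assms(5)[OF that] assms by (intro mult_right_mono; simp)+
  show ?thesis using assms(1) order.trans[OF _ 1] order.trans[OF _ 2(1)] order.trans[OF _ 2(2)] unfolding cell_split_def by (smt (verit, best))
qed

lemma cell_splitI:
  assumes lay: "layer_bounded \<epsilon> \<kappa> s C (Suc k) \<sigma> u" and k: "k \<ge> 1" and ab: "a < b" "{a..b} \<subseteq> {s..s+1}"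
    and pos: "\<epsilon> > 0" "\<kappa> > 0" and h: "b - a \<le> H" "H < 1" and K: "2 * C \<le> K"
  defines "X \<equiv> \<epsilon> powr (\<sigma> - real (Suc k)) * exp (- \<kappa> * (a - s) / \<epsilon>)"
  assumes W: "\<And>x y z. x \<in> {a..b} \<Longrightarrow> \<bar>y\<bar> \<le> 2 * C * X * (b - a) ^ Suc k \<Longrightarrow> \<bar>z\<bar> \<le> 2 * C * X * (b - a) ^ k \<Longrightarrow>
        \<bar>y\<bar> \<le> 2 * C * X * (\<epsilon> / \<kappa>) ^ Suc k \<Longrightarrow> \<bar>z\<bar> \<le> 2 * C * X * (\<epsilon> / \<kappa>) ^ k \<Longrightarrow>
        y\<^sup>2 \<le> K * (\<epsilon> * H ^ (2 * k) * \<rho> x) \<and> \<epsilon> * z\<^sup>2 \<le> K * (H ^ (2 * k) * \<rho> x)"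
  shows "cell_split u k \<epsilon> H K \<rho> a b"
proof -
  have C0: "C \<ge> 0" using layer_bounded_nonneg[OF lay] .
  have hk: "(b - a) ^ k \<le> H ^ k" using ab h by (intro power_mono) auto
  have "(b - a) ^ Suc k \<le> 1 * (b - a) ^ k" unfolding power_Suc using ab h by (intro mult_right_mono) auto
  then have hk': "(b - a) ^ Suc k \<le> H ^ k" using hk by simp
  have S: "2 * C * (b - a) ^ k \<le> K * H ^ k" "2 * C * (b - a) ^ Suc k \<le> K * H ^ k"
    using hk hk' K C0 ab by (intro mult_mono; simp)+
  obtain p S S' W W' where *: "degree p \<le> k" "\<forall>x\<in>{a..b}. u x = poly p x + S x + W x"
     "S a = 0" "S b = 0" "W a = 0" "W b = 0"
     "\<forall>x\<in>{a..b}. (S has_real_derivative S' x) (at x within {a..b})" "continuous_on {a..b} S'"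
     "\<forall>x\<in>{a..b}. (W has_real_derivative W' x) (at x within {a..b})" "continuous_on {a..b} W'" and
     b: "\<forall>x\<in>{a..b}. \<bar>S x\<bar> \<le> 2 * C * (b - a) ^ Suc k \<and> \<bar>S' x\<bar> \<le> 2 * C * (b - a) ^ k \<and>
        \<bar>W x\<bar> \<le> 2 * C * X * (b - a) ^ Suc k \<and> \<bar>W' x\<bar> \<le> 2 * C * X * (b - a) ^ k \<and>
        \<bar>W x\<bar> \<le> 2 * C * X * (\<epsilon> / \<kappa>) ^ Suc k \<and> \<bar>W' x\<bar> \<le> 2 * C * X * (\<epsilon> / \<kappa>) ^ k"
    using cell_approximation[OF lay k ab pos] unfolding X_def by blast
  have "\<bar>S x\<bar> \<le> K * H ^ k \<and> \<bar>S' x\<bar> \<le> K * H ^ k \<and>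
        (W x)\<^sup>2 \<le> K * (\<epsilon> * H ^ (2 * k) * \<rho> x) \<and> \<epsilon> * (W' x)\<^sup>2 \<le> K * (H ^ (2 * k) * \<rho> x)" if x: "x \<in> {a..b}" for x
    using bspec[OF b x] assms(11)[OF x, of "W x" "W' x"] S by linarith
  with * show ?thesis unfolding cell_split_def by blast
qed

text \<open>
With \<open>\<tau> = (a - s) / \<epsilon>\<close> the powers of \<open>1 + \<tau>\<close> that come from the length of the cell are absorbed by one half of the
exponential. As \<open>(x - s) / \<epsilon> \<le> 1 + 2 \<tau>\<close> on the cell, the other half is bounded by the density at \<open>x\<close>.
\<close>

lemma resolved_cell:
  assumes lay: "layer_bounded \<epsilon> \<kappa> s C (Suc k) \<sigma> u" and k: "k \<ge> 1" and ab: "a < b" "{a..b} \<subseteq> {s..s+1}"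
    and pos: "\<epsilon> > 0" "\<kappa> > 0" and h: "b - a \<le> H" "H < 1" "b - a \<le> \<epsilon> + (a - s)"
    and hk: "(b - a) ^ k * \<epsilon> powr (\<sigma> - real k) \<le> H ^ k * (1 + (a - s) / \<epsilon>) ^ k"
    and \<rho>: "\<And>x. x \<in> {a..b} \<Longrightarrow> exp (- (\<kappa>/4) * (x - s) / \<epsilon>) / \<epsilon> \<le> \<rho> x"
  defines "M \<equiv> 2 * C * (1 + real (Suc k) / (\<kappa>/2)) ^ Suc k"
  shows "cell_split u k \<epsilon> H (M\<^sup>2 * exp (\<kappa>/4) + 2 * C) \<rho> a b"
proof -
  have C0: "C \<ge> 0" using layer_bounded_nonneg[OF lay] .
  define \<tau> where "\<tau> = (a - s) / \<epsilon>"
  have \<tau>0: "\<tau> \<ge> 0" using ab pos by (auto simp: \<tau>_def)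
  have H0: "H > 0" using ab h by linarith
  define e where "e = exp (- (\<kappa>/2) * \<tau>)"
  have e: "e > 0" "exp (- \<kappa> * (a - s) / \<epsilon>) = e * e"
    by (auto simp: e_def \<tau>_def simp flip: exp_add)
  define X where "X = \<epsilon> powr (\<sigma> - real (Suc k)) * exp (- \<kappa> * (a - s) / \<epsilon>)"
  have X0: "X \<ge> 0" by (simp add: X_def)
  have M1: "(1 + \<tau>) ^ Suc k * e \<le> (1 + real (Suc k) / (\<kappa>/2)) ^ Suc k"
    unfolding e_def using poly_exp_bounded[of "\<kappa>/2" "Suc k" \<tau>] pos \<tau>0 by simp
  have M1': "2 * C * ((1 + \<tau>) ^ Suc k * e) \<le> M" unfolding M_def using C0 by (intro mult_left_mono M1) auto
  have "\<epsilon> powr (\<sigma> - real (Suc k)) = \<epsilon> powr (\<sigma> - real k) / \<epsilon>"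
    using pos by (simp add: powr_diff powr_add field_simps)
  then have "X * (b - a) ^ k = ((b - a) ^ k * \<epsilon> powr (\<sigma> - real k)) * (e * e / \<epsilon>)"
    unfolding X_def e(2) by simp
  also have "\<dots> \<le> (H ^ k * (1 + \<tau>) ^ k) * (e * e / \<epsilon>)"
    using hk pos e by (intro mult_right_mono) (auto simp: \<tau>_def)
  finally have Xh: "X * (b - a) ^ k \<le> (H ^ k * (1 + \<tau>) ^ k) * (e * e / \<epsilon>)" .
  have hh: "b - a \<le> \<epsilon> * (1 + \<tau>)" 
  proof -
    have "\<epsilon> * \<tau> = a - s" using pos by (simp add: \<tau>_def)
    then show ?thesis using h(3) by (simp add: distrib_left)
  qed
  have z1: "2 * C * X * (b - a) ^ k \<le> M * (H ^ k * (e / \<epsilon>))"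
  proof -
    have "2 * C * (X * (b - a) ^ k) \<le> 2 * C * ((H ^ k * (1 + \<tau>) ^ k) * (e * e / \<epsilon>))"
      using C0 by (intro mult_left_mono Xh) auto
    also have "\<dots> = 2 * C * (1 + \<tau>) ^ k * (e * (H ^ k * (e / \<epsilon>)))" by simp
    also have "\<dots> \<le> 2 * C * (1 + \<tau>) ^ Suc k * (e * (H ^ k * (e / \<epsilon>)))"
      using C0 \<tau>0 e pos H0 by (intro mult_right_mono mult_left_mono power_increasing) auto
    also have "\<dots> = (2 * C * ((1 + \<tau>) ^ Suc k * e)) * (H ^ k * (e / \<epsilon>))" by simp
    also have "\<dots> \<le> M * (H ^ k * (e / \<epsilon>))" using e H0 pos by (intro mult_right_mono M1') auto
    finally show ?thesis by (simp add: mult.assoc)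
  qed
  have y1: "2 * C * X * (b - a) ^ Suc k \<le> M * (H ^ k * e)"
  proof -
    have "2 * C * (X * (b - a) ^ k) * (b - a) \<le> 2 * C * ((H ^ k * (1 + \<tau>) ^ k) * (e * e / \<epsilon>)) * (\<epsilon> * (1 + \<tau>))"
      using C0 X0 ab hh e H0 \<tau>0 pos by (intro mult_mono mult_left_mono Xh) auto
    also have "\<dots> = (2 * C * ((1 + \<tau>) ^ Suc k * e)) * (H ^ k * e)" using pos by simp
    also have "\<dots> \<le> M * (H ^ k * e)" using e H0 pos by (intro mult_right_mono M1') auto
    finally show ?thesis by (simp add: mult.assoc mult.commute mult.left_commute)
  qed
  have M0: "M \<ge> 0" using C0 pos by (simp add: M_def)
  show ?thesis
  proof (rule cell_splitI[OF lay k ab pos h(1,2)])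
    fix x y z assume x: "x \<in> {a..b}" and "\<bar>y\<bar> \<le> 2 * C * (\<epsilon> powr (\<sigma> - real (Suc k)) * exp (- \<kappa> * (a - s) / \<epsilon>)) * (b - a) ^ Suc k"
      "\<bar>z\<bar> \<le> 2 * C * (\<epsilon> powr (\<sigma> - real (Suc k)) * exp (- \<kappa> * (a - s) / \<epsilon>)) * (b - a) ^ k"
    then have y: "\<bar>y\<bar> \<le> M * (H ^ k * e)" and z: "\<bar>z\<bar> \<le> M * (H ^ k * (e / \<epsilon>))"
      using y1 z1 unfolding X_def by linarith+
    have "(x - s) / \<epsilon> \<le> (\<epsilon> + 2 * (a - s)) / \<epsilon>" using x h(3) pos by (intro divide_right_mono) auto
    also have "\<dots> = 1 + 2 * \<tau>" using pos by (simp add: \<tau>_def add_divide_distrib)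
    finally have "(x - s) / \<epsilon> \<le> 1 + 2 * \<tau>" .
    then have "(\<kappa>/4) * ((x - s) / \<epsilon>) \<le> (\<kappa>/4) * (1 + 2 * \<tau>)" using pos by (intro mult_left_mono) auto
    then have "(\<kappa>/4) * (x - s) / \<epsilon> \<le> \<kappa>/4 + (\<kappa>/2) * \<tau>" by (simp add: distrib_left)
    then have "exp (- (\<kappa>/4) - (\<kappa>/2) * \<tau>) \<le> exp (- (\<kappa>/4) * (x - s) / \<epsilon>)"
      by (simp only: exp_le_cancel_iff mult_minus_left minus_divide_left[symmetric])
    then have "exp (- (\<kappa>/4)) * e \<le> exp (- (\<kappa>/4) * (x - s) / \<epsilon>)" by (simp add: e_def flip: exp_add)
    also have "\<dots> \<le> \<epsilon> * \<rho> x" using \<rho>[OF x] pos by (simp add: field_simps)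
    finally have "e \<le> exp (\<kappa>/4) * (\<epsilon> * \<rho> x)" by (simp add: exp_minus field_simps)
    moreover have "e \<le> 1" using pos \<tau>0 by (simp add: e_def)
    then have "e * e \<le> 1 * e" using e by (intro mult_right_mono) auto
    ultimately have ee: "e\<^sup>2 \<le> exp (\<kappa>/4) * (\<epsilon> * \<rho> x)" by (simp add: power2_eq_square)
    then have "0 \<le> exp (\<kappa>/4) * (\<epsilon> * \<rho> x)" by (rule order.trans[rotated]) simp
    then have \<rho>0: "\<rho> x \<ge> 0" using pos by (simp add: zero_le_mult_iff)
    have "y\<^sup>2 \<le> (M * (H ^ k * e))\<^sup>2" using power_mono[OF y, of 2] by simp
    also have "\<dots> = M\<^sup>2 * (H ^ (2 * k) * e\<^sup>2)" by (simp add: power_mult_distrib power_mult power2_eq_square power_add mult_2)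
    also have "\<dots> \<le> M\<^sup>2 * (H ^ (2 * k) * (exp (\<kappa>/4) * (\<epsilon> * \<rho> x)))" using H0 by (intro mult_left_mono ee) auto
    also have "\<dots> = M\<^sup>2 * exp (\<kappa>/4) * (\<epsilon> * H ^ (2 * k) * \<rho> x)" by simp
    also have "\<dots> \<le> (M\<^sup>2 * exp (\<kappa>/4) + 2 * C) * (\<epsilon> * H ^ (2 * k) * \<rho> x)" 
      using C0 \<rho>0 pos H0 by (intro mult_right_mono) auto
    finally have 1: "y\<^sup>2 \<le> (M\<^sup>2 * exp (\<kappa>/4) + 2 * C) * (\<epsilon> * H ^ (2 * k) * \<rho> x)" .
    have "\<epsilon> * z\<^sup>2 \<le> \<epsilon> * (M * (H ^ k * (e / \<epsilon>)))\<^sup>2" using power_mono[OF z, of 2] pos by simp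
    also have "\<dots> = M\<^sup>2 * (H ^ (2 * k) * (e\<^sup>2 / \<epsilon>))" using pos by (simp add: power_mult_distrib power_mult power2_eq_square power_add mult_2)
    also have "\<dots> \<le> M\<^sup>2 * (H ^ (2 * k) * ((exp (\<kappa>/4) * (\<epsilon> * \<rho> x)) / \<epsilon>))" using H0 pos by (intro mult_left_mono divide_right_mono ee) auto
    also have "\<dots> = M\<^sup>2 * exp (\<kappa>/4) * (H ^ (2 * k) * \<rho> x)" using pos by simp
    also have "\<dots> \<le> (M\<^sup>2 * exp (\<kappa>/4) + 2 * C) * (H ^ (2 * k) * \<rho> x)" 
      using C0 \<rho>0 H0 by (intro mult_right_mono) auto
    finally show "y\<^sup>2 \<le> (M\<^sup>2 * exp (\<kappa>/4) + 2 * C) * (\<epsilon> * H ^ (2 * k) * \<rho> x) \<and>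
       \<epsilon> * z\<^sup>2 \<le> (M\<^sup>2 * exp (\<kappa>/4) + 2 * C) * (H ^ (2 * k) * \<rho> x)" using 1 by blast
  qed simp
qed

text \<open>
Here \<open>\<epsilon> \<le> H^k\<close>, and the bounds \<open>W = O(\<epsilon>)\<close>, \<open>W' = O(1)\<close> times the exponential suffice. Since the cell is long,
the exponential at its left end is not controlled by the one at \<open>x\<close> close to \<open>s\<close>; there the constant part
\<open>\<epsilon> / H^(2 k)\<close> of the density is used.
\<close>

lemma unresolved_cell:
  assumes lay: "layer_bounded \<epsilon> \<kappa> s C (Suc k) 1 u" and k: "k \<ge> 1" and ab: "a < b" "{a..b} \<subseteq> {s..s+1}"
    and pos: "\<epsilon> > 0" "\<kappa> > 0" and h: "b - a \<le> H" "H < 1" "b - a \<le> \<mu> \<or> b - a \<le> a - s"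
    and \<epsilon>H: "\<epsilon> \<le> H ^ k"
    and \<rho>: "\<And>x. x \<in> {a..b} \<Longrightarrow> exp (- (\<kappa>/4) * (x - s) / \<epsilon>) / \<epsilon> \<le> \<rho> x"
      "\<And>x. x \<in> {a..b} \<Longrightarrow> x - s \<le> 2 * \<mu> \<Longrightarrow> \<epsilon> / H ^ (2 * k) \<le> \<rho> x"
  defines "M \<equiv> 2 * C * ((1 / \<kappa>) ^ k + (1 / \<kappa>) ^ Suc k)"
  shows "cell_split u k \<epsilon> H (M\<^sup>2 + 2 * C) \<rho> a b"
proof -
  have C0: "C \<ge> 0" using layer_bounded_nonneg[OF lay] .
  have H0: "H > 0" using ab h by linarith
  define e where "e = exp (- \<kappa> * (a - s) / \<epsilon>)"
  have e0: "e > 0" by (simp add: e_def)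
  have e1: "e \<le> 1" using pos ab by (simp add: e_def)
  have "\<epsilon> powr (1 - real (Suc k)) * \<epsilon> ^ k = 1"
    using pos by (simp add: powr_minus powr_realpow field_simps)
  then have q: "\<epsilon> powr (1 - real (Suc k)) * e * (\<epsilon> / \<kappa>) ^ k = (1 / \<kappa>) ^ k * e"
    by (simp add: power_divide field_simps)
  have M0: "M \<ge> 0" using C0 pos by (simp add: M_def)
  have z1: "2 * C * (\<epsilon> powr (1 - real (Suc k)) * e) * (\<epsilon> / \<kappa>) ^ k \<le> M * e"
  proof -
    have "2 * C * (\<epsilon> powr (1 - real (Suc k)) * e) * (\<epsilon> / \<kappa>) ^ k = 2 * C * ((1 / \<kappa>) ^ k * e)"
      using q by (simp only: mult.assoc)
    also have "\<dots> \<le> M * e" unfolding M_def using C0 e0 pos by (simp add: algebra_simps)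
    finally show ?thesis .
  qed
  have y1: "2 * C * (\<epsilon> powr (1 - real (Suc k)) * e) * (\<epsilon> / \<kappa>) ^ Suc k \<le> M * \<epsilon> * e"
  proof -
    have "2 * C * (\<epsilon> powr (1 - real (Suc k)) * e) * (\<epsilon> / \<kappa>) ^ Suc k = 2 * C * ((1 / \<kappa>) ^ k * e) * (\<epsilon> / \<kappa>)"
    proof -
      have "2 * C * (\<epsilon> powr (1 - real (Suc k)) * e) * (\<epsilon> / \<kappa>) ^ Suc k
          = 2 * C * (\<epsilon> powr (1 - real (Suc k)) * e * (\<epsilon> / \<kappa>) ^ k) * (\<epsilon> / \<kappa>)"
        unfolding power_Suc2 by (simp only: mult.assoc)
      then show ?thesis by (simp only: q)
    qed
    also have "\<dots> \<le> M * \<epsilon> * e" unfolding M_def using C0 e0 pos by (simp add: algebra_simps)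
    finally show ?thesis .
  qed
  have sq: "\<epsilon>\<^sup>2 \<le> H ^ (2 * k)" using power_mono[OF \<epsilon>H, of 2] pos by (simp add: power_mult mult.commute)
  show ?thesis
  proof (rule cell_splitI[OF lay k ab pos h(1,2)])
    fix x y z assume x: "x \<in> {a..b}" and "\<bar>y\<bar> \<le> 2 * C * (\<epsilon> powr (1 - real (Suc k)) * exp (- \<kappa> * (a - s) / \<epsilon>)) * (\<epsilon> / \<kappa>) ^ Suc k"
      "\<bar>z\<bar> \<le> 2 * C * (\<epsilon> powr (1 - real (Suc k)) * exp (- \<kappa> * (a - s) / \<epsilon>)) * (\<epsilon> / \<kappa>) ^ k"
    then have y: "\<bar>y\<bar> \<le> M * \<epsilon> * e" and z: "\<bar>z\<bar> \<le> M * e"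
      using y1 z1 unfolding e_def by linarith+
    have ee: "\<epsilon> * e\<^sup>2 \<le> H ^ (2 * k) * \<rho> x"
    proof (cases "x - s \<le> 2 * \<mu>")
      case True
      have "\<epsilon> * e\<^sup>2 \<le> \<epsilon> * 1" using pos e0 e1 by (intro mult_left_mono power_le_one) auto
      also have "\<epsilon> \<le> H ^ (2 * k) * \<rho> x" using \<rho>(2)[OF x True] H0 by (simp add: field_simps)
      finally show ?thesis by simp
    next
      case False
      then have xs: "x - s \<le> 2 * (a - s)" using h(3) x by auto
      have "e\<^sup>2 = exp (- \<kappa> * (2 * (a - s)) / \<epsilon>)" by (simp add: e_def power2_eq_square flip: exp_add)
      also have "\<dots> \<le> exp (- (\<kappa>/4) * (x - s) / \<epsilon>)"
      proof -
        have "(\<kappa>/4) * (x - s) \<le> \<kappa> * (2 * (a - s))" using xs pos ab x by (intro mult_mono) auto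
        then have "(\<kappa>/4) * (x - s) / \<epsilon> \<le> \<kappa> * (2 * (a - s)) / \<epsilon>" using pos by (intro divide_right_mono) auto
        then show ?thesis by (simp only: exp_le_cancel_iff mult_minus_left minus_divide_left[symmetric] neg_le_iff_le)
      qed
      also have "\<dots> \<le> \<epsilon> * \<rho> x" using \<rho>(1)[OF x] pos by (simp add: field_simps)
      finally have 1: "e\<^sup>2 \<le> \<epsilon> * \<rho> x" .
      then have "0 \<le> \<epsilon> * \<rho> x" by (rule order.trans[rotated]) simp
      then have \<rho>0: "\<rho> x \<ge> 0" using pos by (simp add: zero_le_mult_iff)
      have "\<epsilon> * e\<^sup>2 \<le> \<epsilon> * (\<epsilon> * \<rho> x)" using 1 pos by (intro mult_left_mono) auto
      also have "\<dots> = \<epsilon>\<^sup>2 * \<rho> x" by (simp add: power2_eq_square)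
      also have "\<dots> \<le> H ^ (2 * k) * \<rho> x" using sq \<rho>0 by (intro mult_right_mono) auto
      finally show ?thesis .
    qed
    then have "0 \<le> H ^ (2 * k) * \<rho> x" by (rule order.trans[rotated]) (use pos in simp)
    then have \<rho>0: "\<rho> x \<ge> 0" using zero_less_power[OF H0, of "2 * k"] by (simp add: zero_le_mult_iff del: zero_less_power)
    have "\<epsilon> * z\<^sup>2 \<le> \<epsilon> * (M * e)\<^sup>2" using power_mono[OF z, of 2] pos by simp
    also have "\<dots> = M\<^sup>2 * (\<epsilon> * e\<^sup>2)" by (simp add: power_mult_distrib)
    also have "\<dots> \<le> M\<^sup>2 * (H ^ (2 * k) * \<rho> x)" by (intro mult_left_mono ee) auto
    also have "\<dots> \<le> (M\<^sup>2 + 2 * C) * (H ^ (2 * k) * \<rho> x)" using C0 \<rho>0 H0 by (intro mult_right_mono) auto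
    finally have 1: "\<epsilon> * z\<^sup>2 \<le> (M\<^sup>2 + 2 * C) * (H ^ (2 * k) * \<rho> x)" .
    have "y\<^sup>2 \<le> (M * \<epsilon> * e)\<^sup>2" using power_mono[OF y, of 2] pos by simp
    also have "\<dots> = M\<^sup>2 * (\<epsilon> * (\<epsilon> * e\<^sup>2))" by (simp add: power_mult_distrib power2_eq_square)
    also have "\<dots> \<le> M\<^sup>2 * (\<epsilon> * (H ^ (2 * k) * \<rho> x))" using pos by (intro mult_left_mono ee) auto
    also have "\<dots> = M\<^sup>2 * (\<epsilon> * H ^ (2 * k) * \<rho> x)" by simp
    also have "\<dots> \<le> (M\<^sup>2 + 2 * C) * (\<epsilon> * H ^ (2 * k) * \<rho> x)" using C0 \<rho>0 H0 pos by (intro mult_right_mono) auto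
    finally show "y\<^sup>2 \<le> (M\<^sup>2 + 2 * C) * (\<epsilon> * H ^ (2 * k) * \<rho> x) \<and>
       \<epsilon> * z\<^sup>2 \<le> (M\<^sup>2 + 2 * C) * (H ^ (2 * k) * \<rho> x)" using 1 by blast
  qed simp
qed

section \<open>Geometry of the mesh\<close>

text \<open>
The number \<open>q = H e L\<close> is the node where the grading starts. Rounding up in the definition of \<open>M\<close> means that
\<open>M - L\<close> is the least number of factors \<open>1 + H\<close> that lifts \<open>q\<close> to at least \<open>1\<close>.
\<close>

lemma graded_mesh_size:
  fixes H e :: real
  assumes H: "0 < H" "H < 1" and e: "0 < e" "e \<le> 1"
  defines "L \<equiv> nat \<lceil>1 / H\<rceil>"
  defines "M \<equiv> nat \<lceil>of_int \<lceil>1 / H\<rceil> - ln (H * e * of_int \<lceil>1 / H\<rceil>) / ln (1 + H)\<rceil>"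
  shows "2 \<le> L" "L \<le> M" "H * real L < 1 + H" "1 \<le> (1 + H) ^ (M - L) * (H * e * real L)"
    "L < M \<Longrightarrow> (1 + H) ^ (M - L - 1) * (H * e * real L) < 1"
proof -
  have "1 < 1 / H" using H by simp
  then have "\<lceil>1 / H\<rceil> > 1" by (simp add: less_ceiling_iff)
  then have l2: "\<lceil>1 / H\<rceil> \<ge> 2" by linarith
  then show L2: "2 \<le> L" unfolding L_def by linarith
  have rL: "real_of_int \<lceil>1 / H\<rceil> = real L" using l2 by (simp add: L_def)
  have "1 / H \<le> real L" "real L < 1 / H + 1" using rL by linarith+
  then have HL: "1 \<le> H * real L" "H * real L < 1 + H" using H by (auto simp: field_simps)
  show "H * real L < 1 + H" by (rule HL)
  define q where "q = H * e * real L"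
  have q0: "q > 0" using H e L2 by (simp add: q_def)
  have "q \<le> H * real L" unfolding q_def using H e by (simp add: mult_left_le_one_le mult.assoc mult.left_commute)
  then have q1: "q < 1 + H" using HL by linarith
  have lnH: "ln (1 + H) > 0" using H by simp
  define t where "t = ln q / ln (1 + H)"
  have "ln q < ln (1 + H)" using q0 q1 H by (subst ln_less_cancel_iff) auto
  then have t1: "t < 1" using lnH by (simp add: t_def)
  define z where "z = \<lceil>- t\<rceil>"
  have z0: "z \<ge> 0" using t1 unfolding z_def by linarith
  have "\<lceil>real_of_int \<lceil>1 / H\<rceil> - t\<rceil> = \<lceil>1 / H\<rceil> + z" unfolding z_def by linarith
  then have "M = nat (\<lceil>1 / H\<rceil> + z)"
    by (simp add: M_def t_def q_def rL)
  then have M: "M = L + nat z" using z0 l2 by (simp add: L_def nat_add_distrib)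
  then show LM: "L \<le> M" by simp
  define n where "n = nat z"
  have nM: "M - L = n" by (simp add: M n_def)
  have n: "- t \<le> real n" "real n < - t + 1" using z0 unfolding n_def z_def by linarith+
  show "1 \<le> (1 + H) ^ (M - L) * (H * e * real L)"
  proof -
    have "- ln q \<le> real n * ln (1 + H)" using n(1) lnH by (simp add: t_def field_simps)
    then have "0 \<le> ln ((1 + H) ^ n * q)" using q0 H by (simp add: ln_mult ln_realpow)
    then show ?thesis unfolding nM q_def[symmetric] using q0 H by (subst (asm) ln_ge_zero_iff) auto
  qed
  show "(1 + H) ^ (M - L - 1) * (H * e * real L) < 1" if "L < M"
  proof -
    have n1: "n \<ge> 1" using that nM by simp
    have "(real n - 1) * ln (1 + H) < - ln q" using n(2) lnH by (simp add: t_def field_simps)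
    then have "ln ((1 + H) ^ (n - 1) * q) < 0" using q0 H n1 by (simp add: ln_mult ln_realpow of_nat_diff)
    then show ?thesis unfolding nM q_def[symmetric] using q0 H by (subst (asm) ln_less_zero_iff) auto
  qed
qed

text \<open>
The cells have length \<open>H e\<close> up to the node of index \<open>L\<close> and relative length \<open>H\<close> afterwards. The last node is moved to
\<open>1\<close>; minimality of \<open>M\<close> keeps it right of its predecessor, and the regular step would have reached \<open>1\<close>.
\<close>

lemma graded_half_mesh:
  fixes H e :: real and y :: "nat \<Rightarrow> real"
  assumes H: "0 < H" "H < 1" and e: "0 < e" "e \<le> 1"
  defines "L \<equiv> nat \<lceil>1 / H\<rceil>"
  defines "M \<equiv> nat \<lceil>of_int \<lceil>1 / H\<rceil> - ln (H * e * of_int \<lceil>1 / H\<rceil>) / ln (1 + H)\<rceil>"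
  assumes y0: "y 0 = 0" and yM: "y M = 1"
    and y: "\<And>i. 0 < i \<Longrightarrow> i < M \<Longrightarrow> y i = (if i \<le> L then real i * H * e else (1 + H) * y (i - 1))"
    and i: "1 \<le> i" "i \<le> M"
  shows "0 \<le> y (i - 1) \<and> y (i - 1) < y i \<and> y i \<le> 1 \<and> y i - y (i - 1) \<le> H * max e (y (i - 1))"
proof -
  note sz = graded_mesh_size[OF H e, folded L_def, folded M_def]
  note L2 = sz(1) and HL = sz(3)
  define q where "q = H * e * real L"
  have q0: "q > 0" using H e L2 by (simp add: q_def)
  define n where "n = M - L"
  have M: "M = L + n" using sz(2) by (simp add: n_def)
  have qn: "1 \<le> (1 + H) ^ n * q" using sz(4) by (simp add: n_def q_def)
  have qn1: "(1 + H) ^ (n - 1) * q < 1" if "n \<ge> 1" using sz(5) that by (simp add: n_def q_def)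
  have small: "y i = real i * H * e" if "i \<le> L" "i < M" for i using y[of i] y0 that by (cases "i = 0") auto
  have large: "y (L + j) = (1 + H) ^ j * q" if "L + j < M" for j
    using that
  proof (induction j)
    case 0 then show ?case using small[of L] by (simp add: q_def algebra_simps)
  next
    case (Suc j)
    then show ?case using y[of "L + Suc j"] L2 by simp
  qed
  have pos: "y i \<ge> 0" if "i < M" for i
  proof (cases "i \<le> L")
    case True then show ?thesis using small that H e by simp
  next
    case False then show ?thesis using large[of "i - L"] that H q0 by simp
  qed
  have lt1: "y i < 1" if "i < M" for i
  proof (cases "n = 0")
    case True
    then have "i \<le> L - 1" using that M True by simp
    then have "real i \<le> real L - 1" using L2 by linarith
    have "H * real i \<le> H * (real L - 1)" using \<open>real i \<le> real L - 1\<close> H by (intro mult_left_mono) auto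
    also have "\<dots> < 1" using HL by (simp add: algebra_simps)
    finally have "H * real i < 1" .
    then have "(H * real i) * e < 1 * 1" using e H by (intro mult_less_le_imp_less) auto
    then show ?thesis using small[of i] that \<open>i \<le> L - 1\<close> by (simp add: algebra_simps)
  next
    case False
    have "y i \<le> (1 + H) ^ (n - 1) * q"
    proof (cases "i \<le> L")
      case True
      then have "y i \<le> q" using small[OF True that] H e by (simp add: q_def mult_right_mono mult.commute mult.left_commute)
      also have "1 * q \<le> (1 + H) ^ (n - 1) * q" using q0 H by (intro mult_right_mono) auto
      finally show ?thesis by simp
    next
      case False
      then have "y i = (1 + H) ^ (i - L) * q" using large[of "i - L"] that by simp
      also have "\<dots> \<le> (1 + H) ^ (n - 1) * q" 
        using q0 H that M by (intro mult_right_mono power_increasing) auto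
      finally show ?thesis .
    qed
    then show ?thesis using qn1 False by linarith
  qed
  have prev: "0 \<le> y (i - 1)" "y (i - 1) < 1" using pos[of "i - 1"] lt1[of "i - 1"] i by auto
  show "0 \<le> y (i - 1) \<and> y (i - 1) < y i \<and> y i \<le> 1 \<and> y i - y (i - 1) \<le> H * max e (y (i - 1))"
  proof (cases "i = M")
    \<comment> \<open>The last cell ends at \<open>1\<close>, which the regular step reaches or exceeds.\<close>
    case True
    have "1 - y (M - 1) \<le> H * max e (y (M - 1))"
    proof (cases "n = 0")
      case True
      then have "y (M - 1) = (real L - 1) * H * e" using small[of "L - 1"] M L2 True by (simp add: of_nat_diff)
      then have "1 - y (M - 1) \<le> H * e" using qn True by (simp add: q_def algebra_simps)
      also have "\<dots> \<le> H * max e (y (M - 1))" using H by (intro mult_left_mono) auto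
      finally show ?thesis .
    next
      case False
      then have "y (M - 1) = (1 + H) ^ (n - 1) * q" using large[of "n - 1"] M by simp
      then have "(1 + H) * y (M - 1) = (1 + H) ^ n * q" using False by (cases n) auto
      then have "1 - y (M - 1) \<le> H * y (M - 1)" using qn by (simp add: algebra_simps)
      also have "\<dots> \<le> H * max e (y (M - 1))" using H by (intro mult_left_mono) auto
      finally show ?thesis .
    qed
    then show ?thesis using prev yM True by simp
  next
    case False
    then have iM: "i < M" using i by simp
    show ?thesis
    proof (cases "i \<le> L")
      case True
      have "y i - y (i - 1) = H * e" using small[OF True iM] small[of "i - 1"] True iM i by (simp add: of_nat_diff algebra_simps)
      moreover have "H * e \<le> H * max e (y (i - 1))" "H * e > 0" using H e by (auto intro: mult_left_mono)
      ultimately show ?thesis using prev lt1[OF iM] by auto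
    next
      case False
      then have yi: "y i = (1 + H) * y (i - 1)" using y[of i] iM i by simp
      have "y (i - 1) > 0"
        using False iM i H q0 large[of "i - 1 - L"] by simp
      then have "H * y (i - 1) > 0" using H by simp
      moreover have "y i - y (i - 1) = H * y (i - 1)" using yi by (simp add: algebra_simps)
      moreover have "H * y (i - 1) \<le> H * max e (y (i - 1))" using H by (intro mult_left_mono) auto
      ultimately show ?thesis using prev lt1[OF iM] by auto
    qed
  qed
qed

text \<open>
The mesh on \<open>[1, 2]\<close> is the translate of a graded mesh on \<open>[0, 1]\<close> with \<open>\<epsilon>^((k - 1) / k)\<close> in place of \<open>\<epsilon>\<close>.
\<close>

lemma mesh_node_cells:
  fixes \<epsilon> H :: real
  assumes \<epsilon>: "0 < \<epsilon>" "\<epsilon> < 1" and H: "0 < H" "H < 1" and k: "k \<ge> 1"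
  defines "M \<equiv> mesh_M1 \<epsilon> H" and "M2 \<equiv> mesh_M2 k \<epsilon> H" and "X \<equiv> mesh_node k \<epsilon> H"
  defines "\<eta> \<equiv> \<epsilon> powr ((real k - 1) / real k)"
  shows "M \<ge> 1" "X 0 = 0" "X (M + M2) = 2"
    and "\<And>i. 1 \<le> i \<Longrightarrow> i \<le> M + M2 \<Longrightarrow> X (i - 1) < X i \<and>
       (0 \<le> X (i - 1) \<and> X i \<le> 1 \<and> X i - X (i - 1) \<le> H * max \<epsilon> (X (i - 1)) \<or>
        1 \<le> X (i - 1) \<and> X i \<le> 2 \<and> X i - X (i - 1) \<le> H * max \<eta> (X (i - 1) - 1))"
proof -
  define L where "L = nat \<lceil>1 / H\<rceil>"
  have \<eta>: "0 < \<eta>" "\<eta> \<le> 1" using \<epsilon> k by (auto simp: \<eta>_def intro!: powr_le1)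
  have M: "M = nat \<lceil>of_int \<lceil>1 / H\<rceil> - ln (H * \<epsilon> * of_int \<lceil>1 / H\<rceil>) / ln (1 + H)\<rceil>" by (simp add: M_def mesh_M1_def)
  have M2: "M2 = nat \<lceil>of_int \<lceil>1 / H\<rceil> - ln (H * \<eta> * of_int \<lceil>1 / H\<rceil>) / ln (1 + H)\<rceil>" by (simp add: M2_def mesh_M2_def \<eta>_def)
  have X0: "X 0 = 0" by (simp add: X_def)
  have XS: "X i = (if i = M then 1 else if i = M + M2 then 2 else if i < M then
        (if i \<le> L then real i * H * \<epsilon> else (1 + H) * X (i - 1))
      else (if i \<le> M + L then 1 + real (i - M) * H * \<eta> else 1 + (1 + H) * (X (i - 1) - 1)))" if "0 < i" for i
    using that by (cases i) (simp_all add: X_def Let_def M_def M2_def L_def \<eta>_def)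
  have L2: "2 \<le> L" "L \<le> M" using graded_mesh_size(1,2)[OF H \<epsilon>(1) less_imp_le[OF \<epsilon>(2)]] unfolding M L_def by auto
  have LM2: "L \<le> M2" using graded_mesh_size(2)[OF H \<eta>] unfolding M2 L_def by auto
  show "M \<ge> 1" using L2 by simp
  show "X 0 = 0" by (rule X0)
  have XM: "X M = 1" using XS[of M] L2 by simp
  show XE: "X (M + M2) = 2" using XS[of "M + M2"] L2 LM2 by simp
  note h1 = graded_half_mesh[OF H \<epsilon>(1) less_imp_le[OF \<epsilon>(2)], of X, folded L_def, folded M, OF X0 XM]
  define Y where "Y = (\<lambda>i. X (M + i) - 1)"
  note h2 = graded_half_mesh[OF H \<eta>, of Y, folded L_def, folded M2]
  fix i :: nat assume i: "1 \<le> i" "i \<le> M + M2"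
  show "X (i - 1) < X i \<and>
       (0 \<le> X (i - 1) \<and> X i \<le> 1 \<and> X i - X (i - 1) \<le> H * max \<epsilon> (X (i - 1)) \<or>
        1 \<le> X (i - 1) \<and> X i \<le> 2 \<and> X i - X (i - 1) \<le> H * max \<eta> (X (i - 1) - 1))"
  proof (cases "i \<le> M")
    case True
    show ?thesis using h1[OF _ i(1) True] XS by simp
  next
    case False
    define j where "j = i - M"
    have j: "1 \<le> j" "j \<le> M2" "i = M + j" using False i by (auto simp: j_def)
    have "0 \<le> Y (j - 1) \<and> Y (j - 1) < Y j \<and> Y j \<le> 1 \<and> Y j - Y (j - 1) \<le> H * max \<eta> (Y (j - 1))"
    proof (rule h2[OF _ _ _ j(1,2)])
      show "Y 0 = 0" "Y M2 = 1" using XM XE by (auto simp: Y_def)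
      fix l :: nat assume "0 < l" "l < M2"
      then show "Y l = (if l \<le> L then real l * H * \<eta> else (1 + H) * Y (l - 1))"
        using XS[of "M + l"] by (simp add: Y_def)
    qed
    moreover have "M + (j - 1) = i - 1" using j by simp
    ultimately show ?thesis using j(3) by (simp add: Y_def)
  qed
qed

section \<open>The global splitting of the interpolation error\<close>

lemma exp_layer_integral:
  fixes \<epsilon> \<kappa> s e :: real
  assumes "\<epsilon> > 0" "\<kappa> > 0" "s \<le> e"
  shows "((\<lambda>x. exp (- \<kappa> * (x - s) / \<epsilon>) / \<epsilon>) has_integral (1 - exp (- \<kappa> * (e - s) / \<epsilon>)) / \<kappa>) {s..e}"
proof -
  have "((\<lambda>x. exp (- \<kappa> * (x - s) / \<epsilon>) / \<epsilon>) has_integral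
     (\<lambda>x. - exp (- \<kappa> * (x - s) / \<epsilon>) / \<kappa>) e - (\<lambda>x. - exp (- \<kappa> * (x - s) / \<epsilon>) / \<kappa>) s) {s..e}"
    by (rule fundamental_theorem_of_calculus[where f = "\<lambda>x. - exp (- \<kappa> * (x - s) / \<epsilon>) / \<kappa>"])
      (use assms in \<open>auto intro!: derivative_eq_intros simp flip: has_real_derivative_iff_has_vector_derivative\<close>)
  then show ?thesis using assms by (simp add: diff_divide_distrib)
qed

text \<open>
Normalised exponentials at the layers \<open>0\<close> and \<open>1\<close>, and a constant weight next to \<open>1\<close> for the case that the
cells there, of length up to \<open>\<mu>\<close>, do not resolve the weak layer.
\<close>

definition layer_density :: "real \<Rightarrow> nat \<Rightarrow> real \<Rightarrow> real \<Rightarrow> real \<Rightarrow> real \<Rightarrow> real" where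
  "layer_density \<kappa> k \<epsilon> H \<mu> x = exp (- \<kappa> * (x - 0) / \<epsilon>) / \<epsilon> +
     (if x \<in> {1..2} then exp (- \<kappa> * (x - 1) / \<epsilon>) / \<epsilon> else 0) +
     (if x \<in> {1..min 2 (1 + 2 * \<mu>)} then (if \<epsilon> < \<mu> then \<epsilon> / H ^ (2 * k) else 0) else 0)"

lemma layer_density_nonneg: "\<epsilon> > 0 \<Longrightarrow> H > 0 \<Longrightarrow> layer_density \<kappa> k \<epsilon> H \<mu> x \<ge> 0"
  by (simp add: layer_density_def)

lemma layer_density_integral:
  assumes "\<epsilon> > 0" "\<kappa> > 0" "H > 0" "\<mu> > 0" "\<epsilon> < \<mu> \<Longrightarrow> \<epsilon> * \<mu> \<le> H ^ (2 * k)"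
  shows "\<exists>r. (layer_density \<kappa> k \<epsilon> H \<mu> has_integral r) {0..2} \<and> r \<le> 2 / \<kappa> + 2"
proof -
  define v where "v = (if \<epsilon> < \<mu> then \<epsilon> / H ^ (2 * k) else 0)"
  have v0: "v \<ge> 0" using assms by (simp add: v_def)
  have 1: "((\<lambda>x. exp (- \<kappa> * (x - 0) / \<epsilon>) / \<epsilon>) has_integral (1 - exp (- \<kappa> * (2 - 0) / \<epsilon>)) / \<kappa>) {0..2}"
    by (rule exp_layer_integral) (use assms in auto)
  have 2: "((\<lambda>x. if x \<in> {1..2} then exp (- \<kappa> * (x - 1) / \<epsilon>) / \<epsilon> else 0) has_integral (1 - exp (- \<kappa> * (2 - 1) / \<epsilon>)) / \<kappa>) {0..2}"
    by (subst has_integral_restrict) (use exp_layer_integral[of \<epsilon> \<kappa> 1 2] assms in auto)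
  have "((\<lambda>_. v) has_integral (min 2 (1 + 2 * \<mu>) - 1) * v) {1..min 2 (1 + 2 * \<mu>)}"
    using has_integral_const_real[of v 1 "min 2 (1 + 2 * \<mu>)"] assms by simp
  then have 3: "((\<lambda>x. if x \<in> {1..min 2 (1 + 2 * \<mu>)} then v else 0) has_integral (min 2 (1 + 2 * \<mu>) - 1) * v) {0..2}"
    by (subst has_integral_restrict) auto
  have "(min 2 (1 + 2 * \<mu>) - 1) * v \<le> (2 * \<mu>) * v" using v0 by (intro mult_right_mono) auto
  also have "\<dots> \<le> 2" using assms by (simp add: v_def field_simps)
  finally have "(min 2 (1 + 2 * \<mu>) - 1) * v \<le> 2" .
  moreover have "(1 - exp (- \<kappa> * (2 - 0) / \<epsilon>)) / \<kappa> \<le> 1 / \<kappa>" "(1 - exp (- \<kappa> * (2 - 1) / \<epsilon>)) / \<kappa> \<le> 1 / \<kappa>"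
    using assms by (auto intro!: divide_right_mono)
  moreover have "layer_density \<kappa> k \<epsilon> H \<mu> = (\<lambda>x. exp (- \<kappa> * (x - 0) / \<epsilon>) / \<epsilon> +
     (if x \<in> {1..2} then exp (- \<kappa> * (x - 1) / \<epsilon>) / \<epsilon> else 0) +
     (if x \<in> {1..min 2 (1 + 2 * \<mu>)} then v else 0))"
    by (rule ext) (simp only: layer_density_def v_def)
  note eq = this
  moreover have "2 / \<kappa> = 1 / \<kappa> + 1 / \<kappa>" by simp
  ultimately have "(1 - exp (- \<kappa> * (2 - 0) / \<epsilon>)) / \<kappa> + (1 - exp (- \<kappa> * (2 - 1) / \<epsilon>)) / \<kappa> + (min 2 (1 + 2 * \<mu>) - 1) * v \<le> 2 / \<kappa> + 2"
    by linarith
  then show ?thesis unfolding eq using has_integral_add[OF has_integral_add[OF 1 2] 3] by blast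
qed

text \<open>
The exponent \<open>(k - 1) / k\<close> is tuned such that \<open>\<mu>^k = H^k \<epsilon>^(k - 1)\<close>. If \<open>\<epsilon> < \<mu>\<close>, then this gives \<open>\<epsilon> \<le> H^k\<close> and
\<open>\<mu> \<le> H^k\<close>: the weak layer is negligible at the required accuracy, and the constant part of the density has
bounded integral. If \<open>\<mu> \<le> \<epsilon>\<close>, then all cells resolve the layers.
\<close>

lemma mesh_cell_split:
  assumes k: "k \<ge> 1" and \<epsilon>: "0 < \<epsilon>" "\<epsilon> < 1" and H: "0 < H" "H < 1" and \<kappa>: "\<kappa> > 0"
    and lay: "layer_bounded \<epsilon> \<kappa> 0 C (Suc k) 0 u" "layer_bounded \<epsilon> \<kappa> 1 C (Suc k) 1 u"
  defines "\<mu> \<equiv> H * \<epsilon> powr ((real k - 1) / real k)"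
  defines "M1 \<equiv> 2 * C * (1 + real (Suc k) / (\<kappa>/2)) ^ Suc k"
    and "M2 \<equiv> 2 * C * ((1 / \<kappa>) ^ k + (1 / \<kappa>) ^ Suc k)"
  shows "\<mu> > 0" "\<epsilon> < \<mu> \<Longrightarrow> \<epsilon> * \<mu> \<le> H ^ (2 * k)"
    and "\<And>i. 1 \<le> i \<Longrightarrow> i \<le> mesh_M1 \<epsilon> H + mesh_M2 k \<epsilon> H \<Longrightarrow>
       cell_split u k \<epsilon> H (M1\<^sup>2 * exp (\<kappa>/4) + M2\<^sup>2 + 2 * C) (layer_density (\<kappa>/4) k \<epsilon> H \<mu>) (mesh_node k \<epsilon> H (i - 1)) (mesh_node k \<epsilon> H i)"
proof -
  define \<eta> where "\<eta> = \<epsilon> powr ((real k - 1) / real k)"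
  have \<eta>: "0 < \<eta>" "\<eta> \<le> 1" using \<epsilon> k by (auto simp: \<eta>_def intro!: powr_le1)
  have \<mu>\<eta>: "\<mu> = H * \<eta>" by (simp add: \<mu>_def \<eta>_def)
  show \<mu>0: "\<mu> > 0" using H \<eta> by (simp add: \<mu>\<eta>)
  have \<eta>k: "\<eta> ^ k = \<epsilon> ^ (k - 1)"
  proof -
    have "\<eta> ^ k = \<epsilon> powr ((real k - 1) / real k * real k)" using \<epsilon> by (simp add: \<eta>_def powr_powr flip: powr_realpow)
    also have "\<dots> = \<epsilon> powr real (k - 1)" using k by (simp add: of_nat_diff)
    finally show ?thesis using \<epsilon> by (simp add: powr_realpow)
  qed
  have \<epsilon>k: "\<epsilon> ^ k = \<epsilon> * \<epsilon> ^ (k - 1)" using k by (cases k) auto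
  have B: "\<epsilon> \<le> H ^ k" "\<mu> \<le> H ^ k" if "\<epsilon> < \<mu>"
  proof -
    have \<mu>k: "\<mu> ^ k = H ^ k * \<epsilon> ^ (k - 1)" by (simp add: \<mu>\<eta> power_mult_distrib \<eta>k)
    have "\<epsilon> ^ k \<le> \<mu> ^ k" using that \<epsilon> by (intro power_mono) auto
    then have "\<epsilon> * \<epsilon> ^ (k - 1) \<le> H ^ k * \<epsilon> ^ (k - 1)" by (simp add: \<mu>k \<epsilon>k)
    then show 1: "\<epsilon> \<le> H ^ k" using \<epsilon> by (subst (asm) mult_le_cancel_right) auto
    have "\<mu> ^ k \<le> H ^ k * (H ^ k) ^ (k - 1)" unfolding \<mu>k using 1 \<epsilon> H by (intro mult_left_mono power_mono) auto
    also have "\<dots> = (H ^ k) ^ k" using k by (cases k) auto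
    finally show "\<mu> \<le> H ^ k" using H k by (intro power_le_imp_le_base[of \<mu> "k - 1" "H ^ k"]) auto
  qed
  show "\<epsilon> * \<mu> \<le> H ^ (2 * k)" if "\<epsilon> < \<mu>"
  proof -
    have "\<epsilon> * \<mu> \<le> H ^ k * H ^ k" using B[OF that] \<epsilon> H \<mu>0 by (intro mult_mono) auto
    then show ?thesis by (simp add: mult_2 power_add)
  qed
  define \<rho> where "\<rho> = layer_density (\<kappa>/4) k \<epsilon> H \<mu>"
  define K where "K = M1\<^sup>2 * exp (\<kappa>/4) + M2\<^sup>2 + 2 * C"
  have C0: "C \<ge> 0" using layer_bounded_nonneg[OF lay(1)] .
  have \<rho>0: "\<rho> x \<ge> 0" for x unfolding \<rho>_def by (rule layer_density_nonneg) (use \<epsilon> H in auto)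
  have \<rho>1: "exp (- (\<kappa>/4) * (x - 0) / \<epsilon>) / \<epsilon> \<le> \<rho> x" for x
    unfolding \<rho>_def layer_density_def using \<epsilon> H by (simp del: diff_0_right)
  have \<rho>2: "exp (- (\<kappa>/4) * (x - 1) / \<epsilon>) / \<epsilon> \<le> \<rho> x" if "x \<in> {1..2}" for x
    unfolding \<rho>_def layer_density_def using \<epsilon> H that by simp
  have \<rho>3: "\<epsilon> / H ^ (2 * k) \<le> \<rho> x" if "x \<in> {1..2}" "\<epsilon> < \<mu>" "x - 1 \<le> 2 * \<mu>" for x
    unfolding \<rho>_def layer_density_def using \<epsilon> H that by simp
  fix i :: nat assume i: "1 \<le> i" "i \<le> mesh_M1 \<epsilon> H + mesh_M2 k \<epsilon> H"
  define a where "a = mesh_node k \<epsilon> H (i - 1)"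
  define b where "b = mesh_node k \<epsilon> H i"
  have ab: "a < b" and alt: "0 \<le> a \<and> b \<le> 1 \<and> b - a \<le> H * max \<epsilon> a \<or> 1 \<le> a \<and> b \<le> 2 \<and> b - a \<le> H * max \<eta> (a - 1)"
    using mesh_node_cells(4)[OF \<epsilon> H k i] unfolding a_def b_def \<eta>_def by blast+
  have small: "H * max x t \<le> H" "H * t \<le> t" if "x \<le> 1" "0 \<le> t" "t \<le> 1" for x t 
    using H that mult_left_mono[of "max x t" 1 H] mult_right_mono[of H 1 t] by auto
  have "\<exists>K'\<le>K. cell_split u k \<epsilon> H K' \<rho> a b"
  proof (cases "1 \<le> a")
    case False
    then have h: "0 \<le> a" "b \<le> 1" "b - a \<le> H * max \<epsilon> a" using alt by auto
    have h2: "b - a \<le> H * (\<epsilon> + a)" 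
      by (rule order.trans[OF h(3) mult_left_mono]) (use h(1) H \<epsilon> in auto)
    have "cell_split u k \<epsilon> H (M1\<^sup>2 * exp (\<kappa>/4) + 2 * C) \<rho> a b" unfolding M1_def
    proof (rule resolved_cell[OF lay(1) k ab _ \<epsilon>(1) \<kappa> _ H(2)])
      show "b - a \<le> H" using h small[of \<epsilon> a] \<epsilon> ab by auto
      show "b - a \<le> \<epsilon> + (a - 0)" 
        using order.trans[OF h2 mult_right_mono[of H 1 "\<epsilon> + a"]] H h \<epsilon> by simp
      have "(b - a) / \<epsilon> \<le> H * (\<epsilon> + a) / \<epsilon>" using h2 \<epsilon> by (intro divide_right_mono) auto
      then have "(b - a) / \<epsilon> \<le> H * (1 + a / \<epsilon>)" using \<epsilon> by (simp add: distrib_left add_divide_distrib)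
      then have "((b - a) / \<epsilon>) ^ k \<le> (H * (1 + a / \<epsilon>)) ^ k" using ab \<epsilon> by (intro power_mono) auto
      then show "(b - a) ^ k * \<epsilon> powr (0 - real k) \<le> H ^ k * (1 + (a - 0) / \<epsilon>) ^ k"
      proof -
        have "(b - a) ^ k * \<epsilon> powr (0 - real k) = ((b - a) / \<epsilon>) ^ k"
          using \<epsilon> by (simp add: power_mult_distrib power_inverse powr_minus powr_realpow divide_inverse)
        then show ?thesis using \<open>((b - a) / \<epsilon>) ^ k \<le> (H * (1 + a / \<epsilon>)) ^ k\<close> by (simp only: power_mult_distrib diff_0_right)
      qed
    qed (use h \<rho>1 in auto)
    then show ?thesis by (intro exI[of _ "M1\<^sup>2 * exp (\<kappa>/4) + 2 * C"]) (simp add: K_def)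
  next
    case True
    then have h: "1 \<le> a" "b \<le> 2" "b - a \<le> H * max \<eta> (a - 1)" using alt ab by auto
    have Ha: "H * (a - 1) \<le> a - 1" using H h mult_right_mono[of H 1 "a - 1"] by simp
    have hH: "b - a \<le> H" using h small[of \<eta> "a - 1"] \<eta> ab by auto
    show ?thesis
    proof (cases "\<epsilon> < \<mu>")
      case True
      have "cell_split u k \<epsilon> H (M2\<^sup>2 + 2 * C) \<rho> a b" unfolding M2_def
      proof (rule unresolved_cell[OF lay(2) k ab _ \<epsilon>(1) \<kappa> hH H(2) _ B(1)[OF True], of \<mu>])
        show "b - a \<le> \<mu> \<or> b - a \<le> a - 1"
          
        proof (cases "\<eta> \<le> a - 1")
          case True
          then have "max \<eta> (a - 1) = a - 1" by simp
          then have "b - a \<le> H * (a - 1)" using h(3) by simp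
          then show ?thesis using Ha by linarith
        next
          case False
          then have "max \<eta> (a - 1) = \<eta>" by simp
          then show ?thesis using h(3) by (simp add: \<mu>\<eta>)
        qed
      qed (use h \<rho>2 \<rho>3 True in auto)
      then show ?thesis by (intro exI[of _ "M2\<^sup>2 + 2 * C"]) (simp add: K_def)
    next
      case False
      have "cell_split u k \<epsilon> H (M1\<^sup>2 * exp (\<kappa>/4) + 2 * C) \<rho> a b" unfolding M1_def
      proof (rule resolved_cell[OF lay(2) k ab _ \<epsilon>(1) \<kappa> hH H(2)])
        show "b - a \<le> \<epsilon> + (a - 1)" 
          
        proof (cases "\<eta> \<le> a - 1")
          case True
          then have "max \<eta> (a - 1) = a - 1" by simp
          then have "b - a \<le> H * (a - 1)" using h(3) by simp
          then show ?thesis using Ha \<epsilon> by linarith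
        next
          case n: False
          then have "max \<eta> (a - 1) = \<eta>" by simp
          then have "b - a \<le> H * \<eta>" using h(3) by simp
          then show ?thesis using h(1) False \<epsilon> unfolding \<mu>\<eta> by linarith
        qed
        have q: "\<epsilon> powr (1 - real k) * \<epsilon> ^ (k - 1) = 1"
          using \<epsilon> k by (simp add: of_nat_diff flip: powr_realpow powr_add)
        show "(b - a) ^ k * \<epsilon> powr (1 - real k) \<le> H ^ k * (1 + (a - 1) / \<epsilon>) ^ k"
        proof (cases "a - 1 \<le> \<eta>")
          case True
          have "(b - a) ^ k \<le> (H * \<eta>) ^ k" using True h(3) ab by (intro power_mono) (auto simp: max_def)
          then have "(b - a) ^ k * \<epsilon> powr (1 - real k) \<le> (H * \<eta>) ^ k * \<epsilon> powr (1 - real k)" by (intro mult_right_mono) auto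
          also have "\<dots> = H ^ k * (\<epsilon> powr (1 - real k) * \<epsilon> ^ (k - 1))" by (simp add: power_mult_distrib \<eta>k)
          also have "\<dots> = H ^ k * 1" by (simp only: q)
          also have "\<dots> \<le> H ^ k * (1 + (a - 1) / \<epsilon>) ^ k" using H h \<epsilon> by (intro mult_left_mono one_le_power) auto
          finally show ?thesis .
        next
          case False
          have "(b - a) ^ k \<le> (H * (a - 1)) ^ k" using False h(3) ab by (intro power_mono) (auto simp: max_def)
          then have "(b - a) ^ k * \<epsilon> powr (1 - real k) \<le> (H * (a - 1)) ^ k * \<epsilon> powr (1 - real k)" by (intro mult_right_mono) auto
          also have "\<dots> = H ^ k * ((a - 1) / \<epsilon>) ^ k * (\<epsilon> * (\<epsilon> powr (1 - real k) * \<epsilon> ^ (k - 1)))"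
            using \<epsilon> \<epsilon>k by (simp add: power_mult_distrib power_divide)
          also have "\<dots> = H ^ k * ((a - 1) / \<epsilon>) ^ k * \<epsilon>" by (simp only: q mult_1_right)
          also have "\<dots> \<le> H ^ k * (1 + (a - 1) / \<epsilon>) ^ k * 1" using H h \<epsilon> by (intro mult_mono power_mono) auto
          finally show ?thesis by simp
        qed
      qed (use h \<rho>2 in auto)
      then show ?thesis by (intro exI[of _ "M1\<^sup>2 * exp (\<kappa>/4) + 2 * C"]) (simp add: K_def)
    qed
  qed
  then obtain K' where K': "K' \<le> K" "cell_split u k \<epsilon> H K' \<rho> a b" by blast
  show "cell_split u k \<epsilon> H (M1\<^sup>2 * exp (\<kappa>/4) + M2\<^sup>2 + 2 * C) (layer_density (\<kappa>/4) k \<epsilon> H \<mu>) (mesh_node k \<epsilon> H (i - 1)) (mesh_node k \<epsilon> H i)"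
    using cell_split_mono[OF K'(2,1) \<epsilon>(1) H(1) \<rho>0] unfolding K_def \<rho>_def a_def b_def .
qed

section \<open>Smooth cut-off functions\<close>

lemma C_k_on_Suc_iff:
  "C_k_on (Suc m) UNIV f \<longleftrightarrow> (\<exists>f'. (\<forall>x. (f has_real_derivative f' x) (at x)) \<and> C_k_on m UNIV f')"
proof
  assume "C_k_on (Suc m) UNIV f"
  then obtain D where D0: "\<forall>x. D 0 x = f x"
    and D: "\<forall>j<Suc m. \<forall>x. (D j has_real_derivative D (Suc j) x) (at x)"
    and Dm: "continuous_on UNIV (D (Suc m))" unfolding C_k_on_def by auto
  have "f = D 0" using D0 by auto
  then have "\<forall>x. (f has_real_derivative D 1 x) (at x)" using D by auto
  moreover have "C_k_on m UNIV (D 1)" unfolding C_k_on_def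
    by (rule exI[of _ "\<lambda>j. D (Suc j)"]) (use D Dm in auto)
  ultimately show "\<exists>f'. (\<forall>x. (f has_real_derivative f' x) (at x)) \<and> C_k_on m UNIV f'" by blast
next
  assume "\<exists>f'. (\<forall>x. (f has_real_derivative f' x) (at x)) \<and> C_k_on m UNIV f'"
  then obtain f' D where f': "\<forall>x. (f has_real_derivative f' x) (at x)" and D0: "\<forall>x. D 0 x = f' x"
    and D: "\<forall>j<m. \<forall>x. (D j has_real_derivative D (Suc j) x) (at x)"
    and Dm: "continuous_on UNIV (D m)" unfolding C_k_on_def by auto
  have "f' = D 0" using D0 by auto
  define E where "E = (\<lambda>j. if j = 0 then f else D (j - 1))"
  have "(E j has_real_derivative E (Suc j) x) (at x)" if "j < Suc m" for j x
    using that f' D \<open>f' = D 0\<close> by (cases j) (auto simp: E_def)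
  moreover have "continuous_on UNIV (E (Suc m))" using Dm by (simp add: E_def)
  ultimately show "C_k_on (Suc m) UNIV f" unfolding C_k_on_def by (intro exI[of _ E]) (auto simp: E_def)
qed

lemma C_k_on_0_iff: "C_k_on 0 UNIV f \<longleftrightarrow> continuous_on UNIV f"
  unfolding C_k_on_def by (auto intro: continuous_on_eq)

lemma C_k_on_UNIV_continuous: "C_k_on m UNIV f \<Longrightarrow> continuous_on UNIV f"
proof (cases m)
  case (Suc n)
  moreover assume "C_k_on m UNIV f"
  ultimately obtain f' where "\<forall>x. (f has_real_derivative f' x) (at x)" by (auto simp: C_k_on_Suc_iff)
  then show ?thesis using DERIV_isCont by (intro continuous_at_imp_continuous_on ballI) blast
qed (simp add: C_k_on_0_iff)

lemma C_k_on_pred: "C_k_on (Suc m) UNIV f \<Longrightarrow> C_k_on m UNIV f"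
proof (induction m arbitrary: f)
  case 0 then show ?case using C_k_on_UNIV_continuous[OF 0] by (simp add: C_k_on_0_iff)
next
  case (Suc m) then show ?case by (metis C_k_on_Suc_iff)
qed

lemma C_k_on_add: "C_k_on m UNIV f \<Longrightarrow> C_k_on m UNIV g \<Longrightarrow> C_k_on m UNIV (\<lambda>x. f x + g x)"
proof (induction m arbitrary: f g)
  case 0 then show ?case by (auto simp: C_k_on_0_iff intro!: continuous_intros)
next
  case (Suc m)
  from Suc.prems obtain f' g' where *: "\<forall>x. (f has_real_derivative f' x) (at x)" "C_k_on m UNIV f'"
    "\<forall>x. (g has_real_derivative g' x) (at x)" "C_k_on m UNIV g'" unfolding C_k_on_Suc_iff by blast
  show ?case unfolding C_k_on_Suc_iff
    using DERIV_add[OF spec[OF *(1)] spec[OF *(3)]] Suc.IH[OF *(2,4)] by (intro exI[of _ "\<lambda>x. f' x + g' x"]) simp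
qed

lemma C_k_on_mult: "C_k_on m UNIV f \<Longrightarrow> C_k_on m UNIV g \<Longrightarrow> C_k_on m UNIV (\<lambda>x. f x * g x)"
proof (induction m arbitrary: f g)
  case 0 then show ?case by (auto simp: C_k_on_0_iff intro!: continuous_intros)
next
  case (Suc m)
  from Suc.prems obtain f' g' where *: "\<forall>x. (f has_real_derivative f' x) (at x)" "C_k_on m UNIV f'"
    "\<forall>x. (g has_real_derivative g' x) (at x)" "C_k_on m UNIV g'" unfolding C_k_on_Suc_iff by blast
  have "C_k_on m UNIV (\<lambda>x. f' x * g x + g' x * f x)"
    by (rule C_k_on_add[OF Suc.IH[OF *(2) C_k_on_pred[OF Suc.prems(2)]] Suc.IH[OF *(4) C_k_on_pred[OF Suc.prems(1)]]])
  then show ?case unfolding C_k_on_Suc_iff using DERIV_mult[OF spec[OF *(1)] spec[OF *(3)]]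
    by (intro exI[of _ "\<lambda>x. f' x * g x + g' x * f x"]) simp
qed

lemma C_k_on_poly: "C_k_on m UNIV (poly (p :: real poly))"
proof (induction m arbitrary: p)
  case 0 then show ?case by (auto simp: C_k_on_0_iff intro!: continuous_intros)
next
  case (Suc m) then show ?case unfolding C_k_on_Suc_iff by (intro exI[of _ "poly (pderiv p)"]) (auto intro: poly_DERIV)
qed

lemma C_k_on_const: "C_k_on m UNIV (\<lambda>x. c)"
proof -
  have "poly [:c:] = (\<lambda>x. c)" by (simp add: fun_eq_iff)
  then show ?thesis using C_k_on_poly[of m "[:c:]"] by (simp only:)
qed

lemma C_k_on_affine:
  "C_k_on m UNIV f \<Longrightarrow> C_k_on m UNIV (\<lambda>x. f (s * x + t))"
proof (induction m arbitrary: f)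
  case 0 
  then have "continuous_on UNIV f" by (simp add: C_k_on_0_iff)
  then have "continuous_on UNIV (\<lambda>x. f (s * x + t))"
    by (rule continuous_on_compose2) (auto intro!: continuous_intros)
  then show ?case by (simp add: C_k_on_0_iff)
next
  case (Suc m)
  from Suc.prems obtain f' where *: "\<forall>x. (f has_real_derivative f' x) (at x)" "C_k_on m UNIV f'" unfolding C_k_on_Suc_iff by blast
  have "C_k_on m UNIV (\<lambda>x. f' (s * x + t) * s)"
    by (rule C_k_on_mult[OF Suc.IH[OF *(2)] C_k_on_const])
  moreover have "((\<lambda>x. f (s * x + t)) has_real_derivative f' (s * x + t) * s) (at x)" for x
    by (rule DERIV_chain2[OF spec[OF *(1)]]) (auto intro!: derivative_eq_intros)
  ultimately show ?case unfolding C_k_on_Suc_iff by (intro exI[of _ "\<lambda>x. f' (s * x + t) * s"]) simp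
qed

text \<open>
For \<open>p = 1\<close> this is the classical smooth function \<open>exp (- 1 / x)\<close>; polynomials in \<open>1 / x\<close> as factors make
the family closed under differentiation.
\<close>

definition smooth_step :: "real poly \<Rightarrow> real \<Rightarrow> real" where
  "smooth_step p x = (if x \<le> 0 then 0 else poly p (1 / x) * exp (- (1 / x)))"

lemma poly_exp_tendsto_0: "((\<lambda>t. poly p t * exp (- t)) \<longlongrightarrow> 0) at_top" for p :: "real poly"
proof -
  have "((\<lambda>t. \<Sum>i\<le>degree p. coeff p i * (t ^ i / exp t)) \<longlongrightarrow> (\<Sum>i\<le>degree p. coeff p i * 0)) at_top"
    by (intro tendsto_intros tendsto_power_div_exp_0)
  then show ?thesis by (simp add: poly_altdef sum_distrib_right exp_minus divide_inverse mult.assoc)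
qed

lemma smooth_step_derivative:
  "(smooth_step p has_real_derivative smooth_step ([:0, 0, 1:] * (p - pderiv p)) x) (at x)"
proof (cases "x = 0")
  case False
  show ?thesis
  proof (cases "x < 0")
    case True
    have "((\<lambda>x. 0) has_real_derivative 0) (at x)" by simp
    moreover have "smooth_step ([:0, 0, 1:] * (p - pderiv p)) x = 0" using True by (simp add: smooth_step_def)
    ultimately have "((\<lambda>x. 0) has_real_derivative smooth_step ([:0, 0, 1:] * (p - pderiv p)) x) (at x)" by simp
    then show ?thesis
      by (rule has_field_derivative_transform_within_open[of _ _ _ "{..<0}"]) (use True in \<open>auto simp: smooth_step_def\<close>)
  next
    case False
    with \<open>x \<noteq> 0\<close> have x: "x > 0" by simp
    have "((\<lambda>x. poly p (1 / x) * exp (- (1 / x))) has_real_derivative 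
       (poly (pderiv p) (1 / x) * (- (1 / x\<^sup>2))) * exp (- (1 / x)) + poly p (1 / x) * (exp (- (1 / x)) * (1 / x\<^sup>2))) (at x)"
      using x by (auto intro!: derivative_eq_intros DERIV_chain2[OF poly_DERIV] simp: power2_eq_square)
    moreover have "(poly (pderiv p) (1 / x) * (- (1 / x\<^sup>2))) * exp (- (1 / x)) + poly p (1 / x) * (exp (- (1 / x)) * (1 / x\<^sup>2))
       = smooth_step ([:0, 0, 1:] * (p - pderiv p)) x"
      using x by (simp add: smooth_step_def power2_eq_square algebra_simps)
    ultimately have "((\<lambda>x. poly p (1 / x) * exp (- (1 / x))) has_real_derivative smooth_step ([:0, 0, 1:] * (p - pderiv p)) x) (at x)" by simp
    then show ?thesis
      by (rule has_field_derivative_transform_within_open[of _ _ _ "{0<..}"]) (use x in \<open>auto simp: smooth_step_def\<close>)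
  qed
next
  case True
  have "((\<lambda>h. smooth_step p h / h) \<longlongrightarrow> 0) (at 0)"
  proof (subst filterlim_at_split, intro conjI)
    have "\<forall>\<^sub>F h in at_left 0. smooth_step p h / h = 0" by (auto simp: eventually_at_filter smooth_step_def)
    then show "((\<lambda>h. smooth_step p h / h) \<longlongrightarrow> 0) (at_left 0)" by (simp add: tendsto_eventually)
    have "((\<lambda>t. poly ([:0, 1:] * p) t * exp (- t)) \<longlongrightarrow> 0) at_top" by (rule poly_exp_tendsto_0)
    then have "((\<lambda>h. poly ([:0, 1:] * p) (inverse h) * exp (- inverse h)) \<longlongrightarrow> 0) (at_right (0::real))"
      by (rule filterlim_compose[OF _ filterlim_inverse_at_top_right])
    moreover have "\<forall>\<^sub>F h in at_right 0. poly ([:0, 1:] * p) (inverse h) * exp (- inverse h) = smooth_step p h / h"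
      by (auto simp: eventually_at_filter smooth_step_def divide_inverse)
    ultimately show "((\<lambda>h. smooth_step p h / h) \<longlongrightarrow> 0) (at_right 0)" by (rule Lim_transform_eventually)
  qed
  then show ?thesis using True by (simp add: DERIV_def smooth_step_def)
qed

lemma C_k_on_smooth_step: "C_k_on m UNIV (smooth_step p)"
proof (induction m arbitrary: p)
  case 0
  then show ?case unfolding C_k_on_0_iff
    by (auto intro!: continuous_at_imp_continuous_on DERIV_isCont smooth_step_derivative)
next
  case (Suc m)
  then show ?case unfolding C_k_on_Suc_iff using smooth_step_derivative by blast
qed

text \<open>
Smooth, with values in \<open>[0, 1]\<close> and support in \<open>[a + 1 / n, b - 1 / n]\<close>, converging to the indicator of
\<open>(a, b)\<close> as \<open>n\<close> grows.
\<close>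

definition cutoff :: "nat \<Rightarrow> real \<Rightarrow> real \<Rightarrow> real \<Rightarrow> real" where
  "cutoff n a b x = smooth_step 1 (real n * (x - a) - 1) * smooth_step 1 (real n * (b - x) - 1)"

lemma smooth_step_1_range: "0 \<le> smooth_step 1 x" "smooth_step 1 x \<le> 1"
  by (auto simp: smooth_step_def)

lemma cutoff_range: "0 \<le> cutoff n a b x" "cutoff n a b x \<le> 1"
  unfolding cutoff_def using smooth_step_1_range by (auto intro: mult_le_one)

lemma cutoff_support: "cutoff n a b x \<noteq> 0 \<Longrightarrow> n > 0 \<and> a + 1 / real n \<le> x \<and> x \<le> b - 1 / real n"
  by (cases "n = 0") (auto simp: cutoff_def smooth_step_def field_simps split: if_splits)

lemma C_k_on_cutoff: "C_k_on m UNIV (cutoff n a b)"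
proof -
  have 1: "C_k_on m UNIV (\<lambda>x. smooth_step 1 (real n * x + (- (real n * a) - 1)))"
    by (rule C_k_on_affine[OF C_k_on_smooth_step])
  have 2: "C_k_on m UNIV (\<lambda>x. smooth_step 1 ((- real n) * x + (real n * b - 1)))"
    by (rule C_k_on_affine[OF C_k_on_smooth_step])
  have "cutoff n a b = (\<lambda>x. smooth_step 1 (real n * x + (- (real n * a) - 1)) * smooth_step 1 ((- real n) * x + (real n * b - 1)))"
    by (auto simp: cutoff_def fun_eq_iff algebra_simps)
  then show ?thesis using C_k_on_mult[OF 1 2] by simp
qed

lemma smooth_step_tendsto_1:
  assumes "t > 0" shows "(\<lambda>n. smooth_step 1 (real n * t - 1)) \<longlonglongrightarrow> 1"
proof -
  have lim: "filterlim (\<lambda>n. real n * t - 1) at_top sequentially"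
    using assms by real_asymp
  have ev: "\<forall>\<^sub>F n in sequentially. real n * t - 1 > 0"
    using lim[unfolded filterlim_at_top_dense, rule_format, of 0] .
  have "(\<lambda>n. exp (- (1 / (real n * t - 1)))) \<longlonglongrightarrow> 1" using assms by real_asymp
  then show ?thesis
    by (rule Lim_transform_eventually) (use ev in eventually_elim, simp add: smooth_step_def)
qed

lemma cutoff_tendsto: "(\<lambda>n. cutoff n a b x) \<longlonglongrightarrow> indicator {a<..<b} x"
proof (cases "x \<in> {a<..<b}")
  case True
  then have "(\<lambda>n. cutoff n a b x) \<longlonglongrightarrow> 1 * 1" unfolding cutoff_def
    by (intro tendsto_mult smooth_step_tendsto_1) auto
  then show ?thesis using True by simp
next
  case False
  then have "x \<le> a \<or> b \<le> x" by auto
  then have "cutoff n a b x = 0" for n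
    using mult_nonneg_nonpos[of "real n" "x - a"] mult_nonneg_nonpos[of "real n" "b - x"] unfolding cutoff_def smooth_step_def by auto
  then show ?thesis using False by simp
qed

lemma cutoff_test_function:
  assumes "0 \<le> a" "b \<le> 2" "\<And>m. C_k_on m UNIV g"
  shows "(\<lambda>x. g x * cutoff n a b x) \<in> test_functions Omega"
proof -
  have "C_k_on m UNIV (\<lambda>x. g x * cutoff n a b x)" for m by (rule C_k_on_mult[OF assms(3) C_k_on_cutoff])
  moreover have "\<exists>K. compact K \<and> K \<subseteq> Omega \<and> (\<forall>x. x \<notin> K \<longrightarrow> g x * cutoff n a b x = 0)"
  proof (cases "n = 0")
    case True
    then have "cutoff n a b x = 0" for x using cutoff_support[of n a b x] by auto
    then show ?thesis by (intro exI[of _ "{}"]) auto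
  next
    case False
    then have "0 < 1 / real n" by simp
    then have "{a + 1 / real n .. b - 1 / real n} \<subseteq> Omega" using assms by (auto; linarith)
    moreover have "cutoff n a b x = 0" if "x \<notin> {a + 1 / real n .. b - 1 / real n}" for x
      using cutoff_support[of n a b x] that by auto
    ultimately show ?thesis by (intro exI[of _ "{a + 1 / real n .. b - 1 / real n}"]) auto
  qed
  ultimately show ?thesis by (simp add: test_functions_def)
qed

section \<open>Square integrable functions\<close>

lemma L2D: "f \<in> L2 D \<Longrightarrow> f \<in> borel_measurable (lebesgue_on D)" "f \<in> L2 D \<Longrightarrow> integrable (lebesgue_on D) (\<lambda>x. (f x)\<^sup>2)"
  by (auto simp: L2_def)

lemma L2_mult_integrable:
  assumes "f \<in> L2 D" "g \<in> L2 D"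
  shows "integrable (lebesgue_on D) (\<lambda>x. f x * g x)"
proof (rule Bochner_Integration.integrable_bound)
  show "integrable (lebesgue_on D) (\<lambda>x. (f x)\<^sup>2 + (g x)\<^sup>2)"
    using L2D(2)[OF assms(1)] L2D(2)[OF assms(2)] by (rule Bochner_Integration.integrable_add)
  show "(\<lambda>x. f x * g x) \<in> borel_measurable (lebesgue_on D)"
    using L2D(1)[OF assms(1)] L2D(1)[OF assms(2)] by (rule borel_measurable_times)
  have "\<bar>a * b\<bar> \<le> a\<^sup>2 + b\<^sup>2" for a b :: real
    using sum_squares_ge_zero[of "a - b" "a"] sum_squares_ge_zero[of "a + b" a] 
      zero_le_power2[of "a - b"] zero_le_power2[of "a + b"] zero_le_power2[of a] zero_le_power2[of b]
    by (simp add: abs_le_iff power2_eq_square algebra_simps)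
  then show "AE x in lebesgue_on D. norm (f x * g x) \<le> norm ((f x)\<^sup>2 + (g x)\<^sup>2)" by simp
qed

lemma L2_add: assumes "f \<in> L2 D" "g \<in> L2 D" shows "(\<lambda>x. f x + g x) \<in> L2 D"
proof -
  have "integrable (lebesgue_on D) (\<lambda>x. (f x)\<^sup>2 + 2 * (f x * g x) + (g x)\<^sup>2)"
    using L2D(2)[OF assms(1)] L2D(2)[OF assms(2)] L2_mult_integrable[OF assms] by simp
  then have "integrable (lebesgue_on D) (\<lambda>x. (f x + g x)\<^sup>2)" by (simp add: power2_sum algebra_simps)
  with borel_measurable_add[OF L2D(1)[OF assms(1)] L2D(1)[OF assms(2)]] show ?thesis by (simp add: L2_def)
qed

lemma L2_cmult: "f \<in> L2 D \<Longrightarrow> (\<lambda>x. c * f x) \<in> L2 D"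
  by (auto simp: L2_def power_mult_distrib)

lemma L2_diff: assumes "f \<in> L2 D" "g \<in> L2 D" shows "(\<lambda>x. f x - g x) \<in> L2 D"
  using L2_add[OF assms(1) L2_cmult[OF assms(2), of "-1"]] by simp

lemma L2_bounded_mult:
  assumes "f \<in> L2 D" "b \<in> borel_measurable (lebesgue_on D)" "\<And>x. x \<in> D \<Longrightarrow> \<bar>b x\<bar> \<le> K"
  shows "(\<lambda>x. b x * f x) \<in> L2 D"
proof -
  have "integrable (lebesgue_on D) (\<lambda>x. (b x * f x)\<^sup>2)"
  proof (rule Bochner_Integration.integrable_bound)
    show "integrable (lebesgue_on D) (\<lambda>x. K\<^sup>2 * (f x)\<^sup>2)" using L2D(2)[OF assms(1)] by simp
    show "AE x in lebesgue_on D. norm ((b x * f x)\<^sup>2) \<le> norm (K\<^sup>2 * (f x)\<^sup>2)"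
    proof (rule AE_I2)
      fix x assume "x \<in> space (lebesgue_on D)"
      then have "(b x)\<^sup>2 \<le> K\<^sup>2" using power_mono[OF assms(3)[of x], of 2] by simp
      then show "norm ((b x * f x)\<^sup>2) \<le> norm (K\<^sup>2 * (f x)\<^sup>2)" by (simp add: power_mult_distrib mult_right_mono)
    qed
    show "(\<lambda>x. (b x * f x)\<^sup>2) \<in> borel_measurable (lebesgue_on D)"
      using assms(2) L2D(1)[OF assms(1)] by (intro borel_measurable_power borel_measurable_times)
  qed
  with borel_measurable_times[OF assms(2) L2D(1)[OF assms(1)]] show ?thesis by (simp add: L2_def)
qed

lemma L2_bounded:
  assumes "f \<in> borel_measurable (lebesgue_on D)" "D \<in> lmeasurable" "\<And>x. x \<in> D \<Longrightarrow> \<bar>f x\<bar> \<le> K"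
  shows "f \<in> L2 D"
proof -
  interpret finite_measure "lebesgue_on D" by (rule finite_measure_lebesgue_on[OF assms(2)])
  have "(\<lambda>x. 1) \<in> L2 D" by (simp add: L2_def)
  from L2_bounded_mult[OF this assms(1,3)] show ?thesis by simp
qed

text \<open>
The quadratic polynomial \<open>t \<mapsto> \<integral> (f - t g)\<^sup>2\<close> is nonnegative; it is evaluated at its minimum.
\<close>

lemma L2_Cauchy_Schwarz:
  assumes f: "f \<in> L2 D" and g: "g \<in> L2 D"
  shows "(\<integral>x. f x * g x \<partial>(lebesgue_on D))\<^sup>2 \<le> (\<integral>x. (f x)\<^sup>2 \<partial>(lebesgue_on D)) * (\<integral>x. (g x)\<^sup>2 \<partial>(lebesgue_on D))"
proof -
  define A where "A = (\<integral>x. (f x)\<^sup>2 \<partial>(lebesgue_on D))"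
  define B where "B = (\<integral>x. (g x)\<^sup>2 \<partial>(lebesgue_on D))"
  define P where "P = (\<integral>x. f x * g x \<partial>(lebesgue_on D))"
  have q: "0 \<le> A - 2 * t * P + t\<^sup>2 * B" for t
  proof -
    have "0 \<le> (\<integral>x. (f x - t * g x)\<^sup>2 \<partial>(lebesgue_on D))" by (rule integral_nonneg_AE) simp
    also have "\<dots> = (\<integral>x. (f x)\<^sup>2 - 2 * t * (f x * g x) + t\<^sup>2 * (g x)\<^sup>2 \<partial>(lebesgue_on D))"
      by (rule Bochner_Integration.integral_cong) (auto simp: power2_eq_square algebra_simps)
    also have "\<dots> = A - 2 * t * P + t\<^sup>2 * B"
      using L2D(2)[OF f] L2D(2)[OF g] L2_mult_integrable[OF f g] unfolding A_def B_def P_def by simp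
    finally show ?thesis .
  qed
  have B0: "B \<ge> 0" unfolding B_def by (rule integral_nonneg_AE) simp
  show ?thesis
  proof (cases "B = 0")
    case True
    have "P = 0"
    proof (rule ccontr)
      assume "P \<noteq> 0"
      then show False using q[of "(A + 1) / (2 * P)"] True by simp
    qed
    then show ?thesis using True by (simp add: A_def[symmetric] B_def[symmetric] P_def[symmetric])
  next
    case False
    then have "0 \<le> A - P\<^sup>2 / B" using q[of "P / B"] B0 by (simp add: power2_eq_square field_simps)
    then show ?thesis using B0 False by (simp add: A_def[symmetric] B_def[symmetric] P_def[symmetric] field_simps)
  qed
qed

text \<open>
Integrals against a fixed square integrable function pass to the limit under convergence in \<open>L2\<close>; this carries
identities from test functions over to \<open>H10\<close>.
\<close>

lemma L2_weak_limit:
  assumes f: "f \<in> L2 D" and \<psi>: "\<psi> \<in> L2 D" "\<And>n. \<psi>n n \<in> L2 D"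
    and lim: "(\<lambda>n. \<integral>x. (\<psi> x - \<psi>n n x)\<^sup>2 \<partial>(lebesgue_on D)) \<longlonglongrightarrow> 0"
  shows "(\<lambda>n. \<integral>x. f x * \<psi>n n x \<partial>(lebesgue_on D)) \<longlonglongrightarrow> (\<integral>x. f x * \<psi> x \<partial>(lebesgue_on D))"
proof -
  define A where "A = (\<integral>x. (f x)\<^sup>2 \<partial>(lebesgue_on D))"
  define e where "e = (\<lambda>n. (\<integral>x. f x * \<psi> x \<partial>(lebesgue_on D)) - (\<integral>x. f x * \<psi>n n x \<partial>(lebesgue_on D)))"
  have "(e n)\<^sup>2 \<le> A * (\<integral>x. (\<psi> x - \<psi>n n x)\<^sup>2 \<partial>(lebesgue_on D))" for n
  proof -
    have "e n = (\<integral>x. f x * (\<psi> x - \<psi>n n x) \<partial>(lebesgue_on D))"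
      unfolding e_def right_diff_distrib 
      by (rule Bochner_Integration.integral_diff[symmetric]) (intro L2_mult_integrable f \<psi>)+
    then show ?thesis unfolding A_def using L2_Cauchy_Schwarz[OF f L2_diff[OF \<psi>(1) \<psi>(2)[of n]]] by simp
  qed
  moreover have "(\<lambda>n. A * (\<integral>x. (\<psi> x - \<psi>n n x)\<^sup>2 \<partial>(lebesgue_on D))) \<longlonglongrightarrow> A * 0" by (intro tendsto_intros lim)
  ultimately have "(\<lambda>n. (e n)\<^sup>2) \<longlonglongrightarrow> 0" by (intro tendsto_sandwich[of "\<lambda>_. 0" "\<lambda>n. (e n)\<^sup>2" _ _ 0]) auto
  then have "(\<lambda>n. sqrt ((e n)\<^sup>2)) \<longlonglongrightarrow> sqrt 0" by (rule tendsto_real_sqrt)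
  then have "e \<longlonglongrightarrow> 0" by (simp add: tendsto_rabs_zero_iff)
  then have "(\<lambda>n. (\<integral>x. f x * \<psi> x \<partial>(lebesgue_on D)) - e n) \<longlonglongrightarrow> (\<integral>x. f x * \<psi> x \<partial>(lebesgue_on D)) - 0" by (intro tendsto_intros)
  then show ?thesis by (simp add: e_def)
qed

section \<open>Piecewise continuously differentiable functions\<close>

abbreviation integral_Omega :: "(real \<Rightarrow> real) \<Rightarrow> real" (binder "\<integral>\<^sub>\<Omega>" 10)
  where "integral_Omega f \<equiv> integral\<^sup>L (lebesgue_on Omega) f"

text \<open>
The function \<open>g\<close> stands for the derivative of \<open>w\<close>; its values at the exceptional points are irrelevant up to the
common bound. Boundedness puts \<open>w\<close> and \<open>g\<close> into \<open>L2\<close>, and continuity of \<open>w\<close> makes \<open>g\<close> the weak derivative.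
\<close>

definition piecewise_C1 :: "(real \<Rightarrow> real) \<Rightarrow> (real \<Rightarrow> real) \<Rightarrow> bool" where
  "piecewise_C1 w g \<longleftrightarrow> continuous_on {0..2} w \<and>
     (\<exists>X. finite X \<and> (\<forall>x\<in>Omega - X. (w has_real_derivative g x) (at x) \<and> isCont g x)) \<and>
     (\<exists>K. \<forall>x\<in>Omega. \<bar>g x\<bar> \<le> K)"

lemma piecewise_C1_bounded:
  assumes "piecewise_C1 w g" obtains K where "\<And>x. x \<in> {0..2} \<Longrightarrow> \<bar>w x\<bar> \<le> K" "\<And>x. x \<in> Omega \<Longrightarrow> \<bar>g x\<bar> \<le> K"
proof -
  obtain K1 where K1: "\<forall>x\<in>{0..2}. \<bar>w x\<bar> \<le> K1"
    using assms compact_imp_bounded[OF compact_continuous_image[of "{0..2}" w]]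
    unfolding piecewise_C1_def by (force simp: bounded_iff)
  obtain K2 where K2: "\<forall>x\<in>Omega. \<bar>g x\<bar> \<le> K2" using assms unfolding piecewise_C1_def by blast
  show ?thesis using K1 K2 by (intro that[of "max K1 K2"]) (auto simp: le_max_iff_disj)
qed

lemma piecewise_C1_measurable:
  assumes "piecewise_C1 w g"
  shows "w \<in> borel_measurable (lebesgue_on Omega)" "g \<in> borel_measurable (lebesgue_on Omega)"
proof -
  obtain X where X: "finite X" "\<forall>x\<in>Omega - X. isCont g x" and w: "continuous_on {0..2} w"
    using assms unfolding piecewise_C1_def by blast
  show "w \<in> borel_measurable (lebesgue_on Omega)"
    by (intro continuous_imp_measurable_on_sets_lebesgue continuous_on_subset[OF w]) auto
  have "continuous_on (Omega - X) g" using X(2) continuous_at_imp_continuous_on by blast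
  moreover have "open (Omega - X)" using X(1) by (intro open_Diff finite_imp_closed) auto
  ultimately have "(\<lambda>x. indicator (Omega - X) x *\<^sub>R g x) \<in> borel_measurable borel"
    by (intro borel_measurable_continuous_on_indicator) auto
  then have 1: "(\<lambda>x. indicator (Omega - X) x *\<^sub>R g x) \<in> borel_measurable (lebesgue_on Omega)"
    by (intro measurable_restrict_space1 measurable_completion) simp
  show "g \<in> borel_measurable (lebesgue_on Omega)"
    by (rule measurable_discrete_difference[OF 1, of "X \<inter> Omega"])
       (use X(1) in \<open>auto intro: countable_finite simp: sets_restrict_space indicator_def\<close>)
qed

lemma Omega_lmeasurable: "Omega \<in> lmeasurable" by (simp add: lmeasurable_box[of 0 2, simplified box_real])

lemma piecewise_C1_L2:
  assumes "piecewise_C1 w g" shows "w \<in> L2 Omega" "g \<in> L2 Omega"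
proof -
  obtain K where K: "\<And>x. x \<in> {0..2} \<Longrightarrow> \<bar>w x\<bar> \<le> K" "\<And>x. x \<in> Omega \<Longrightarrow> \<bar>g x\<bar> \<le> K"
    using piecewise_C1_bounded[OF assms] by blast
  show "w \<in> L2 Omega" by (rule L2_bounded[OF piecewise_C1_measurable(1)[OF assms] Omega_lmeasurable, of K]) (use K in auto)
  show "g \<in> L2 Omega" by (rule L2_bounded[OF piecewise_C1_measurable(2)[OF assms] Omega_lmeasurable, of K]) (use K in auto)
qed

lemma one_L2: "(\<lambda>_. 1) \<in> L2 Omega"
  by (rule L2_bounded[of _ _ 1]) (auto simp: Omega_lmeasurable)

lemma L2_integrable: "f \<in> L2 Omega \<Longrightarrow> integrable (lebesgue_on Omega) f"
  using L2_mult_integrable[OF _ one_L2] by simp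

lemma piecewise_C1_integral:
  assumes "piecewise_C1 w g" and x: "0 \<le> x" "x \<le> 2"
  shows "(\<integral>\<^sub>\<Omega> t. g t * indicator {0<..<x} t) = w x - w 0"
proof -
  obtain X where X: "finite X" "\<And>t. t\<in>Omega - X \<Longrightarrow> (w has_real_derivative g t) (at t)" and w: "continuous_on {0..2} w"
    using assms unfolding piecewise_C1_def by blast
  have "(g has_integral (w x - w 0)) {0..x}"
    by (rule fundamental_theorem_of_calculus_interior_strong[OF X(1) x(1)])
       (use X(2) x in \<open>auto simp flip: has_real_derivative_iff_has_vector_derivative intro: continuous_on_subset[OF w]\<close>)
  then have 1: "(g has_integral (w x - w 0)) {0<..<x}" using has_integral_open_interval[of g "w x - w 0" 0 x] by simp
  have "integrable (lebesgue_on Omega) (\<lambda>t. g t * indicator {0<..<x} t)"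
  proof -
    have "indicator {0<..<x} \<in> borel_measurable (lebesgue_on Omega)"
      by (intro measurable_restrict_space1 measurable_completion) simp
    then have "(\<lambda>t. indicator {0<..<x} t * g t) \<in> L2 Omega"
      by (rule L2_bounded_mult[OF piecewise_C1_L2(2)[OF assms(1)], of _ 1]) (simp add: indicator_def)
    then show ?thesis using L2_integrable by (simp add: mult.commute)
  qed
  then have "((\<lambda>t. g t * indicator {0<..<x} t) has_integral (\<integral>\<^sub>\<Omega> t. g t * indicator {0<..<x} t)) Omega"
    by (rule has_integral_integral_lebesgue_on) simp
  moreover have "((\<lambda>t. if t \<in> {0<..<x} then g t else 0) has_integral (w x - w 0)) Omega"
    by (subst has_integral_restrict) (use 1 x in auto)
  moreover have "(\<lambda>t. if t \<in> {0<..<x} then g t else 0) = (\<lambda>t. g t * indicator {0<..<x} t)" by (auto simp: indicator_def fun_eq_iff)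
  ultimately show ?thesis using has_integral_unique by metis
qed

lemma piecewise_C1_integral_full:
  assumes "piecewise_C1 w g" shows "(\<integral>\<^sub>\<Omega> t. g t) = w 2 - w 0"
proof -
  have "(\<integral>\<^sub>\<Omega> t. g t) = (\<integral>\<^sub>\<Omega> t. g t * indicator {0<..<2} t)"
    by (rule Bochner_Integration.integral_cong) auto
  then show ?thesis using piecewise_C1_integral[OF assms, of 2] by simp
qed

lemma piecewise_C1_add:
  assumes "piecewise_C1 w1 g1" "piecewise_C1 w2 g2"
  shows "piecewise_C1 (\<lambda>x. w1 x + w2 x) (\<lambda>x. g1 x + g2 x)"
proof -
  obtain X1 K1 where 1: "finite X1" "\<And>x. x\<in>Omega - X1 \<Longrightarrow> (w1 has_real_derivative g1 x) (at x) \<and> isCont g1 x"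
     "\<And>x. x\<in>Omega \<Longrightarrow> \<bar>g1 x\<bar> \<le> K1" "continuous_on {0..2} w1" using assms(1) unfolding piecewise_C1_def by blast
  obtain X2 K2 where 2: "finite X2" "\<And>x. x\<in>Omega - X2 \<Longrightarrow> (w2 has_real_derivative g2 x) (at x) \<and> isCont g2 x"
     "\<And>x. x\<in>Omega \<Longrightarrow> \<bar>g2 x\<bar> \<le> K2" "continuous_on {0..2} w2" using assms(2) unfolding piecewise_C1_def by blast
  have "\<forall>x\<in>Omega. \<bar>g1 x + g2 x\<bar> \<le> K1 + K2"
  proof
    fix x :: real assume "x \<in> Omega" then show "\<bar>g1 x + g2 x\<bar> \<le> K1 + K2" using 1(3)[of x] 2(3)[of x] by linarith
  qed
  then show ?thesis unfolding piecewise_C1_def using 1 2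
    by (intro conjI exI[of _ "X1 \<union> X2"] exI[of _ "K1 + K2"]) (auto intro!: continuous_intros DERIV_add)
qed

lemma piecewise_C1_mult:
  assumes "piecewise_C1 w1 g1" "piecewise_C1 w2 g2"
  shows "piecewise_C1 (\<lambda>x. w1 x * w2 x) (\<lambda>x. g1 x * w2 x + w1 x * g2 x)"
proof -
  obtain X1 where 1: "finite X1" "\<And>x. x\<in>Omega - X1 \<Longrightarrow> (w1 has_real_derivative g1 x) (at x) \<and> isCont g1 x"
     "continuous_on {0..2} w1" using assms(1) unfolding piecewise_C1_def by blast
  obtain X2 where 2: "finite X2" "\<And>x. x\<in>Omega - X2 \<Longrightarrow> (w2 has_real_derivative g2 x) (at x) \<and> isCont g2 x"
     "continuous_on {0..2} w2" using assms(2) unfolding piecewise_C1_def by blast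
  obtain K1 where K1: "\<And>x. x \<in> {0..2} \<Longrightarrow> \<bar>w1 x\<bar> \<le> K1" "\<And>x. x \<in> Omega \<Longrightarrow> \<bar>g1 x\<bar> \<le> K1"
    using piecewise_C1_bounded[OF assms(1)] by blast
  obtain K2 where K2: "\<And>x. x \<in> {0..2} \<Longrightarrow> \<bar>w2 x\<bar> \<le> K2" "\<And>x. x \<in> Omega \<Longrightarrow> \<bar>g2 x\<bar> \<le> K2"
    using piecewise_C1_bounded[OF assms(2)] by blast
  have bd: "\<bar>g1 x * w2 x + w1 x * g2 x\<bar> \<le> K1 * K2 + K1 * K2" if "x \<in> Omega" for x
  proof -
    have K0: "0 \<le> K1" "0 \<le> K2" using K1(2)[of 1] K2(2)[of 1] by auto
    have x: "x \<in> {0..2}" using that by auto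
    have "\<bar>g1 x\<bar> * \<bar>w2 x\<bar> \<le> K1 * K2" by (rule mult_mono[OF K1(2)[OF that] K2(1)[OF x] K0(1) abs_ge_zero])
    moreover have "\<bar>w1 x\<bar> * \<bar>g2 x\<bar> \<le> K1 * K2" by (rule mult_mono[OF K1(1)[OF x] K2(2)[OF that] K0(1) abs_ge_zero])
    ultimately have "\<bar>g1 x * w2 x\<bar> \<le> K1 * K2" "\<bar>w1 x * g2 x\<bar> \<le> K1 * K2" by (simp_all only: abs_mult)
    then show ?thesis by linarith
  qed
  have d: "((\<lambda>x. w1 x * w2 x) has_real_derivative g1 x * w2 x + w1 x * g2 x) (at x) \<and> isCont (\<lambda>x. g1 x * w2 x + w1 x * g2 x) x"
    if x: "x \<in> Omega - (X1 \<union> X2)" for x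
  proof -
    have *: "(w1 has_real_derivative g1 x) (at x)" "(w2 has_real_derivative g2 x) (at x)" "isCont g1 x" "isCont g2 x"
      using 1(2)[of x] 2(2)[of x] x by auto
    then have "isCont w1 x" "isCont w2 x" by (auto dest: DERIV_isCont)
    with * show ?thesis using DERIV_mult[OF *(1,2)] by (auto intro!: continuous_intros simp: algebra_simps)
  qed
  show ?thesis unfolding piecewise_C1_def
  proof (intro conjI exI[of _ "X1 \<union> X2"] exI[of _ "K1 * K2 + K1 * K2"] ballI)
    show "continuous_on {0..2} (\<lambda>x. w1 x * w2 x)" using 1 2 by (intro continuous_intros)
  qed (use 1(1) 2(1) d bd in auto)
qed

lemma piecewise_C1_C1:
  assumes d: "\<And>x. x \<in> {0..2} \<Longrightarrow> (b has_real_derivative b' x) (at x within {0..2})" and c: "continuous_on {0..2} b'"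
  shows "piecewise_C1 b b'"
proof -
  have "(b has_real_derivative b' x) (at x) \<and> isCont b' x" if "x \<in> Omega" for x
  proof -
    have "at x within {0..2} = at x" using that by (intro at_within_interior) auto
    moreover have "isCont b' x"
      using continuous_on_interior[OF c] that by (auto simp: interior_atLeastAtMost_real)
    ultimately show ?thesis using d[of x] that by auto
  qed
  moreover obtain K where "\<forall>x\<in>{0..2}. \<bar>b' x\<bar> \<le> K" 
    using compact_imp_bounded[OF compact_continuous_image[OF c]] by (force simp: bounded_iff)
  moreover have "continuous_on {0..2} b" using d by (rule DERIV_continuous_on)
  ultimately show ?thesis unfolding piecewise_C1_def by (intro conjI exI[of _ "{}"] exI[of _ K]) auto
qed

lemma test_function_derivative:
  assumes "\<phi> \<in> test_functions Omega"
  shows "(\<phi> has_real_derivative deriv \<phi> x) (at x)" "continuous_on UNIV (deriv \<phi>)" "\<phi> 0 = 0" "\<phi> 2 = 0"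
proof -
  have c: "C_k_on 2 UNIV \<phi>" using assms by (simp add: test_functions_def)
  obtain f where f: "\<And>x. (\<phi> has_real_derivative f x) (at x)" "C_k_on 1 UNIV f"
    using c C_k_on_Suc_iff[of 1 \<phi>] by (auto simp: numeral_2_eq_2)
  have "deriv \<phi> = f" using f(1) by (auto intro!: DERIV_imp_deriv)
  then show "(\<phi> has_real_derivative deriv \<phi> x) (at x)" "continuous_on UNIV (deriv \<phi>)"
    using f C_k_on_UNIV_continuous[OF f(2)] by auto
  obtain K where "K \<subseteq> Omega" "\<forall>x. x \<notin> K \<longrightarrow> \<phi> x = 0" using assms by (auto simp: test_functions_def)
  then show "\<phi> 0 = 0" "\<phi> 2 = 0" by auto
qed

lemma test_function_piecewise_C1: "\<phi> \<in> test_functions Omega \<Longrightarrow> piecewise_C1 \<phi> (deriv \<phi>)"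
  by (rule piecewise_C1_C1)
     (auto intro: has_field_derivative_at_within test_function_derivative continuous_on_subset[OF test_function_derivative(2)])

lemma piecewise_C1_weak_deriv:
  assumes "piecewise_C1 w g" shows "has_L2_weak_deriv Omega w g"
  unfolding has_L2_weak_deriv_def
proof (intro conjI ballI)
  show "g \<in> L2 Omega" by (rule piecewise_C1_L2[OF assms])
  fix \<phi> assume \<phi>: "\<phi> \<in> test_functions Omega"
  note pc = test_function_piecewise_C1[OF \<phi>]
  have "(\<integral>\<^sub>\<Omega> x. g x * \<phi> x + w x * deriv \<phi> x) = w 2 * \<phi> 2 - w 0 * \<phi> 0"
    by (rule piecewise_C1_integral_full[OF piecewise_C1_mult[OF assms pc]])
  also have "(\<integral>\<^sub>\<Omega> x. g x * \<phi> x + w x * deriv \<phi> x) = L2_inner Omega g \<phi> + L2_inner Omega w (deriv \<phi>)"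
    unfolding L2_inner_def
    by (intro Bochner_Integration.integral_add L2_mult_integrable piecewise_C1_L2[OF assms] piecewise_C1_L2[OF pc])
  finally show "L2_inner Omega w (deriv \<phi>) = - L2_inner Omega g \<phi>"
    using test_function_derivative[OF \<phi>] by simp
qed

section \<open>Uniqueness of the weak derivative\<close>

text \<open>
The positive and the negative part of \<open>h\<close> are densities of finite measures that agree on all half-lines and
hence coincide.
\<close>

lemma interval_integrals_zero_imp_AE_zero:
  fixes h :: "real \<Rightarrow> real"
  assumes h: "integrable lborel h" and zero: "\<And>a. (\<integral>x. h x * indicator {a<..} x \<partial>lborel) = 0"
  shows "AE x in lborel. h x = 0"
proof -
  have [measurable]: "h \<in> borel_measurable borel" using h by auto
  define P where "P = density lborel (\<lambda>x. ennreal (h x))"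
  define N where "N = density lborel (\<lambda>x. ennreal (- h x))"
  have part: "(\<integral>\<^sup>+x. ennreal (f x) * indicator {a<..} x \<partial>lborel) = ennreal (\<integral>x. max 0 (f x) * indicator {a<..} x \<partial>lborel)"
    if f: "integrable lborel f" for f :: "real \<Rightarrow> real" and a
  proof -
    have "integrable lborel (\<lambda>x. max 0 (f x))" using f by (intro integrable_max) auto
    then have i: "integrable lborel (\<lambda>x. max 0 (f x) * indicator {a<..} x)"
      using integrable_real_mult_indicator[of "{a<..}" lborel "\<lambda>x. max 0 (f x)"] by simp
    have "(\<integral>\<^sup>+x. ennreal (f x) * indicator {a<..} x \<partial>lborel) = (\<integral>\<^sup>+x. ennreal (max 0 (f x) * indicator {a<..} x) \<partial>lborel)"
      by (intro nn_integral_cong) (auto simp: indicator_def max_def ennreal_neg)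
    also have "\<dots> = ennreal (\<integral>x. max 0 (f x) * indicator {a<..} x \<partial>lborel)"
      by (rule nn_integral_eq_integral[OF i]) auto
    finally show ?thesis .
  qed
  have "P = N"
  proof (rule measure_eqI_lessThan)
    fix a :: real
    have eP: "emeasure P {a<..} = ennreal (\<integral>x. max 0 (h x) * indicator {a<..} x \<partial>lborel)"
      unfolding P_def using part[OF h, of a] by (subst emeasure_density) auto
    have eN: "emeasure N {a<..} = ennreal (\<integral>x. max 0 (- h x) * indicator {a<..} x \<partial>lborel)"
      unfolding N_def using part[of "\<lambda>x. - h x" a] h by (subst emeasure_density) auto
    show "emeasure P {a<..} < \<infinity>" by (simp add: eP)
    have i1: "integrable lborel (\<lambda>x. max 0 (h x) * indicator {a<..} x)" and i2: "integrable lborel (\<lambda>x. max 0 (- h x) * indicator {a<..} x)"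
      using integrable_real_mult_indicator[of "{a<..}" lborel "\<lambda>x. max 0 (h x)"] 
        integrable_real_mult_indicator[of "{a<..}" lborel "\<lambda>x. max 0 (- h x)"] h by auto
    have "(\<integral>x. max 0 (h x) * indicator {a<..} x \<partial>lborel) - (\<integral>x. max 0 (- h x) * indicator {a<..} x \<partial>lborel)
        = (\<integral>x. max 0 (h x) * indicator {a<..} x - max 0 (- h x) * indicator {a<..} x \<partial>lborel)"
      using i1 i2 by (rule Bochner_Integration.integral_diff[symmetric])
    also have "\<dots> = (\<integral>x. h x * indicator {a<..} x \<partial>lborel)"
      by (rule Bochner_Integration.integral_cong) (auto simp: max_def indicator_def)
    finally show "emeasure P {a<..} = emeasure N {a<..}" using zero[of a] by (simp add: eP eN)
  qed (auto simp: P_def N_def)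
  then have "AE x in lborel. ennreal (h x) = ennreal (- h x)"
    unfolding P_def N_def by (intro sigma_finite_measure.density_unique[OF sigma_finite_lborel]) auto
  then show ?thesis
  proof eventually_elim
    case (elim x)
    then show ?case
      using ennreal_eq_0_iff[of "h x"] ennreal_eq_0_iff[of "- h x"] by (cases "h x \<ge> 0") (auto simp: ennreal_neg)
  qed
qed

text \<open>
Testing with cut-offs that converge to the indicator of \<open>(a, 2)\<close> shows that the integrals of \<open>h\<close> over these
intervals vanish. Uniqueness of densities is applied to a Borel measurable representative of \<open>h\<close>.
\<close>

lemma weakly_zero_imp_AE_zero:
  assumes h: "h \<in> L2 Omega" and zero: "\<And>\<phi>. \<phi> \<in> test_functions Omega \<Longrightarrow> L2_inner Omega h \<phi> = 0"
  shows "AE x in lebesgue_on Omega. h x = 0"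
proof -
  have ih: "integrable (lebesgue_on Omega) h" by (rule L2_integrable[OF h])
  have int0: "(\<integral>\<^sub>\<Omega> x. h x * indicator {a<..<2} x) = 0" if "0 \<le> a" for a
  proof -
    have "(\<lambda>n. \<integral>\<^sub>\<Omega> x. h x * cutoff n a 2 x) \<longlonglongrightarrow> (\<integral>\<^sub>\<Omega> x. h x * indicator {a<..<2} x)"
    proof (rule integral_dominated_convergence[where w = "\<lambda>x. \<bar>h x\<bar>"])
      have c: "cutoff n a 2 \<in> borel_measurable (lebesgue_on Omega)" for n
        by (intro continuous_imp_measurable_on_sets_lebesgue continuous_on_subset[OF C_k_on_UNIV_continuous[OF C_k_on_cutoff[of 0]]]) auto
      show "(\<lambda>x. h x * cutoff n a 2 x) \<in> borel_measurable (lebesgue_on Omega)" for n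
        using L2D(1)[OF h] c by (rule borel_measurable_times)
      have "indicator {a<..<2} \<in> borel_measurable (lebesgue_on Omega)"
        by (intro measurable_restrict_space1 measurable_completion) simp
      then show "(\<lambda>x. h x * indicator {a<..<2} x) \<in> borel_measurable (lebesgue_on Omega)"
        using L2D(1)[OF h] by (intro borel_measurable_times) auto
      show "AE x in lebesgue_on Omega. (\<lambda>n. h x * cutoff n a 2 x) \<longlonglongrightarrow> h x * indicator {a<..<2} x"
        by (intro AE_I2 tendsto_intros cutoff_tendsto)
      show "AE x in lebesgue_on Omega. norm (h x * cutoff n a 2 x) \<le> \<bar>h x\<bar>" for n
        using cutoff_range[of n a 2] by (intro AE_I2) (auto simp: abs_mult intro!: mult_left_le)
    qed (use ih in simp)
    moreover have "(\<integral>\<^sub>\<Omega> x. h x * cutoff n a 2 x) = 0" for n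
      using zero[OF cutoff_test_function[OF that order.refl C_k_on_const[of _ 1], of n]] by (simp add: L2_inner_def)
    ultimately show ?thesis by (simp add: LIMSEQ_const_iff)
  qed
  define H where "H = (\<lambda>x. indicator Omega x * h x)"
  have iH: "integrable lebesgue H"
    using ih by (subst (asm) integrable_restrict_space) (auto simp: H_def)
  obtain h' where h': "h' \<in> borel_measurable lborel" "AE x in lborel. H x = h' x"
    using completion_ex_borel_measurable_real[of H lborel] iH by auto
  have AEc: "AE x in lebesgue. H x = h' x" using h'(2) by (rule AE_completion)
  have "integrable lebesgue h'"
    by (rule integrable_cong_AE_imp[OF iH]) (use h'(1) AEc in \<open>auto intro: measurable_completion\<close>)
  then have ih': "integrable lborel h'" using h'(1) by (simp add: integrable_completion)
  have "(\<integral>x. h' x * indicator {a<..} x \<partial>lborel) = 0" for a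
  proof -
    have m: "(\<lambda>x. h' x * indicator {a<..} x) \<in> borel_measurable lborel"
      using h'(1) by (intro borel_measurable_times) auto
    have "(\<integral>x. h' x * indicator {a<..} x \<partial>lborel) = (\<integral>x. h' x * indicator {a<..} x \<partial>lebesgue)"
      by (rule integral_completion[symmetric, OF m])
    also have "\<dots> = (\<integral>x. H x * indicator {a<..} x \<partial>lebesgue)"
    proof (rule integral_cong_AE)
      show "(\<lambda>x. H x * indicator {a<..} x) \<in> borel_measurable lebesgue"
        using iH by (intro borel_measurable_times measurable_completion[of "indicator {a<..}"]) auto
    qed (use m AEc in \<open>auto intro: measurable_completion\<close>)
    also have "\<dots> = (\<integral>x. indicator Omega x *\<^sub>R (h x * indicator {max 0 a<..<2} x) \<partial>lebesgue)"
      by (rule Bochner_Integration.integral_cong) (auto simp: H_def indicator_def)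
    also have "\<dots> = (\<integral>\<^sub>\<Omega> x. h x * indicator {max 0 a<..<2} x)"
      by (rule integral_restrict_space[symmetric]) simp
    also have "\<dots> = 0" by (rule int0) simp
    finally show ?thesis .
  qed
  then have "AE x in lborel. h' x = 0" by (rule interval_integrals_zero_imp_AE_zero[OF ih'])
  with h'(2) have "AE x in lborel. H x = 0" by eventually_elim simp
  then have "AE x in lebesgue. H x = 0" by (rule AE_completion)
  then have "AE x in lebesgue. x \<in> Omega \<longrightarrow> h x = 0" by eventually_elim (auto simp: H_def indicator_def)
  then show ?thesis by (subst AE_restrict_space_iff) auto
qed

lemma weak_deriv_unique:
  assumes "has_L2_weak_deriv Omega v g1" "has_L2_weak_deriv Omega v g2"
  shows "AE x in lebesgue_on Omega. g1 x = g2 x"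
proof -
  have g: "g1 \<in> L2 Omega" "g2 \<in> L2 Omega" using assms by (auto simp: has_L2_weak_deriv_def)
  have "AE x in lebesgue_on Omega. g1 x - g2 x = 0"
  proof (rule weakly_zero_imp_AE_zero[OF L2_diff[OF g]])
    fix \<phi> assume \<phi>: "\<phi> \<in> test_functions Omega"
    have p: "\<phi> \<in> L2 Omega" by (rule piecewise_C1_L2(1)[OF test_function_piecewise_C1[OF \<phi>]])
    have "L2_inner Omega (\<lambda>x. g1 x - g2 x) \<phi> = L2_inner Omega g1 \<phi> - L2_inner Omega g2 \<phi>"
      unfolding L2_inner_def left_diff_distrib
      by (intro Bochner_Integration.integral_diff L2_mult_integrable g p)
    then show "L2_inner Omega (\<lambda>x. g1 x - g2 x) \<phi> = 0" using assms \<phi> by (simp add: has_L2_weak_deriv_def)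
  qed
  then show ?thesis by simp
qed

lemma has_L2_weak_deriv_diff:
  assumes v: "v1 \<in> L2 Omega" "v2 \<in> L2 Omega" and "has_L2_weak_deriv Omega v1 g1" "has_L2_weak_deriv Omega v2 g2"
  shows "has_L2_weak_deriv Omega (\<lambda>x. v1 x - v2 x) (\<lambda>x. g1 x - g2 x)"
  unfolding has_L2_weak_deriv_def
proof (intro conjI ballI)
  have g: "g1 \<in> L2 Omega" "g2 \<in> L2 Omega" using assms by (auto simp: has_L2_weak_deriv_def)
  then show "(\<lambda>x. g1 x - g2 x) \<in> L2 Omega" by (rule L2_diff)
  fix \<phi> assume \<phi>: "\<phi> \<in> test_functions Omega"
  note pL = piecewise_C1_L2[OF test_function_piecewise_C1[OF \<phi>]]
  have "L2_inner Omega (\<lambda>x. g1 x - g2 x) \<phi> = L2_inner Omega g1 \<phi> - L2_inner Omega g2 \<phi>"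
    unfolding L2_inner_def left_diff_distrib by (intro Bochner_Integration.integral_diff L2_mult_integrable g pL)
  moreover have "L2_inner Omega (\<lambda>x. v1 x - v2 x) (deriv \<phi>) = L2_inner Omega v1 (deriv \<phi>) - L2_inner Omega v2 (deriv \<phi>)"
    unfolding L2_inner_def left_diff_distrib by (intro Bochner_Integration.integral_diff L2_mult_integrable v pL)
  ultimately show "L2_inner Omega (\<lambda>x. v1 x - v2 x) (deriv \<phi>) = - L2_inner Omega (\<lambda>x. g1 x - g2 x) \<phi>"
    using assms(3,4) \<phi> by (simp add: has_L2_weak_deriv_def)
qed

lemma weak_deriv_has: "has_L2_weak_deriv D v g \<Longrightarrow> has_L2_weak_deriv D v (weak_deriv D v)"
  unfolding weak_deriv_def by (rule someI[where P = "has_L2_weak_deriv D v"])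

lemma weak_deriv_AE:
  "has_L2_weak_deriv Omega v g \<Longrightarrow> AE x in lebesgue_on Omega. weak_deriv Omega v x = g x"
  using weak_deriv_unique weak_deriv_has by blast

lemma weak_deriv_square_integral:
  assumes "has_L2_weak_deriv Omega v g"
  shows "(L2_norm Omega (weak_deriv Omega v))\<^sup>2 = (\<integral>\<^sub>\<Omega> x. (g x)\<^sup>2)"
proof -
  have g: "g \<in> L2 Omega" "weak_deriv Omega v \<in> L2 Omega" using assms weak_deriv_has[OF assms] by (auto simp: has_L2_weak_deriv_def)
  have "L2_inner Omega (weak_deriv Omega v) (weak_deriv Omega v) = (\<integral>\<^sub>\<Omega> x. (g x)\<^sup>2)"
    unfolding L2_inner_def
  proof (rule integral_cong_AE)
    show "(\<lambda>x. weak_deriv Omega v x * weak_deriv Omega v x) \<in> borel_measurable (lebesgue_on Omega)"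
      using L2D(1)[OF g(2)] L2D(1)[OF g(2)] by (rule borel_measurable_times)
    show "(\<lambda>x. (g x)\<^sup>2) \<in> borel_measurable (lebesgue_on Omega)" using L2D(2)[OF g(1)] by auto
    show "AE x in lebesgue_on Omega. weak_deriv Omega v x * weak_deriv Omega v x = (g x)\<^sup>2"
      using weak_deriv_AE[OF assms] by eventually_elim (simp add: power2_eq_square)
  qed
  moreover have "(\<integral>\<^sub>\<Omega> x. (g x)\<^sup>2) \<ge> 0" by (rule integral_nonneg_AE) simp
  ultimately show ?thesis by (simp add: L2_norm_def)
qed

lemma L2_norm_square: "(L2_norm D v)\<^sup>2 = (\<integral>x. (v x)\<^sup>2 \<partial>(lebesgue_on D))"
proof -
  have "(\<integral>x. (v x)\<^sup>2 \<partial>(lebesgue_on D)) \<ge> 0" by (rule integral_nonneg_AE) simp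
  then show ?thesis by (simp add: L2_norm_def L2_inner_def power2_eq_square)
qed

section \<open>The space with zero boundary values\<close>

lemma H10_approximation:
  assumes v: "v \<in> H10 Omega" and g: "has_L2_weak_deriv Omega v g"
  obtains \<phi> where "\<And>n. \<phi> n \<in> test_functions Omega" 
    "(\<lambda>n. \<integral>\<^sub>\<Omega> x. (v x - \<phi> n x)\<^sup>2) \<longlonglongrightarrow> 0"
    "(\<lambda>n. \<integral>\<^sub>\<Omega> x. (g x - deriv (\<phi> n) x)\<^sup>2) \<longlonglongrightarrow> 0"
proof -
  have vL: "v \<in> L2 Omega" using v by (auto simp: H10_def H1_def)
  have "\<exists>\<phi>\<in>test_functions Omega. H1_norm Omega (\<lambda>x. v x - \<phi> x) < inverse (real (Suc n))" for n
    using v by (simp add: H10_def)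
  then obtain \<phi> where \<phi>: "\<And>n. \<phi> n \<in> test_functions Omega" 
    and b: "\<And>n. H1_norm Omega (\<lambda>x. v x - \<phi> n x) < inverse (real (Suc n))" by metis
  have nn: "(\<integral>\<^sub>\<Omega> x. (f x)\<^sup>2) \<ge> 0" for f :: "real \<Rightarrow> real" by (rule integral_nonneg_AE) simp
  have sum: "(\<integral>\<^sub>\<Omega> x. (v x - \<phi> n x)\<^sup>2) + (\<integral>\<^sub>\<Omega> x. (g x - deriv (\<phi> n) x)\<^sup>2) \<le> (inverse (real (Suc n)))\<^sup>2" for n
  proof -
    note pc = test_function_piecewise_C1[OF \<phi>[of n]]
    have d: "has_L2_weak_deriv Omega (\<lambda>x. v x - \<phi> n x) (\<lambda>x. g x - deriv (\<phi> n) x)"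
      by (rule has_L2_weak_deriv_diff[OF vL piecewise_C1_L2(1)[OF pc] g piecewise_C1_weak_deriv[OF pc]])
    have "(H1_norm Omega (\<lambda>x. v x - \<phi> n x))\<^sup>2 = (\<integral>\<^sub>\<Omega> x. (v x - \<phi> n x)\<^sup>2) + (\<integral>\<^sub>\<Omega> x. (g x - deriv (\<phi> n) x)\<^sup>2)"
      unfolding H1_norm_def weak_deriv_square_integral[OF d] unfolding L2_norm_square using nn by simp
    moreover have "(H1_norm Omega (\<lambda>x. v x - \<phi> n x))\<^sup>2 \<le> (inverse (real (Suc n)))\<^sup>2"
      by (rule power_mono) (use b[of n] in \<open>auto simp: H1_norm_def\<close>)
    ultimately show ?thesis by simp
  qed
  have lim: "(\<lambda>n. (inverse (real (Suc n)))\<^sup>2) \<longlonglongrightarrow> 0"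
    using tendsto_power[OF LIMSEQ_inverse_real_of_nat, of 2] by simp
  show ?thesis
  proof (rule that[OF \<phi>])
    show "(\<lambda>n. \<integral>\<^sub>\<Omega> x. (v x - \<phi> n x)\<^sup>2) \<longlonglongrightarrow> 0"
    proof (rule tendsto_sandwich[OF _ _ tendsto_const lim])
      show "\<forall>\<^sub>F n in sequentially. (\<integral>\<^sub>\<Omega> x. (v x - \<phi> n x)\<^sup>2) \<le> (inverse (real (Suc n)))\<^sup>2"
        using sum nn by (intro always_eventually allI) (meson add_increasing2 dual_order.trans le_add_same_cancel1)
    qed (use nn in simp)
    show "(\<lambda>n. \<integral>\<^sub>\<Omega> x. (g x - deriv (\<phi> n) x)\<^sup>2) \<longlonglongrightarrow> 0"
    proof (rule tendsto_sandwich[OF _ _ tendsto_const lim])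
      show "\<forall>\<^sub>F n in sequentially. (\<integral>\<^sub>\<Omega> x. (g x - deriv (\<phi> n) x)\<^sup>2) \<le> (inverse (real (Suc n)))\<^sup>2"
        using sum nn by (intro always_eventually allI) (meson add_increasing2 dual_order.trans le_add_same_cancel2)
    qed (use nn in simp)
  qed
qed

lemma H10I:
  assumes vL: "v \<in> L2 Omega" and g: "has_L2_weak_deriv Omega v g" and \<phi>: "\<And>n. \<phi> n \<in> test_functions Omega" 
    and lim: "(\<lambda>n. \<integral>\<^sub>\<Omega> x. (v x - \<phi> n x)\<^sup>2) \<longlonglongrightarrow> 0"
    "(\<lambda>n. \<integral>\<^sub>\<Omega> x. (g x - deriv (\<phi> n) x)\<^sup>2) \<longlonglongrightarrow> 0"
  shows "v \<in> H10 Omega"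
proof -
  have "\<exists>\<psi>\<in>test_functions Omega. H1_norm Omega (\<lambda>x. v x - \<psi> x) < e" if "e > 0" for e
  proof -
    have "H1_norm Omega (\<lambda>x. v x - \<phi> n x) = sqrt ((\<integral>\<^sub>\<Omega> x. (v x - \<phi> n x)\<^sup>2) + (\<integral>\<^sub>\<Omega> x. (g x - deriv (\<phi> n) x)\<^sup>2))" for n
    proof -
      note pc = test_function_piecewise_C1[OF \<phi>[of n]]
      have d: "has_L2_weak_deriv Omega (\<lambda>x. v x - \<phi> n x) (\<lambda>x. g x - deriv (\<phi> n) x)"
        by (rule has_L2_weak_deriv_diff[OF vL piecewise_C1_L2(1)[OF pc] g piecewise_C1_weak_deriv[OF pc]])
      show ?thesis unfolding H1_norm_def weak_deriv_square_integral[OF d] unfolding L2_norm_square ..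
    qed
    moreover have "(\<lambda>n. sqrt ((\<integral>\<^sub>\<Omega> x. (v x - \<phi> n x)\<^sup>2) + (\<integral>\<^sub>\<Omega> x. (g x - deriv (\<phi> n) x)\<^sup>2))) \<longlonglongrightarrow> sqrt (0 + 0)"
      by (intro tendsto_intros lim)
    ultimately have "(\<lambda>n. H1_norm Omega (\<lambda>x. v x - \<phi> n x)) \<longlonglongrightarrow> 0" by simp
    then have "\<forall>\<^sub>F n in sequentially. H1_norm Omega (\<lambda>x. v x - \<phi> n x) < e" using that by (rule order_tendstoD)
    then obtain n where "H1_norm Omega (\<lambda>x. v x - \<phi> n x) < e" by (auto simp: eventually_sequentially)
    with \<phi> show ?thesis by blast
  qed
  then show ?thesis using vL g by (auto simp: H10_def H1_def)
qed

lemma H10_L2: "v \<in> H10 Omega \<Longrightarrow> v \<in> L2 Omega" by (simp add: H10_def H1_def)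

lemma H10_weak_deriv: "v \<in> H10 Omega \<Longrightarrow> has_L2_weak_deriv Omega v (weak_deriv Omega v)"
  using weak_deriv_has by (auto simp: H10_def H1_def)

lemma weak_deriv_L2: "has_L2_weak_deriv D v g \<Longrightarrow> g \<in> L2 D" by (simp add: has_L2_weak_deriv_def)

text \<open>
If \<open>v\<close> is a test function, this says that \<open>w'\<close> is the weak derivative of \<open>w\<close>. Both sides are continuous in
\<open>v\<close> with respect to the \<open>H1\<close> norm.
\<close>

lemma H10_integration_by_parts:
  assumes v: "v \<in> H10 Omega" and g: "has_L2_weak_deriv Omega v g" and w: "piecewise_C1 w w'"
  shows "(\<integral>\<^sub>\<Omega> x. w x * g x) = - (\<integral>\<^sub>\<Omega> x. w' x * v x)"
proof -
  obtain \<phi> where \<phi>: "\<And>n. \<phi> n \<in> test_functions Omega" 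
    and lim: "(\<lambda>n. \<integral>\<^sub>\<Omega> x. (v x - \<phi> n x)\<^sup>2) \<longlonglongrightarrow> 0"
    "(\<lambda>n. \<integral>\<^sub>\<Omega> x. (g x - deriv (\<phi> n) x)\<^sup>2) \<longlonglongrightarrow> 0"
    using H10_approximation[OF v g] by blast
  note pc = test_function_piecewise_C1[OF \<phi>]
  note wL = piecewise_C1_L2[OF w] and pL = piecewise_C1_L2[OF pc]
  have 1: "(\<lambda>n. \<integral>\<^sub>\<Omega> x. w x * deriv (\<phi> n) x) \<longlonglongrightarrow> (\<integral>\<^sub>\<Omega> x. w x * g x)"
    by (rule L2_weak_limit[OF wL(1) weak_deriv_L2[OF g] pL(2) lim(2)])
  have 2: "(\<lambda>n. \<integral>\<^sub>\<Omega> x. w' x * \<phi> n x) \<longlonglongrightarrow> (\<integral>\<^sub>\<Omega> x. w' x * v x)"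
    by (rule L2_weak_limit[OF wL(2) H10_L2[OF v] pL(1) lim(1)])
  have "(\<integral>\<^sub>\<Omega> x. w x * deriv (\<phi> n) x) = - (\<integral>\<^sub>\<Omega> x. w' x * \<phi> n x)" for n
    using piecewise_C1_weak_deriv[OF w] \<phi>[of n] unfolding has_L2_weak_deriv_def L2_inner_def by blast
  then have "(\<lambda>n. \<integral>\<^sub>\<Omega> x. w x * deriv (\<phi> n) x) \<longlonglongrightarrow> - (\<integral>\<^sub>\<Omega> x. w' x * v x)"
    using tendsto_minus[OF 2] by simp
  then show ?thesis using 1 LIMSEQ_unique by blast
qed

text \<open>
For test functions \<open>\<phi>\<close> close to \<open>v\<close>, the product \<open>b \<phi>\<close> is admissible in the integration by parts against \<open>v\<close>. In
the limit the integral of \<open>b g v\<close> appears on both sides.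
\<close>

lemma H10_convection_identity:
  assumes v: "v \<in> H10 Omega" and g: "has_L2_weak_deriv Omega v g" and b: "piecewise_C1 b b'"
  shows "(\<integral>\<^sub>\<Omega> x. b x * g x * v x) = - (\<integral>\<^sub>\<Omega> x. b' x * (v x)\<^sup>2) / 2"
proof -
  obtain \<phi> where \<phi>: "\<And>n. \<phi> n \<in> test_functions Omega" 
    and lim: "(\<lambda>n. \<integral>\<^sub>\<Omega> x. (v x - \<phi> n x)\<^sup>2) \<longlonglongrightarrow> 0"
    "(\<lambda>n. \<integral>\<^sub>\<Omega> x. (g x - deriv (\<phi> n) x)\<^sup>2) \<longlonglongrightarrow> 0"
    using H10_approximation[OF v g] by blast
  note pc = test_function_piecewise_C1[OF \<phi>]
  note pL = piecewise_C1_L2[OF pc] and vL = H10_L2[OF v] and gL = weak_deriv_L2[OF g]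
  obtain K where K: "\<And>x. x \<in> {0..2} \<Longrightarrow> \<bar>b x\<bar> \<le> K" "\<And>x. x \<in> Omega \<Longrightarrow> \<bar>b' x\<bar> \<le> K"
    using piecewise_C1_bounded[OF b] by blast
  have bL: "(\<lambda>x. b x * f x) \<in> L2 Omega" "(\<lambda>x. b' x * f x) \<in> L2 Omega" if "f \<in> L2 Omega" for f
    by (rule L2_bounded_mult[OF that piecewise_C1_measurable(1)[OF b], of K], use K(1) in auto)
       (rule L2_bounded_mult[OF that piecewise_C1_measurable(2)[OF b], of K], use K(2) in auto)
  have 1: "(\<lambda>n. \<integral>\<^sub>\<Omega> x. (b x * g x) * \<phi> n x) \<longlonglongrightarrow> (\<integral>\<^sub>\<Omega> x. (b x * g x) * v x)"
    by (rule L2_weak_limit[OF bL(1)[OF gL] vL pL(1) lim(1)])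
  have 2: "(\<lambda>n. \<integral>\<^sub>\<Omega> x. (b' x * v x) * \<phi> n x) \<longlonglongrightarrow> (\<integral>\<^sub>\<Omega> x. (b' x * v x) * v x)"
    by (rule L2_weak_limit[OF bL(2)[OF vL] vL pL(1) lim(1)])
  have 3: "(\<lambda>n. \<integral>\<^sub>\<Omega> x. (b x * v x) * deriv (\<phi> n) x) \<longlonglongrightarrow> (\<integral>\<^sub>\<Omega> x. (b x * v x) * g x)"
    by (rule L2_weak_limit[OF bL(1)[OF vL] gL pL(2) lim(2)])
  have "(\<integral>\<^sub>\<Omega> x. (b x * g x) * \<phi> n x) = - ((\<integral>\<^sub>\<Omega> x. (b' x * v x) * \<phi> n x) + (\<integral>\<^sub>\<Omega> x. (b x * v x) * deriv (\<phi> n) x))" for n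
  proof -
    have "(\<integral>\<^sub>\<Omega> x. (b x * \<phi> n x) * g x) = - (\<integral>\<^sub>\<Omega> x. (b' x * \<phi> n x + b x * deriv (\<phi> n) x) * v x)"
      by (rule H10_integration_by_parts[OF v g piecewise_C1_mult[OF b pc]])
    also have "(\<integral>\<^sub>\<Omega> x. (b' x * \<phi> n x + b x * deriv (\<phi> n) x) * v x) =
        (\<integral>\<^sub>\<Omega> x. (b' x * v x) * \<phi> n x + (b x * v x) * deriv (\<phi> n) x)"
      by (rule Bochner_Integration.integral_cong) (auto simp: algebra_simps)
    also have "\<dots> = (\<integral>\<^sub>\<Omega> x. (b' x * v x) * \<phi> n x) + (\<integral>\<^sub>\<Omega> x. (b x * v x) * deriv (\<phi> n) x)"
      by (intro Bochner_Integration.integral_add L2_mult_integrable bL vL pL)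
    finally show ?thesis by (simp add: mult.assoc mult.commute mult.left_commute)
  qed
  then have "(\<lambda>n. \<integral>\<^sub>\<Omega> x. (b x * g x) * \<phi> n x) \<longlonglongrightarrow> - ((\<integral>\<^sub>\<Omega> x. (b' x * v x) * v x) + (\<integral>\<^sub>\<Omega> x. (b x * v x) * g x))"
    using tendsto_minus[OF tendsto_add[OF 2 3]] by simp
  with 1 have "(\<integral>\<^sub>\<Omega> x. (b x * g x) * v x) = - ((\<integral>\<^sub>\<Omega> x. (b' x * v x) * v x) + (\<integral>\<^sub>\<Omega> x. (b x * v x) * g x))"
    using LIMSEQ_unique by blast
  moreover have "(\<integral>\<^sub>\<Omega> x. (b x * v x) * g x) = (\<integral>\<^sub>\<Omega> x. (b x * g x) * v x)"
    by (rule Bochner_Integration.integral_cong) (auto simp: algebra_simps)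
  moreover have "(\<integral>\<^sub>\<Omega> x. (b' x * v x) * v x) = (\<integral>\<^sub>\<Omega> x. b' x * (v x)\<^sup>2)"
    by (rule Bochner_Integration.integral_cong) (auto simp: power2_eq_square)
  ultimately show ?thesis by simp
qed

lemma H10_diff:
  assumes "v1 \<in> H10 Omega" "v2 \<in> H10 Omega" shows "(\<lambda>x. v1 x - v2 x) \<in> H10 Omega"
proof -
  define g1 where "g1 = weak_deriv Omega v1"
  define g2 where "g2 = weak_deriv Omega v2"
  have g: "has_L2_weak_deriv Omega v1 g1" "has_L2_weak_deriv Omega v2 g2" 
    unfolding g1_def g2_def using assms H10_weak_deriv by auto
  obtain \<phi> where \<phi>: "\<And>n. \<phi> n \<in> test_functions Omega" 
    and l1: "(\<lambda>n. \<integral>\<^sub>\<Omega> x. (v1 x - \<phi> n x)\<^sup>2) \<longlonglongrightarrow> 0"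
    "(\<lambda>n. \<integral>\<^sub>\<Omega> x. (g1 x - deriv (\<phi> n) x)\<^sup>2) \<longlonglongrightarrow> 0"
    using H10_approximation[OF assms(1) g(1)] by blast
  obtain \<psi> where \<psi>: "\<And>n. \<psi> n \<in> test_functions Omega" 
    and l2: "(\<lambda>n. \<integral>\<^sub>\<Omega> x. (v2 x - \<psi> n x)\<^sup>2) \<longlonglongrightarrow> 0"
    "(\<lambda>n. \<integral>\<^sub>\<Omega> x. (g2 x - deriv (\<psi> n) x)\<^sup>2) \<longlonglongrightarrow> 0"
    using H10_approximation[OF assms(2) g(2)] by blast
  define \<theta> where "\<theta> = (\<lambda>n x. \<phi> n x - \<psi> n x)"
  have \<theta>: "\<theta> n \<in> test_functions Omega" for n
  proof -
    have "C_k_on m UNIV (\<lambda>x. \<phi> n x + (-1) * \<psi> n x)" for m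
      using \<phi>[of n] \<psi>[of n] by (intro C_k_on_add C_k_on_mult C_k_on_const) (auto simp: test_functions_def)
    moreover obtain K1 K2 where "compact K1" "K1 \<subseteq> Omega" "\<forall>x. x \<notin> K1 \<longrightarrow> \<phi> n x = 0" 
      "compact K2" "K2 \<subseteq> Omega" "\<forall>x. x \<notin> K2 \<longrightarrow> \<psi> n x = 0"
      using \<phi>[of n] \<psi>[of n] by (auto simp: test_functions_def)
    ultimately show ?thesis unfolding test_functions_def \<theta>_def
      by (auto intro!: exI[of _ "K1 \<union> K2"])
  qed
  have d\<theta>: "deriv (\<theta> n) x = deriv (\<phi> n) x - deriv (\<psi> n) x" for n x
    unfolding \<theta>_def by (rule DERIV_imp_deriv) (intro derivative_intros test_function_derivative \<phi> \<psi>)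
  have comb: "(\<lambda>n. \<integral>\<^sub>\<Omega> x. ((a1 x - a2 x) - (p1 n x - p2 n x))\<^sup>2) \<longlonglongrightarrow> 0"
    if L: "a1 \<in> L2 Omega" "a2 \<in> L2 Omega" "\<And>n. p1 n \<in> L2 Omega" "\<And>n. p2 n \<in> L2 Omega"
     and lim: "(\<lambda>n. \<integral>\<^sub>\<Omega> x. (a1 x - p1 n x)\<^sup>2) \<longlonglongrightarrow> 0" "(\<lambda>n. \<integral>\<^sub>\<Omega> x. (a2 x - p2 n x)\<^sup>2) \<longlonglongrightarrow> 0"
    for a1 a2 :: "real \<Rightarrow> real" and p1 p2
  proof (rule tendsto_sandwich[OF _ _ tendsto_const])
    show "(\<lambda>n. 2 * (\<integral>\<^sub>\<Omega> x. (a1 x - p1 n x)\<^sup>2) + 2 * (\<integral>\<^sub>\<Omega> x. (a2 x - p2 n x)\<^sup>2)) \<longlonglongrightarrow> 0"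
      using tendsto_add[OF tendsto_mult[OF tendsto_const lim(1)] tendsto_mult[OF tendsto_const lim(2)], of 2 2] by simp
    have "(\<integral>\<^sub>\<Omega> x. ((a1 x - a2 x) - (p1 n x - p2 n x))\<^sup>2) \<le> 
       2 * (\<integral>\<^sub>\<Omega> x. (a1 x - p1 n x)\<^sup>2) + 2 * (\<integral>\<^sub>\<Omega> x. (a2 x - p2 n x)\<^sup>2)" for n
    proof -
      have i: "integrable (lebesgue_on Omega) (\<lambda>x. (a1 x - p1 n x)\<^sup>2)" "integrable (lebesgue_on Omega) (\<lambda>x. (a2 x - p2 n x)\<^sup>2)"
        by (intro L2D(2) L2_diff L)+
      have "(\<integral>\<^sub>\<Omega> x. ((a1 x - a2 x) - (p1 n x - p2 n x))\<^sup>2) \<le> (\<integral>\<^sub>\<Omega> x. 2 * (a1 x - p1 n x)\<^sup>2 + 2 * (a2 x - p2 n x)\<^sup>2)"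
      proof (rule integral_mono)
        show "integrable (lebesgue_on Omega) (\<lambda>x. ((a1 x - a2 x) - (p1 n x - p2 n x))\<^sup>2)"
          by (intro L2D(2) L2_diff L)
        show "integrable (lebesgue_on Omega) (\<lambda>x. 2 * (a1 x - p1 n x)\<^sup>2 + 2 * (a2 x - p2 n x)\<^sup>2)" using i by simp
        have "(s - t)\<^sup>2 \<le> 2 * s\<^sup>2 + 2 * t\<^sup>2" for s t :: real
          using zero_le_power2[of "s + t"] by (simp add: power2_eq_square algebra_simps)
        from this[of "a1 x - p1 n x" "a2 x - p2 n x" for x] 
        show "((a1 x - a2 x) - (p1 n x - p2 n x))\<^sup>2 \<le> 2 * (a1 x - p1 n x)\<^sup>2 + 2 * (a2 x - p2 n x)\<^sup>2" for x
          by (simp add: algebra_simps)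
      qed
      also have "\<dots> = 2 * (\<integral>\<^sub>\<Omega> x. (a1 x - p1 n x)\<^sup>2) + 2 * (\<integral>\<^sub>\<Omega> x. (a2 x - p2 n x)\<^sup>2)"
        using i by simp
      finally show ?thesis .
    qed
    then show "\<forall>\<^sub>F n in sequentially. (\<integral>\<^sub>\<Omega> x. ((a1 x - a2 x) - (p1 n x - p2 n x))\<^sup>2) \<le> 
       2 * (\<integral>\<^sub>\<Omega> x. (a1 x - p1 n x)\<^sup>2) + 2 * (\<integral>\<^sub>\<Omega> x. (a2 x - p2 n x)\<^sup>2)" by simp
    show "\<forall>\<^sub>F n in sequentially. 0 \<le> (\<integral>\<^sub>\<Omega> x. ((a1 x - a2 x) - (p1 n x - p2 n x))\<^sup>2)"
      by (intro always_eventually allI integral_nonneg_AE) simp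
  qed
  note pL = piecewise_C1_L2[OF test_function_piecewise_C1[OF \<phi>]] piecewise_C1_L2[OF test_function_piecewise_C1[OF \<psi>]]
  show ?thesis
  proof (rule H10I[OF _ has_L2_weak_deriv_diff[OF _ _ g] \<theta>])
    show "(\<lambda>n. \<integral>\<^sub>\<Omega> x. (v1 x - v2 x - \<theta> n x)\<^sup>2) \<longlonglongrightarrow> 0"
      unfolding \<theta>_def by (rule comb[OF _ _ pL(1,3) l1(1) l2(1)]) (use assms H10_L2 in auto)
    show "(\<lambda>n. \<integral>\<^sub>\<Omega> x. (g1 x - g2 x - deriv (\<theta> n) x)\<^sup>2) \<longlonglongrightarrow> 0"
      unfolding d\<theta> by (rule comb[OF _ _ pL(2,4) l1(2) l2(2)]) (use g weak_deriv_L2 in auto)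
  qed (use assms H10_L2 L2_diff in auto)
qed

text \<open>
A vanishing mean makes the antiderivative from the left vanish again to the right of the support.
\<close>

lemma test_function_antiderivative:
  assumes \<psi>: "\<psi> \<in> test_functions Omega" and int: "(\<integral>\<^sub>\<Omega> x. \<psi> x) = 0"
  obtains \<phi> where "\<phi> \<in> test_functions Omega" "\<And>x. (\<phi> has_real_derivative \<psi> x) (at x)"
proof -
  obtain K where K: "compact K" "K \<subseteq> Omega" "\<And>x. x \<notin> K \<Longrightarrow> \<psi> x = 0" and C: "\<And>m. C_k_on m UNIV \<psi>"
    using \<psi> by (auto simp: test_functions_def)
  have c: "continuous_on UNIV \<psi>" using C_k_on_UNIV_continuous[OF C] .
  have "\<exists>l r. 0 < l \<and> l < r \<and> r < 2 \<and> K \<subseteq> {l..r}"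
  proof (cases "K = {}")
    case True then show ?thesis by (intro exI[of _ "1/2"] exI[of _ 1]) auto
  next
    case False
    obtain p q where pq: "p \<in> K" "q \<in> K" "\<forall>x\<in>K. p \<le> x" "\<forall>x\<in>K. x \<le> q"
      using compact_attains_inf[OF K(1) False] compact_attains_sup[OF K(1) False] by blast
    then have "0 < p" "q < 2" "p \<le> q" using K(2) by auto
    then show ?thesis using pq by (intro exI[of _ "p/2"] exI[of _ "(q + 2)/2"]) (auto simp: subset_iff field_simps; force)
  qed
  then obtain l r where lr: "0 < l" "l < r" "r < 2" and z: "\<And>x. x \<notin> {l..r} \<Longrightarrow> \<psi> x = 0" using K(3) by blast
  define F where "F = (\<lambda>x. integral {0..x} \<psi>)"
  have dF: "(F has_real_derivative \<psi> x) (at x)" if x: "x > 0" for x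
  proof -
    have "(F has_real_derivative \<psi> x) (at x within {0..x+1})" unfolding F_def
      by (rule integral_has_real_derivative) (use x in \<open>auto intro: continuous_on_subset[OF c]\<close>)
    moreover have "at x within {0..x+1} = at x" using x by (intro at_within_interior) auto
    ultimately show ?thesis by simp
  qed
  have F0: "F x = 0" if "x < l" for x
  proof -
    have "integral {0..x} \<psi> = integral {0..x} (\<lambda>_. 0)"
      by (rule integral_cong) (use that z in auto)
    then show ?thesis by (simp add: F_def)
  qed
  have dF': "(F has_real_derivative \<psi> x) (at x)" for x
  proof (cases "x > 0")
    case False
    then have x: "x < l" using lr by simp
    have "((\<lambda>_. 0) has_real_derivative 0) (at x)" by simp
    then have "(F has_real_derivative 0) (at x)"
      by (rule has_field_derivative_transform_within_open[of _ _ _ "{..<l}"]) (use x F0 in auto)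
    then show ?thesis using z[of x] x by simp
  qed (rule dF)
  have "piecewise_C1 F \<psi>"
    by (rule piecewise_C1_C1) (auto intro: has_field_derivative_at_within[OF dF'] continuous_on_subset[OF c])
  then have F2: "F 2 = 0" using piecewise_C1_integral_full[of F \<psi>] int F0[of 0] lr by simp
  have F1: "F x = 0" if x: "x > r" for x
  proof -
    have "\<exists>k. \<forall>y\<in>{r<..}. F y = k"
    proof (rule has_field_derivative_zero_constant)
      show "(F has_real_derivative 0) (at y within {r<..})" if "y \<in> {r<..}" for y
        using has_field_derivative_at_within[OF dF'[of y], of "{r<..}"] z[of y] that by simp
    qed auto
    then obtain k where "\<And>y. y \<in> {r<..} \<Longrightarrow> F y = k" by blast
    from this[of x] this[of 2] show ?thesis using x lr F2 by simp
  qed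
  have "C_k_on m UNIV F" for m
  proof -
    have "C_k_on (Suc m) UNIV F" unfolding C_k_on_Suc_iff using dF' C[of m] by blast
    then show ?thesis by (rule C_k_on_pred)
  qed
  moreover have "compact {l..r}" "{l..r} \<subseteq> Omega" "\<forall>x. x \<notin> {l..r} \<longrightarrow> F x = 0" using lr F0 F1 by auto
  ultimately have "F \<in> test_functions Omega" unfolding test_functions_def by blast
  then show ?thesis using dF' by (rule that)
qed

lemma AE_not_finite: "finite X \<Longrightarrow> AE x in lebesgue_on Omega. x \<notin> X"
proof -
  assume "finite X"
  then have "AE x in lebesgue. x \<notin> X" by (intro AE_not_in null_sets_completionI finite_imp_null_set_lborel)
  then show ?thesis by (subst AE_restrict_space_iff) auto
qed

lemma integral_Omega_const: "(\<integral>\<^sub>\<Omega> x. c) = 2 * (c::real)"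
proof -
  have "measure lebesgue Omega = 2" by (simp add: measure_completion)
  then show ?thesis by (simp add: measure_restrict_space)
qed

lemma Poincare_pointwise:
  assumes z: "piecewise_C1 z z'" "z 0 = 0" and x: "0 \<le> x" "x \<le> 2"
  shows "(z x)\<^sup>2 \<le> 2 * (\<integral>\<^sub>\<Omega> t. (z' t)\<^sup>2)"
proof -
  have m: "indicator {0<..<x} \<in> borel_measurable (lebesgue_on Omega)"
    by (intro measurable_restrict_space1 measurable_completion) simp
  have iL: "indicat_real {0<..<x} \<in> L2 Omega" by (rule L2_bounded[OF m Omega_lmeasurable, of 1]) (simp add: indicator_def)
  have "(z x)\<^sup>2 = (\<integral>\<^sub>\<Omega> t. z' t * indicator {0<..<x} t)\<^sup>2"
    using piecewise_C1_integral[OF z(1) x] z(2) by simp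
  also have "\<dots> \<le> (\<integral>\<^sub>\<Omega> t. (z' t)\<^sup>2) * (\<integral>\<^sub>\<Omega> t. (indicat_real {0<..<x} t)\<^sup>2)"
    by (rule L2_Cauchy_Schwarz[OF piecewise_C1_L2(2)[OF z(1)] iL])
  also have "\<dots> \<le> (\<integral>\<^sub>\<Omega> t. (z' t)\<^sup>2) * 2"
  proof (rule mult_left_mono)
    have "(\<integral>\<^sub>\<Omega> t. (indicat_real {0<..<x} t)\<^sup>2) \<le> (\<integral>\<^sub>\<Omega> t. 1)"
      by (rule integral_mono[OF L2D(2)[OF iL] L2_integrable[OF one_L2]]) (simp add: indicator_def)
    then show "(\<integral>\<^sub>\<Omega> t. (indicat_real {0<..<x} t)\<^sup>2) \<le> 2" by (simp only: integral_Omega_const)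
  qed (rule integral_nonneg_AE, simp)
  finally show ?thesis by simp
qed

lemma test_functions_combine:
  assumes "\<phi> \<in> test_functions Omega" "\<psi> \<in> test_functions Omega"
  shows "(\<lambda>x. \<phi> x + c * \<psi> x) \<in> test_functions Omega"
proof -
  have "C_k_on m UNIV (\<lambda>x. \<phi> x + c * \<psi> x)" for m
    using assms by (intro C_k_on_add C_k_on_mult C_k_on_const) (auto simp: test_functions_def)
  moreover obtain K1 K2 where "compact K1" "K1 \<subseteq> Omega" "\<forall>x. x \<notin> K1 \<longrightarrow> \<phi> x = 0" 
    "compact K2" "K2 \<subseteq> Omega" "\<forall>x. x \<notin> K2 \<longrightarrow> \<psi> x = 0"
    using assms by (auto simp: test_functions_def)
  ultimately show ?thesis unfolding test_functions_def
    by (auto intro!: exI[of _ "K1 \<union> K2"])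
qed

text \<open>
Test functions are obtained from their derivatives: the approximations \<open>\<psi> n\<close> of \<open>g\<close> are corrected by a multiple of a
fixed cut-off to have mean zero and then integrated. The corrections tend to \<open>0\<close> because \<open>g\<close> has mean
\<open>w 2 - w 0 = 0\<close>, and Poincare's inequality controls the functions by their derivatives.
\<close>

lemma piecewise_C1_H10:
  assumes w: "piecewise_C1 w g" "w 0 = 0" "w 2 = 0"
    and \<psi>: "\<And>n. \<psi> n \<in> test_functions Omega" and K: "\<And>n x. x \<in> Omega \<Longrightarrow> \<bar>\<psi> n x\<bar> \<le> K"
    and lim: "finite X" "\<And>x. x \<in> Omega - X \<Longrightarrow> (\<lambda>n. \<psi> n x) \<longlonglongrightarrow> g x"
  shows "w \<in> H10 Omega"
proof -
  obtain Kg where "\<And>x. x \<in> {0..2} \<Longrightarrow> \<bar>w x\<bar> \<le> Kg" and Kg: "\<And>x. x \<in> Omega \<Longrightarrow> \<bar>g x\<bar> \<le> Kg"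
    using piecewise_C1_bounded[OF w(1)] by blast
  note gm = piecewise_C1_measurable(2)[OF w(1)]
  have AEX: "AE x in lebesgue_on Omega. x \<in> Omega - X"
    using AE_not_finite[OF lim(1)] AE_space by eventually_elim simp
  have tm: "\<phi> \<in> borel_measurable (lebesgue_on Omega)" if "\<phi> \<in> test_functions Omega" for \<phi>
    by (rule piecewise_C1_measurable(1)[OF test_function_piecewise_C1[OF that]])
  have ci: "integrable (lebesgue_on Omega) (\<lambda>_. c)" for c :: real
    using L2_integrable[OF L2_cmult[OF one_L2, of c]] by simp
  define cut where "cut = (\<lambda>n. cutoff n 0 2)"
  have cutT: "cut n \<in> test_functions Omega" for n
    using cutoff_test_function[OF order.refl order.refl C_k_on_const[of _ 1], of n] by (simp add: cut_def)
  have "(\<lambda>n. \<integral>\<^sub>\<Omega> x. cut n x) \<longlonglongrightarrow> (\<integral>\<^sub>\<Omega> x. 1)"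
  proof (rule integral_dominated_convergence[where w = "\<lambda>_. 1"])
    show "AE x in lebesgue_on Omega. (\<lambda>n. cut n x) \<longlonglongrightarrow> 1"
    proof (rule AE_I2)
      fix x assume "x \<in> space (lebesgue_on Omega)"
      then have "x \<in> Omega" by simp
      then show "(\<lambda>n. cut n x) \<longlonglongrightarrow> 1" using cutoff_tendsto[of 0 2 x] unfolding cut_def by simp
    qed
    show "AE x in lebesgue_on Omega. norm (cut n x) \<le> 1" for n
      using cutoff_range[of n 0 2] by (intro AE_I2) (simp add: cut_def)
  qed (use tm cutT ci in auto)
  then have "(\<lambda>n. \<integral>\<^sub>\<Omega> x. cut n x) \<longlonglongrightarrow> 2" by (simp only: integral_Omega_const mult_1_right)
  then have "\<forall>\<^sub>F n in sequentially. (\<integral>\<^sub>\<Omega> x. cut n x) > 1" by (rule order_tendstoD) simp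
  then obtain n0 where n0: "(\<integral>\<^sub>\<Omega> x. cut n0 x) > 1" by (auto simp: eventually_sequentially)
  \<comment> \<open>A fixed test function with nonzero integral, by which the means are corrected.\<close>
  define \<theta> where "\<theta> = cut n0"
  define a where "a = (\<integral>\<^sub>\<Omega> x. \<theta> x)"
  have a: "a > 1" using n0 by (simp add: a_def \<theta>_def)
  have \<theta>: "\<theta> \<in> test_functions Omega" "\<And>x. \<bar>\<theta> x\<bar> \<le> 1" using cutT cutoff_range by (auto simp: \<theta>_def cut_def)
  define m where "m = (\<lambda>n. \<integral>\<^sub>\<Omega> x. \<psi> n x)"
  have "m \<longlonglongrightarrow> (\<integral>\<^sub>\<Omega> x. g x)" unfolding m_def
  proof (rule integral_dominated_convergence[where w = "\<lambda>_. K"])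
    show "AE x in lebesgue_on Omega. (\<lambda>n. \<psi> n x) \<longlonglongrightarrow> g x"
      using AEX by eventually_elim (rule lim(2))
    show "AE x in lebesgue_on Omega. norm (\<psi> n x) \<le> K" for n by (intro AE_I2) (simp add: K)
  qed (use tm \<psi> ci gm in auto)
  then have m0: "m \<longlonglongrightarrow> 0" using piecewise_C1_integral_full[OF w(1)] w(2,3) by simp
  then have "Bseq m" by (intro convergent_imp_Bseq convergentI)
  then obtain Km where Km: "\<And>n. \<bar>m n\<bar> \<le> Km" by (auto simp: Bseq_def)
  have Km0: "Km \<ge> 0" using Km[of 0] by simp
  define \<xi> where "\<xi> = (\<lambda>n x. \<psi> n x + (- m n / a) * \<theta> x)"
  have \<xi>: "\<xi> n \<in> test_functions Omega" for n unfolding \<xi>_def by (rule test_functions_combine[OF \<psi> \<theta>(1)])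
  have "(\<integral>\<^sub>\<Omega> x. \<xi> n x) = 0" for n
  proof -
    have "integrable (lebesgue_on Omega) (\<psi> n)" "integrable (lebesgue_on Omega) \<theta>"
      by (intro L2_integrable piecewise_C1_L2(1)[OF test_function_piecewise_C1] \<psi> \<theta>)+
    then have "(\<integral>\<^sub>\<Omega> x. \<xi> n x) = m n + (- m n / a) * a" unfolding \<xi>_def by (simp add: m_def a_def)
    then show ?thesis using a by simp
  qed
  then have "\<exists>\<phi>. \<phi> \<in> test_functions Omega \<and> (\<forall>x. (\<phi> has_real_derivative \<xi> n x) (at x))" for n
    using test_function_antiderivative[OF \<xi>] by metis
  then obtain \<phi> where \<phi>: "\<And>n. \<phi> n \<in> test_functions Omega" "\<And>n x. (\<phi> n has_real_derivative \<xi> n x) (at x)" by metis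
  have d\<phi>: "deriv (\<phi> n) = \<xi> n" for n using \<phi>(2)[of n] by (auto intro: DERIV_imp_deriv)
  define J where "J = (\<lambda>n. \<integral>\<^sub>\<Omega> x. (g x - \<xi> n x)\<^sup>2)"
  have J: "J \<longlonglongrightarrow> 0"
  proof -
    have "J \<longlonglongrightarrow> (\<integral>\<^sub>\<Omega> x. 0)" unfolding J_def
    proof (rule integral_dominated_convergence[where w = "\<lambda>_. (Kg + (K + Km))\<^sup>2"])
      show "(\<lambda>x. (g x - \<xi> n x)\<^sup>2) \<in> borel_measurable (lebesgue_on Omega)" for n
        using gm tm[OF \<xi>[of n]] by (intro borel_measurable_power borel_measurable_diff)
      show "AE x in lebesgue_on Omega. (\<lambda>n. (g x - \<xi> n x)\<^sup>2) \<longlonglongrightarrow> 0"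
        using AEX
      proof eventually_elim
        case (elim x)
        have "(\<lambda>n. (g x - (\<psi> n x + (- m n / a) * \<theta> x))\<^sup>2) \<longlonglongrightarrow> (g x - (g x + (- 0 / a) * \<theta> x))\<^sup>2"
          by (intro tendsto_intros lim(2) elim m0) (use a in simp)
        then show ?case by (simp add: \<xi>_def)
      qed
      show "AE x in lebesgue_on Omega. norm ((g x - \<xi> n x)\<^sup>2) \<le> (Kg + (K + Km))\<^sup>2" for n
      proof (rule AE_I2)
        fix x assume "x \<in> space (lebesgue_on Omega)"
        then have x: "x \<in> Omega" by simp
        have "\<bar>m n / a * \<theta> x\<bar> \<le> Km * 1" unfolding abs_mult
        proof (rule mult_mono)
          have "\<bar>m n\<bar> / a \<le> \<bar>m n\<bar> / 1" using a by (intro divide_left_mono) auto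
          then show "\<bar>m n / a\<bar> \<le> Km" using Km[of n] a by simp
        qed (use \<theta>(2) Km0 in auto)
        then have "\<bar>g x - \<xi> n x\<bar> \<le> Kg + (K + Km)" 
        proof -
          have "\<xi> n x = \<psi> n x - m n / a * \<theta> x" by (simp add: \<xi>_def)
          then show ?thesis using Kg[OF x] K[OF x, of n] \<open>\<bar>m n / a * \<theta> x\<bar> \<le> Km * 1\<close> by linarith
        qed
        then show "norm ((g x - \<xi> n x)\<^sup>2) \<le> (Kg + (K + Km))\<^sup>2" using power_mono[of "\<bar>g x - \<xi> n x\<bar>" "Kg + (K + Km)" 2] by simp
      qed
    qed (use ci in auto)
    then show ?thesis by simp
  qed
  show ?thesis
  proof (rule H10I[OF piecewise_C1_L2(1)[OF w(1)] piecewise_C1_weak_deriv[OF w(1)] \<phi>(1)])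
    show "(\<lambda>n. \<integral>\<^sub>\<Omega> x. (g x - deriv (\<phi> n) x)\<^sup>2) \<longlonglongrightarrow> 0" using J by (simp add: d\<phi> J_def)
    have pcd: "piecewise_C1 (\<lambda>x. w x + (-1) * \<phi> n x) (\<lambda>x. g x + (0 * \<phi> n x + (-1) * deriv (\<phi> n) x))" for n
    proof (rule piecewise_C1_add[OF w(1) piecewise_C1_mult[OF _ test_function_piecewise_C1[OF \<phi>(1)]]])
      show "piecewise_C1 (\<lambda>_. - 1) (\<lambda>_. 0)" by (rule piecewise_C1_C1) auto
    qed
    have "(w x - \<phi> n x)\<^sup>2 \<le> 2 * J n" if "x \<in> Omega" for n x
      using Poincare_pointwise[OF pcd[of n], of x] that w(2) test_function_derivative(3)[OF \<phi>(1)[of n]] by (simp add: d\<phi> J_def)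
    then have "(\<integral>\<^sub>\<Omega> x. (w x - \<phi> n x)\<^sup>2) \<le> (\<integral>\<^sub>\<Omega> x. 2 * J n)" for n
      by (intro integral_mono L2D(2) L2_diff piecewise_C1_L2(1)[OF w(1)] piecewise_C1_L2(1)[OF test_function_piecewise_C1[OF \<phi>(1)]] ci) auto
    then have le: "(\<integral>\<^sub>\<Omega> x. (w x - \<phi> n x)\<^sup>2) \<le> 2 * (2 * J n)" for n by (simp only: integral_Omega_const)
    show "(\<lambda>n. \<integral>\<^sub>\<Omega> x. (w x - \<phi> n x)\<^sup>2) \<longlonglongrightarrow> 0"
    proof (rule tendsto_sandwich[OF _ _ tendsto_const])
      show "(\<lambda>n. 2 * (2 * J n)) \<longlonglongrightarrow> 0" using tendsto_mult[OF tendsto_const tendsto_mult[OF tendsto_const J], of 2 2] by simp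
      show "\<forall>\<^sub>F n in sequentially. 0 \<le> (\<integral>\<^sub>\<Omega> x. (w x - \<phi> n x)\<^sup>2)"
        by (intro always_eventually allI integral_nonneg_AE) simp
    qed (use le in simp)
  qed
qed

section \<open>Shifted functions and elementary inequalities\<close>

definition shift_ext :: "(real \<Rightarrow> real) \<Rightarrow> real \<Rightarrow> real" where
  "shift_ext w x = indicator {1<..<2} x * w (x - 1)"

lemma indicator_measurable_Omega: "A \<in> sets borel \<Longrightarrow> indicat_real A \<in> borel_measurable (lebesgue_on Omega)"
  by (intro measurable_restrict_space1 measurable_completion) simp

lemma indicator_mult_L2: "w \<in> L2 Omega \<Longrightarrow> A \<in> sets borel \<Longrightarrow> (\<lambda>x. indicator A x * w x) \<in> L2 Omega"
  by (erule L2_bounded_mult[of _ _ _ 1], rule indicator_measurable_Omega) (auto simp: indicator_def)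

lemma integral_sub_Omega:
  fixes h :: "real \<Rightarrow> real"
  assumes "A \<subseteq> Omega" "A \<in> sets borel"
  shows "(\<integral>x. h x \<partial>(lebesgue_on A)) = (\<integral>\<^sub>\<Omega> x. indicator A x * h x)"
proof -
  have "(\<integral>x. h x \<partial>(lebesgue_on A)) = (\<integral>x. indicator A x *\<^sub>R h x \<partial>lebesgue)"
    by (rule integral_restrict_space) (use assms in auto)
  also have "\<dots> = (\<integral>x. indicator Omega x *\<^sub>R (indicator A x * h x) \<partial>lebesgue)"
    by (rule Bochner_Integration.integral_cong) (use assms in \<open>auto simp: indicator_def\<close>)
  also have "\<dots> = (\<integral>\<^sub>\<Omega> x. indicator A x * h x)"
    by (rule integral_restrict_space[symmetric]) simp
  finally show ?thesis .
qed

lemma shift_ext_L2: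
  assumes w: "w \<in> L2 Omega"
  shows "shift_ext w \<in> L2 Omega"
    and "(\<integral>\<^sub>\<Omega> x. (shift_ext w x)\<^sup>2) = (\<integral>\<^sub>\<Omega> x. indicator {0<..<1} x * (w x)\<^sup>2)"
proof -
  have push: "integrable lebesgue (\<lambda>x. indicator {1<..<2} x * f (x - 1)) \<and>
     (\<integral>x. indicator {1<..<2} x * f (x - 1) \<partial>lebesgue) = (\<integral>\<^sub>\<Omega> x. indicator {0<..<1} x * f x)"
    if f: "integrable (lebesgue_on Omega) (\<lambda>x. indicator {0<..<1} x * f x)" for f :: "real \<Rightarrow> real"
  proof -
    define F where "F = (\<lambda>x. indicator {0<..<1} x * f x)"
    have eq: "(\<lambda>x. indicator Omega x * (indicator {0<..<1} x * f x)) = F"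
      by (auto simp: F_def fun_eq_iff indicator_def)
    have iF: "integrable lebesgue F" using f by (subst (asm) integrable_restrict_space) (auto simp: eq)
    have sh: "F (-1 + 1 * x) = indicator {1<..<2} x * f (x - 1)" for x by (auto simp: F_def indicator_def)
    have "integrable lebesgue (\<lambda>x. F (-1 + 1 * x))" by (rule lebesgue_integrable_real_affine[OF iF]) simp
    moreover have "integral\<^sup>L lebesgue F = (\<integral>x. F (-1 + 1 * x) \<partial>lebesgue)"
      using lebesgue_integral_real_affine[of 1 F "-1"] by simp
    moreover have "(\<integral>\<^sub>\<Omega> x. indicator {0<..<1} x * f x) = integral\<^sup>L lebesgue F"
      by (subst integral_restrict_space) (auto simp: eq)
    ultimately show ?thesis unfolding sh by simp
  qed
  have 1: "integrable (lebesgue_on Omega) (\<lambda>x. indicator {0<..<1} x * w x)"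
    by (rule L2_integrable[OF indicator_mult_L2[OF w]]) simp
  have "integrable (lebesgue_on Omega) (\<lambda>x. (indicator {0<..<1} x * w x)\<^sup>2)"
    by (rule L2D(2)[OF indicator_mult_L2[OF w]]) simp
  moreover have "(indicator {0<..<1} x * w x)\<^sup>2 = indicator {0<..<1} x * (w x)\<^sup>2" for x by (simp add: indicator_def)
  ultimately have 2: "integrable (lebesgue_on Omega) (\<lambda>x. indicator {0<..<1} x * (w x)\<^sup>2)" by simp
  have sq: "(shift_ext w x)\<^sup>2 = indicator {1<..<2} x * (\<lambda>x. (w x)\<^sup>2) (x - 1)" for x by (simp add: shift_ext_def indicator_def)
  have e: "indicator Omega x * (indicator {1<..<2} x * t) = indicator {1<..<2} x * t" for x t :: real
    by (auto simp: indicator_def)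
  have m: "shift_ext w \<in> borel_measurable (lebesgue_on Omega)"
  proof (rule measurable_restrict_space1)
    have "integrable lebesgue (shift_ext w)" using push[OF 1] by (simp add: shift_ext_def[abs_def])
    then show "shift_ext w \<in> borel_measurable lebesgue" by simp
  qed
  have "integrable (lebesgue_on Omega) (\<lambda>x. (shift_ext w x)\<^sup>2)"
    unfolding sq by (subst integrable_restrict_space) (use push[OF 2] in \<open>auto simp: e\<close>)
  with m show "shift_ext w \<in> L2 Omega" by (simp add: L2_def)
  show "(\<integral>\<^sub>\<Omega> x. (shift_ext w x)\<^sup>2) = (\<integral>\<^sub>\<Omega> x. indicator {0<..<1} x * (w x)\<^sup>2)"
    unfolding sq using push[OF 2] by (subst integral_restrict_space) (auto simp: e)
qed

lemma L2_square_mono: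
  assumes "f \<in> L2 Omega" "g \<in> L2 Omega" "\<And>x. x \<in> Omega \<Longrightarrow> (f x)\<^sup>2 \<le> (g x)\<^sup>2"
  shows "(\<integral>\<^sub>\<Omega> x. (f x)\<^sup>2) \<le> (\<integral>\<^sub>\<Omega> x. (g x)\<^sup>2)"
  by (rule integral_mono[OF L2D(2)[OF assms(1)] L2D(2)[OF assms(2)]]) (use assms(3) in simp)

lemma shift_ext_norm_le:
  assumes "w \<in> L2 Omega"
  shows "(\<integral>\<^sub>\<Omega> x. (shift_ext w x)\<^sup>2) \<le> (\<integral>\<^sub>\<Omega> x. (w x)\<^sup>2)"
proof -
  have "(\<integral>\<^sub>\<Omega> x. (shift_ext w x)\<^sup>2) = (\<integral>\<^sub>\<Omega> x. (indicator {0<..<1} x * w x)\<^sup>2)"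
    unfolding shift_ext_L2(2)[OF assms] by (rule Bochner_Integration.integral_cong) (auto simp: indicator_def)
  also have "\<dots> \<le> (\<integral>\<^sub>\<Omega> x. (w x)\<^sup>2)"
    by (rule L2_square_mono[OF indicator_mult_L2[OF assms] assms]) (auto simp: indicator_def)
  finally show ?thesis .
qed

lemma L2_Young:
  assumes "f \<in> L2 Omega" "g \<in> L2 Omega" "t > 0"
  shows "\<bar>\<integral>\<^sub>\<Omega> x. f x * g x\<bar> \<le> t * (\<integral>\<^sub>\<Omega> x. (f x)\<^sup>2) + (\<integral>\<^sub>\<Omega> x. (g x)\<^sup>2) / (4 * t)"
proof -
  have i: "integrable (lebesgue_on Omega) (\<lambda>x. t * (f x)\<^sup>2 + (g x)\<^sup>2 / (4 * t))"
    using L2D(2)[OF assms(1)] L2D(2)[OF assms(2)] by simp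
  have "\<bar>\<integral>\<^sub>\<Omega> x. f x * g x\<bar> \<le> (\<integral>\<^sub>\<Omega> x. t * (f x)\<^sup>2 + (g x)\<^sup>2 / (4 * t))"
  proof (rule integral_abs_bound[THEN order.trans], rule integral_mono)
    show "integrable (lebesgue_on Omega) (\<lambda>x. \<bar>f x * g x\<bar>)" using L2_mult_integrable[OF assms(1,2)] by simp
    fix x
    have "0 \<le> (2 * t * \<bar>f x\<bar> - \<bar>g x\<bar>)\<^sup>2 / (4 * t)" using assms by simp
    also have "\<dots> = t * (f x)\<^sup>2 + (g x)\<^sup>2 / (4 * t) - \<bar>f x * g x\<bar>"
      using assms by (simp add: power2_eq_square field_simps abs_mult)
    finally show "\<bar>f x * g x\<bar> \<le> t * (f x)\<^sup>2 + (g x)\<^sup>2 / (4 * t)" by simp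
  qed (rule i)
  also have "\<dots> = t * (\<integral>\<^sub>\<Omega> x. (f x)\<^sup>2) + (\<integral>\<^sub>\<Omega> x. (g x)\<^sup>2) / (4 * t)"
    using L2D(2)[OF assms(1)] L2D(2)[OF assms(2)] by simp
  finally show ?thesis .
qed

lemma L2_bounded_mult_norm:
  assumes "f \<in> L2 Omega" "b \<in> borel_measurable (lebesgue_on Omega)" "\<And>x. x \<in> Omega \<Longrightarrow> \<bar>b x\<bar> \<le> K"
  shows "(\<integral>\<^sub>\<Omega> x. (b x * f x)\<^sup>2) \<le> K\<^sup>2 * (\<integral>\<^sub>\<Omega> x. (f x)\<^sup>2)"
proof -
  have "(\<integral>\<^sub>\<Omega> x. (b x * f x)\<^sup>2) \<le> (\<integral>\<^sub>\<Omega> x. (K * f x)\<^sup>2)"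
  proof (rule L2_square_mono[OF L2_bounded_mult[OF assms] L2_cmult[OF assms(1)]])
    fix x assume "x \<in> Omega"
    then have "(b x)\<^sup>2 \<le> K\<^sup>2" using power_mono[OF assms(3)[of x], of 2] by simp
    then show "(b x * f x)\<^sup>2 \<le> (K * f x)\<^sup>2" by (simp add: power_mult_distrib mult_right_mono)
  qed
  then show ?thesis by (simp add: power_mult_distrib)
qed

lemma L2_sum_norm:
  assumes "f \<in> L2 Omega" "g \<in> L2 Omega"
  shows "(\<integral>\<^sub>\<Omega> x. (f x + g x)\<^sup>2) \<le> 2 * (\<integral>\<^sub>\<Omega> x. (f x)\<^sup>2) + 2 * (\<integral>\<^sub>\<Omega> x. (g x)\<^sup>2)"
proof -
  have "(\<integral>\<^sub>\<Omega> x. (f x + g x)\<^sup>2) \<le> (\<integral>\<^sub>\<Omega> x. 2 * (f x)\<^sup>2 + 2 * (g x)\<^sup>2)"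
  proof (rule integral_mono[OF L2D(2)[OF L2_add[OF assms]]])
    show "integrable (lebesgue_on Omega) (\<lambda>x. 2 * (f x)\<^sup>2 + 2 * (g x)\<^sup>2)" using L2D(2)[OF assms(1)] L2D(2)[OF assms(2)] by simp
    show "(f x + g x)\<^sup>2 \<le> 2 * (f x)\<^sup>2 + 2 * (g x)\<^sup>2" for x
      using zero_le_power2[of "f x - g x"] by (simp add: power2_eq_square algebra_simps)
  qed
  then show ?thesis using L2D(2)[OF assms(1)] L2D(2)[OF assms(2)] by simp
qed

lemma integral_square_nonneg: "0 \<le> (\<integral>x. (f x :: real)\<^sup>2 \<partial>M)"
  by (rule integral_nonneg_AE) simp

section \<open>Energy estimate for the discrete error\<close>

text \<open>
The bilinear form with the derivatives as separate arguments, since a weak derivative is determined only up to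
null sets. The shifted term is written as an integral over all of \<open>Omega\<close>.
\<close>

definition form :: "real \<Rightarrow> (real \<Rightarrow> real) \<Rightarrow> (real \<Rightarrow> real) \<Rightarrow> (real \<Rightarrow> real) \<Rightarrow>
    (real \<Rightarrow> real) \<Rightarrow> (real \<Rightarrow> real) \<Rightarrow> (real \<Rightarrow> real) \<Rightarrow> (real \<Rightarrow> real) \<Rightarrow> real" where
  "form \<epsilon> b c d w w' v v' = \<epsilon> * (\<integral>\<^sub>\<Omega> x. w' x * v' x)
     + ((\<integral>\<^sub>\<Omega> x. (c x * w x) * v x) - (\<integral>\<^sub>\<Omega> x. (b x * w' x) * v x))
     + (\<integral>\<^sub>\<Omega> x. (d x * shift_ext w x) * v x)"

locale coefficients =
  fixes b b' c d :: "real \<Rightarrow> real" and K \<gamma> \<delta> :: real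
  assumes db: "\<And>x. x \<in> {0..2} \<Longrightarrow> (b has_real_derivative b' x) (at x within {0..2})"
    and cont: "continuous_on {0..2} b'" "continuous_on {0..2} c" "continuous_on {0..2} d"
    and K: "\<And>x. x \<in> {0..2} \<Longrightarrow> \<bar>b x\<bar> \<le> K" "\<And>x. x \<in> {0..2} \<Longrightarrow> \<bar>b' x\<bar> \<le> K" "\<And>x. x \<in> {0..2} \<Longrightarrow> \<bar>c x\<bar> \<le> K" "\<And>x. x \<in> {0..2} \<Longrightarrow> \<bar>d x\<bar> \<le> K"
    and \<gamma>: "\<gamma> > 0" and coer: "\<And>x. x \<in> {0..2} \<Longrightarrow> c x + b' x / 2 - \<delta> / 2 \<ge> \<gamma>"
    and d\<delta>: "\<And>x. x \<in> {1..2} \<Longrightarrow> \<bar>d x\<bar> \<le> \<delta>"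
begin

lemma b_piecewise_C1: "piecewise_C1 b b'" by (rule piecewise_C1_C1[OF db cont(1)])

lemma coefficient_measurable: "b \<in> borel_measurable (lebesgue_on Omega)" "b' \<in> borel_measurable (lebesgue_on Omega)"
  "c \<in> borel_measurable (lebesgue_on Omega)" "d \<in> borel_measurable (lebesgue_on Omega)"
proof -
  have "continuous_on {0..2} b" using db by (rule DERIV_continuous_on)
  note c = this cont
  show "b \<in> borel_measurable (lebesgue_on Omega)" "b' \<in> borel_measurable (lebesgue_on Omega)"
  "c \<in> borel_measurable (lebesgue_on Omega)" "d \<in> borel_measurable (lebesgue_on Omega)"
    by (rule continuous_imp_measurable_on_sets_lebesgue, rule continuous_on_subset, rule c, auto)+
qed

lemma coefficient_bound: "x \<in> Omega \<Longrightarrow> \<bar>b x\<bar> \<le> K" "x \<in> Omega \<Longrightarrow> \<bar>b' x\<bar> \<le> K" "x \<in> Omega \<Longrightarrow> \<bar>c x\<bar> \<le> K" "x \<in> Omega \<Longrightarrow> \<bar>d x\<bar> \<le> K"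
  using K[of x] by auto

lemma coefficient_L2:
  assumes "f \<in> L2 Omega"
  shows "(\<lambda>x. b x * f x) \<in> L2 Omega" "(\<lambda>x. b' x * f x) \<in> L2 Omega" "(\<lambda>x. c x * f x) \<in> L2 Omega" "(\<lambda>x. d x * f x) \<in> L2 Omega"
  using L2_bounded_mult[OF assms coefficient_measurable(1) coefficient_bound(1)] L2_bounded_mult[OF assms coefficient_measurable(2) coefficient_bound(2)]
    L2_bounded_mult[OF assms coefficient_measurable(3) coefficient_bound(3)] L2_bounded_mult[OF assms coefficient_measurable(4) coefficient_bound(4)] by auto

lemma form_diff:
  assumes "w1 \<in> L2 Omega" "w1' \<in> L2 Omega" "w2 \<in> L2 Omega" "w2' \<in> L2 Omega" "v \<in> L2 Omega" "v' \<in> L2 Omega"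
  shows "form \<epsilon> b c d (\<lambda>x. w1 x - w2 x) (\<lambda>x. w1' x - w2' x) v v' = form \<epsilon> b c d w1 w1' v v' - form \<epsilon> b c d w2 w2' v v'"
proof -
  have lin: "(\<integral>\<^sub>\<Omega> x. (a1 x - a2 x) * g x) = (\<integral>\<^sub>\<Omega> x. a1 x * g x) - (\<integral>\<^sub>\<Omega> x. a2 x * g x)"
    if "a1 \<in> L2 Omega" "a2 \<in> L2 Omega" "g \<in> L2 Omega" for a1 a2 g
    unfolding left_diff_distrib by (intro Bochner_Integration.integral_diff L2_mult_integrable that)
  have s: "d x * shift_ext (\<lambda>x. w1 x - w2 x) x = d x * shift_ext w1 x - d x * shift_ext w2 x" for x
    by (simp add: shift_ext_def right_diff_distrib)
  note l = lin[OF assms(2,4,6)] lin[OF coefficient_L2(3)[OF assms(1)] coefficient_L2(3)[OF assms(3)] assms(5)]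
      lin[OF coefficient_L2(1)[OF assms(2)] coefficient_L2(1)[OF assms(4)] assms(5)]
      lin[OF coefficient_L2(4)[OF shift_ext_L2(1)[OF assms(1)]] coefficient_L2(4)[OF shift_ext_L2(1)[OF assms(3)]] assms(5)]
  show ?thesis unfolding form_def s right_diff_distrib[of "b _"] right_diff_distrib[of "c _"] l
    by (simp add: algebra_simps)
qed

lemma form_cong_AE:
  assumes "w' \<in> L2 Omega" "w2' \<in> L2 Omega" "v \<in> L2 Omega" "v' \<in> L2 Omega" "v2' \<in> L2 Omega"
    and "AE x in lebesgue_on Omega. w' x = w2' x" "AE x in lebesgue_on Omega. v' x = v2' x"
  shows "form \<epsilon> b c d w w' v v' = form \<epsilon> b c d w w2' v v2'"
proof -
  have "(\<integral>\<^sub>\<Omega> x. w' x * v' x) = (\<integral>\<^sub>\<Omega> x. w2' x * v2' x)"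
    by (rule integral_cong_AE, rule borel_measurable_integrable[OF L2_mult_integrable[OF assms(1,4)]],
        rule borel_measurable_integrable[OF L2_mult_integrable[OF assms(2,5)]])
       (use assms(6,7) in eventually_elim, simp)
  moreover have "(\<integral>\<^sub>\<Omega> x. (b x * w' x) * v x) = (\<integral>\<^sub>\<Omega> x. (b x * w2' x) * v x)"
    by (rule integral_cong_AE, rule borel_measurable_integrable[OF L2_mult_integrable[OF coefficient_L2(1)[OF assms(1)] assms(3)]],
        rule borel_measurable_integrable[OF L2_mult_integrable[OF coefficient_L2(1)[OF assms(2)] assms(3)]])
       (use assms(6) in eventually_elim, simp)
  ultimately show ?thesis by (simp add: form_def)
qed

text \<open>
On \<open>(1, 2)\<close> the product of \<open>v\<close> with its shift is bounded by half the sum of the squares, and the shift moves the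
values on \<open>(0, 1)\<close> to \<open>(1, 2)\<close>. Hence either interval pays \<open>\<delta> / 2\<close> times the square of \<open>v\<close>, which is what the
assumption on \<open>c + b' / 2\<close> provides.
\<close>

lemma form_coercive:
  assumes v: "v \<in> H10 Omega" and g: "has_L2_weak_deriv Omega v g"
  shows "\<epsilon> * (\<integral>\<^sub>\<Omega> x. (g x)\<^sup>2) + \<gamma> * (\<integral>\<^sub>\<Omega> x. (v x)\<^sup>2) \<le> form \<epsilon> b c d v g v g"
proof -
  define J where "J = (\<integral>\<^sub>\<Omega> x. (v x)\<^sup>2)"
  have vL: "v \<in> L2 Omega" by (rule H10_L2[OF v])
  have iv: "integrable (lebesgue_on Omega) (\<lambda>x. (v x)\<^sup>2)" by (rule L2D(2)[OF vL])
  have \<delta>0: "\<delta> \<ge> 0" using d\<delta>[of 1] by simp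
  have ind: "integrable (lebesgue_on Omega) (\<lambda>x. indicator A x * (v x)\<^sup>2)" if "A \<in> sets borel" for A
  proof -
    have "(indicator A x * v x)\<^sup>2 = indicator A x * (v x)\<^sup>2" for x by (simp add: indicator_def)
    then show ?thesis using L2D(2)[OF indicator_mult_L2[OF vL that]] by simp
  qed
  define J1 where "J1 = (\<integral>\<^sub>\<Omega> x. indicator {0<..<1} x * (v x)\<^sup>2)"
  define J2 where "J2 = (\<integral>\<^sub>\<Omega> x. indicator {1<..<2} x * (v x)\<^sup>2)"
  have "J1 + J2 = (\<integral>\<^sub>\<Omega> x. indicator {0<..<1} x * (v x)\<^sup>2 + indicator {1<..<2} x * (v x)\<^sup>2)"
    unfolding J1_def J2_def by (rule Bochner_Integration.integral_add[symmetric]; rule ind; simp)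
  also have "\<dots> \<le> J" unfolding J_def
    by (rule integral_mono[OF Bochner_Integration.integrable_add[OF ind ind] iv]) (auto simp: indicator_def)
  finally have J12: "J1 + J2 \<le> J" .
  have cvv: "integrable (lebesgue_on Omega) (\<lambda>x. (c x * v x) * v x)" by (rule L2_mult_integrable[OF coefficient_L2(3)[OF vL] vL])
  have bvv: "integrable (lebesgue_on Omega) (\<lambda>x. (b' x * v x) * v x)" by (rule L2_mult_integrable[OF coefficient_L2(2)[OF vL] vL])
  have conv: "(\<integral>\<^sub>\<Omega> x. (b x * g x) * v x) = - (\<integral>\<^sub>\<Omega> x. (b' x * v x) * v x) / 2"
    using H10_convection_identity[OF v g b_piecewise_C1] by (simp add: power2_eq_square mult.assoc)
  have r: "(\<gamma> + \<delta> / 2) * J \<le> (\<integral>\<^sub>\<Omega> x. (c x * v x) * v x) + (\<integral>\<^sub>\<Omega> x. (b' x * v x) * v x) / 2"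
  proof -
    have "(\<integral>\<^sub>\<Omega> x. (\<gamma> + \<delta> / 2) * (v x)\<^sup>2) \<le> (\<integral>\<^sub>\<Omega> x. (c x * v x) * v x + ((b' x * v x) * v x) / 2)"
    proof (rule integral_mono)
      show "(\<gamma> + \<delta> / 2) * (v x)\<^sup>2 \<le> (c x * v x) * v x + ((b' x * v x) * v x) / 2" if "x \<in> space (lebesgue_on Omega)" for x
      proof -
        have "\<gamma> + \<delta> / 2 \<le> c x + b' x / 2" using coer[of x] that by simp
        then have "(\<gamma> + \<delta> / 2) * (v x)\<^sup>2 \<le> (c x + b' x / 2) * (v x)\<^sup>2" by (rule mult_right_mono) simp
        then show ?thesis by (simp add: power2_eq_square algebra_simps)
      qed
    qed (use iv cvv bvv in auto)
    then show ?thesis using cvv bvv by (simp add: J_def)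
  qed
  have s: "- (\<delta> / 2) * (J1 + J2) \<le> (\<integral>\<^sub>\<Omega> x. (d x * shift_ext v x) * v x)"
  proof -
    have sL: "shift_ext v \<in> L2 Omega" by (rule shift_ext_L2(1)[OF vL])
    have "(\<integral>\<^sub>\<Omega> x. - (\<delta> / 2) * ((shift_ext v x)\<^sup>2 + indicator {1<..<2} x * (v x)\<^sup>2)) \<le> (\<integral>\<^sub>\<Omega> x. (d x * shift_ext v x) * v x)"
    proof (rule integral_mono)
      show "integrable (lebesgue_on Omega) (\<lambda>x. - (\<delta> / 2) * ((shift_ext v x)\<^sup>2 + indicator {1<..<2} x * (v x)\<^sup>2))"
        using L2D(2)[OF sL] ind[of "{1<..<2}"] by simp
      show "integrable (lebesgue_on Omega) (\<lambda>x. (d x * shift_ext v x) * v x)"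
        by (rule L2_mult_integrable[OF coefficient_L2(4)[OF sL] vL])
      show "- (\<delta> / 2) * ((shift_ext v x)\<^sup>2 + indicator {1<..<2} x * (v x)\<^sup>2) \<le> (d x * shift_ext v x) * v x" for x
      proof (cases "x \<in> {1<..<2}")
        case True
        define y where "y = shift_ext v x"
        have "\<bar>d x * (y * v x)\<bar> \<le> \<delta> * ((y\<^sup>2 + (v x)\<^sup>2) / 2)" unfolding abs_mult[of "d x"]
        proof (rule mult_mono)
          show "\<bar>y * v x\<bar> \<le> (y\<^sup>2 + (v x)\<^sup>2) / 2"
            using zero_le_power2[of "y - v x"] zero_le_power2[of "y + v x"] by (simp add: power2_eq_square algebra_simps abs_le_iff)
        qed (use d\<delta>[of x] True \<delta>0 in auto)
        then have "- (\<delta> * ((y\<^sup>2 + (v x)\<^sup>2) / 2)) \<le> d x * (y * v x)" by linarith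
        then show ?thesis using True by (simp add: y_def algebra_simps add_divide_distrib)
      next
        case False
        then show ?thesis by (simp add: shift_ext_def)
      qed
    qed
    also have "(\<integral>\<^sub>\<Omega> x. - (\<delta> / 2) * ((shift_ext v x)\<^sup>2 + indicator {1<..<2} x * (v x)\<^sup>2)) = - (\<delta> / 2) * (J1 + J2)"
      using L2D(2)[OF sL] ind[of "{1<..<2}"] shift_ext_L2(2)[OF vL] by (simp add: J1_def J2_def)
    finally show ?thesis .
  qed
  have "(\<delta> / 2) * (J1 + J2) \<le> (\<delta> / 2) * J" using \<delta>0 J12 by (intro mult_left_mono) auto
  moreover have "(\<integral>\<^sub>\<Omega> x. g x * g x) = (\<integral>\<^sub>\<Omega> x. (g x)\<^sup>2)" by (simp add: power2_eq_square)
  ultimately show ?thesis using r s conv unfolding form_def J_def[symmetric] by (simp add: algebra_simps add_divide_distrib)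
qed

text \<open>
In the convection term only the layer part is integrated by parts. This trades \<open>W'\<close>, which is large, for \<open>W\<close>
times \<open>g\<close>, where \<open>K\<^sup>2 \<integral> W\<^sup>2 / \<epsilon>\<close> and \<open>\<epsilon> \<integral> g\<^sup>2\<close> are balanced. The weights in Young's inequality are such that the two
terms with \<open>g\<close> and the four terms with \<open>v\<close> add up to one half of the energy.
\<close>

lemma form_upper:
  assumes \<epsilon>: "\<epsilon> > 0" and v: "v \<in> H10 Omega" and g: "has_L2_weak_deriv Omega v g"
    and S: "piecewise_C1 S S'" and W: "piecewise_C1 W W'"
  defines "I \<equiv> (\<lambda>f. \<integral>\<^sub>\<Omega> x. (f x)\<^sup>2)"
  shows "- form \<epsilon> b c d (\<lambda>x. S x + W x) (\<lambda>x. S' x + W' x) v g \<le> (\<epsilon> * I g + \<gamma> * I v) / 2 +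
     \<epsilon> * I (\<lambda>x. S' x + W' x) + K\<^sup>2 * I W / \<epsilon> + 2 * K\<^sup>2 / \<gamma> * (2 * I (\<lambda>x. S x + W x) + I S' + I W)"
proof -
  define P where "P = (\<lambda>x. S x + W x)"
  define P' where "P' = (\<lambda>x. S' x + W' x)"
  have vL: "v \<in> L2 Omega" and gL: "g \<in> L2 Omega" using H10_L2[OF v] weak_deriv_L2[OF g] by auto
  note SL = piecewise_C1_L2[OF S] and WL = piecewise_C1_L2[OF W]
  have PL: "P \<in> L2 Omega" "P' \<in> L2 Omega" unfolding P_def P'_def using SL WL by (auto intro: L2_add)
  have sL: "shift_ext P \<in> L2 Omega" by (rule shift_ext_L2(1)[OF PL(1)])
  have \<gamma>t: "2 / \<gamma> > 0" "(4::real) * (2 / \<gamma>) = 8 / \<gamma>" using \<gamma> by auto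
  have 1: "\<epsilon> * \<bar>\<integral>\<^sub>\<Omega> x. P' x * g x\<bar> \<le> \<epsilon> * (I P' + I g / 4)"
    using L2_Young[OF PL(2) gL, of 1] \<epsilon> unfolding I_def by (intro mult_left_mono) auto
  have zero_order: "\<bar>\<integral>\<^sub>\<Omega> x. (a x * w x) * v x\<bar> \<le> 2 / \<gamma> * (K\<^sup>2 * I w) + \<gamma> / 8 * I v"
    if a: "a \<in> borel_measurable (lebesgue_on Omega)" "\<And>x. x \<in> Omega \<Longrightarrow> \<bar>a x\<bar> \<le> K" and w: "w \<in> L2 Omega" for a w
  proof -
    have "\<bar>\<integral>\<^sub>\<Omega> x. (a x * w x) * v x\<bar> \<le> 2 / \<gamma> * I (\<lambda>x. a x * w x) + I v / (4 * (2 / \<gamma>))"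
      unfolding I_def by (rule L2_Young[OF L2_bounded_mult[OF w a] vL \<gamma>t(1)])
    also have "\<dots> \<le> 2 / \<gamma> * (K\<^sup>2 * I w) + I v / (4 * (2 / \<gamma>))"
      unfolding I_def using L2_bounded_mult_norm[OF w a] \<gamma> by (intro add_mono mult_left_mono) auto
    finally show ?thesis by (simp add: mult.commute)
  qed
  note 2 = zero_order[OF coefficient_measurable(3) coefficient_bound(3) PL(1)]
    and 3 = zero_order[OF coefficient_measurable(1) coefficient_bound(1) SL(2)]
    and 4 = zero_order[OF coefficient_measurable(2) coefficient_bound(2) WL(1)]
  have 5: "\<bar>\<integral>\<^sub>\<Omega> x. (d x * shift_ext P x) * v x\<bar> \<le> 2 / \<gamma> * (K\<^sup>2 * I P) + \<gamma> / 8 * I v"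
  proof -
    have "K\<^sup>2 * I (shift_ext P) \<le> K\<^sup>2 * I P" unfolding I_def by (intro mult_left_mono shift_ext_norm_le[OF PL(1)]) auto
    then have "2 / \<gamma> * (K\<^sup>2 * I (shift_ext P)) \<le> 2 / \<gamma> * (K\<^sup>2 * I P)" using \<gamma> by (intro mult_left_mono[of _ _ "2 / \<gamma>"]) (simp_all only: divide_nonneg_pos zero_le_numeral)
    then show ?thesis using zero_order[OF coefficient_measurable(4) coefficient_bound(4) sL] by linarith
  qed
  have 6: "\<bar>\<integral>\<^sub>\<Omega> x. (b x * W x) * g x\<bar> \<le> K\<^sup>2 * I W / \<epsilon> + \<epsilon> / 4 * I g"
  proof -
    have "\<bar>\<integral>\<^sub>\<Omega> x. (b x * W x) * g x\<bar> \<le> 1 / \<epsilon> * I (\<lambda>x. b x * W x) + I g / (4 * (1 / \<epsilon>))"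
      unfolding I_def using \<epsilon> by (intro L2_Young[OF coefficient_L2(1)[OF WL(1)] gL]) auto
    also have "\<dots> \<le> 1 / \<epsilon> * (K\<^sup>2 * I W) + I g / (4 * (1 / \<epsilon>))"
      unfolding I_def using L2_bounded_mult_norm[OF WL(1) coefficient_measurable(1) coefficient_bound(1)] \<epsilon> by (intro add_mono mult_left_mono) auto
    finally show ?thesis by (simp add: mult.commute)
  qed
  have split: "(\<integral>\<^sub>\<Omega> x. (b x * P' x) * v x) = (\<integral>\<^sub>\<Omega> x. (b x * S' x) * v x) + (\<integral>\<^sub>\<Omega> x. (b x * W' x) * v x)"
  proof -
    have "(\<integral>\<^sub>\<Omega> x. (b x * P' x) * v x) = (\<integral>\<^sub>\<Omega> x. (b x * S' x) * v x + (b x * W' x) * v x)"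
      by (simp add: P'_def algebra_simps)
    also have "\<dots> = (\<integral>\<^sub>\<Omega> x. (b x * S' x) * v x) + (\<integral>\<^sub>\<Omega> x. (b x * W' x) * v x)"
      by (intro Bochner_Integration.integral_add L2_mult_integrable coefficient_L2(1) SL WL vL)
    finally show ?thesis .
  qed
  have parts: "(\<integral>\<^sub>\<Omega> x. (b x * W' x) * v x) = - (\<integral>\<^sub>\<Omega> x. (b x * W x) * g x) - (\<integral>\<^sub>\<Omega> x. (b' x * W x) * v x)"
  proof -
    have "(\<integral>\<^sub>\<Omega> x. (b x * W x) * g x) = - (\<integral>\<^sub>\<Omega> x. (b' x * W x + b x * W' x) * v x)"
      by (rule H10_integration_by_parts[OF v g piecewise_C1_mult[OF b_piecewise_C1 W]])
    also have "(\<integral>\<^sub>\<Omega> x. (b' x * W x + b x * W' x) * v x) = (\<integral>\<^sub>\<Omega> x. (b' x * W x) * v x + (b x * W' x) * v x)"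
      by (simp add: algebra_simps)
    also have "\<dots> = (\<integral>\<^sub>\<Omega> x. (b' x * W x) * v x) + (\<integral>\<^sub>\<Omega> x. (b x * W' x) * v x)"
      by (intro Bochner_Integration.integral_add L2_mult_integrable coefficient_L2(1,2) WL vL)
    finally show ?thesis by simp
  qed
  have "- form \<epsilon> b c d P P' v g \<le> \<epsilon> * \<bar>\<integral>\<^sub>\<Omega> x. P' x * g x\<bar> + \<bar>\<integral>\<^sub>\<Omega> x. (c x * P x) * v x\<bar>
     + \<bar>\<integral>\<^sub>\<Omega> x. (b x * S' x) * v x\<bar> + \<bar>\<integral>\<^sub>\<Omega> x. (b' x * W x) * v x\<bar>
     + \<bar>\<integral>\<^sub>\<Omega> x. (d x * shift_ext P x) * v x\<bar> + \<bar>\<integral>\<^sub>\<Omega> x. (b x * W x) * g x\<bar>"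
  proof -
    have "- (\<epsilon> * (\<integral>\<^sub>\<Omega> x. P' x * g x)) \<le> \<epsilon> * \<bar>\<integral>\<^sub>\<Omega> x. P' x * g x\<bar>"
      using \<epsilon> mult_left_mono[of "- (\<integral>\<^sub>\<Omega> x. P' x * g x)" "\<bar>\<integral>\<^sub>\<Omega> x. P' x * g x\<bar>" \<epsilon>] by simp
    then show ?thesis unfolding form_def split parts by linarith
  qed
  also have "\<dots> \<le> \<epsilon> * (I P' + I g / 4) + (2 / \<gamma> * (K\<^sup>2 * I P) + \<gamma> / 8 * I v) + (2 / \<gamma> * (K\<^sup>2 * I S') + \<gamma> / 8 * I v)
     + (2 / \<gamma> * (K\<^sup>2 * I W) + \<gamma> / 8 * I v) + (2 / \<gamma> * (K\<^sup>2 * I P) + \<gamma> / 8 * I v) + (K\<^sup>2 * I W / \<epsilon> + \<epsilon> / 4 * I g)"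
    by (intro add_mono 1 2 3 4 5 6)
  also have "\<dots> = (\<epsilon> * I g + \<gamma> * I v) / 2 + \<epsilon> * I P' + K\<^sup>2 * I W / \<epsilon> + 2 * K\<^sup>2 / \<gamma> * (2 * I P + I S' + I W)"
    by (simp add: algebra_simps add_divide_distrib)
  finally show ?thesis by (simp add: P_def P'_def)
qed

end

section \<open>Gluing cell-wise functions\<close>

lemma mesh_strict_mono:
  fixes X :: "nat \<Rightarrow> real"
  assumes "\<And>i. 1 \<le> i \<Longrightarrow> i \<le> N \<Longrightarrow> X (i - 1) < X i" and "i < j" "j \<le> N"
  shows "X i < X j"
  using assms(2,3)
proof (induction j)
  case (Suc j)
  have "X j < X (Suc j)" using assms(1)[of "Suc j"] Suc.prems by simp
  then show ?case using Suc by (cases "i = j") auto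
qed simp

lemma mesh_cell_exists:
  fixes X :: "nat \<Rightarrow> real"
  assumes "X 0 = 0" "X N = 2" "0 < x" "x \<le> 2"
  shows "\<exists>i. 1 \<le> i \<and> i \<le> N \<and> X (i - 1) < x \<and> x \<le> X i"
proof -
  define i where "i = (LEAST i. x \<le> X i)"
  have "x \<le> X N" using assms by simp
  then have i: "x \<le> X i" "i \<le> N" unfolding i_def by (auto intro: LeastI Least_le)
  have "i \<noteq> 0" using i(1) assms by (intro notI) simp
  then have "\<not> x \<le> X (i - 1)" unfolding i_def by (intro not_less_Least) simp
  then show ?thesis using i \<open>i \<noteq> 0\<close> by (intro exI[of _ i]) auto
qed

text \<open>
At a node the cell to its left is selected; at the left end of the interval, the first cell.
\<close>

definition cell_index :: "(nat \<Rightarrow> real) \<Rightarrow> real \<Rightarrow> nat" where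
  "cell_index X x = (LEAST i. x \<le> X i \<and> 1 \<le> i)"

lemma cell_index_eq:
  assumes mono: "\<And>i. 1 \<le> i \<Longrightarrow> i \<le> N \<Longrightarrow> X (i - 1) < X i" and i: "1 \<le> i" "i \<le> N" and x: "X (i - 1) < x" "x \<le> X i"
  shows "cell_index X x = i"
  unfolding cell_index_def
proof (rule Least_equality)
  show "x \<le> X i \<and> 1 \<le> i" using x i by simp
  fix j assume j: "x \<le> X j \<and> 1 \<le> j"
  show "i \<le> j"
  proof (rule ccontr)
    assume "\<not> i \<le> j"
    then have "j < i - 1 \<or> j = i - 1" by auto
    then have "X j \<le> X (i - 1)" 
    proof
      assume "j < i - 1"
      moreover have "i - 1 \<le> N" using i by simp
      ultimately show ?thesis using mesh_strict_mono[of N X j "i - 1", OF mono] by simp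
    qed simp
    then show False using j x by simp
  qed
qed

lemma piecewise_C1_glue:
  fixes X :: "nat \<Rightarrow> real" and f f' :: "nat \<Rightarrow> real \<Rightarrow> real"
  assumes X: "X 0 = 0" "X N = 2" and mono: "\<And>i. 1 \<le> i \<Longrightarrow> i \<le> N \<Longrightarrow> X (i - 1) < X i"
    and d: "\<And>i x. 1 \<le> i \<Longrightarrow> i \<le> N \<Longrightarrow> x \<in> {X (i - 1)..X i} \<Longrightarrow> (f i has_real_derivative f' i x) (at x within {X (i - 1)..X i})"
    and c: "\<And>i. 1 \<le> i \<Longrightarrow> i \<le> N \<Longrightarrow> continuous_on {X (i - 1)..X i} (f' i)"
    and z: "\<And>i. 1 \<le> i \<Longrightarrow> i \<le> N \<Longrightarrow> f i (X (i - 1)) = 0" "\<And>i. 1 \<le> i \<Longrightarrow> i \<le> N \<Longrightarrow> f i (X i) = 0"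
  defines "F \<equiv> (\<lambda>x. f (cell_index X x) x)" and "F' \<equiv> (\<lambda>x. f' (cell_index X x) x)"
  shows "piecewise_C1 F F'"
    and "\<And>i x. 1 \<le> i \<Longrightarrow> i \<le> N \<Longrightarrow> x \<in> {X (i - 1)..X i} \<Longrightarrow> F x = f i x"
    and "\<And>i x. 1 \<le> i \<Longrightarrow> i \<le> N \<Longrightarrow> x \<in> {X (i - 1)<..X i} \<Longrightarrow> F' x = f' i x"
proof -
  have N: "N \<ge> 1" using X by (cases N) auto
  show eq': "F' x = f' i x" if "1 \<le> i" "i \<le> N" "x \<in> {X (i - 1)<..X i}" for i x
    using cell_index_eq[of N X i x, OF mono] that by (simp add: F'_def)
  have eq0: "F x = f i x" if "1 \<le> i" "i \<le> N" "x \<in> {X (i - 1)<..X i}" for i x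
    using cell_index_eq[of N X i x, OF mono] that by (simp add: F_def)
  show eq: "F x = f i x" if i: "1 \<le> i" "i \<le> N" and x: "x \<in> {X (i - 1)..X i}" for i x
  proof (cases "x = X (i - 1)")
    case True
    show ?thesis
    proof (cases "i = 1")
      case True
      have "cell_index X x = 1" unfolding cell_index_def
        by (rule Least_equality) (use \<open>x = X (i - 1)\<close> True mono[of 1] N in auto)
      then show ?thesis using True by (simp add: F_def)
    next
      case False
      have "F x = f (i - 1) x" by (rule eq0) (use False i True mono[of "i - 1"] in auto)
      then show ?thesis using z(2)[of "i - 1"] z(1)[of i] i False True by simp
    qed
  qed (use eq0[OF i] x in auto)
  have cf: "continuous_on {X (i - 1)..X i} (f i)" if "1 \<le> i" "i \<le> N" for i
    using d[OF that] by (rule DERIV_continuous_on)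
  have "continuous_on {0..X n} F" if "n \<le> N" for n
    using that
  proof (induction n)
    case (Suc n)
    have "X 0 \<le> X n" using mesh_strict_mono[of N X 0 n, OF mono] Suc.prems by (cases "n = 0") auto
    then have "{0..X (Suc n)} = {0..X n} \<union> {X n..X (Suc n)}" using mono[of "Suc n"] Suc.prems X(1) by auto
    moreover have "continuous_on {X n..X (Suc n)} F"
      by (rule continuous_on_eq[OF cf[of "Suc n", simplified]]) (use eq[of "Suc n"] Suc.prems in auto)
    ultimately show ?case using Suc by (auto intro!: continuous_on_closed_Un)
  qed (simp add: X)
  from this[of N] have cF: "continuous_on {0..2} F" using X by simp
  define Y where "Y = X ` {0..N}"
  have dF: "(F has_real_derivative F' x) (at x) \<and> isCont F' x" if x: "x \<in> Omega - Y" for x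
  proof -
    obtain i where i: "1 \<le> i" "i \<le> N" "X (i - 1) < x" "x \<le> X i" using mesh_cell_exists[OF X, of x] x by auto
    then have lt: "x < X i" using x by (force simp: Y_def)
    have op: "open {X (i - 1)<..<X i}" "x \<in> {X (i - 1)<..<X i}" using i lt by auto
    have "at x within {X (i - 1)..X i} = at x" using op by (intro at_within_interior) auto
    then have "(f i has_real_derivative f' i x) (at x)" using d[OF i(1,2), of x] i lt by simp
    then have "(f i has_real_derivative F' x) (at x)" using eq'[OF i(1,2), of x] i by simp
    then have 1: "(F has_real_derivative F' x) (at x)"
      by (rule has_field_derivative_transform_within_open[OF _ op]) (use eq0[OF i(1,2)] in auto)
    have "isCont (f' i) x" using continuous_on_interior[OF c[OF i(1,2)]] op by (auto simp: interior_atLeastAtMost_real)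
    moreover have "\<forall>\<^sub>F y in nhds x. f' i y = F' y"
      using eventually_nhds_in_open[OF op] by eventually_elim (use eq'[OF i(1,2)] in auto)
    ultimately have "isCont F' x" using isCont_cong by blast
    with 1 show ?thesis by blast
  qed
  have "\<exists>K. \<forall>x\<in>{X (i - 1)..X i}. \<bar>f' i x\<bar> \<le> K" if "1 \<le> i" "i \<le> N" for i
    using compact_imp_bounded[OF compact_continuous_image[OF c[OF that]]] by (force simp: bounded_iff)
  then obtain K where K: "\<And>i x. 1 \<le> i \<Longrightarrow> i \<le> N \<Longrightarrow> x \<in> {X (i - 1)..X i} \<Longrightarrow> \<bar>f' i x\<bar> \<le> K i" by metis
  have "\<bar>F' x\<bar> \<le> Max (K ` {1..N})" if x: "x \<in> Omega" for x
  proof -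
    obtain i where i: "1 \<le> i" "i \<le> N" "X (i - 1) < x" "x \<le> X i" using mesh_cell_exists[OF X, of x] x by auto
    have "\<bar>F' x\<bar> \<le> K i" using K[OF i(1,2), of x] eq'[OF i(1,2), of x] i by simp
    also have "K i \<le> Max (K ` {1..N})" using i by (intro Max_ge) auto
    finally show ?thesis .
  qed
  then show "piecewise_C1 F F'" unfolding piecewise_C1_def using cF dF
    by (intro conjI exI[of _ Y] exI[of _ "Max (K ` {1..N})"]) (auto simp: Y_def)
qed

lemma test_functions_sum:
  "finite A \<Longrightarrow> (\<And>i. i \<in> A \<Longrightarrow> f i \<in> test_functions Omega) \<Longrightarrow> (\<lambda>x. \<Sum>i\<in>A. f i x) \<in> test_functions Omega"
proof (induction A rule: finite_induct)
  case empty
  show ?case by (auto simp: test_functions_def C_k_on_const intro!: exI[of _ "{}"])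
next
  case (insert a A)
  have "(\<lambda>x. f a x + 1 * (\<Sum>i\<in>A. f i x)) \<in> test_functions Omega"
    by (rule test_functions_combine) (use insert in auto)
  then show ?case using insert by simp
qed

text \<open>
On each cell the derivative is a polynomial, so it is the limit of its products with cut-offs of the cells.
\<close>

lemma piecewise_polynomial_H10:
  fixes X :: "nat \<Rightarrow> real" and p :: "nat \<Rightarrow> real poly"
  assumes X: "X 0 = 0" "X N = 2" and mono: "\<And>i. 1 \<le> i \<Longrightarrow> i \<le> N \<Longrightarrow> X (i - 1) < X i"
    and w: "piecewise_C1 w g" "w 0 = 0" "w 2 = 0"
    and p: "\<And>i x. 1 \<le> i \<Longrightarrow> i \<le> N \<Longrightarrow> x \<in> {X (i - 1)<..<X i} \<Longrightarrow> w x = poly (p i) x"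
  shows "w \<in> H10 Omega"
proof -
  obtain Y where Y: "finite Y" "\<And>x. x\<in>Omega - Y \<Longrightarrow> (w has_real_derivative g x) (at x)"
    using w(1) unfolding piecewise_C1_def by blast
  define \<psi> where "\<psi> = (\<lambda>n x. \<Sum>i\<in>{1..N}. poly (pderiv (p i)) x * cutoff n (X (i - 1)) (X i) x)"
  have XO: "0 \<le> X i" "X i \<le> 2" if "i \<le> N" for i
    using mesh_strict_mono[of N X 0 i, OF mono] mesh_strict_mono[of N X i N, OF mono] that X by (cases "i = 0"; cases "i = N"; force)+
  have "\<exists>B. \<forall>x\<in>{0..2}. \<bar>poly q x\<bar> \<le> B" for q :: "real poly"
    using compact_imp_bounded[OF compact_continuous_image[of "{0..2}" "poly q"]] by (force simp: bounded_iff intro!: continuous_intros)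
  then obtain B where B: "\<And>q x. x \<in> {0..2} \<Longrightarrow> \<bar>poly q x\<bar> \<le> B (q :: real poly)" by metis
  show ?thesis
  proof (rule piecewise_C1_H10[OF w, of \<psi> "\<Sum>i\<in>{1..N}. B (pderiv (p i))" "Y \<union> X ` {0..N}"])
    show "\<psi> n \<in> test_functions Omega" for n unfolding \<psi>_def
      by (intro test_functions_sum cutoff_test_function C_k_on_poly XO) auto
    show "\<bar>\<psi> n x\<bar> \<le> (\<Sum>i\<in>{1..N}. B (pderiv (p i)))" if "x \<in> Omega" for n x
      unfolding \<psi>_def
    proof (rule order.trans[OF sum_abs sum_mono])
      fix i
      have "\<bar>poly (pderiv (p i)) x\<bar> * \<bar>cutoff n (X (i - 1)) (X i) x\<bar> \<le> B (pderiv (p i)) * 1"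
        using B[of x "pderiv (p i)"] cutoff_range[of n "X (i - 1)" "X i" x] that by (intro mult_mono) auto
      then show "\<bar>poly (pderiv (p i)) x * cutoff n (X (i - 1)) (X i) x\<bar> \<le> B (pderiv (p i))" by (simp add: abs_mult)
    qed
    show "finite (Y \<union> X ` {0..N})" using Y by simp
    show "(\<lambda>n. \<psi> n x) \<longlonglongrightarrow> g x" if x: "x \<in> Omega - (Y \<union> X ` {0..N})" for x
    proof -
      obtain j where j: "1 \<le> j" "j \<le> N" "X (j - 1) < x" "x \<le> X j" using mesh_cell_exists[OF X, of x] x by auto
      then have lt: "x < X j" using x by force
      have "(\<lambda>n. \<psi> n x) \<longlonglongrightarrow> (\<Sum>i\<in>{1..N}. poly (pderiv (p i)) x * indicator {X (i - 1)<..<X i} x)"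
        unfolding \<psi>_def by (intro tendsto_intros cutoff_tendsto)
      also have "(\<Sum>i\<in>{1..N}. poly (pderiv (p i)) x * indicator {X (i - 1)<..<X i} x) = (\<Sum>i\<in>{1..N}. if i = j then poly (pderiv (p j)) x else 0)"
      proof (rule sum.cong[OF refl])
        fix i assume i: "i \<in> {1..N}"
        show "poly (pderiv (p i)) x * indicator {X (i - 1)<..<X i} x = (if i = j then poly (pderiv (p j)) x else 0)"
        proof (cases "x \<in> {X (i - 1)<..<X i}")
          case True
          then have "cell_index X x = i" "cell_index X x = j"
            using cell_index_eq[of N X i x, OF mono] cell_index_eq[of N X j x, OF mono] i j by auto
          then show ?thesis using True by simp
        next
          case False
          then have "i \<noteq> j" using j lt by auto
          then show ?thesis using False by simp
        qed
      qed
      also have "\<dots> = poly (pderiv (p j)) x" using j by simp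
      also have "poly (pderiv (p j)) x = g x"
      proof -
        have "(w has_real_derivative poly (pderiv (p j)) x) (at x)"
          by (rule has_field_derivative_transform_within_open[OF poly_DERIV[of "p j" x], of "{X (j - 1)<..<X j}"]) (use j lt p in auto)
        moreover have "(w has_real_derivative g x) (at x)" using Y(2)[of x] x by auto
        ultimately show ?thesis by (rule DERIV_unique)
      qed
      finally show ?thesis .
    qed
  qed
qed

text \<open>
The layer and smooth remainders vanish at all nodes, so that they are continuous across the cells and so is the
piecewise polynomial \<open>u - (S + W)\<close>, the interpolant of \<open>u\<close>.
\<close>

lemma global_splitting:
  fixes X :: "nat \<Rightarrow> real"
  assumes X: "X 0 = 0" "X N = 2" and mono: "\<And>i. 1 \<le> i \<Longrightarrow> i \<le> N \<Longrightarrow> X (i - 1) < X i"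
    and u: "piecewise_C1 u V" "u 0 = 0" "u 2 = 0"
    and cells: "\<And>i. 1 \<le> i \<Longrightarrow> i \<le> N \<Longrightarrow> cell_split u k \<epsilon> H K \<rho> (X (i - 1)) (X i)"
  shows "\<exists>S S' W W'. piecewise_C1 S S' \<and> piecewise_C1 W W' \<and> (\<lambda>x. u x - (S x + W x)) \<in> H10 Omega \<and>
    (\<forall>i. 1 \<le> i \<longrightarrow> i \<le> N \<longrightarrow> (\<exists>p. degree p \<le> k \<and> (\<forall>x\<in>{X (i - 1)<..<X i}. u x - (S x + W x) = poly p x))) \<and>
    (\<forall>x\<in>Omega. \<bar>S x\<bar> \<le> K * H ^ k \<and> \<bar>S' x\<bar> \<le> K * H ^ k \<and>
        (W x)\<^sup>2 \<le> K * (\<epsilon> * H ^ (2 * k) * \<rho> x) \<and> \<epsilon> * (W' x)\<^sup>2 \<le> K * (H ^ (2 * k) * \<rho> x))"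
proof -
  define Q where "Q = (\<lambda>i p S S' W W'. degree p \<le> k \<and> (\<forall>x\<in>{X (i - 1)..X i}. u x = poly p x + S x + W x) \<and>
     S (X (i - 1)) = 0 \<and> S (X i) = 0 \<and> W (X (i - 1)) = 0 \<and> W (X i) = 0 \<and>
     (\<forall>x\<in>{X (i - 1)..X i}. (S has_real_derivative S' x) (at x within {X (i - 1)..X i})) \<and> continuous_on {X (i - 1)..X i} S' \<and>
     (\<forall>x\<in>{X (i - 1)..X i}. (W has_real_derivative W' x) (at x within {X (i - 1)..X i})) \<and> continuous_on {X (i - 1)..X i} W' \<and>
     (\<forall>x\<in>{X (i - 1)..X i}. \<bar>S x\<bar> \<le> K * H ^ k \<and> \<bar>S' x\<bar> \<le> K * H ^ k \<and>
        (W x)\<^sup>2 \<le> K * (\<epsilon> * H ^ (2 * k) * \<rho> x) \<and> \<epsilon> * (W' x)\<^sup>2 \<le> K * (H ^ (2 * k) * \<rho> x)))"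
  have "\<exists>p S S' W W'. Q i p S S' W W'" if "1 \<le> i" "i \<le> N" for i
    using cells[OF that] unfolding cell_split_def Q_def .
  then obtain p S S' W W' where "\<And>i. 1 \<le> i \<Longrightarrow> i \<le> N \<Longrightarrow> Q i (p i) (S i) (S' i) (W i) (W' i)" by metis
  note * = this[unfolded Q_def]
  define FS where "FS = (\<lambda>x. S (cell_index X x) x)"
  define FS' where "FS' = (\<lambda>x. S' (cell_index X x) x)"
  define FW where "FW = (\<lambda>x. W (cell_index X x) x)"
  define FW' where "FW' = (\<lambda>x. W' (cell_index X x) x)"
  have dS: "(S i has_real_derivative S' i x) (at x within {X (i - 1)..X i})" if "1 \<le> i" "i \<le> N" "x \<in> {X (i - 1)..X i}" for i x
    using *[OF that(1,2)] that(3) by blast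
  have cS: "continuous_on {X (i - 1)..X i} (S' i)" if "1 \<le> i" "i \<le> N" for i using *[OF that] by blast
  have zS: "S i (X (i - 1)) = 0" if "1 \<le> i" "i \<le> N" for i using *[OF that] by blast
  have yS: "S i (X i) = 0" if "1 \<le> i" "i \<le> N" for i using *[OF that] by blast
  have gS1: "piecewise_C1 FS FS'" unfolding FS_def FS'_def
    by (rule piecewise_C1_glue(1)[OF X, of S S']) (fact mono dS cS zS yS)+
  have gS2: "FS x = S i x" if "1 \<le> i" "i \<le> N" "x \<in> {X (i - 1)..X i}" for i x unfolding FS_def
    by (rule piecewise_C1_glue(2)[OF X, of S S']) (fact mono dS cS zS yS that)+
  have gS3: "FS' x = S' i x" if "1 \<le> i" "i \<le> N" "x \<in> {X (i - 1)<..X i}" for i x unfolding FS'_def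
    by (rule piecewise_C1_glue(3)[OF X, of S S']) (fact mono dS cS zS yS that)+
  have dW: "(W i has_real_derivative W' i x) (at x within {X (i - 1)..X i})" if "1 \<le> i" "i \<le> N" "x \<in> {X (i - 1)..X i}" for i x
    using *[OF that(1,2)] that(3) by blast
  have cW: "continuous_on {X (i - 1)..X i} (W' i)" if "1 \<le> i" "i \<le> N" for i using *[OF that] by blast
  have zW: "W i (X (i - 1)) = 0" if "1 \<le> i" "i \<le> N" for i using *[OF that] by blast
  have yW: "W i (X i) = 0" if "1 \<le> i" "i \<le> N" for i using *[OF that] by blast
  have gW1: "piecewise_C1 FW FW'" unfolding FW_def FW'_def
    by (rule piecewise_C1_glue(1)[OF X, of W W']) (fact mono dW cW zW yW)+
  have gW2: "FW x = W i x" if "1 \<le> i" "i \<le> N" "x \<in> {X (i - 1)..X i}" for i x unfolding FW_def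
    by (rule piecewise_C1_glue(2)[OF X, of W W']) (fact mono dW cW zW yW that)+
  have gW3: "FW' x = W' i x" if "1 \<le> i" "i \<le> N" "x \<in> {X (i - 1)<..X i}" for i x unfolding FW'_def
    by (rule piecewise_C1_glue(3)[OF X, of W W']) (fact mono dW cW zW yW that)+
  have N: "N \<ge> 1" using X by (cases N) auto
  have poly: "u x - (FS x + FW x) = poly (p i) x" if "1 \<le> i" "i \<le> N" "x \<in> {X (i - 1)<..<X i}" for i x
  proof -
    have x: "x \<in> {X (i - 1)..X i}" using that by auto
    have "u x = poly (p i) x + S i x + W i x" using *[OF that(1,2)] x by blast
    then show ?thesis using gS2[OF that(1,2) x] gW2[OF that(1,2) x] by simp
  qed
  have bd: "FS 0 = 0" "FS 2 = 0" "FW 0 = 0" "FW 2 = 0"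
    using gS2[of 1 0] gS2[of N 2] gW2[of 1 0] gW2[of N 2] zS[of 1] yS[of N] zW[of 1] yW[of N] N mono[of 1] mono[of N] X by simp_all
  have pc: "piecewise_C1 (\<lambda>x. u x - (FS x + FW x)) (\<lambda>x. V x + (0 * (FS x + FW x) + (-1) * (FS' x + FW' x)))"
  proof -
    have "piecewise_C1 (\<lambda>x. u x + (-1) * (FS x + FW x)) (\<lambda>x. V x + (0 * (FS x + FW x) + (-1) * (FS' x + FW' x)))"
      by (intro piecewise_C1_add[OF u(1)] piecewise_C1_mult piecewise_C1_add[OF gS1 gW1] piecewise_C1_C1) auto
    moreover have "(\<lambda>x. u x + (-1) * (FS x + FW x)) = (\<lambda>x. u x - (FS x + FW x))" by (simp add: fun_eq_iff)
    ultimately show ?thesis by (simp only:)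
  qed
  have H: "(\<lambda>x. u x - (FS x + FW x)) \<in> H10 Omega"
    by (rule piecewise_polynomial_H10[OF X mono pc _ _ poly]) (use bd u in auto)
  have b: "\<bar>FS x\<bar> \<le> K * H ^ k \<and> \<bar>FS' x\<bar> \<le> K * H ^ k \<and>
        (FW x)\<^sup>2 \<le> K * (\<epsilon> * H ^ (2 * k) * \<rho> x) \<and> \<epsilon> * (FW' x)\<^sup>2 \<le> K * (H ^ (2 * k) * \<rho> x)" if x: "x \<in> Omega" for x
  proof -
    obtain i where i: "1 \<le> i" "i \<le> N" "X (i - 1) < x" "x \<le> X i" using mesh_cell_exists[OF X, of x] x by auto
    then have x: "x \<in> {X (i - 1)<..X i}" "x \<in> {X (i - 1)..X i}" by auto
    show ?thesis using *[OF i(1,2)] x(2) unfolding gS2[OF i(1,2) x(2)] gW2[OF i(1,2) x(2)] gS3[OF i(1,2) x(1)] gW3[OF i(1,2) x(1)]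
      by blast
  qed
  show ?thesis
  proof (rule exI[of _ FS], rule exI[of _ FS'], rule exI[of _ FW], rule exI[of _ FW'], intro conjI gS1 gW1 H)
    show "\<forall>i. 1 \<le> i \<longrightarrow> i \<le> N \<longrightarrow> (\<exists>p. degree p \<le> k \<and> (\<forall>x\<in>{X (i - 1)<..<X i}. u x - (FS x + FW x) = poly p x))"
      using poly * by blast
    show "\<forall>x\<in>Omega. \<bar>FS x\<bar> \<le> K * H ^ k \<and> \<bar>FS' x\<bar> \<le> K * H ^ k \<and>
        (FW x)\<^sup>2 \<le> K * (\<epsilon> * H ^ (2 * k) * \<rho> x) \<and> \<epsilon> * (FW' x)\<^sup>2 \<le> K * (H ^ (2 * k) * \<rho> x)"
      using b by blast
  qed
qed

section \<open>Consistency of the weak form\<close>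

lemma continuous_L2: "continuous_on {0..2} f \<Longrightarrow> f \<in> L2 Omega"
proof -
  assume f: "continuous_on {0..2} f"
  obtain K where K: "\<forall>x\<in>{0..2}. \<bar>f x\<bar> \<le> K" using continuous_bounded_interval[OF f] by blast
  have "f \<in> borel_measurable (lebesgue_on Omega)"
    by (intro continuous_imp_measurable_on_sets_lebesgue continuous_on_subset[OF f]) auto
  then show ?thesis by (rule L2_bounded[OF _ Omega_lmeasurable, of _ K]) (use K in auto)
qed

lemma regular_solution_piecewise_C1:
  assumes "regular_solution \<epsilon> b c d f \<Phi> u V V'"
  shows "piecewise_C1 u V"
proof (rule piecewise_C1_C1)
  show "(u has_real_derivative V x) (at x within {0..2})" if "x \<in> {0..2}" for x
    using assms that unfolding regular_solution_def by blast
  have "\<forall>x\<in>{0..2}. (V has_real_derivative V' x) (at x within {0..2})" using assms unfolding regular_solution_def by blast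
  then show "continuous_on {0..2} V" by (rule deriv_imp_continuous_on)
qed

text \<open>
Integration by parts of \<open>\<epsilon> u''\<close> against \<open>v\<close>. The history part of the shifted term, supported in \<open>(0, 1)\<close>, moves
to the right-hand side.
\<close>

lemma regular_solution_weak:
  assumes \<epsilon>: "\<epsilon> > 0" and reg: "regular_solution \<epsilon> b c d f \<Phi> u V V'"
    and cont: "continuous_on {0..2} b" "continuous_on {0..2} c" "continuous_on {0..2} d" "continuous_on {0..2} f"
    and v: "v \<in> H10 Omega" and g: "has_L2_weak_deriv Omega v g"
  shows "form \<epsilon> b c d u V v g = linform d f \<Phi> v"
proof -
  have u0: "u 0 = 0" and csh: "continuous_on {0..2} (shifted \<Phi> u)"
    and du: "\<And>x. x \<in> {0..2} \<Longrightarrow> (u has_real_derivative V x) (at x within {0..2})"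
    and dV: "\<And>x. x \<in> {0..2} \<Longrightarrow> (V has_real_derivative V' x) (at x within {0..2})"
    and ode: "\<And>x. x \<in> {0..2} \<Longrightarrow> \<epsilon> * V' x + b x * V x = c x * u x + d x * shifted \<Phi> u x - f x"
    using reg unfolding regular_solution_def by auto
  have cu: "continuous_on {0..2} u" using du by (rule DERIV_continuous_on)
  have cV: "continuous_on {0..2} V" using dV by (rule DERIV_continuous_on)
  have cV': "continuous_on {0..2} V'"
  proof (rule continuous_on_eq)
    show "continuous_on {0..2} (\<lambda>x. (c x * u x + d x * shifted \<Phi> u x - f x - b x * V x) / \<epsilon>)"
      using \<epsilon> by (auto intro!: continuous_intros cont cu cV csh)
    show "(c x * u x + d x * shifted \<Phi> u x - f x - b x * V x) / \<epsilon> = V' x" if "x \<in> {0..2}" for x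
      using ode[OF that] \<epsilon> by (simp add: field_simps)
  qed
  have vL: "v \<in> L2 Omega" by (rule H10_L2[OF v])
  have bp: "(\<integral>\<^sub>\<Omega> x. V x * g x) = - (\<integral>\<^sub>\<Omega> x. V' x * v x)"
    by (rule H10_integration_by_parts[OF v g piecewise_C1_C1[OF dV cV']])
  define q where "q = (\<lambda>x. indicator {0<..<1} x * (d x * shifted \<Phi> u x))"
  have qL: "q \<in> L2 Omega" unfolding q_def
    by (intro indicator_mult_L2 continuous_L2 continuous_intros cont csh) auto
  have L: "V' \<in> L2 Omega" "(\<lambda>x. c x * u x) \<in> L2 Omega" "(\<lambda>x. b x * V x) \<in> L2 Omega" "f \<in> L2 Omega"
    by (intro continuous_L2 continuous_intros cV' cont cu cV)+
  have sL: "(\<lambda>x. d x * shift_ext u x) \<in> L2 Omega"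
  proof -
    obtain Kd where Kd: "\<forall>x\<in>{0..2}. \<bar>d x\<bar> \<le> Kd" using continuous_bounded_interval[OF cont(3)] by blast
    have "d \<in> borel_measurable (lebesgue_on Omega)" by (rule L2D(1)[OF continuous_L2[OF cont(3)]])
    then show ?thesis by (rule L2_bounded_mult[OF shift_ext_L2(1)[OF continuous_L2[OF cu]], of _ Kd]) (use Kd in auto)
  qed
  note i = L2_mult_integrable[OF L(1) vL] L2_mult_integrable[OF L(2) vL] L2_mult_integrable[OF L(3) vL]
    L2_mult_integrable[OF L(4) vL] L2_mult_integrable[OF sL vL] L2_mult_integrable[OF qL vL]
  have "form \<epsilon> b c d u V v g = - \<epsilon> * (\<integral>\<^sub>\<Omega> x. V' x * v x) + ((\<integral>\<^sub>\<Omega> x. (c x * u x) * v x) - (\<integral>\<^sub>\<Omega> x. (b x * V x) * v x))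
     + (\<integral>\<^sub>\<Omega> x. (d x * shift_ext u x) * v x)"
    by (simp add: form_def bp)
  also have "\<dots> = (\<integral>\<^sub>\<Omega> x. - \<epsilon> * (V' x * v x) + ((c x * u x) * v x - (b x * V x) * v x) + (d x * shift_ext u x) * v x)"
    using i by simp
  also have "\<dots> = (\<integral>\<^sub>\<Omega> x. f x * v x - q x * v x)"
  proof (rule Bochner_Integration.integral_cong[OF refl])
    fix x :: real assume "x \<in> space (lebesgue_on Omega)"
    then have x: "x \<in> Omega" by simp
    have "d x * shifted \<Phi> u x = q x + d x * shift_ext u x"
    proof (cases "x = 1")
      case True then show ?thesis using u0 by (simp add: q_def shifted_def shift_ext_def)
    next
      case False then show ?thesis using x by (auto simp: q_def shifted_def shift_ext_def indicator_def)
    qed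
    then have "- \<epsilon> * V' x + (c x * u x - b x * V x) + d x * shift_ext u x = f x - q x"
      using ode[of x] x by simp
    then have "(- \<epsilon> * V' x + (c x * u x - b x * V x) + d x * shift_ext u x) * v x = (f x - q x) * v x" by simp
    then show "- \<epsilon> * (V' x * v x) + ((c x * u x) * v x - (b x * V x) * v x) + (d x * shift_ext u x) * v x = f x * v x - q x * v x"
      by (simp add: algebra_simps)
  qed
  also have "\<dots> = (\<integral>\<^sub>\<Omega> x. f x * v x) - (\<integral>\<^sub>\<Omega> x. q x * v x)" using i by simp
  also have "(\<integral>\<^sub>\<Omega> x. q x * v x) = L2_inner {0<..<1} (\<lambda>x. d x * \<Phi> (x - 1)) v"
  proof -
    have "L2_inner {0<..<1} (\<lambda>x. d x * \<Phi> (x - 1)) v = (\<integral>\<^sub>\<Omega> x. indicator {0<..<1} x * (d x * \<Phi> (x - 1) * v x))"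
      unfolding L2_inner_def by (rule integral_sub_Omega) auto
    also have "\<dots> = (\<integral>\<^sub>\<Omega> x. q x * v x)"
      by (rule Bochner_Integration.integral_cong) (auto simp: q_def shifted_def indicator_def)
    finally show ?thesis by simp
  qed
  finally show ?thesis by (simp add: linform_def L2_inner_def)
qed

context coefficients begin

lemma bilin_form:
  assumes w: "w \<in> H10 Omega" and v: "v \<in> H10 Omega" and g: "has_L2_weak_deriv Omega v g"
  shows "bilin \<epsilon> b c d w v = form \<epsilon> b c d w (weak_deriv Omega w) v g"
proof -
  note wL = H10_L2[OF w] and vL = H10_L2[OF v]
  note wd = weak_deriv_L2[OF H10_weak_deriv[OF w]] and vd = weak_deriv_L2[OF H10_weak_deriv[OF v]]
  have "bilin \<epsilon> b c d w v = form \<epsilon> b c d w (weak_deriv Omega w) v (weak_deriv Omega v)"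
  proof -
    have "L2_inner Omega (\<lambda>x. c x * w x - b x * weak_deriv Omega w x) v = 
       (\<integral>\<^sub>\<Omega> x. (c x * w x) * v x) - (\<integral>\<^sub>\<Omega> x. (b x * weak_deriv Omega w x) * v x)"
      unfolding L2_inner_def left_diff_distrib
      by (intro Bochner_Integration.integral_diff L2_mult_integrable coefficient_L2 wL wd vL)
    moreover have "L2_inner {1<..<2} (\<lambda>x. d x * w (x - 1)) v = (\<integral>\<^sub>\<Omega> x. (d x * shift_ext w x) * v x)"
    proof -
      have "L2_inner {1<..<2} (\<lambda>x. d x * w (x - 1)) v = (\<integral>\<^sub>\<Omega> x. indicator {1<..<2} x * (d x * w (x - 1) * v x))"
        unfolding L2_inner_def by (rule integral_sub_Omega) auto
      also have "\<dots> = (\<integral>\<^sub>\<Omega> x. (d x * shift_ext w x) * v x)"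
        by (rule Bochner_Integration.integral_cong) (auto simp: shift_ext_def)
      finally show ?thesis .
    qed
    ultimately show ?thesis by (simp add: bilin_def form_def L2_inner_def)
  qed
  also have "\<dots> = form \<epsilon> b c d w (weak_deriv Omega w) v g"
    by (rule form_cong_AE[OF wd wd vL vd weak_deriv_L2[OF g] _ weak_deriv_AE[OF g]]) simp
  finally show ?thesis .
qed

text \<open>
With \<open>P = S + W\<close> the interpolant is \<open>u - P\<close>, and \<open>v\<close> is its difference to \<open>uN\<close>. Orthogonality gives
\<open>form v v = - form P v\<close>, and \<open>form_upper\<close> lets one half of the energy of \<open>v\<close> be absorbed. The error is
\<open>v + P\<close>. The number \<open>h\<close> stands for \<open>H^(2 k)\<close>.
\<close>

lemma energy_error:
  assumes \<epsilon>: "0 < \<epsilon>" "\<epsilon> < 1" and h: "h \<ge> 0"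
    and u: "piecewise_C1 u V" and S: "piecewise_C1 S S'" and W: "piecewise_C1 W W'"
    and uI: "(\<lambda>x. u x - (S x + W x)) \<in> H10 Omega" and uN: "uN \<in> H10 Omega"
    and orth: "\<And>g. has_L2_weak_deriv Omega (\<lambda>x. (u x - (S x + W x)) - uN x) g \<Longrightarrow>
       form \<epsilon> b c d u V (\<lambda>x. (u x - (S x + W x)) - uN x) g = form \<epsilon> b c d uN (weak_deriv Omega uN) (\<lambda>x. (u x - (S x + W x)) - uN x) g"
    and A: "A \<ge> 0" and bS: "(\<integral>\<^sub>\<Omega> x. (S x)\<^sup>2) \<le> A * h" "(\<integral>\<^sub>\<Omega> x. (S' x)\<^sup>2) \<le> A * h"
    and bW: "(\<integral>\<^sub>\<Omega> x. (W x)\<^sup>2) \<le> A * h * \<epsilon>" "\<epsilon> * (\<integral>\<^sub>\<Omega> x. (W' x)\<^sup>2) \<le> A * h"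
  shows "\<epsilon> * (L2_norm Omega (weak_deriv Omega (\<lambda>x. u x - uN x)))\<^sup>2 + \<gamma> * (L2_norm Omega (\<lambda>x. u x - uN x))\<^sup>2
     \<le> (24 + 8 * \<gamma> + 4 * K\<^sup>2 + 80 * K\<^sup>2 / \<gamma>) * A * h"
proof -
  define I where "I = (\<lambda>f. \<integral>\<^sub>\<Omega> x. (f x :: real)\<^sup>2)"
  have I0: "I f \<ge> 0" for f unfolding I_def by (rule integral_square_nonneg)
  define P where "P = (\<lambda>x. S x + W x)"
  define P' where "P' = (\<lambda>x. S' x + W' x)"
  define gN where "gN = weak_deriv Omega uN"
  define v where "v = (\<lambda>x. (u x - P x) - uN x)"
  define g where "g = (\<lambda>x. (V x - P' x) - gN x)"
  note SL = piecewise_C1_L2[OF S] and WL = piecewise_C1_L2[OF W] and uL = piecewise_C1_L2[OF u]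
  have PL: "P \<in> L2 Omega" "P' \<in> L2 Omega" unfolding P_def P'_def using SL WL by (auto intro: L2_add)
  have pcP: "piecewise_C1 P P'" unfolding P_def P'_def by (rule piecewise_C1_add[OF S W])
  have uNL: "uN \<in> L2 Omega" by (rule H10_L2[OF uN])
  have dN: "has_L2_weak_deriv Omega uN gN" unfolding gN_def by (rule H10_weak_deriv[OF uN])
  have gNL: "gN \<in> L2 Omega" by (rule weak_deriv_L2[OF dN])
  have dI: "has_L2_weak_deriv Omega (\<lambda>x. u x - P x) (\<lambda>x. V x - P' x)"
    by (rule has_L2_weak_deriv_diff[OF uL(1) PL(1) piecewise_C1_weak_deriv[OF u] piecewise_C1_weak_deriv[OF pcP]])
  have dv: "has_L2_weak_deriv Omega v g" unfolding v_def g_def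
    by (rule has_L2_weak_deriv_diff[OF L2_diff[OF uL(1) PL(1)] uNL dI dN])
  have vH: "v \<in> H10 Omega" unfolding v_def by (rule H10_diff[OF _ uN]) (use uI in \<open>simp add: P_def\<close>)
  have vL: "v \<in> L2 Omega" and gL: "g \<in> L2 Omega" using H10_L2[OF vH] weak_deriv_L2[OF dv] by auto
  have "form \<epsilon> b c d v g v g = form \<epsilon> b c d (\<lambda>x. u x - P x) (\<lambda>x. V x - P' x) v g - form \<epsilon> b c d uN gN v g"
    using form_diff[OF L2_diff[OF uL(1) PL(1)] L2_diff[OF uL(2) PL(2)] uNL gNL vL gL, of \<epsilon>] by (simp only: v_def[symmetric] g_def[symmetric])
  also have "form \<epsilon> b c d (\<lambda>x. u x - P x) (\<lambda>x. V x - P' x) v g = form \<epsilon> b c d u V v g - form \<epsilon> b c d P P' v g"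
    by (rule form_diff[OF uL PL vL gL])
  also have "form \<epsilon> b c d u V v g = form \<epsilon> b c d uN gN v g"
    using orth[of g] dv unfolding v_def P_def gN_def by blast
  finally have eq: "form \<epsilon> b c d v g v g = - form \<epsilon> b c d P P' v g" by simp
  define E where "E = \<epsilon> * I g + \<gamma> * I v"
  define R where "R = \<epsilon> * I P' + K\<^sup>2 * I W / \<epsilon> + 2 * K\<^sup>2 / \<gamma> * (2 * I P + I S' + I W)"
  have "E \<le> form \<epsilon> b c d v g v g" unfolding E_def I_def by (rule form_coercive[OF vH dv])
  also have "\<dots> \<le> E / 2 + R"
    using form_upper[OF \<epsilon>(1) vH dv S W] unfolding eq E_def R_def I_def P_def P'_def by simp
  finally have ER: "E \<le> 2 * R" by simp
  have Ah: "A * h \<ge> 0" using A h by simp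
  have W1: "I W \<le> A * h" 
  proof -
    have "A * h * \<epsilon> \<le> A * h * 1" using Ah \<epsilon> by (intro mult_left_mono) auto
    then show ?thesis using bW(1) by (simp add: I_def)
  qed
  have P1: "I P \<le> 4 * (A * h)" 
    using L2_sum_norm[OF SL(1) WL(1)] bS(1) W1 unfolding P_def I_def by linarith
  have P2: "\<epsilon> * I P' \<le> 4 * (A * h)"
  proof -
    have "\<epsilon> * I P' \<le> \<epsilon> * (2 * I S' + 2 * I W')"
      using L2_sum_norm[OF SL(2) WL(2)] \<epsilon> unfolding P'_def I_def by (intro mult_left_mono) auto
    also have "\<dots> = 2 * (\<epsilon> * I S') + 2 * (\<epsilon> * I W')" by (simp add: algebra_simps)
    also have "\<epsilon> * I S' \<le> 1 * I S'" using I0 \<epsilon> by (intro mult_right_mono) auto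
    finally show ?thesis using bS(2) bW(2) by (simp add: I_def)
  qed
  have R1: "R \<le> (4 + K\<^sup>2 + 20 * K\<^sup>2 / \<gamma>) * (A * h)"
  proof -
    have "K\<^sup>2 * I W / \<epsilon> \<le> K\<^sup>2 * (A * h * \<epsilon>) / \<epsilon>"
      using bW(1) \<epsilon> unfolding I_def by (intro divide_right_mono mult_left_mono) auto
    then have 1: "K\<^sup>2 * I W / \<epsilon> \<le> K\<^sup>2 * (A * h)" using \<epsilon> by simp
    have "2 * I P + I S' + I W \<le> 10 * (A * h)" using P1 W1 bS(2) unfolding I_def by linarith
    then have "2 * K\<^sup>2 / \<gamma> * (2 * I P + I S' + I W) \<le> 2 * K\<^sup>2 / \<gamma> * (10 * (A * h))" using \<gamma> by (intro mult_left_mono) auto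
    then show ?thesis using 1 P2 by (simp add: R_def algebra_simps)
  qed
  have de: "has_L2_weak_deriv Omega (\<lambda>x. u x - uN x) (\<lambda>x. V x - gN x)"
    by (rule has_L2_weak_deriv_diff[OF uL(1) uNL piecewise_C1_weak_deriv[OF u] dN])
  have "(L2_norm Omega (weak_deriv Omega (\<lambda>x. u x - uN x)))\<^sup>2 = I (\<lambda>x. g x + P' x)"
    unfolding weak_deriv_square_integral[OF de] I_def g_def by simp
  also have "\<dots> \<le> 2 * I g + 2 * I P'" unfolding I_def by (rule L2_sum_norm[OF gL PL(2)])
  finally have e1: "\<epsilon> * (L2_norm Omega (weak_deriv Omega (\<lambda>x. u x - uN x)))\<^sup>2 \<le> \<epsilon> * (2 * I g + 2 * I P')"
    using \<epsilon> by (intro mult_left_mono) auto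
  have "(L2_norm Omega (\<lambda>x. u x - uN x))\<^sup>2 = I (\<lambda>x. v x + P x)"
    unfolding L2_norm_square I_def v_def by simp
  also have "\<dots> \<le> 2 * I v + 2 * I P" unfolding I_def by (rule L2_sum_norm[OF vL PL(1)])
  finally have e2: "\<gamma> * (L2_norm Omega (\<lambda>x. u x - uN x))\<^sup>2 \<le> \<gamma> * (2 * I v + 2 * I P)"
    using \<gamma> by (intro mult_left_mono) auto
  have "\<epsilon> * (2 * I g + 2 * I P') + \<gamma> * (2 * I v + 2 * I P) = 2 * E + 2 * (\<epsilon> * I P') + 2 * (\<gamma> * I P)"
    by (simp add: E_def algebra_simps)
  also have "\<dots> \<le> 2 * (2 * ((4 + K\<^sup>2 + 20 * K\<^sup>2 / \<gamma>) * (A * h))) + 2 * (4 * (A * h)) + 2 * (\<gamma> * (4 * (A * h)))"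
  proof -
    have "\<gamma> * I P \<le> \<gamma> * (4 * (A * h))" using P1 \<gamma> by (intro mult_left_mono) auto
    then show ?thesis using ER R1 P2 by linarith
  qed
  also have "\<dots> = (24 + 8 * \<gamma> + 4 * K\<^sup>2 + 80 * K\<^sup>2 / \<gamma>) * A * h" by (simp add: algebra_simps)
  finally show ?thesis using e1 e2 by linarith
qed

end

lemma density_dominates:
  assumes \<rho>: "(\<rho> has_integral r) {0..2}" "\<And>x. \<rho> x \<ge> 0" and f: "f \<in> L2 Omega"
    and le: "\<And>x. x \<in> Omega \<Longrightarrow> a * (f x)\<^sup>2 \<le> B * \<rho> x"
  shows "a * (\<integral>\<^sub>\<Omega> x. (f x)\<^sup>2) \<le> B * r"
proof -
  have 1: "(\<rho> has_integral r) Omega" using \<rho>(1) has_integral_open_interval[of \<rho> r 0 2] by simp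
  then have "\<rho> absolutely_integrable_on Omega"
    by (intro nonnegative_absolutely_integrable_1) (use \<rho>(2) in \<open>auto simp: has_integral_integrable\<close>)
  then have i: "integrable (lebesgue_on Omega) \<rho>" by (intro absolutely_integrable_imp_integrable) auto
  have "(\<integral>\<^sub>\<Omega> x. \<rho> x) = r"
    by (rule has_integral_unique[OF has_integral_integral_lebesgue_on[OF i] 1]) simp
  moreover have "(\<integral>\<^sub>\<Omega> x. a * (f x)\<^sup>2) \<le> (\<integral>\<^sub>\<Omega> x. B * \<rho> x)"
    by (rule integral_mono) (use i L2D(2)[OF f] le in auto)
  ultimately show ?thesis by simp
qed

section \<open>Convergence of the finite element method\<close>

text \<open>
Makes the difference of interpolant and discrete solution an admissible test function of the discrete problem.
\<close>

lemma interpolant_minus_FE_in_space: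
  fixes k :: nat and \<epsilon> H :: real
  defines "X \<equiv> mesh_node k \<epsilon> H" and "N \<equiv> mesh_M1 \<epsilon> H + mesh_M2 k \<epsilon> H"
  assumes w: "w \<in> H10 Omega" and p: "\<And>i. 1 \<le> i \<Longrightarrow> i \<le> N \<Longrightarrow> \<exists>p. degree p \<le> k \<and> (\<forall>x\<in>{X (i - 1)<..<X i}. w x = poly p x)"
    and uN: "uN \<in> FE_space k \<epsilon> H"
  shows "(\<lambda>x. w x - uN x) \<in> FE_space k \<epsilon> H"
proof -
  have "\<exists>p. degree p \<le> k \<and> (AE x in lebesgue_on \<tau>. w x - uN x = poly p x)" if \<tau>: "\<tau> \<in> mesh_cells k \<epsilon> H" for \<tau>
  proof -
    obtain i where i: "i \<in> {1..N}" "\<tau> = {X (i - 1)<..<X i}" using \<tau> unfolding mesh_cells_def X_def N_def by blast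
    obtain p1 where p1: "degree p1 \<le> k" "\<forall>x\<in>\<tau>. w x = poly p1 x" using p[of i] i by auto
    obtain p2 where p2: "degree p2 \<le> k" "AE x in lebesgue_on \<tau>. uN x = poly p2 x"
      using uN \<tau> unfolding FE_space_def by blast
    have "AE x in lebesgue_on \<tau>. w x - uN x = poly (p1 - p2) x"
      using p2(2) AE_space by eventually_elim (use p1(2) in simp)
    then show ?thesis using degree_diff_le[OF p1(1) p2(1)] by blast
  qed
  moreover have "(\<lambda>x. w x - uN x) \<in> H10 Omega" by (rule H10_diff[OF w]) (use uN in \<open>simp add: FE_space_def\<close>)
  ultimately show ?thesis unfolding FE_space_def by blast
qed

theorem theorem4p2:
  fixes k :: nat
  assumes "k \<ge> 1"
  shows "\<exists>m. \<forall>(b::real \<Rightarrow> real) (c::real \<Rightarrow> real) (d::real \<Rightarrow> real) (f::real \<Rightarrow> real)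
             (\<Phi>::real \<Rightarrow> real) (\<beta>::real) (\<gamma>::real).
           C_k_on m {0..2} b \<and> C_k_on m {0..2} c \<and> C_k_on m {0..2} d \<and> C_k_on m {0..2} f \<and>
           C_k_on m {-1..0} \<Phi> \<and>
           \<beta> > 0 \<and> \<gamma> > 0 \<and>
           (\<forall>x\<in>{0..2}. b x \<ge> \<beta>) \<and> (\<forall>x\<in>{0..2}. d x \<ge> 0) \<and>
           (\<forall>x\<in>{0..2}. c x + vector_derivative b (at x within {0..2}) / 2
                         - Linf_norm {1<..<2} d / 2 \<ge> \<gamma>) \<and>
           \<Phi> 0 = 0
           \<longrightarrow> (\<exists>C>0. \<forall>\<epsilon>\<in>{0<..<1}. \<forall>H\<in>{0<..<1}. \<forall>u uN.
                 solves_shift_problem \<epsilon> b c d f \<Phi> u \<and> FE_solution k \<epsilon> H b c d f \<Phi> uN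
                 \<longrightarrow> sqrt (\<epsilon> * (L2_norm Omega (weak_deriv Omega (\<lambda>x. u x - uN x)))\<^sup>2
                           + \<gamma> * (L2_norm Omega (\<lambda>x. u x - uN x))\<^sup>2)
                     \<le> C * H ^ k)"
proof (intro exI[of _ "Suc k"] allI impI)
  fix b c d f \<Phi> :: "real \<Rightarrow> real" and \<beta> \<gamma> :: real
  assume "C_k_on (Suc k) {0..2} b \<and> C_k_on (Suc k) {0..2} c \<and> C_k_on (Suc k) {0..2} d \<and> C_k_on (Suc k) {0..2} f \<and>
           C_k_on (Suc k) {-1..0} \<Phi> \<and>
           \<beta> > 0 \<and> \<gamma> > 0 \<and>
           (\<forall>x\<in>{0..2}. b x \<ge> \<beta>) \<and> (\<forall>x\<in>{0..2}. d x \<ge> 0) \<and>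
           (\<forall>x\<in>{0..2}. c x + vector_derivative b (at x within {0..2}) / 2
                         - Linf_norm {1<..<2} d / 2 \<ge> \<gamma>) \<and>
           \<Phi> 0 = 0"
  then have Ck: "C_k_on (Suc k) {0..2} b" "C_k_on (Suc k) {0..2} c" "C_k_on (Suc k) {0..2} d" "C_k_on (Suc k) {0..2} f"
      "C_k_on (Suc k) {-1..0} \<Phi>" and \<beta>: "\<beta> > 0" and \<gamma>: "\<gamma> > 0" and b\<beta>: "\<forall>x\<in>{0..2}. b x \<ge> \<beta>"
    and coercivity: "\<forall>x\<in>{0..2}. c x + vector_derivative b (at x within {0..2}) / 2
                         - Linf_norm {1<..<2} d / 2 \<ge> \<gamma>" and \<Phi>0: "\<Phi> 0 = 0"
    by auto
  define b' where "b' = (\<lambda>x. vector_derivative b (at x within {0..2}))"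
  define \<delta> where "\<delta> = Linf_norm {1<..<2} d"
  have db: "\<And>x. x \<in> {0..2} \<Longrightarrow> (b has_real_derivative b' x) (at x within {0..2})" and cb': "continuous_on {0..2} b'"
    unfolding b'_def using C_k_on_derivative[OF Ck(1)] by auto
  note ct = C_k_on_continuous[OF Ck(1)] C_k_on_continuous[OF Ck(2)] C_k_on_continuous[OF Ck(3)] C_k_on_continuous[OF Ck(4)]
  obtain K1 K2 K3 K4 where K': "\<forall>x\<in>{0..2}. \<bar>b' x\<bar> \<le> K1" "\<forall>x\<in>{0..2}. \<bar>c x\<bar> \<le> K2" "\<forall>x\<in>{0..2}. \<bar>d x\<bar> \<le> K3" "\<forall>x\<in>{0..2}. \<bar>b x\<bar> \<le> K4"
    using continuous_bounded_interval[OF cb'] continuous_bounded_interval[OF ct(2)] continuous_bounded_interval[OF ct(3)] 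
      continuous_bounded_interval[OF ct(1)] by blast
  define K where "K = Max {K1,K2,K3,K4}"
  have Kge: "K1 \<le> K" "K2 \<le> K" "K3 \<le> K" "K4 \<le> K" unfolding K_def by (rule Max_ge; simp)+
  interpret coefficients b b' c d K \<gamma> \<delta>
  proof
    fix x :: real
    show "\<bar>b x\<bar> \<le> K" "\<bar>b' x\<bar> \<le> K" "\<bar>c x\<bar> \<le> K" "\<bar>d x\<bar> \<le> K" if "x \<in> {0..2}"
      using order.trans[OF bspec[OF K'(4) that] Kge(4)] order.trans[OF bspec[OF K'(1) that] Kge(1)]
        order.trans[OF bspec[OF K'(2) that] Kge(2)] order.trans[OF bspec[OF K'(3) that] Kge(3)] by auto
    show "\<gamma> \<le> c x + b' x / 2 - \<delta> / 2" if "x \<in> {0..2}" using coercivity that by (simp add: b'_def \<delta>_def)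
    show "\<bar>d x\<bar> \<le> \<delta>" if "x \<in> {1..2}"
      unfolding \<delta>_def by (rule Linf_norm_bound[OF continuous_on_subset[OF ct(3)] that]) auto
  qed (use db cb' ct \<gamma> in auto)
  obtain C where C: "C \<ge> 0" and sol: "\<And>\<epsilon> u. \<epsilon> \<in> {0<..<1} \<Longrightarrow> solves_shift_problem \<epsilon> b c d f \<Phi> u \<Longrightarrow>
     (\<exists>V V'. regular_solution \<epsilon> b c d f \<Phi> u V V') \<and>
     layer_bounded \<epsilon> (\<beta>/2) 0 C (Suc k) 0 u \<and> layer_bounded \<epsilon> (\<beta>/2) 1 C (Suc k) 1 u"
    using solution_layer_bounds[OF Ck \<beta> \<gamma> b\<beta> coercivity \<Phi>0] by blast
  define \<kappa> where "\<kappa> = \<beta> / 2"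
  have \<kappa>: "\<kappa> > 0" using \<beta> by (simp add: \<kappa>_def)
  define M where "M = (2 * C * (1 + real (Suc k) / (\<kappa>/2)) ^ Suc k)\<^sup>2 * exp (\<kappa>/4)
     + (2 * C * ((1 / \<kappa>) ^ k + (1 / \<kappa>) ^ Suc k))\<^sup>2 + 2 * C"
  have M: "M \<ge> 0" using C by (simp add: M_def)
  define r0 where "r0 = 2 / (\<kappa>/4) + 2"
  have r0: "r0 > 0" unfolding r0_def using \<kappa> by (intro add_pos_pos) auto
  \<comment> \<open>\<open>M\<close> is the constant of the cell-wise splitting and \<open>r0\<close> bounds the integral of the layer density, so \<open>A\<close> bounds
    the squared norms of both remainders relative to \<open>H^(2 k)\<close>.\<close>
  define A where "A = 2 * M\<^sup>2 + M * r0"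
  have A: "A \<ge> 0" using M r0 by (simp add: A_def)
  define B where "B = (24 + 8 * \<gamma> + 4 * K\<^sup>2 + 80 * K\<^sup>2 / \<gamma>) * A"
  have B: "B \<ge> 0" using A \<gamma> by (simp add: B_def)
  show "\<exists>C>0. \<forall>\<epsilon>\<in>{0<..<1}. \<forall>H\<in>{0<..<1}. \<forall>u uN.
                 solves_shift_problem \<epsilon> b c d f \<Phi> u \<and> FE_solution k \<epsilon> H b c d f \<Phi> uN
                 \<longrightarrow> sqrt (\<epsilon> * (L2_norm Omega (weak_deriv Omega (\<lambda>x. u x - uN x)))\<^sup>2
                           + \<gamma> * (L2_norm Omega (\<lambda>x. u x - uN x))\<^sup>2)
                     \<le> C * H ^ k"
  proof (intro exI[of _ "sqrt B + 1"] conjI ballI allI impI)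
    show "sqrt B + 1 > 0" using real_sqrt_ge_zero[OF B] by linarith
    fix \<epsilon> H :: real and u uN
    assume e: "\<epsilon> \<in> {0<..<1}" and "H \<in> {0<..<1}" and
      "solves_shift_problem \<epsilon> b c d f \<Phi> u \<and> FE_solution k \<epsilon> H b c d f \<Phi> uN"
    then have \<epsilon>: "0 < \<epsilon>" "\<epsilon> < 1" and H: "0 < H" "H < 1" and su: "solves_shift_problem \<epsilon> b c d f \<Phi> u"
      and fe: "FE_solution k \<epsilon> H b c d f \<Phi> uN" by auto
    obtain V V' where reg: "regular_solution \<epsilon> b c d f \<Phi> u V V'" and lay: "layer_bounded \<epsilon> \<kappa> 0 C (Suc k) 0 u" "layer_bounded \<epsilon> \<kappa> 1 C (Suc k) 1 u"
      using sol[OF e su] unfolding \<kappa>_def by blast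
    have pu: "piecewise_C1 u V" by (rule regular_solution_piecewise_C1[OF reg])
    have u02: "u 0 = 0" "u 2 = 0" using reg unfolding regular_solution_def by auto
    define X where "X = mesh_node k \<epsilon> H"
    define N where "N = mesh_M1 \<epsilon> H + mesh_M2 k \<epsilon> H"
    define \<mu> where "\<mu> = H * \<epsilon> powr ((real k - 1) / real k)"
    define \<rho> where "\<rho> = layer_density (\<kappa>/4) k \<epsilon> H \<mu>"
    have X: "X 0 = 0" "X N = 2" using mesh_node_cells(2,3)[OF \<epsilon> H assms] by (auto simp: X_def N_def)
    have mono: "X (i - 1) < X i" if "1 \<le> i" "i \<le> N" for i
      using mesh_node_cells(4)[OF \<epsilon> H assms that[unfolded N_def]] by (simp add: X_def)
    note mcs = mesh_cell_split[OF assms \<epsilon> H \<kappa> lay, folded \<mu>_def]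
    have cells: "cell_split u k \<epsilon> H M \<rho> (X (i - 1)) (X i)" if "1 \<le> i" "i \<le> N" for i
      using mcs(3)[OF that[unfolded N_def]] unfolding M_def \<rho>_def X_def .
    obtain r where r: "(\<rho> has_integral r) {0..2}" "r \<le> r0"
      using layer_density_integral[OF \<epsilon>(1) _ H(1) mcs(1,2), of "\<kappa>/4"] \<kappa> unfolding \<rho>_def r0_def by auto
    have \<rho>0: "\<rho> x \<ge> 0" for x unfolding \<rho>_def by (rule layer_density_nonneg[OF \<epsilon>(1) H(1)])
    obtain S S' W W' where S: "piecewise_C1 S S'" and W: "piecewise_C1 W W'" and uI: "(\<lambda>x. u x - (S x + W x)) \<in> H10 Omega"
      and poly: "\<forall>i. 1 \<le> i \<longrightarrow> i \<le> N \<longrightarrow> (\<exists>p. degree p \<le> k \<and> (\<forall>x\<in>{X (i - 1)<..<X i}. u x - (S x + W x) = poly p x))"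
      and bnd: "\<forall>x\<in>Omega. \<bar>S x\<bar> \<le> M * H ^ k \<and> \<bar>S' x\<bar> \<le> M * H ^ k \<and>
        (W x)\<^sup>2 \<le> M * (\<epsilon> * H ^ (2 * k) * \<rho> x) \<and> \<epsilon> * (W' x)\<^sup>2 \<le> M * (H ^ (2 * k) * \<rho> x)"
      using global_splitting[of X N u V k \<epsilon> H M \<rho>, OF X mono pu u02 cells] by blast
    have uN: "uN \<in> FE_space k \<epsilon> H" "uN \<in> H10 Omega" and gal: "\<And>v. v \<in> FE_space k \<epsilon> H \<Longrightarrow> bilin \<epsilon> b c d uN v = linform d f \<Phi> v"
      using fe unfolding FE_solution_def FE_space_def by auto
    define h where "h = H ^ (2 * k)"
    have h: "h \<ge> 0" using H by (simp add: h_def)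
    have orth: "form \<epsilon> b c d u V (\<lambda>x. (u x - (S x + W x)) - uN x) g = form \<epsilon> b c d uN (weak_deriv Omega uN) (\<lambda>x. (u x - (S x + W x)) - uN x) g"
      if g: "has_L2_weak_deriv Omega (\<lambda>x. (u x - (S x + W x)) - uN x) g" for g
    proof -
      have v: "(\<lambda>x. (u x - (S x + W x)) - uN x) \<in> FE_space k \<epsilon> H"
        by (rule interpolant_minus_FE_in_space[OF uI _ uN(1)]) (use poly in \<open>auto simp: X_def N_def\<close>)
      then have vH: "(\<lambda>x. (u x - (S x + W x)) - uN x) \<in> H10 Omega" by (simp add: FE_space_def)
      show ?thesis
        using regular_solution_weak[OF \<epsilon>(1) reg ct vH g] gal[OF v] bilin_form[OF uN(2) vH g] by simp
    qed
    have square: "(\<integral>\<^sub>\<Omega> x. (w x)\<^sup>2) \<le> A * h" if w: "w \<in> L2 Omega" "\<And>x. x \<in> Omega \<Longrightarrow> \<bar>w x\<bar> \<le> M * H ^ k" for w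
    proof -
      have "(\<integral>\<^sub>\<Omega> x. (w x)\<^sup>2) \<le> (\<integral>\<^sub>\<Omega> x. (M * H ^ k)\<^sup>2)"
      proof (rule integral_mono[OF L2D(2)[OF w(1)]])
        show "integrable (lebesgue_on Omega) (\<lambda>x. (M * H ^ k)\<^sup>2)" using L2_integrable[OF L2_cmult[OF one_L2, of "(M * H ^ k)\<^sup>2"]] by simp
        show "(w x)\<^sup>2 \<le> (M * H ^ k)\<^sup>2" if "x \<in> space (lebesgue_on Omega)" for x
          using power_mono[OF w(2)[of x], of 2] that by simp
      qed
      also have "\<dots> = 2 * M\<^sup>2 * h" by (simp only: integral_Omega_const) (simp add: h_def power_mult_distrib power_mult[symmetric] mult.commute)
      also have "\<dots> \<le> A * h" using M r0 h by (intro mult_right_mono) (auto simp: A_def)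
      finally show ?thesis .
    qed
    have Mr: "M * r \<le> A" using mult_left_mono[OF r(2) M] by (simp add: A_def add_increasing)
    have bW: "(\<integral>\<^sub>\<Omega> x. (W x)\<^sup>2) \<le> A * h * \<epsilon>"
    proof -
      have "1 * (\<integral>\<^sub>\<Omega> x. (W x)\<^sup>2) \<le> (M * (\<epsilon> * h)) * r"
        by (rule density_dominates[OF r(1) \<rho>0 piecewise_C1_L2(1)[OF W]]) (use bnd in \<open>simp add: h_def mult.assoc\<close>)
      also have "\<dots> = (M * r) * (\<epsilon> * h)" by simp
      also have "\<dots> \<le> A * (\<epsilon> * h)" using \<epsilon> h by (intro mult_right_mono Mr) auto
      finally show ?thesis by (simp add: mult.commute mult.left_commute)
    qed
    have bW': "\<epsilon> * (\<integral>\<^sub>\<Omega> x. (W' x)\<^sup>2) \<le> A * h"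
    proof -
      have "\<epsilon> * (\<integral>\<^sub>\<Omega> x. (W' x)\<^sup>2) \<le> (M * h) * r"
        by (rule density_dominates[OF r(1) \<rho>0 piecewise_C1_L2(2)[OF W]]) (use bnd in \<open>simp add: h_def mult.assoc\<close>)
      also have "\<dots> = (M * r) * h" by simp
      also have "\<dots> \<le> A * h" using h by (intro mult_right_mono Mr) auto
      finally show ?thesis .
    qed
    have "\<epsilon> * (L2_norm Omega (weak_deriv Omega (\<lambda>x. u x - uN x)))\<^sup>2 + \<gamma> * (L2_norm Omega (\<lambda>x. u x - uN x))\<^sup>2 \<le> B * h"
      unfolding B_def
      by (rule energy_error[OF \<epsilon> h pu S W uI uN(2) orth A square[OF piecewise_C1_L2(1)[OF S]] square[OF piecewise_C1_L2(2)[OF S]] bW bW'])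
         (use bnd in auto)
    then have "sqrt (\<epsilon> * (L2_norm Omega (weak_deriv Omega (\<lambda>x. u x - uN x)))\<^sup>2 + \<gamma> * (L2_norm Omega (\<lambda>x. u x - uN x))\<^sup>2) \<le> sqrt (B * h)"
      by (rule real_sqrt_le_mono)
    also have "sqrt (B * h) = sqrt B * H ^ k"
    proof -
      have "h = (H ^ k)\<^sup>2" by (simp add: h_def power_mult[symmetric] mult.commute)
      then show ?thesis using H by (simp add: real_sqrt_mult)
    qed
    also have "\<dots> \<le> (sqrt B + 1) * H ^ k" using H by (intro mult_right_mono) auto
    finally show "sqrt (\<epsilon> * (L2_norm Omega (weak_deriv Omega (\<lambda>x. u x - uN x)))\<^sup>2
                           + \<gamma> * (L2_norm Omega (\<lambda>x. u x - uN x))\<^sup>2) \<le> (sqrt B + 1) * H ^ k" .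
  qed
qed

end
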